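(* Let $f:M^m\to N^{m+t}$ be a complete $\varepsilon$-superbiharmonic submanifold in a Riemannian manifold $N^{m+t}$ of dimension $m+t$, for some $\varepsilon>0$, with mean curvature vector field $\vec H$. Assume in addition that $$\int_M|\vec H|^{2+a}\,d\mu<\infty,$$ where $a\ge0$ is a constant. Then $\vec H=0$ and $f$ is minimal.
   Context: Manifolds are smooth, connected and without boundary; $t\ge1$. $M$ is an immersed submanifold via $f$, carries the metric induced by $f$ (with respect to which it is complete), and $d\mu$ is its Riemannian volume element. Let $D$ be the Levi-Civita connection of $N$, pulled back to $f^{-1}TN$, and $\nabla^M$ the Levi-Civita connection of $M$. With $\{e_i\}_{i=1}^m$ a local orthonormal frame of $M$, the second fundamental form is $B(X,Y)=D_XY-\nabla^M_XY$ and the mean curvature vector field is $\vec H=\frac1m\sum_{i=1}^mB(e_i,e_i)$; $f$ is minimal if $\vec H\equiv0$. Regarding $\vec H$ as a section of $f^{-1}TN$, $\nabla\vec H$ denotes its full covariant derivative $X\mapsto D_X\vec H$ (both tangential and normal parts), $|\nabla\vec H|^2=\sum_i|D_{e_i}\vec H|^2$, and $\Delta\vec H=\sum_i\left(D_{e_i}D_{e_i}\vec H-D_{\nabla^M_{e_i}e_i}\vec H\right)$ is the rough Laplacian. For a constant $\varepsilon\in[0,1]$, $M$ is called an $\varepsilon$-superbiharmonic submanifold of $N$ if $$\langle\Delta\vec H,\vec H\rangle\ge(\varepsilon-1)|\nabla\vec H|^2$$ on $M$, where $\langle\cdot,\cdot\rangle$ is the metric of $N$. *)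

theory Defs
  imports "HOL-Analysis.Analysis"
begin

section \<open>Smooth functions between Euclidean spaces\<close>

text \<open>
  \<open>Ck_on k S F\<close> is meant for open \<open>S\<close>: all iterated directional derivatives of \<open>F\<close> of order
  at most \<open>k\<close> exist as Frechet derivatives on \<open>S\<close> and are continuous there.
\<close>

fun Ck_on :: "nat \<Rightarrow> 'a::euclidean_space set \<Rightarrow> ('a \<Rightarrow> 'b::real_normed_vector) \<Rightarrow> bool" where
  "Ck_on 0 S F \<longleftrightarrow> continuous_on S F"
| "Ck_on (Suc k) S F \<longleftrightarrow>
     (\<forall>x\<in>S. F differentiable (at x)) \<and>
     (\<forall>v. Ck_on k S (\<lambda>x. frechet_derivative F (at x) v))"

definition smooth_on :: "'a::euclidean_space set \<Rightarrow> ('a \<Rightarrow> 'b::real_normed_vector) \<Rightarrow> bool" where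
  "smooth_on S F \<longleftrightarrow> (\<forall>k. Ck_on k S F)"


section \<open>Smooth manifolds and smooth maps\<close>

text \<open>
  A chart is a pair of its domain and its coordinate map (whose values off the domain are
  irrelevant). The underlying Hausdorff, second countable space of a manifold is a type of the
  corresponding classes, and its smooth structure is the one generated by an atlas.
\<close>

type_synonym ('p, 'm) chart = "'p set \<times> ('p \<Rightarrow> real ^ 'm)"

definition chart_inv :: "('p, 'm::finite) chart \<Rightarrow> real ^ 'm \<Rightarrow> 'p" where
  "chart_inv c = inv_into (fst c) (snd c)"

definition is_chart :: "('p::topological_space, 'm::finite) chart \<Rightarrow> bool" where
  "is_chart c \<longleftrightarrow> open (fst c) \<and> open (snd c ` fst c) \<and>
     homeomorphism (fst c) (snd c ` fst c) (snd c) (chart_inv c)"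

text \<open>
  The expression of \<open>f\<close> in a chart \<open>c\<close> of the source and a chart \<open>d\<close> of the target, and the
  open set of coordinates on which this expression is meaningful.
\<close>

definition local_dom ::
    "('p \<Rightarrow> 'q) \<Rightarrow> ('p, 'm::finite) chart \<Rightarrow> ('q, 'n::finite) chart \<Rightarrow> (real ^ 'm) set" where
  "local_dom f c d = snd c ` (fst c \<inter> f -` fst d)"

definition local_rep ::
    "('p \<Rightarrow> 'q) \<Rightarrow> ('p, 'm::finite) chart \<Rightarrow> ('q, 'n::finite) chart \<Rightarrow> real ^ 'm \<Rightarrow> real ^ 'n" where
  "local_rep f c d = snd d \<circ> f \<circ> chart_inv c"

definition smooth_manifold ::
    "('p::{t2_space,second_countable_topology}, 'm::finite) chart set \<Rightarrow> bool" where
  "smooth_manifold A \<longleftrightarrow>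
     connected (UNIV :: 'p set) \<and>
     (\<forall>c\<in>A. is_chart c) \<and>
     (\<Union>c\<in>A. fst c) = UNIV \<and>
     (\<forall>c\<in>A. \<forall>d\<in>A. smooth_on (local_dom id c d) (local_rep id c d))"

definition smooth_map ::
    "('p::topological_space, 'm::finite) chart set \<Rightarrow> ('q::topological_space, 'n::finite) chart set
      \<Rightarrow> ('p \<Rightarrow> 'q) \<Rightarrow> bool" where
  "smooth_map A C f \<longleftrightarrow>
     continuous_on UNIV f \<and>
     (\<forall>c\<in>A. \<forall>d\<in>C. smooth_on (local_dom f c d) (local_rep f c d))"

definition chart_at :: "('p, 'm) chart set \<Rightarrow> 'p \<Rightarrow> ('p, 'm) chart" where
  "chart_at A p = (SOME c. c \<in> A \<and> p \<in> fst c)"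


section \<open>Riemannian metrics\<close>

text \<open>
  A metric on a manifold with atlas \<open>A\<close> is given by its Gram matrices
  \<open>g c x = (g(\<partial>\<^sub>i, \<partial>\<^sub>j))\<^sub>i\<^sub>j\<close> in every chart \<open>c\<close>, as functions of the coordinates \<open>x\<close>, which are
  required to transform as a covariant 2-tensor.
\<close>

definition ip :: "real ^ 'n ^ 'n \<Rightarrow> real ^ 'n \<Rightarrow> real ^ 'n \<Rightarrow> real" where
  "ip G u v = u \<bullet> (G *v v)"

type_synonym ('p, 'm) metric = "('p, 'm) chart \<Rightarrow> real ^ 'm \<Rightarrow> real ^ 'm ^ 'm"

definition riemannian_manifold ::
    "('p::{t2_space,second_countable_topology}, 'm::finite) chart set \<Rightarrow> ('p, 'm) metric \<Rightarrow> bool" where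
  "riemannian_manifold A g \<longleftrightarrow>
     smooth_manifold A \<and>
     (\<forall>c\<in>A. \<forall>i j. smooth_on (snd c ` fst c) (\<lambda>x. g c x $ i $ j)) \<and>
     (\<forall>c\<in>A. \<forall>x\<in>snd c ` fst c.
        (\<forall>u v. ip (g c x) u v = ip (g c x) v u) \<and> (\<forall>v. v \<noteq> 0 \<longrightarrow> 0 < ip (g c x) v v)) \<and>
     (\<forall>c\<in>A. \<forall>d\<in>A. \<forall>x\<in>local_dom id c d. \<forall>u v.
        ip (g c x) u v =
        ip (g d (local_rep id c d x))
           (frechet_derivative (local_rep id c d) (at x) u)
           (frechet_derivative (local_rep id c d) (at x) v))"

text \<open>
  An immersion \<open>f\<close> such that the metric \<open>g\<close> of the source is the one induced by \<open>f\<close> from the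
  metric \<open>h\<close> of the target.
\<close>

definition isometric_immersion ::
    "('p::{t2_space,second_countable_topology}, 'm::finite) chart set \<Rightarrow> ('p, 'm) metric \<Rightarrow>
     ('q::{t2_space,second_countable_topology}, 'n::finite) chart set \<Rightarrow> ('q, 'n) metric \<Rightarrow>
     ('p \<Rightarrow> 'q) \<Rightarrow> bool" where
  "isometric_immersion A g C h f \<longleftrightarrow>
     smooth_map A C f \<and>
     (\<forall>c\<in>A. \<forall>d\<in>C. \<forall>x\<in>local_dom f c d.
        inj (frechet_derivative (local_rep f c d) (at x)) \<and>
        (\<forall>u v. ip (g c x) u v =
           ip (h d (local_rep f c d x))
              (frechet_derivative (local_rep f c d) (at x) u)
              (frechet_derivative (local_rep f c d) (at x) v)))"


section \<open>Riemannian distance, completeness and volume\<close>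

definition piecewise_C1_path ::
    "('p::topological_space, 'm::finite) chart set \<Rightarrow> (real \<Rightarrow> 'p) \<Rightarrow> bool" where
  "piecewise_C1_path A \<gamma> \<longleftrightarrow>
     path \<gamma> \<and>
     (\<exists>S. finite S \<and>
        (\<forall>c\<in>A. (snd c \<circ> \<gamma>) C1_differentiable_on (({0<..<1} - S) \<inter> \<gamma> -` fst c)))"

definition speed ::
    "('p, 'm::finite) chart set \<Rightarrow> ('p, 'm) metric \<Rightarrow> (real \<Rightarrow> 'p) \<Rightarrow> real \<Rightarrow> real" where
  "speed A g \<gamma> t =
     (let c = chart_at A (\<gamma> t); v = vector_derivative (snd c \<circ> \<gamma>) (at t)
      in sqrt (ip (g c (snd c (\<gamma> t))) v v))"

definition path_length ::
    "('p, 'm::finite) chart set \<Rightarrow> ('p, 'm) metric \<Rightarrow> (real \<Rightarrow> 'p) \<Rightarrow> ennreal" where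
  "path_length A g \<gamma> = (\<integral>\<^sup>+ t\<in>{0..1}. ennreal (speed A g \<gamma> t) \<partial>lborel)"

definition riemannian_dist ::
    "('p::topological_space, 'm::finite) chart set \<Rightarrow> ('p, 'm) metric \<Rightarrow> 'p \<Rightarrow> 'p \<Rightarrow> ennreal" where
  "riemannian_dist A g p q =
     (INF \<gamma>\<in>{\<gamma>. piecewise_C1_path A \<gamma> \<and> pathstart \<gamma> = p \<and> pathfinish \<gamma> = q}. path_length A g \<gamma>)"

definition complete_riemannian ::
    "('p::topological_space, 'm::finite) chart set \<Rightarrow> ('p, 'm) metric \<Rightarrow> bool" where
  "complete_riemannian A g \<longleftrightarrow>
     (\<forall>X :: nat \<Rightarrow> 'p.
        (\<forall>e>0. \<exists>K. \<forall>i\<ge>K. \<forall>j\<ge>K. riemannian_dist A g (X i) (X j) < e) \<longrightarrow>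
        (\<exists>p. (\<lambda>i. riemannian_dist A g (X i) p) \<longlonglongrightarrow> 0))"

text \<open>
  The Borel measure which is \<open>sqrt (det (g\<^sub>i\<^sub>j)) dx\<close> in every chart. These conditions determine it
  uniquely, since countably many chart domains cover the manifold.
\<close>

definition riemannian_volume ::
    "('p::topological_space, 'm::finite) chart set \<Rightarrow> ('p, 'm) metric \<Rightarrow> 'p measure \<Rightarrow> bool" where
  "riemannian_volume A g \<mu> \<longleftrightarrow>
     sets \<mu> = sets borel \<and>
     (\<forall>c\<in>A. \<forall>S\<in>sets borel. S \<subseteq> fst c \<longrightarrow>
        emeasure \<mu> S = (\<integral>\<^sup>+ x\<in>snd c ` S. ennreal (sqrt (det (g c x))) \<partial>lborel))"


section \<open>Levi-Civita connections in coordinates\<close>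

text \<open>
  In this section and the next one, \<open>G\<close> and \<open>K\<close> denote the matrix functions of metrics in a fixed
  chart of the source and of the target, respectively, and \<open>F\<close> denotes the expression of a map in
  these two charts. Vector fields are given by their components in the charts.
\<close>

definition pderiv_coord :: "'m \<Rightarrow> (real ^ 'm \<Rightarrow> real) \<Rightarrow> real ^ 'm::finite \<Rightarrow> real" where
  "pderiv_coord i \<phi> x = frechet_derivative \<phi> (at x) (axis i 1)"

text \<open>The Christoffel symbol with upper index \<open>k\<close> and lower indices \<open>i\<close>, \<open>j\<close>.\<close>

definition christoffel ::
    "(real ^ 'm \<Rightarrow> real ^ 'm ^ 'm) \<Rightarrow> real ^ 'm \<Rightarrow> 'm \<Rightarrow> 'm \<Rightarrow> 'm::finite \<Rightarrow> real" where
  "christoffel G x k i j =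
     (\<Sum>l\<in>UNIV. matrix_inv (G x) $ k $ l *
        (pderiv_coord i (\<lambda>y. G y $ j $ l) x + pderiv_coord j (\<lambda>y. G y $ i $ l) x
          - pderiv_coord l (\<lambda>y. G y $ i $ j) x)) / 2"

definition christoffel_form ::
    "(real ^ 'm \<Rightarrow> real ^ 'm ^ 'm) \<Rightarrow> real ^ 'm \<Rightarrow> real ^ 'm \<Rightarrow> real ^ 'm \<Rightarrow> real ^ 'm::finite" where
  "christoffel_form G x u v =
     (\<chi> k. \<Sum>i\<in>UNIV. \<Sum>j\<in>UNIV. christoffel G x k i j * u $ i * v $ j)"

text \<open>\<open>levi_civita G X Y\<close> is the covariant derivative of \<open>Y\<close> in direction \<open>X\<close>.\<close>

definition levi_civita ::
    "(real ^ 'm \<Rightarrow> real ^ 'm ^ 'm) \<Rightarrow> (real ^ 'm \<Rightarrow> real ^ 'm) \<Rightarrow> (real ^ 'm \<Rightarrow> real ^ 'm) \<Rightarrow>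
     real ^ 'm \<Rightarrow> real ^ 'm::finite" where
  "levi_civita G X Y x = frechet_derivative Y (at x) (X x) + christoffel_form G x (X x) (Y x)"

text \<open>
  The Levi-Civita connection of the target pulled back along \<open>F\<close>, applied to a section \<open>V\<close> of the
  pulled back tangent bundle of the target.
\<close>

definition pullback_connection ::
    "(real ^ 'n \<Rightarrow> real ^ 'n ^ 'n) \<Rightarrow> (real ^ 'm \<Rightarrow> real ^ 'n) \<Rightarrow>
     (real ^ 'm \<Rightarrow> real ^ 'm) \<Rightarrow> (real ^ 'm::finite \<Rightarrow> real ^ 'n) \<Rightarrow> real ^ 'm \<Rightarrow> real ^ 'n::finite" where
  "pullback_connection K F X V x =
     frechet_derivative V (at x) (X x)
     + christoffel_form K (F x) (frechet_derivative F (at x) (X x)) (V x)"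


section \<open>Second fundamental form, mean curvature and rough Laplacian\<close>

definition push_forward ::
    "(real ^ 'm::finite \<Rightarrow> real ^ 'n::finite) \<Rightarrow> (real ^ 'm \<Rightarrow> real ^ 'm) \<Rightarrow> real ^ 'm \<Rightarrow> real ^ 'n" where
  "push_forward F X x = frechet_derivative F (at x) (X x)"

definition second_fundamental_form ::
    "(real ^ 'm \<Rightarrow> real ^ 'm ^ 'm) \<Rightarrow> (real ^ 'n \<Rightarrow> real ^ 'n ^ 'n) \<Rightarrow> (real ^ 'm \<Rightarrow> real ^ 'n) \<Rightarrow>
     (real ^ 'm \<Rightarrow> real ^ 'm) \<Rightarrow> (real ^ 'm::finite \<Rightarrow> real ^ 'm) \<Rightarrow> real ^ 'm \<Rightarrow> real ^ 'n::finite" where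
  "second_fundamental_form G K F X Y x =
     pullback_connection K F X (push_forward F Y) x - push_forward F (levi_civita G X Y) x"

definition orthonormal_frame_on ::
    "(real ^ 'm \<Rightarrow> real ^ 'm ^ 'm) \<Rightarrow> (real ^ 'm) set \<Rightarrow> ('m::finite \<Rightarrow> real ^ 'm \<Rightarrow> real ^ 'm) \<Rightarrow> bool" where
  "orthonormal_frame_on G \<Omega> E \<longleftrightarrow>
     (\<forall>i. smooth_on \<Omega> (E i)) \<and>
     (\<forall>x\<in>\<Omega>. \<forall>i j. ip (G x) (E i x) (E j x) = (if i = j then 1 else 0))"

definition mean_curvature ::
    "(real ^ 'm \<Rightarrow> real ^ 'm ^ 'm) \<Rightarrow> (real ^ 'n \<Rightarrow> real ^ 'n ^ 'n) \<Rightarrow> (real ^ 'm \<Rightarrow> real ^ 'n) \<Rightarrow>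
     ('m::finite \<Rightarrow> real ^ 'm \<Rightarrow> real ^ 'm) \<Rightarrow> real ^ 'm \<Rightarrow> real ^ 'n::finite" where
  "mean_curvature G K F E x =
     (1 / real CARD('m)) *\<^sub>R (\<Sum>i\<in>UNIV. second_fundamental_form G K F (E i) (E i) x)"

definition rough_laplacian ::
    "(real ^ 'm \<Rightarrow> real ^ 'm ^ 'm) \<Rightarrow> (real ^ 'n \<Rightarrow> real ^ 'n ^ 'n) \<Rightarrow> (real ^ 'm \<Rightarrow> real ^ 'n) \<Rightarrow>
     ('m::finite \<Rightarrow> real ^ 'm \<Rightarrow> real ^ 'm) \<Rightarrow> (real ^ 'm \<Rightarrow> real ^ 'n) \<Rightarrow>
     real ^ 'm \<Rightarrow> real ^ 'n::finite" where
  "rough_laplacian G K F E V x =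
     (\<Sum>i\<in>UNIV. pullback_connection K F (E i) (pullback_connection K F (E i) V) x
               - pullback_connection K F (levi_civita G (E i) (E i)) V x)"

definition norm_grad_sq ::
    "(real ^ 'n \<Rightarrow> real ^ 'n ^ 'n) \<Rightarrow> (real ^ 'm \<Rightarrow> real ^ 'n) \<Rightarrow>
     ('m::finite \<Rightarrow> real ^ 'm \<Rightarrow> real ^ 'm) \<Rightarrow> (real ^ 'm \<Rightarrow> real ^ 'n::finite) \<Rightarrow>
     real ^ 'm \<Rightarrow> real" where
  "norm_grad_sq K F E V x =
     (\<Sum>i\<in>UNIV. ip (K (F x)) (pullback_connection K F (E i) V x) (pullback_connection K F (E i) V x))"


section \<open>The global notions\<close>

text \<open>
  A section \<open>V\<close> of the pullback along \<open>f\<close> of the tangent bundle of the target is given by the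
  component vectors \<open>V d p\<close> of its value at \<open>p\<close>, for every chart \<open>d\<close> of the target whose domain
  contains \<open>f p\<close>.
\<close>

type_synonym ('p, 'q, 'n) section_along = "('q, 'n) chart \<Rightarrow> 'p \<Rightarrow> real ^ 'n"

definition section_norm ::
    "('q, 'n::finite) chart set \<Rightarrow> ('q, 'n) metric \<Rightarrow> ('p \<Rightarrow> 'q) \<Rightarrow> ('p, 'q, 'n) section_along \<Rightarrow>
     'p \<Rightarrow> real" where
  "section_norm C h f V p =
     (let d = chart_at C (f p) in sqrt (ip (h d (snd d (f p))) (V d p) (V d p)))"

definition zero_section ::
    "('q, 'n::finite) chart set \<Rightarrow> ('p \<Rightarrow> 'q) \<Rightarrow> ('p, 'q, 'n) section_along \<Rightarrow> bool" where
  "zero_section C f V \<longleftrightarrow> (\<forall>d\<in>C. \<forall>p. f p \<in> fst d \<longrightarrow> V d p = 0)"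

definition is_local_frame ::
    "('p::topological_space, 'm::finite) chart set \<Rightarrow> ('p, 'm) metric \<Rightarrow>
     ('q, 'n::finite) chart set \<Rightarrow> ('p \<Rightarrow> 'q) \<Rightarrow> ('p, 'm) chart \<Rightarrow> ('q, 'n) chart \<Rightarrow>
     (real ^ 'm) set \<Rightarrow> ('m \<Rightarrow> real ^ 'm \<Rightarrow> real ^ 'm) \<Rightarrow> bool" where
  "is_local_frame A g C f c d \<Omega> E \<longleftrightarrow>
     c \<in> A \<and> d \<in> C \<and> open \<Omega> \<and> \<Omega> \<subseteq> local_dom f c d \<and> orthonormal_frame_on (g c) \<Omega> E"

text \<open>
  The mean curvature does not depend on the charts and on the local orthonormal frame, so the
  following condition is satisfied by a section, and determines it where it is meaningful.
\<close>

definition mean_curvature_field ::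
    "('p::topological_space, 'm::finite) chart set \<Rightarrow> ('p, 'm) metric \<Rightarrow>
     ('q, 'n::finite) chart set \<Rightarrow> ('q, 'n) metric \<Rightarrow> ('p \<Rightarrow> 'q) \<Rightarrow>
     ('p, 'q, 'n) section_along \<Rightarrow> bool" where
  "mean_curvature_field A g C h f H \<longleftrightarrow>
     (\<forall>c d \<Omega> E. is_local_frame A g C f c d \<Omega> E \<longrightarrow>
        (\<forall>x\<in>\<Omega>. H d (chart_inv c x) = mean_curvature (g c) (h d) (local_rep f c d) E x))"

definition minimal_immersion ::
    "('p::topological_space, 'm::finite) chart set \<Rightarrow> ('p, 'm) metric \<Rightarrow>
     ('q, 'n::finite) chart set \<Rightarrow> ('q, 'n) metric \<Rightarrow> ('p \<Rightarrow> 'q) \<Rightarrow> bool" where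
  "minimal_immersion A g C h f \<longleftrightarrow> mean_curvature_field A g C h f (\<lambda>d p. 0)"

definition superbiharmonic ::
    "real \<Rightarrow> ('p::topological_space, 'm::finite) chart set \<Rightarrow> ('p, 'm) metric \<Rightarrow>
     ('q, 'n::finite) chart set \<Rightarrow> ('q, 'n) metric \<Rightarrow> ('p \<Rightarrow> 'q) \<Rightarrow>
     ('p, 'q, 'n) section_along \<Rightarrow> bool" where
  "superbiharmonic \<epsilon> A g C h f H \<longleftrightarrow>
     \<epsilon> \<in> {0..1} \<and>
     mean_curvature_field A g C h f H \<and>
     (\<forall>c d \<Omega> E. is_local_frame A g C f c d \<Omega> E \<longrightarrow>
        (\<forall>x\<in>\<Omega>. let F = local_rep f c d; V = H d \<circ> chart_inv c in
           ip (h d (F x)) (rough_laplacian (g c) (h d) F E V x) (V x)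
             \<ge> (\<epsilon> - 1) * norm_grad_sq (h d) F E V x))"

end

(* The function u = |H|^2 satisfies (Laplacian u) / 2 = <Laplacian H, H> + |nabla H|^2 >= eps |nabla H|^2.
   Since H is normal, the tangential part of nabla H has trace -m |H|^2, so |nabla H|^2 >= m u^2, while
   |nabla u|^2 <= 4 u |nabla H|^2; together u (Laplacian u) >= eps u^3 + (eps / 4) |nabla u|^2. Testing this with
   Phi^2 w(u), where Phi is a cutoff function of the ball of radius R, integrating by parts and absorbing the
   gradient of u by Young's inequality bounds the integral of Phi^2 w(u) u^3 by a constant times R^(-2) times
   the integral of |H|^(2 + a), and R tends to infinity. Completeness enters through the Hopf-Rinow theorem:
   closed balls are compact, so that such cutoff functions, obtained by smoothing the distance function,
   have compact support. The divergence theorem is only needed in a chart, by a partition of unity. *)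

theory Submission
  imports Defs
begin

text \<open>The square u = |H|^2 is used because |H| may fail to be differentiable where H vanishes,
  and the inequality is multiplied by u so that nothing is divided by u. The cubic term forces H =
  0; the gradient term alone would only make u constant. With a plain cutoff the error term would
  contain |H|^4 instead of |H|^(2 + a), and the weight corrects the exponent. Completeness is stated
  by an infimum over piecewise C^1 paths, while the proof of Hopf-Rinow cuts connections at a
  prescribed length. A second distance \<open>dst\<close> is therefore built from chains of segments
  in chart balls, which are easy to cut. It dominates \<open>riemannian_dist\<close>; in the other
  direction, C^1 functions with gradient at most 1 turn convergence in
  \<open>riemannian_dist\<close> into convergence of points. A test function is differentiated only
  once, so all cutoffs may be C^1 and are built from the square of the positive part. H is
  prescribed separately in each target chart, so the regularity of |H|^2 rests on the transformation
  law of the second fundamental form.\<close>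

section \<open>Calculus of continuously differentiable functions\<close>

lemma frechet_derivative_cong_open:
  assumes "open S" "x \<in> S" "\<And>y. y \<in> S \<Longrightarrow> f y = g y"
  shows "frechet_derivative f (at x) = frechet_derivative g (at x)"
proof -
  have "(f has_derivative D) (at x) \<longleftrightarrow> (g has_derivative D) (at x)" for D
    using has_derivative_transform_within_open[of f D x UNIV S g]
      has_derivative_transform_within_open[of g D x UNIV S f] assms by auto
  then show ?thesis by (simp add: frechet_derivative_def)
qed

lemma differentiable_cong_open:
  assumes "open S" "x \<in> S" "\<And>y. y \<in> S \<Longrightarrow> f y = g y" "f differentiable at x"
  shows "g differentiable at x"
  using assms has_derivative_transform_within_open[of f _ x UNIV S g]
  unfolding differentiable_def by metis

lemma Ck_on_cong:
  assumes "open S" "\<And>x. x \<in> S \<Longrightarrow> f x = g x"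
  shows "Ck_on k S f \<longleftrightarrow> Ck_on k S g"
  using assms(2)
proof (induction k arbitrary: f g)
  case 0
  then show ?case by (simp cong: continuous_on_cong)
next
  case (Suc k)
  have "frechet_derivative f (at x) = frechet_derivative g (at x)" if "x \<in> S" for x
    by (rule frechet_derivative_cong_open[OF assms(1) that Suc.prems])
  then have "Ck_on k S (\<lambda>x. frechet_derivative f (at x) v) \<longleftrightarrow> Ck_on k S (\<lambda>x. frechet_derivative g (at x) v)" for v
    by (intro Suc.IH) simp
  moreover have "f differentiable at x \<longleftrightarrow> g differentiable at x" if "x \<in> S" for x
    using differentiable_cong_open[OF assms(1) that, of f g] differentiable_cong_open[OF assms(1) that, of g f]
      Suc.prems by auto
  ultimately show ?case by auto
qed

lemma Ck_on_congI:
  assumes "open S" "Ck_on k S g" "\<And>x. x \<in> S \<Longrightarrow> f x = g x"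
  shows "Ck_on k S f"
  using Ck_on_cong[OF assms(1), of f g k] assms(2,3) by simp

lemma Ck_on_subset: "Ck_on k S f \<Longrightarrow> T \<subseteq> S \<Longrightarrow> Ck_on k T f"
  by (induction k arbitrary: f) (auto intro: continuous_on_subset)

lemma Ck_on_SucD: "Ck_on (Suc k) S f \<Longrightarrow> Ck_on k S f"
proof (induction k arbitrary: f)
  case 0
  then show ?case
    using differentiable_imp_continuous_on[OF differentiable_at_imp_differentiable_on[of S f]] by simp
next
  case (Suc k)
  show ?case
    using Suc.prems Suc.IH[of "\<lambda>x. frechet_derivative f (at x) _"] unfolding Ck_on.simps(2)[of k]
      Ck_on.simps(2)[of "Suc k"] by blast
qed

lemma Ck_on_mono: "Ck_on k S f \<Longrightarrow> j \<le> k \<Longrightarrow> Ck_on j S f"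
proof (induction k)
  case (Suc k)
  then show ?case using Ck_on_SucD le_SucE by metis
qed simp

lemma Ck_on_continuous: "Ck_on k S f \<Longrightarrow> continuous_on S f"
  using Ck_on_mono[of k S f 0] by simp

lemma Ck_on_has_derivative:
  "Ck_on (Suc k) S f \<Longrightarrow> x \<in> S \<Longrightarrow> (f has_derivative frechet_derivative f (at x)) (at x)"
  using frechet_derivative_works by auto

text \<open>Lets an explicit derivative replace the chosen \<open>frechet_derivative\<close>, so
  that the closure properties below reduce to differentiation rules and induction on
  \<open>k\<close>.\<close>

lemma Ck_on_SucI:
  assumes "open S" "\<And>x. x \<in> S \<Longrightarrow> (f has_derivative f' x) (at x)" "\<And>v. Ck_on k S (\<lambda>x. f' x v)"
  shows "Ck_on (Suc k) S f"
proof -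
  have eq: "frechet_derivative f (at x) = f' x" if "x \<in> S" for x
    using frechet_derivative_at[OF assms(2)[OF that]] by simp
  have "Ck_on k S (\<lambda>x. frechet_derivative f (at x) v)" for v
    using assms(3)[of v] Ck_on_cong[OF assms(1), of "\<lambda>x. frechet_derivative f (at x) v" "\<lambda>x. f' x v" k] eq by simp
  with assms(2) show ?thesis by (auto simp: differentiable_def)
qed

lemma Ck_on_const: "open S \<Longrightarrow> Ck_on k S (\<lambda>_. c)"
proof (induction k arbitrary: c)
  case (Suc k)
  show ?case by (rule Ck_on_SucI[where f'="\<lambda>_ _. 0"]) (use Suc in auto)
qed simp

lemma Ck_on_bounded_linear:
  assumes "open S" "bounded_linear L" "Ck_on k S f"
  shows "Ck_on k S (\<lambda>x. L (f x))"
  using assms(3)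
proof (induction k arbitrary: f)
  case 0
  then show ?case using bounded_linear.continuous_on[OF assms(2)] by auto
next
  case (Suc k)
  show ?case
  proof (rule Ck_on_SucI[OF assms(1)])
    show "((\<lambda>x. L (f x)) has_derivative (\<lambda>v. L (frechet_derivative f (at x) v))) (at x)" if "x \<in> S" for x
      using bounded_linear.has_derivative[OF assms(2) Ck_on_has_derivative[OF Suc(2) that]] .
    show "Ck_on k S (\<lambda>x. L (frechet_derivative f (at x) v))" for v
      by (rule Suc.IH) (use Suc.prems in simp)
  qed
qed

lemma Ck_on_add:
  assumes "open S" "Ck_on k S f" "Ck_on k S g"
  shows "Ck_on k S (\<lambda>x. f x + g x)"
  using assms(2,3)
proof (induction k arbitrary: f g)
  case (Suc k)
  show ?case
  proof (rule Ck_on_SucI[OF assms(1)])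
    show "((\<lambda>x. f x + g x) has_derivative (\<lambda>v. frechet_derivative f (at x) v + frechet_derivative g (at x) v)) (at x)"
      if "x \<in> S" for x
      by (intro has_derivative_add Ck_on_has_derivative[OF Suc(2) that] Ck_on_has_derivative[OF Suc(3) that])
    show "Ck_on k S (\<lambda>x. frechet_derivative f (at x) v + frechet_derivative g (at x) v)" for v
      by (rule Suc.IH) (use Suc.prems in simp_all)
  qed
qed (auto intro: continuous_on_add)

lemma Ck_on_bilinear:
  assumes "open S" "bounded_bilinear bop" "Ck_on k S f" "Ck_on k S g"
  shows "Ck_on k S (\<lambda>x. bop (f x) (g x))"
  using assms(3,4)
proof (induction k arbitrary: f g)
  case 0
  then show ?case using bounded_bilinear.continuous_on[OF assms(2)] by auto
next
  case (Suc k)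
  show ?case
  proof (rule Ck_on_SucI[OF assms(1)])
    show "((\<lambda>x. bop (f x) (g x)) has_derivative
       (\<lambda>v. bop (f x) (frechet_derivative g (at x) v) + bop (frechet_derivative f (at x) v) (g x))) (at x)"
      if "x \<in> S" for x
      by (rule bounded_bilinear.FDERIV[OF assms(2) Ck_on_has_derivative[OF Suc(2) that] Ck_on_has_derivative[OF Suc(3) that]])
    show "Ck_on k S (\<lambda>x. bop (f x) (frechet_derivative g (at x) v) + bop (frechet_derivative f (at x) v) (g x))" for v
      by (intro Ck_on_add[OF assms(1)] Suc.IH Ck_on_SucD[OF Suc(2)] Ck_on_SucD[OF Suc(3)])
        (use Suc(2,3) in auto)
  qed
qed

lemmas Ck_on_scaleR = Ck_on_bilinear[OF _ bounded_bilinear_scaleR]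
lemmas Ck_on_inner = Ck_on_bilinear[OF _ bounded_bilinear_inner]

lemma Ck_on_mult:
  fixes f g :: "_ \<Rightarrow> real"
  shows "open S \<Longrightarrow> Ck_on k S f \<Longrightarrow> Ck_on k S g \<Longrightarrow> Ck_on k S (\<lambda>x. f x * g x)"
  by (rule Ck_on_bilinear[OF _ bounded_bilinear_mult])

lemma Ck_on_minus: "open S \<Longrightarrow> Ck_on k S f \<Longrightarrow> Ck_on k S (\<lambda>x. - f x)"
  by (rule Ck_on_bounded_linear[of _ uminus]) (auto simp: bounded_linear_minus bounded_linear_ident)

lemma Ck_on_diff: "open S \<Longrightarrow> Ck_on k S f \<Longrightarrow> Ck_on k S g \<Longrightarrow> Ck_on k S (\<lambda>x. f x - g x)"
  using Ck_on_add[of S k f "\<lambda>x. - g x"] Ck_on_minus[of S k g] by simp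

lemma Ck_on_sum:
  assumes "open S" "\<And>i. i \<in> I \<Longrightarrow> Ck_on k S (f i)"
  shows "Ck_on k S (\<lambda>x. \<Sum>i\<in>I. f i x)"
  using assms by (induction I rule: infinite_finite_induct) (simp_all add: Ck_on_const Ck_on_add)

lemma Ck_on_power:
  fixes f :: "_ \<Rightarrow> real"
  shows "open S \<Longrightarrow> Ck_on k S f \<Longrightarrow> Ck_on k S (\<lambda>x. f x ^ n)"
  by (induction n) (simp_all add: Ck_on_const Ck_on_mult)

lemma Ck_on_ident: "open S \<Longrightarrow> Ck_on k S (\<lambda>x. x)"
proof (cases k)
  case (Suc j)
  assume "open S"
  then show ?thesis unfolding Suc by (rule Ck_on_SucI[where f' = "\<lambda>x v. v"]) (simp_all add: Ck_on_const \<open>open S\<close>)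
qed simp

lemma Ck_on_nth: "open S \<Longrightarrow> Ck_on k S f \<Longrightarrow> Ck_on k S (\<lambda>x. f x $ i)"
  by (rule Ck_on_bounded_linear[OF _ bounded_linear_vec_nth])

lemma Ck_on_vec:
  fixes f :: "'n::finite \<Rightarrow> 'a::euclidean_space \<Rightarrow> real"
  assumes "open S" "\<And>i. Ck_on k S (f i)"
  shows "Ck_on k S (\<lambda>x. \<chi> i. f i x)"
proof -
  have "(\<lambda>x. \<chi> i. f i x) = (\<lambda>x. \<Sum>i\<in>UNIV. f i x *\<^sub>R axis i 1)"
    by (auto simp: fun_eq_iff vec_eq_iff axis_def if_distrib cong: if_cong)
  then show ?thesis
    using assms by (simp add: Ck_on_sum Ck_on_scaleR Ck_on_const)
qed

lemma Ck_on_prod: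
  fixes f :: "'i \<Rightarrow> _ \<Rightarrow> real"
  assumes "open S" "\<And>i. i \<in> I \<Longrightarrow> Ck_on k S (f i)"
  shows "Ck_on k S (\<lambda>x. \<Prod>i\<in>I. f i x)"
  using assms by (induction I rule: infinite_finite_induct) (simp_all add: Ck_on_const Ck_on_mult)

text \<open>The derivative again contains \<open>inverse (f x)\<close>, one order lower, where the
  induction hypothesis applies; the square root below works in the same way.\<close>

lemma Ck_on_inverse:
  fixes f :: "_ \<Rightarrow> real"
  assumes "open S" "Ck_on k S f" "\<And>x. x \<in> S \<Longrightarrow> f x \<noteq> 0"
  shows "Ck_on k S (\<lambda>x. inverse (f x))"
  using assms(2)
proof (induction k)
  case 0
  then show ?case using assms(3) by (auto intro: continuous_on_inverse)
next
  case (Suc k)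
  show ?case
  proof (rule Ck_on_SucI[OF assms(1)])
    show "((\<lambda>x. inverse (f x)) has_derivative (\<lambda>v. - (inverse (f x) * frechet_derivative f (at x) v * inverse (f x)))) (at x)"
      if "x \<in> S" for x
      using Deriv.has_derivative_inverse[OF assms(3)[OF that] Ck_on_has_derivative[OF Suc(2) that]] .
    show "Ck_on k S (\<lambda>x. - (inverse (f x) * frechet_derivative f (at x) v * inverse (f x)))" for v
      using Suc(2) Suc.IH[OF Ck_on_SucD[OF Suc(2)]] by (intro Ck_on_minus Ck_on_mult assms) auto
  qed
qed

lemma Ck_on_divide:
  fixes f g :: "_ \<Rightarrow> real"
  assumes "open S" "Ck_on k S f" "Ck_on k S g" "\<And>x. x \<in> S \<Longrightarrow> g x \<noteq> 0"
  shows "Ck_on k S (\<lambda>x. f x / g x)"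
  using Ck_on_mult[OF assms(1,2) Ck_on_inverse[OF assms(1,3,4)]] by (simp add: divide_inverse)

lemma Ck_on_sqrt:
  assumes "open S" "Ck_on k S f" "\<And>x. x \<in> S \<Longrightarrow> f x > 0"
  shows "Ck_on k S (\<lambda>x. sqrt (f x))"
  using assms(2)
proof (induction k)
  case 0
  then show ?case by (auto intro: continuous_on_real_sqrt)
next
  case (Suc k)
  show ?case
  proof (rule Ck_on_SucI[OF assms(1)])
    show "((\<lambda>x. sqrt (f x)) has_derivative (\<lambda>v. frechet_derivative f (at x) v * inverse (2 * sqrt (f x)))) (at x)"
      if "x \<in> S" for x
      using has_derivative_real_sqrt[OF assms(3)[OF that] Ck_on_has_derivative[OF Suc(2) that]]
      by (rule has_derivative_eq_rhs) (simp add: fun_eq_iff field_simps)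
    have "Ck_on k S (\<lambda>x. 2 * sqrt (f x))"
      by (rule Ck_on_mult[OF assms(1) Ck_on_const[OF assms(1)] Suc.IH[OF Ck_on_SucD[OF Suc(2)]]])
    moreover have "2 * sqrt (f x) \<noteq> 0" if "x \<in> S" for x
      using assms(3)[OF that] by simp
    ultimately have "Ck_on k S (\<lambda>x. inverse (2 * sqrt (f x)))"
      by (rule Ck_on_inverse[OF assms(1)])
    then show "Ck_on k S (\<lambda>x. frechet_derivative f (at x) v * inverse (2 * sqrt (f x)))" for v
      using Suc(2) by (intro Ck_on_mult[OF assms(1)]) simp_all
  qed
qed

section \<open>Derivatives in variable directions and the chain rule\<close>

lemma linear_basis_expansion:
  fixes w :: "'a::euclidean_space"
  assumes "linear L"
  shows "L w = (\<Sum>b\<in>Basis. (w \<bullet> b) *\<^sub>R L b)"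
proof -
  have "L w = L (\<Sum>b\<in>Basis. (w \<bullet> b) *\<^sub>R b)" by (simp add: euclidean_representation)
  also have "\<dots> = (\<Sum>b\<in>Basis. (w \<bullet> b) *\<^sub>R L b)" by (simp add: linear_sum[OF assms] linear_scale[OF assms])
  finally show ?thesis .
qed

text \<open>\<open>Ck_on\<close> speaks of constant directions only. Expanding \<open>w x\<close> in
  the basis turns a derivative in a variable direction into a finite sum of functions times
  derivatives in constant directions.\<close>

lemma Ck_on_frechet_apply:
  assumes "open S" "Ck_on (Suc k) S F" "Ck_on k S w"
  shows "Ck_on k S (\<lambda>x. frechet_derivative F (at x) (w x))"
proof -
  have "Ck_on k S (\<lambda>x. \<Sum>b\<in>Basis. (w x \<bullet> b) *\<^sub>R frechet_derivative F (at x) b)"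
    using assms by (intro Ck_on_sum Ck_on_scaleR Ck_on_inner Ck_on_const) auto
  then show ?thesis
    by (rule Ck_on_congI[OF assms(1)])
      (rule linear_basis_expansion[OF has_derivative_linear[OF Ck_on_has_derivative[OF assms(2)]]])
qed

lemma Ck_on_compose:
  fixes f :: "'b::euclidean_space \<Rightarrow> 'c::real_normed_vector" and g :: "'a::euclidean_space \<Rightarrow> 'b"
  assumes "open S" "Ck_on k T f" "Ck_on k S g" "g ` S \<subseteq> T"
  shows "Ck_on k S (\<lambda>x. f (g x))"
  using assms(2,3)
proof (induction k arbitrary: f)
  case 0
  then show ?case using assms(4) continuous_on_compose2[of T f S g] by auto
next
  case (Suc k)
  show ?case
  proof (rule Ck_on_SucI[OF assms(1)])
    show "((\<lambda>x. f (g x)) has_derivative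
      (\<lambda>v. frechet_derivative f (at (g x)) (frechet_derivative g (at x) v))) (at x)" if "x \<in> S" for x
      using that assms(4)
      by (intro has_derivative_compose[OF Ck_on_has_derivative[OF Suc(3)] Ck_on_has_derivative[OF Suc(2)]]) auto
    show "Ck_on k S (\<lambda>x. frechet_derivative f (at (g x)) (frechet_derivative g (at x) v))" for v
    proof -
      \<comment> \<open>The inner derivative makes the direction depend on \<open>x\<close>;
        expanding it in the basis lets the induction hypothesis act on the directional derivatives
        of \<open>f\<close>.\<close>
      have "Ck_on k S (\<lambda>x. \<Sum>b\<in>Basis. (frechet_derivative g (at x) v \<bullet> b) *\<^sub>R frechet_derivative f (at (g x)) b)"
        using Suc(2,3) Ck_on_SucD[OF Suc(3)] by (intro Ck_on_sum Ck_on_scaleR Ck_on_inner Ck_on_const Suc.IH assms) auto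
      then show ?thesis
        by (rule Ck_on_congI[OF assms(1)])
          (rule linear_basis_expansion[OF has_derivative_linear[OF Ck_on_has_derivative[OF Suc(2)]]], use assms(4) in blast)
    qed
  qed
qed

text \<open>Serves extensions by zero: the function is treated on its own domain and off its support
  separately.\<close>

lemma Ck_on_Un:
  assumes "open S" "open T" "Ck_on k S f" "Ck_on k T f"
  shows "Ck_on k (S \<union> T) f"
  using assms(3,4)
proof (induction k arbitrary: f)
  case 0
  then show ?case using assms(1,2) by (simp add: continuous_on_open_Un)
next
  case (Suc k)
  have "Ck_on k (S \<union> T) (\<lambda>x. frechet_derivative f (at x) v)" for v
    by (rule Suc.IH) (use Suc.prems in simp_all)
  then show ?case using Suc.prems by auto
qed

lemma Ck_on_locally:
  assumes "\<And>x. x \<in> S \<Longrightarrow> \<exists>U. open U \<and> x \<in> U \<and> Ck_on k U f"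
  shows "Ck_on k S f"
  using assms
proof (induction k arbitrary: f)
  case 0
  show ?case
  proof (simp, intro continuous_at_imp_continuous_on ballI)
    fix x assume "x \<in> S"
    then obtain U where "open U" "x \<in> U" "continuous_on U f" using 0 by auto
    then show "isCont f x" by (simp add: continuous_on_eq_continuous_at)
  qed
next
  case (Suc k)
  have "Ck_on k S (\<lambda>x. frechet_derivative f (at x) v)" for v
  proof (rule Suc.IH)
    fix x assume "x \<in> S"
    then show "\<exists>U. open U \<and> x \<in> U \<and> Ck_on k U (\<lambda>x. frechet_derivative f (at x) v)"
      using Suc.prems[of x] unfolding Ck_on.simps by blast
  qed
  moreover have "f differentiable at x" if "x \<in> S" for x
    using Suc.prems[OF that] unfolding Ck_on.simps by blast
  ultimately show ?case by simp
qed

lemma smooth_onD: "smooth_on S f \<Longrightarrow> Ck_on k S f"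
  by (simp add: smooth_on_def)

lemma smooth_on_differentiable: "smooth_on S f \<Longrightarrow> x \<in> S \<Longrightarrow> f differentiable at x"
  using smooth_onD[of S f 1] by simp

lemma smooth_on_has_derivative:
  "smooth_on S f \<Longrightarrow> x \<in> S \<Longrightarrow> (f has_derivative frechet_derivative f (at x)) (at x)"
  using smooth_on_differentiable frechet_derivative_works by blast

text \<open>The second difference is the increment in direction \<open>v\<close> of a difference in
  direction \<open>w\<close>. The mean value theorem, applied in each direction in turn, yields a
  mixed derivative at an intermediate point.\<close>

lemma second_difference_mean_value:
  fixes F :: "'a::euclidean_space \<Rightarrow> real"
  assumes "Ck_on 2 (ball x e) F" "0 < t" "t * (norm v + norm w) < e"
  shows "\<exists>y. dist x y \<le> t * (norm v + norm w) \<and>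
     F (x + t *\<^sub>R v + t *\<^sub>R w) - F (x + t *\<^sub>R v) - F (x + t *\<^sub>R w) + F x
       = t * t * frechet_derivative (\<lambda>y. frechet_derivative F (at y) v) (at y) w"
proof -
  have C: "Ck_on (Suc (Suc 0)) (ball x e) F" using assms(1) by (simp add: numeral_2_eq_2)
  then have C1: "Ck_on (Suc 0) (ball x e) (\<lambda>y. frechet_derivative F (at y) v)" by simp
  have nrm: "norm (s *\<^sub>R v + r *\<^sub>R w) \<le> t * (norm v + norm w)" if "0 \<le> s" "s \<le> t" "0 \<le> r" "r \<le> t" for s r
  proof -
    have "norm (s *\<^sub>R v + r *\<^sub>R w) \<le> s * norm v + r * norm w"
      using norm_triangle_ineq[of "s *\<^sub>R v" "r *\<^sub>R w"] that by simp
    also have "\<dots> \<le> t * (norm v + norm w)"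
      using that by (simp add: distrib_left add_mono mult_right_mono)
    finally show ?thesis .
  qed
  have inb: "x + s *\<^sub>R v + r *\<^sub>R w \<in> ball x e" if "0 \<le> s" "s \<le> t" "0 \<le> r" "r \<le> t" for s r
  proof -
    have "dist x (x + s *\<^sub>R v + r *\<^sub>R w) = norm (s *\<^sub>R v + r *\<^sub>R w)"
      by (metis add.assoc add_diff_cancel_left' dist_commute dist_norm)
    then show ?thesis using nrm[OF that] assms(3) by simp
  qed
  define gg where "gg = (\<lambda>s. F (x + s *\<^sub>R v + t *\<^sub>R w) - F (x + s *\<^sub>R v))"
  have dF: "((\<lambda>s. F (x + s *\<^sub>R v + r *\<^sub>R w)) has_real_derivative frechet_derivative F (at (x + s *\<^sub>R v + r *\<^sub>R w)) v) (at s)"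
    if "0 \<le> s" "s \<le> t" "0 \<le> r" "r \<le> t" for s r
  proof -
    have *: "((\<lambda>s. x + s *\<^sub>R v + r *\<^sub>R w) has_derivative (\<lambda>h. h *\<^sub>R v)) (at s)"
      by (auto intro!: derivative_eq_intros)
    have D: "(F has_derivative frechet_derivative F (at (x + s *\<^sub>R v + r *\<^sub>R w))) (at (x + s *\<^sub>R v + r *\<^sub>R w))"
      using Ck_on_has_derivative[OF C inb[OF that]] .
    show ?thesis
      using has_derivative_compose[OF * D] linear_scale[OF has_derivative_linear[OF D]]
      by (simp add: has_field_derivative_def mult_commute_abs)
  qed
  have "\<exists>s. 0 < s \<and> s < t \<and> gg t - gg 0 = (t - 0) * (frechet_derivative F (at (x + s *\<^sub>R v + t *\<^sub>R w)) v - frechet_derivative F (at (x + s *\<^sub>R v)) v)"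
  proof (rule MVT2[OF assms(2)])
    fix s assume "0 \<le> s" "s \<le> t"
    then show "DERIV gg s :> frechet_derivative F (at (x + s *\<^sub>R v + t *\<^sub>R w)) v - frechet_derivative F (at (x + s *\<^sub>R v)) v"
      unfolding gg_def using dF[of s t] dF[of s 0] assms(2) by (auto intro!: DERIV_diff)
  qed
  then obtain s where s: "0 < s" "s < t" "gg t - gg 0 = t * (frechet_derivative F (at (x + s *\<^sub>R v + t *\<^sub>R w)) v - frechet_derivative F (at (x + s *\<^sub>R v)) v)"
    by auto
  let ?D = "\<lambda>y. frechet_derivative F (at y) v"
  have "\<exists>r. 0 < r \<and> r < t \<and> ?D (x + s *\<^sub>R v + t *\<^sub>R w) - ?D (x + s *\<^sub>R v + 0 *\<^sub>R w) =
    (t - 0) * frechet_derivative ?D (at (x + s *\<^sub>R v + r *\<^sub>R w)) w"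
  proof (rule MVT2[OF assms(2)])
    fix r assume r: "0 \<le> r" "r \<le> t"
    have *: "((\<lambda>r. x + s *\<^sub>R v + r *\<^sub>R w) has_derivative (\<lambda>h. h *\<^sub>R w)) (at r)"
      by (auto intro!: derivative_eq_intros)
    have D: "(?D has_derivative frechet_derivative ?D (at (x + s *\<^sub>R v + r *\<^sub>R w))) (at (x + s *\<^sub>R v + r *\<^sub>R w))"
      using Ck_on_has_derivative[OF C1 inb[of s r]] r s by simp
    show "DERIV (\<lambda>r. ?D (x + s *\<^sub>R v + r *\<^sub>R w)) r :> frechet_derivative ?D (at (x + s *\<^sub>R v + r *\<^sub>R w)) w"
      using has_derivative_compose[OF * D] linear_scale[OF has_derivative_linear[OF D]]
      by (simp add: has_field_derivative_def mult_commute_abs)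
  qed
  then obtain r where r: "0 < r" "r < t" "?D (x + s *\<^sub>R v + t *\<^sub>R w) - ?D (x + s *\<^sub>R v) =
    t * frechet_derivative ?D (at (x + s *\<^sub>R v + r *\<^sub>R w)) w" by auto
  have "dist x (x + s *\<^sub>R v + r *\<^sub>R w) \<le> t * (norm v + norm w)"
    using nrm[of s r] s r by (metis add.assoc add_diff_cancel_left' dist_commute dist_norm less_le)
  moreover have "F (x + t *\<^sub>R v + t *\<^sub>R w) - F (x + t *\<^sub>R v) - F (x + t *\<^sub>R w) + F x = gg t - gg 0"
    by (simp add: gg_def)
  ultimately show ?thesis using s(3) r(3) by (intro exI[of _ "x + s *\<^sub>R v + r *\<^sub>R w"]) auto
qed

text \<open>The second difference is symmetric in \<open>v\<close> and \<open>w\<close>. Hence for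
  every small \<open>t\<close> the two mixed derivatives share a value, attained at points within
  \<open>t * (norm v + norm w)\<close> of \<open>x\<close>; continuity lets these points tend to
  \<open>x\<close>.\<close>

lemma second_derivative_symmetric_real:
  fixes F :: "'a::euclidean_space \<Rightarrow> real"
  assumes "open S" "Ck_on 2 S F" "x \<in> S"
  shows "frechet_derivative (\<lambda>y. frechet_derivative F (at y) v) (at x) w =
         frechet_derivative (\<lambda>y. frechet_derivative F (at y) w) (at x) v"
proof -
  define P where "P = (\<lambda>y. frechet_derivative (\<lambda>y. frechet_derivative F (at y) v) (at y) w)"
  define Q where "Q = (\<lambda>y. frechet_derivative (\<lambda>y. frechet_derivative F (at y) w) (at y) v)"
  have cont: "isCont P x" "isCont Q x"
    using assms unfolding P_def Q_def by (auto simp: numeral_2_eq_2 continuous_on_eq_continuous_at)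
  obtain e where e: "e > 0" "ball x e \<subseteq> S" using assms openE by blast
  \<comment> \<open>The summand 1 keeps \<open>M\<close> positive when both directions vanish; with
    it, \<open>t n * (norm v + norm w)\<close> is at most \<open>e / 2\<close>.\<close>
  define M where "M = norm v + norm w + 1"
  have M: "M > 0" unfolding M_def by (smt (verit) norm_ge_zero)
  define t where "t = (\<lambda>n::nat. e / (2 * M) / real (Suc n))"
  have t: "0 < t n" "t n * (norm v + norm w) < e" "t n * (norm w + norm v) < e" for n
  proof -
    show "0 < t n" using e M by (simp add: t_def)
    have "e / (2 * M) / real (Suc n) \<le> e / (2 * M) / 1" using e M by (intro divide_left_mono) auto
    then have "t n \<le> e / (2 * M)" by (simp add: t_def)
    then have "t n * (norm v + norm w) \<le> e / (2 * M) * M"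
      using \<open>0 < t n\<close> by (intro mult_mono) (auto simp: M_def)
    also have "\<dots> < e" using e M by simp
    finally show "t n * (norm v + norm w) < e" "t n * (norm w + norm v) < e" by (auto simp: add.commute)
  qed
  have C: "Ck_on 2 (ball x e) F" using assms e Ck_on_subset by blast
  have "\<exists>y z. dist x y \<le> t n * (norm v + norm w) \<and> dist x z \<le> t n * (norm v + norm w) \<and> P y = Q z" for n
  proof -
    obtain y where y: "dist x y \<le> t n * (norm v + norm w)"
       "F (x + t n *\<^sub>R v + t n *\<^sub>R w) - F (x + t n *\<^sub>R v) - F (x + t n *\<^sub>R w) + F x = t n * t n * P y"
      using second_difference_mean_value[OF C t(1,2)[of n]] unfolding P_def by auto
    obtain z where z: "dist x z \<le> t n * (norm w + norm v)"
       "F (x + t n *\<^sub>R w + t n *\<^sub>R v) - F (x + t n *\<^sub>R w) - F (x + t n *\<^sub>R v) + F x = t n * t n * Q z"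
      using second_difference_mean_value[OF C t(1,3)[of n]] unfolding Q_def by auto
    have "t n * t n * P y = t n * t n * Q z"
      using y(2) z(2) by (simp add: algebra_simps)
    then show ?thesis using t(1)[of n] y z by (auto simp: add.commute)
  qed
  then obtain y z where yz: "\<And>n. dist x (y n) \<le> t n * (norm v + norm w)"
    "\<And>n. dist x (z n) \<le> t n * (norm v + norm w)" "\<And>n. P (y n) = Q (z n)" by metis
  have "t \<longlonglongrightarrow> 0" unfolding t_def by (rule LIMSEQ_Suc[OF lim_const_over_n])
  then have t0: "(\<lambda>n. t n * (norm v + norm w)) \<longlonglongrightarrow> 0"
    by (rule tendsto_mult_left_zero)
  have "(\<lambda>n. dist (y n) x) \<longlonglongrightarrow> 0"
    by (rule tendsto_sandwich[OF _ _ tendsto_const t0]) (simp_all add: yz(1) dist_commute[of _ x])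
  moreover have "(\<lambda>n. dist (z n) x) \<longlonglongrightarrow> 0"
    by (rule tendsto_sandwich[OF _ _ tendsto_const t0]) (simp_all add: yz(2) dist_commute[of _ x])
  ultimately have "y \<longlonglongrightarrow> x" "z \<longlonglongrightarrow> x" by (simp_all add: tendsto_dist_iff[of _ x])
  then have "(\<lambda>n. P (y n)) \<longlonglongrightarrow> P x" "(\<lambda>n. Q (z n)) \<longlonglongrightarrow> Q x"
    using isCont_tendsto_compose[OF cont(1), of y sequentially] isCont_tendsto_compose[OF cont(2), of z sequentially] by simp_all
  then have "P x = Q x" using LIMSEQ_unique[of "\<lambda>n. P (y n)"] by (simp add: yz(3))
  then show ?thesis by (simp add: P_def Q_def)
qed

lemma second_derivative_symmetric:
  fixes F :: "'a::euclidean_space \<Rightarrow> 'b::euclidean_space"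
  assumes "open S" "Ck_on 2 S F" "x \<in> S"
  shows "frechet_derivative (\<lambda>y. frechet_derivative F (at y) v) (at x) w =
         frechet_derivative (\<lambda>y. frechet_derivative F (at y) w) (at x) v"
proof (rule euclidean_eqI)
  fix b :: 'b assume "b \<in> Basis"
  have C: "Ck_on (Suc (Suc 0)) S F" using assms(2) by (simp add: numeral_2_eq_2)
  have inner: "frechet_derivative (\<lambda>x. G x \<bullet> b) (at y) c = frechet_derivative G (at y) c \<bullet> b"
    if "Ck_on (Suc 0) S G" "y \<in> S" for G :: "'a \<Rightarrow> 'b" and y c
    using frechet_derivative_at[OF bounded_linear.has_derivative[OF bounded_linear_inner_left Ck_on_has_derivative[OF that]], of b]
    by (auto simp: fun_eq_iff)
  have *: "frechet_derivative (\<lambda>y. frechet_derivative (\<lambda>x. F x \<bullet> b) (at y) c) (at x) d =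
     frechet_derivative (\<lambda>y. frechet_derivative F (at y) c) (at x) d \<bullet> b" for c d
  proof -
    have "frechet_derivative (\<lambda>y. frechet_derivative (\<lambda>x. F x \<bullet> b) (at y) c) (at x)
       = frechet_derivative (\<lambda>y. frechet_derivative F (at y) c \<bullet> b) (at x)"
      by (rule frechet_derivative_cong_open[OF assms(1,3)]) (rule inner[OF Ck_on_SucD[OF C]])
    then show ?thesis using inner[of "\<lambda>y. frechet_derivative F (at y) c" x] C assms(3) by auto
  qed
  have "Ck_on 2 S (\<lambda>x. F x \<bullet> b)" by (intro Ck_on_inner Ck_on_const assms)
  from second_derivative_symmetric_real[OF assms(1) this assms(3), of v w]
  show "frechet_derivative (\<lambda>y. frechet_derivative F (at y) v) (at x) w \<bullet> b =
     frechet_derivative (\<lambda>y. frechet_derivative F (at y) w) (at x) v \<bullet> b" unfolding * .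
qed

section \<open>Inner products given by matrices\<close>

definition spd :: "real ^ 'n ^ 'n \<Rightarrow> bool" where
  "spd G \<longleftrightarrow> (\<forall>u v. ip G u v = ip G v u) \<and> (\<forall>v. v \<noteq> 0 \<longrightarrow> 0 < ip G v v)"

lemma bounded_bilinear_matrix_vector: "bounded_bilinear ((*v) :: real ^ 'n ^ 'm \<Rightarrow> real ^ 'n \<Rightarrow> real ^ 'm)"
proof -
  have "linear (\<lambda>A :: real ^ 'n ^ 'm. A *v x)" for x
    by (rule linearI) (simp_all add: matrix_vector_mult_add_rdistrib scaleR_matrix_vector_assoc)
  then have "bilinear ((*v) :: real ^ 'n ^ 'm \<Rightarrow> real ^ 'n \<Rightarrow> real ^ 'm)"
    unfolding bilinear_def by simp
  then show ?thesis by (simp add: bilinear_conv_bounded_bilinear)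
qed

lemma bounded_bilinear_ip: "bounded_bilinear (ip G)"
  unfolding ip_def
  by (rule bounded_bilinear.comp[OF bounded_bilinear_inner bounded_linear_ident matrix_vector_mul_bounded_linear])

lemmas ip_add_left = bounded_bilinear.add_left[OF bounded_bilinear_ip]
  and ip_add_right = bounded_bilinear.add_right[OF bounded_bilinear_ip]
  and ip_diff_left = bounded_bilinear.diff_left[OF bounded_bilinear_ip]
  and ip_diff_right = bounded_bilinear.diff_right[OF bounded_bilinear_ip]
  and ip_minus_left = bounded_bilinear.minus_left[OF bounded_bilinear_ip]
  and ip_minus_right = bounded_bilinear.minus_right[OF bounded_bilinear_ip]
  and ip_scaleR_left = bounded_bilinear.scaleR_left[OF bounded_bilinear_ip]
  and ip_scaleR_right = bounded_bilinear.scaleR_right[OF bounded_bilinear_ip]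
  and ip_zero_left = bounded_bilinear.zero_left[OF bounded_bilinear_ip]
  and ip_zero_right = bounded_bilinear.zero_right[OF bounded_bilinear_ip]
  and ip_sum_left = bounded_bilinear.sum_left[OF bounded_bilinear_ip]
  and ip_sum_right = bounded_bilinear.sum_right[OF bounded_bilinear_ip]

lemmas ip_linear_simps = ip_add_left ip_add_right ip_diff_left ip_diff_right ip_scaleR_left ip_scaleR_right

lemma ip_matrix_add: "ip (A + B) u v = ip A u v + ip B u v"
  by (simp add: ip_def matrix_vector_mult_add_rdistrib inner_add_right)

lemma ip_matrix_scaleR: "ip (c *\<^sub>R A) u v = c * ip A u v"
  by (simp add: ip_def flip: scaleR_matrix_vector_assoc)

lemma ip_axis: "ip G (axis i 1) (axis j 1) = G $ i $ j"
  by (simp add: ip_def inner_axis' matrix_vector_mul_component inner_axis)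

lemma vec_eq_sum_axis: "(v :: real ^ 'n) = (\<Sum>i\<in>UNIV. (v $ i) *\<^sub>R axis i 1)"
  by (auto simp: vec_eq_iff axis_def if_distrib cong: if_cong)

lemma ip_eq_sum: "ip G u v = (\<Sum>i\<in>UNIV. \<Sum>j\<in>UNIV. G $ i $ j * u $ i * v $ j)"
proof -
  have "ip G u v = ip G (\<Sum>i\<in>UNIV. (u $ i) *\<^sub>R axis i 1) (\<Sum>j\<in>UNIV. (v $ j) *\<^sub>R axis j 1)"
    by (simp flip: vec_eq_sum_axis)
  also have "\<dots> = (\<Sum>j\<in>UNIV. \<Sum>i\<in>UNIV. G $ i $ j * u $ i * v $ j)"
    by (simp add: ip_sum_left ip_sum_right ip_scaleR_left ip_scaleR_right ip_axis sum_distrib_left mult_ac)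
  also have "\<dots> = (\<Sum>i\<in>UNIV. \<Sum>j\<in>UNIV. G $ i $ j * u $ i * v $ j)"
    by (rule sum.swap)
  finally show ?thesis .
qed

lemma ip_has_derivative:
  fixes M :: "'a::real_normed_vector \<Rightarrow> real ^ 'n ^ 'n"
  assumes "(M has_derivative M') (at x)" "(u has_derivative u') (at x)" "(v has_derivative v') (at x)"
  shows "((\<lambda>x. ip (M x) (u x) (v x)) has_derivative
    (\<lambda>h. ip (M' h) (u x) (v x) + ip (M x) (u' h) (v x) + ip (M x) (u x) (v' h))) (at x)"
  unfolding ip_def
  by (rule has_derivative_eq_rhs,
      rule bounded_bilinear.FDERIV[OF bounded_bilinear_inner assms(2)
        bounded_bilinear.FDERIV[OF bounded_bilinear_matrix_vector assms(1,3)]])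
    (simp add: fun_eq_iff inner_add_right algebra_simps)

lemma Ck_on_ip:
  assumes "open S" "Ck_on k S M" "Ck_on k S u" "Ck_on k S v"
  shows "Ck_on k S (\<lambda>x. ip (M x) (u x) (v x))"
  unfolding ip_def using assms
  by (intro Ck_on_inner Ck_on_bilinear[OF _ bounded_bilinear_matrix_vector])

lemma Ck_on_matrix:
  fixes M :: "'a::euclidean_space \<Rightarrow> real ^ 'n ^ 'm"
  assumes "open S" "\<And>i j. Ck_on k S (\<lambda>x. M x $ i $ j)"
  shows "Ck_on k S M"
proof -
  have eq: "M x = (\<Sum>i\<in>UNIV. \<Sum>j\<in>UNIV. M x $ i $ j *\<^sub>R axis i (axis j 1))" for x
  proof -
    have "(\<Sum>i\<in>UNIV. \<Sum>j\<in>UNIV. M x $ i $ j *\<^sub>R axis i (axis j 1)) $ a $ b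
       = (\<Sum>i\<in>UNIV. \<Sum>j\<in>UNIV. if j = b then (if i = a then M x $ i $ j else 0) else 0)" for a b
      unfolding sum_component by (intro sum.cong refl) (simp add: axis_def)
    then show ?thesis by (simp add: vec_eq_iff)
  qed
  have "Ck_on k S (\<lambda>x. \<Sum>i\<in>UNIV. \<Sum>j\<in>UNIV. M x $ i $ j *\<^sub>R axis i (axis j 1))"
    by (intro Ck_on_sum Ck_on_scaleR Ck_on_const assms)
  then show ?thesis by (rule Ck_on_congI[OF assms(1)]) (rule eq)
qed

lemma spd_sym: "spd G \<Longrightarrow> ip G u v = ip G v u"
  by (simp add: spd_def)

lemma spd_pos: "spd G \<Longrightarrow> v \<noteq> 0 \<Longrightarrow> 0 < ip G v v"
  by (simp add: spd_def)

lemma spd_nonneg: "spd G \<Longrightarrow> 0 \<le> ip G v v"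
  by (cases "v = 0") (auto simp: ip_zero_left dest: spd_pos[of G v])

lemma spd_eq_0_iff: "spd G \<Longrightarrow> ip G v v = 0 \<longleftrightarrow> v = 0"
  by (metis ip_zero_left less_irrefl spd_pos)

lemma spd_eqI:
  assumes "spd G" "\<And>c. ip G u c = ip G v c"
  shows "u = v"
  using spd_eq_0_iff[OF assms(1), of "u - v"] assms(2)[of "u - v"] by (simp add: ip_diff_left)

lemma spd_Cauchy_Schwarz:
  assumes "spd G"
  shows "(ip G u v)\<^sup>2 \<le> ip G u u * ip G v v"
proof (cases "v = 0")
  case False
  define t where "t = ip G u v / ip G v v"
  have pos: "ip G v v > 0" using spd_pos[OF assms False] .
  have "0 \<le> ip G (u - t *\<^sub>R v) (u - t *\<^sub>R v)" by (rule spd_nonneg[OF assms])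
  also have "\<dots> = ip G u u - 2 * t * ip G u v + t * t * ip G v v"
    using spd_sym[OF assms, of v u] by (simp add: ip_linear_simps algebra_simps)
  also have "\<dots> = ip G u u - (ip G u v)\<^sup>2 / ip G v v"
    using pos by (simp add: t_def power2_eq_square)
  finally show ?thesis using pos by (simp add: field_simps)
qed (simp add: ip_zero_right)

text \<open>The family is indexed by the coordinate index type, so it has as many members as the
  dimension and is a basis.\<close>

definition orthonormal :: "real ^ 'n ^ 'n \<Rightarrow> ('n \<Rightarrow> real ^ 'n) \<Rightarrow> bool" where
  "orthonormal G e \<longleftrightarrow> (\<forall>i j. ip G (e i) (e j) = (if i = j then 1 else 0))"

text \<open>Source of the facts on inverses, expansions and determinants below: \<open>G\<close> is
  congruent to the identity by the matrix whose rows are the vectors of \<open>e\<close>.\<close>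

lemma orthonormal_matrix:
  assumes "orthonormal G e"
  defines "P \<equiv> (\<chi> i. e i)"
  shows "P ** (G ** transpose P) = mat 1"
proof -
  have "(P ** (G ** transpose P)) $ i $ j = ip G (e i) (e j)" for i j
    by (simp add: P_def matrix_matrix_mult_def transpose_def ip_def inner_vec_def matrix_vector_mult_def)
  then show ?thesis using assms by (simp add: orthonormal_def vec_eq_iff mat_def)
qed

text \<open>\<open>matrix_inv\<close> is a choice among two-sided inverses; a right inverse of a
  square matrix is one of them and determines it.\<close>

lemma matrix_inv_unique:
  fixes A B :: "real ^ 'n ^ 'n"
  assumes "A ** B = mat 1"
  shows "matrix_inv A = B"
proof -
  have BA: "B ** A = mat 1" using assms matrix_left_right_inverse by blast
  have "A ** matrix_inv A = mat 1"
    unfolding matrix_inv_def by (rule someI2[of _ B]) (use assms BA in auto)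
  then have "B ** (A ** matrix_inv A) = B" by simp
  then show ?thesis by (simp add: matrix_mul_assoc BA)
qed

lemma orthonormal_inverse:
  assumes "orthonormal G e"
  shows "matrix_inv G = transpose (\<chi> i. e i) ** (\<chi> i. e i)" "G ** matrix_inv G = mat 1" "matrix_inv G ** G = mat 1"
proof -
  let ?P = "\<chi> i. e i"
  have "(G ** transpose ?P) ** ?P = mat 1"
    using orthonormal_matrix[OF assms] matrix_left_right_inverse by blast
  then have 1: "G ** (transpose ?P ** ?P) = mat 1" by (simp add: matrix_mul_assoc)
  show 2: "matrix_inv G = transpose ?P ** ?P" by (rule matrix_inv_unique[OF 1])
  show "G ** matrix_inv G = mat 1" using 1 2 by simp
  then show "matrix_inv G ** G = mat 1" using matrix_left_right_inverse by blast
qed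

lemma matrix_inv_orthonormal:
  assumes "orthonormal G e"
  shows "matrix_inv G $ k $ l = (\<Sum>i\<in>UNIV. e i $ k * e i $ l)"
  by (simp add: orthonormal_inverse(1)[OF assms] matrix_matrix_mult_def transpose_def)

text \<open>This is \<open>v\<close> written as the inverse of \<open>G\<close> applied to
  \<open>G *v v\<close>, with the inverse factored through the basis.\<close>

lemma orthonormal_expansion:
  assumes "orthonormal G e" "spd G"
  shows "v = (\<Sum>i\<in>UNIV. ip G v (e i) *\<^sub>R e i)"
proof -
  have "v = (transpose (\<chi> i. e i) ** (\<chi> i. e i)) *v (G *v v)"
    by (simp add: matrix_vector_mul_assoc orthonormal_inverse(3)[OF assms(1)] flip: orthonormal_inverse(1)[OF assms(1)])
  also have "\<dots> = transpose (\<chi> i. e i) *v ((\<chi> i. e i) *v (G *v v))"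
    by (simp add: matrix_vector_mul_assoc matrix_mul_assoc)
  also have "(\<chi> i. e i) *v (G *v v) = (\<chi> i. ip G v (e i))"
    by (simp add: vec_eq_iff matrix_vector_mul_component spd_sym[OF assms(2), of "e _" v] flip: ip_def)
  also have "transpose (\<chi> i. e i) *v (\<chi> i. ip G v (e i)) = (\<Sum>i\<in>UNIV. ip G v (e i) *\<^sub>R e i)"
    by (simp add: vec_eq_iff matrix_vector_mult_def transpose_def mult.commute)
  finally show ?thesis .
qed

text \<open>Each coordinate vector is expanded in \<open>e\<close> and the two sums are exchanged.
  It passes from coordinate divergences to frames.\<close>

lemma orthonormal_trace:
  assumes "orthonormal G e" "spd G" "linear L"
  shows "(\<Sum>k\<in>UNIV. L (axis k 1) $ k) = (\<Sum>j\<in>UNIV. ip G (L (e j)) (e j))"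
proof -
  have "L (axis k 1) = (\<Sum>j\<in>UNIV. ip G (axis k 1) (e j) *\<^sub>R L (e j))" for k
    using arg_cong[OF orthonormal_expansion[OF assms(1,2), of "axis k 1"], of L]
    by (simp add: linear_sum[OF assms(3)] linear_scale[OF assms(3)])
  then have "(\<Sum>k\<in>UNIV. L (axis k 1) $ k) = (\<Sum>k\<in>UNIV. \<Sum>j\<in>UNIV. ip G (axis k 1) (e j) * L (e j) $ k)"
    by simp
  also have "\<dots> = (\<Sum>j\<in>UNIV. \<Sum>k\<in>UNIV. ip G (axis k 1) (e j) * L (e j) $ k)"
    by (rule sum.swap)
  also have "\<dots> = (\<Sum>j\<in>UNIV. ip G (\<Sum>k\<in>UNIV. L (e j) $ k *\<^sub>R axis k 1) (e j))"
    by (simp add: ip_sum_left ip_scaleR_left mult.commute)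
  finally show ?thesis by (simp flip: vec_eq_sum_axis)
qed

text \<open>The inner product of covectors dual to \<open>G\<close>. In an orthonormal basis it is
  the sum of the products of the values, whence its independence of coordinates.\<close>

definition cip :: "real ^ 'm ^ 'm \<Rightarrow> (real ^ 'm \<Rightarrow> real) \<Rightarrow> (real ^ 'm \<Rightarrow> real) \<Rightarrow> real" where
  "cip G a b = (\<Sum>k\<in>UNIV. \<Sum>l\<in>UNIV. matrix_inv G $ k $ l * a (axis k 1) * b (axis l 1))"

lemma cip_orthonormal:
  assumes "orthonormal G e" "linear a" "linear b"
  shows "cip G a b = (\<Sum>i\<in>UNIV. a (e i) * b (e i))"
proof -
  have ex: "L v = (\<Sum>k\<in>UNIV. v $ k * L (axis k 1))" if "linear L" for L :: "real ^ 'a \<Rightarrow> real" and v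
    using arg_cong[OF vec_eq_sum_axis[of v], of L] by (simp add: linear_sum[OF that] linear_scale[OF that])
  have "(\<Sum>i\<in>UNIV. a (e i) * b (e i)) =
    (\<Sum>i\<in>UNIV. \<Sum>k\<in>UNIV. \<Sum>l\<in>UNIV. e i $ k * e i $ l * a (axis k 1) * b (axis l 1))"
    by (simp add: ex[OF assms(2), of "e _"] ex[OF assms(3), of "e _"] sum_product mult_ac)
  also have "\<dots> = (\<Sum>k\<in>UNIV. \<Sum>l\<in>UNIV. \<Sum>i\<in>UNIV. e i $ k * e i $ l * a (axis k 1) * b (axis l 1))"
    by (subst sum.swap) (intro sum.cong refl sum.swap)
  finally show ?thesis
    by (simp add: cip_def matrix_inv_orthonormal[OF assms(1)] sum_distrib_right)
qed

text \<open>Taking determinants in \<open>orthonormal_matrix\<close> makes \<open>det G\<close>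
  times a square equal to 1.\<close>

lemma det_pos_orthonormal:
  assumes "orthonormal G e"
  shows "det G > 0"
proof -
  let ?P = "\<chi> i. e i"
  have "det ?P * det ?P * det G = 1"
    using arg_cong[OF orthonormal_matrix[OF assms], of det] by (simp add: det_mul det_transpose mult_ac)
  then show ?thesis by (metis less_eq_real_def mult_le_0_iff not_one_le_zero verit_comp_simplify1(3) zero_le_square)
qed

text \<open>Row \<open>i\<close> of \<open>C ** A\<close> is a combination of the rows of
  \<open>A\<close>; by multilinearity, every term except the one of row \<open>i\<close> itself is a
  determinant with two equal rows.\<close>

lemma det_replace_row:
  fixes A C :: "real ^ 'n ^ 'n"
  shows "det (\<chi> j. if j = i then (C ** A) $ i else A $ j) = C $ i $ i * det A"
proof -
  have row: "(C ** A) $ i = (\<Sum>k\<in>UNIV. C $ i $ k *s A $ k)"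
    by (simp add: vec_eq_iff matrix_matrix_mult_def)
  have "det (\<chi> j. if j = i then (C ** A) $ i else A $ j)
      = (\<Sum>k\<in>UNIV. det (\<chi> j. if j = i then C $ i $ k *s A $ k else A $ j))"
    unfolding row by (rule det_linear_row_sum[OF finite])
  also have "\<dots> = (\<Sum>k\<in>UNIV. C $ i $ k * det (\<chi> j. if j = i then A $ k else A $ j))"
    using det_row_mul[of i "C $ i $ _" "\<lambda>_. A $ _" "\<lambda>j. A $ j"] by simp
  also have "\<dots> = (\<Sum>k\<in>UNIV. if k = i then C $ i $ i * det A else 0)"
  proof (intro sum.cong refl)
    fix k
    show "C $ i $ k * det (\<chi> j. if j = i then A $ k else A $ j) = (if k = i then C $ i $ i * det A else 0)"
    proof (cases "k = i")
      case True
      have "(\<chi> j. if j = i then A $ i else A $ j) = A" by (simp add: vec_eq_iff)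
      then show ?thesis unfolding True by simp
    next
      case False
      have "det (\<chi> j. if j = i then A $ k else A $ j) = 0"
        by (rule det_identical_rows[of i k]) (use False in \<open>auto simp: row_def vec_eq_iff\<close>)
      then show ?thesis using False by simp
    qed
  qed
  finally show ?thesis by simp
qed

text \<open>Jacobi's formula. Differentiating the Leibniz sum replaces one row of \<open>M x\<close>
  at a time by a row of \<open>M' h\<close>. Writing \<open>M' h = C ** M x\<close>,
  \<open>det_replace_row\<close> leaves \<open>det (M x)\<close> times the trace of
  \<open>C\<close>, and this trace is computed in the basis \<open>e\<close>.\<close>

lemma det_has_derivative:
  fixes M :: "'a::real_normed_vector \<Rightarrow> real ^ 'n ^ 'n"
  assumes M: "(M has_derivative M') (at x)" and e: "orthonormal (M x) e"
  shows "((\<lambda>x. det (M x)) has_derivative (\<lambda>h. det (M x) * (\<Sum>j\<in>UNIV. ip (M' h) (e j) (e j)))) (at x)"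
proof -
  have ent: "((\<lambda>x. M x $ i $ j) has_derivative (\<lambda>h. M' h $ i $ j)) (at x)" for i j
    by (intro bounded_linear.has_derivative[OF bounded_linear_vec_nth] M)
  have *: "((\<lambda>x. \<Sum>p\<in>{p. p permutes UNIV}. of_int (sign p) * (\<Prod>i\<in>UNIV. M x $ i $ p i)) has_derivative
     (\<lambda>h. \<Sum>p\<in>{p. p permutes UNIV}. of_int (sign p) *
         (\<Sum>i\<in>UNIV. M' h $ i $ p i * (\<Prod>j\<in>UNIV - {i}. M x $ j $ p j)))) (at x)"
    by (intro has_derivative_sum has_derivative_mult_right has_derivative_prod ent)
  have eq: "(\<Sum>p\<in>{p. p permutes UNIV}. of_int (sign p) *
         (\<Sum>i\<in>UNIV. M' h $ i $ p i * (\<Prod>j\<in>UNIV - {i}. M x $ j $ p j)))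
     = det (M x) * (\<Sum>j\<in>UNIV. ip (M' h) (e j) (e j))" for h
  proof -
    define C where "C = M' h ** matrix_inv (M x)"
    have CA: "C ** M x = M' h"
      using orthonormal_inverse(3)[OF e] by (simp add: C_def flip: matrix_mul_assoc)
    have "(\<Sum>p\<in>{p. p permutes UNIV}. of_int (sign p) *
         (\<Sum>i\<in>UNIV. M' h $ i $ p i * (\<Prod>j\<in>UNIV - {i}. M x $ j $ p j)))
      = (\<Sum>p\<in>{p. p permutes UNIV}. \<Sum>i\<in>UNIV. of_int (sign p) *
          (\<Prod>j\<in>UNIV. (\<chi> j. if j = i then M' h $ i else M x $ j) $ j $ p j))"
    proof (intro sum.cong refl)
      fix p :: "'n \<Rightarrow> 'n"
      have "(\<Prod>j\<in>UNIV. (\<chi> j. if j = i then M' h $ i else M x $ j) $ j $ p j)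
         = M' h $ i $ p i * (\<Prod>j\<in>UNIV - {i}. M x $ j $ p j)" for i
        by (subst prod.remove[of UNIV i]) (auto intro!: prod.cong)
      then show "of_int (sign p) * (\<Sum>i\<in>UNIV. M' h $ i $ p i * (\<Prod>j\<in>UNIV - {i}. M x $ j $ p j))
        = (\<Sum>i\<in>UNIV. of_int (sign p) * (\<Prod>j\<in>UNIV. (\<chi> j. if j = i then M' h $ i else M x $ j) $ j $ p j))"
        by (simp add: sum_distrib_left)
    qed
    also have "\<dots> = (\<Sum>i\<in>UNIV. det (\<chi> j. if j = i then (C ** M x) $ i else M x $ j))"
      unfolding CA det_def by (rule sum.swap)
    also have "\<dots> = det (M x) * (\<Sum>i\<in>UNIV. C $ i $ i)"
      by (simp add: det_replace_row sum_distrib_left mult.commute)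
    also have "(\<Sum>i\<in>UNIV. C $ i $ i) = (\<Sum>i\<in>UNIV. \<Sum>l\<in>UNIV. \<Sum>j\<in>UNIV. M' h $ i $ l * e j $ i * e j $ l)"
      by (simp add: C_def matrix_matrix_mult_def matrix_inv_orthonormal[OF e] sum_distrib_left mult_ac)
    also have "\<dots> = (\<Sum>j\<in>UNIV. \<Sum>i\<in>UNIV. \<Sum>l\<in>UNIV. M' h $ i $ l * e j $ i * e j $ l)"
      by (subst sum.swap, subst (2) sum.swap) (intro sum.cong refl sum.swap)
    finally show ?thesis by (simp add: ip_eq_sum)
  qed
  show ?thesis using * unfolding eq by (simp add: det_def)
qed

section \<open>Orthonormal frames\<close>

text \<open>Gram-Schmidt applied to the coordinate fields, on all of \<open>S\<close> at once. The
  induction also records that the fields already built have no components outside \<open>I\<close>;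
  this shows that the next coordinate field does not vanish after projection, since its own
  component remains 1.\<close>

lemma exists_orthonormal_frame:
  fixes G :: "real ^ 'm \<Rightarrow> real ^ 'm ^ 'm"
  assumes S: "open S" and G: "smooth_on S G" and spd: "\<And>x. x \<in> S \<Longrightarrow> spd (G x)"
  shows "\<exists>E. orthonormal_frame_on G S E"
proof -
  have "\<exists>E. (\<forall>i\<in>I. smooth_on S (E i)) \<and>
      (\<forall>x\<in>S. (\<forall>i\<in>I. \<forall>j\<in>I. ip (G x) (E i x) (E j x) = (if i = j then 1 else 0)) \<and>
             (\<forall>i\<in>I. \<forall>j. j \<notin> I \<longrightarrow> E i x $ j = 0))" for I :: "'m set"
    using finite[of I]
  proof (induction I)
    case empty
    show ?case by simp
  next
    case (insert k I)
    then obtain E where E: "\<And>i. i \<in> I \<Longrightarrow> smooth_on S (E i)"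
      "\<And>x i j. x \<in> S \<Longrightarrow> i \<in> I \<Longrightarrow> j \<in> I \<Longrightarrow> ip (G x) (E i x) (E j x) = (if i = j then 1 else 0)"
      "\<And>x i j. x \<in> S \<Longrightarrow> i \<in> I \<Longrightarrow> j \<notin> I \<Longrightarrow> E i x $ j = 0" by metis
    define w where "w = (\<lambda>x. axis k 1 - (\<Sum>i\<in>I. ip (G x) (axis k 1) (E i x) *\<^sub>R E i x))"
    have w_perp: "ip (G x) (w x) (E j x) = 0" if "x \<in> S" "j \<in> I" for x j
    proof -
      have "(\<Sum>i\<in>I. ip (G x) (axis k 1) (E i x) * ip (G x) (E i x) (E j x)) = ip (G x) (axis k 1) (E j x)"
        using that insert(1) by (simp add: E(2) if_distrib cong: if_cong)
      then show ?thesis by (simp add: w_def ip_diff_left ip_sum_left ip_scaleR_left)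
    qed
    have "w x $ k = 1" if "x \<in> S" for x
      using E(3)[OF that] insert(2) by (simp add: w_def)
    then have w0: "w x \<noteq> 0" if "x \<in> S" for x
      using that by (metis zero_index zero_neq_one)
    have w_out: "w x $ j = 0" if "x \<in> S" "j \<notin> insert k I" for x j
      using E(3)[OF that(1)] that(2) by (simp add: w_def axis_def)
    define N where "N = (\<lambda>x. ip (G x) (w x) (w x))"
    have N: "N x > 0" if "x \<in> S" for x
      unfolding N_def by (rule spd_pos[OF spd[OF that] w0[OF that]])
    have Gk: "Ck_on n S G" for n using G by (rule smooth_onD)
    have Ek: "Ck_on n S (E i)" if "i \<in> I" for n i using E(1)[OF that] by (rule smooth_onD)
    have wk: "Ck_on n S w" for n
      unfolding w_def by (intro Ck_on_diff Ck_on_const Ck_on_sum Ck_on_scaleR Ck_on_ip S Gk Ek)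
    define e where "e = (\<lambda>x. inverse (sqrt (N x)) *\<^sub>R w x)"
    have ek: "Ck_on n S e" for n
      unfolding e_def
    proof (intro Ck_on_scaleR Ck_on_inverse Ck_on_sqrt S wk)
      show "Ck_on n S N" unfolding N_def by (intro Ck_on_ip S Gk wk)
    qed (use N in \<open>fastforce+\<close>)
    have e_perp: "ip (G x) (e x) (E j x) = 0" "ip (G x) (E j x) (e x) = 0" if "x \<in> S" "j \<in> I" for x j
      using w_perp[OF that] spd_sym[OF spd[OF that(1)], of "E j x"] by (simp_all add: e_def ip_scaleR_left)
    have e_unit: "ip (G x) (e x) (e x) = 1" if "x \<in> S" for x
    proof -
      have "ip (G x) (e x) (e x) = inverse (sqrt (N x)) * (inverse (sqrt (N x)) * N x)"
        by (simp add: e_def N_def ip_scaleR_left ip_scaleR_right)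
      also have "\<dots> = 1" using N[OF that] by (simp add: field_simps)
      finally show ?thesis .
    qed
    let ?E = "E(k := e)"
    show ?case
    proof (rule exI[of _ ?E], intro conjI ballI allI impI)
      fix i assume "i \<in> insert k I"
      then show "smooth_on S (?E i)" using E(1) ek by (auto simp: smooth_on_def)
    next
      fix x i j assume "x \<in> S" "i \<in> insert k I" "j \<in> insert k I"
      then show "ip (G x) (?E i x) (?E j x) = (if i = j then 1 else 0)"
        using E(2) e_perp e_unit insert(2) by auto
    next
      fix x i j assume "x \<in> S" "i \<in> insert k I" "j \<notin> insert k I"
      then show "?E i x $ j = 0" using E(3) w_out by (auto simp: e_def)
    qed
  qed
  from this[of UNIV] show ?thesis unfolding orthonormal_frame_on_def by auto
qed

lemma orthonormal_frame_onD: "orthonormal_frame_on G S E \<Longrightarrow> x \<in> S \<Longrightarrow> orthonormal (G x) (\<lambda>i. E i x)"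
  by (simp add: orthonormal_frame_on_def orthonormal_def)

lemma orthonormal_frame_on_smooth: "orthonormal_frame_on G S E \<Longrightarrow> smooth_on S (E i)"
  by (simp add: orthonormal_frame_on_def)

lemma orthonormal_frame_on_subset: "orthonormal_frame_on G S E \<Longrightarrow> T \<subseteq> S \<Longrightarrow> orthonormal_frame_on G T E"
  unfolding orthonormal_frame_on_def smooth_on_def using Ck_on_subset by blast

text \<open>A basis for one matrix is a frame for the constant matrix function.\<close>

lemma spd_exists_orthonormal:
  assumes "spd (G :: real ^ 'm ^ 'm)"
  shows "\<exists>e. orthonormal G e"
proof -
  have "smooth_on UNIV (\<lambda>_ :: real ^ 'm. G)" by (simp add: smooth_on_def Ck_on_const)
  from exists_orthonormal_frame[OF open_UNIV this] assms obtain E where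
    "orthonormal_frame_on (\<lambda>_ :: real ^ 'm. G) UNIV E" by auto
  from orthonormal_frame_onD[OF this] show ?thesis by auto
qed

text \<open>The entries of the inverse are sums of products of components of a smooth frame.\<close>

lemma smooth_on_matrix_inv:
  fixes G :: "real ^ 'm \<Rightarrow> real ^ 'm ^ 'm"
  assumes "open S" "smooth_on S G" "\<And>x. x \<in> S \<Longrightarrow> spd (G x)"
  shows "smooth_on S (\<lambda>x. matrix_inv (G x))"
  unfolding smooth_on_def
proof
  fix k
  obtain E where E: "orthonormal_frame_on G S E" using exists_orthonormal_frame[OF assms] by auto
  show "Ck_on k S (\<lambda>x. matrix_inv (G x))"
  proof (rule Ck_on_matrix[OF assms(1)])
    fix i j
    show "Ck_on k S (\<lambda>x. matrix_inv (G x) $ i $ j)"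
    proof (rule Ck_on_congI[OF assms(1)])
      show "Ck_on k S (\<lambda>x. \<Sum>l\<in>UNIV. E l x $ i * E l x $ j)"
        by (intro Ck_on_sum Ck_on_mult Ck_on_nth assms(1) smooth_onD[OF orthonormal_frame_on_smooth[OF E]])
    qed (rule matrix_inv_orthonormal[OF orthonormal_frame_onD[OF E]])
  qed
qed

section \<open>Christoffel symbols and metric compatibility\<close>

text \<open>Product rule for a derivative evaluated on a field: the first term moves the base point
  with the vector \<open>W x\<close> frozen, the second moves the vector. It differentiates pushed
  forward fields and their images under a change of charts.\<close>

lemma frechet_apply_has_derivative:
  fixes \<phi> :: "'b::euclidean_space \<Rightarrow> 'c::real_normed_vector" and F :: "'a::real_normed_vector \<Rightarrow> 'b"
  assumes T: "open T" and phi: "Ck_on 2 T \<phi>" and F: "(F has_derivative F') (at x)"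
    and W: "(W has_derivative W') (at x)" and U: "open U" "x \<in> U" "F ` U \<subseteq> T"
  shows "((\<lambda>x. frechet_derivative \<phi> (at (F x)) (W x)) has_derivative
     (\<lambda>\<xi>. frechet_derivative (\<lambda>z. frechet_derivative \<phi> (at z) (W x)) (at (F x)) (F' \<xi>)
          + frechet_derivative \<phi> (at (F x)) (W' \<xi>))) (at x)"
proof -
  let ?D = "\<lambda>b z. frechet_derivative \<phi> (at z) b"
  have C: "Ck_on (Suc (Suc 0)) T \<phi>" using phi by (simp add: numeral_2_eq_2)
  have lin: "linear (frechet_derivative \<phi> (at z))" if "z \<in> T" for z
    using has_derivative_linear[OF Ck_on_has_derivative[OF C that]] .
  have ex: "?D w z = (\<Sum>b\<in>Basis. (w \<bullet> b) *\<^sub>R ?D b z)" if "z \<in> T" for w z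
    by (rule linear_basis_expansion[OF lin[OF that]])
  have D: "(?D b has_derivative frechet_derivative (?D b) (at z)) (at z)" if "z \<in> T" for b z
    using C Ck_on_has_derivative[of 0 T "?D b" z] that by simp
  have Fx: "F x \<in> T" using U by auto
  have "((\<lambda>z. \<Sum>b\<in>Basis. (W x \<bullet> b) *\<^sub>R ?D b z) has_derivative
       (\<lambda>\<xi>. \<Sum>b\<in>Basis. (W x \<bullet> b) *\<^sub>R frechet_derivative (?D b) (at (F x)) \<xi>)) (at (F x))"
    by (intro has_derivative_sum has_derivative_scaleR_right D Fx)
  then have "(?D (W x) has_derivative
       (\<lambda>\<xi>. \<Sum>b\<in>Basis. (W x \<bullet> b) *\<^sub>R frechet_derivative (?D b) (at (F x)) \<xi>)) (at (F x))"
    by (rule has_derivative_transform_within_open[OF _ T Fx]) (simp add: ex[of _ "W x"])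
  from frechet_derivative_at[OF this]
  have D2: "frechet_derivative (?D (W x)) (at (F x)) \<xi>
      = (\<Sum>b\<in>Basis. (W x \<bullet> b) *\<^sub>R frechet_derivative (?D b) (at (F x)) \<xi>)" for \<xi>
    by (simp add: fun_eq_iff)
  have "((\<lambda>x. \<Sum>b\<in>Basis. (W x \<bullet> b) *\<^sub>R ?D b (F x)) has_derivative
     (\<lambda>\<xi>. \<Sum>b\<in>Basis. (W x \<bullet> b) *\<^sub>R frechet_derivative (?D b) (at (F x)) (F' \<xi>) + (W' \<xi> \<bullet> b) *\<^sub>R ?D b (F x))) (at x)"
    by (intro has_derivative_sum has_derivative_scaleR has_derivative_inner_left W
        has_derivative_compose[OF F D[OF Fx]])
  then have "((\<lambda>x. \<Sum>b\<in>Basis. (W x \<bullet> b) *\<^sub>R ?D b (F x)) has_derivative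
     (\<lambda>\<xi>. frechet_derivative (?D (W x)) (at (F x)) (F' \<xi>) + frechet_derivative \<phi> (at (F x)) (W' \<xi>))) (at x)"
    by (simp add: sum.distrib D2 ex[OF Fx, of "W' _"])
  then show ?thesis
    by (rule has_derivative_transform_within_open[OF _ U(1,2)]) (use U(3) in \<open>auto simp: ex[of _ "W _"]\<close>)
qed

lemma Ck_on_frechet_compose_apply:
  fixes \<phi> :: "'b::euclidean_space \<Rightarrow> 'c::real_normed_vector" and F :: "'a::euclidean_space \<Rightarrow> 'b"
  assumes "open S" "Ck_on (Suc k) T \<phi>" "Ck_on k S F" "F ` S \<subseteq> T" "Ck_on k S a"
  shows "Ck_on k S (\<lambda>x. frechet_derivative \<phi> (at (F x)) (a x))"
proof (rule Ck_on_congI[OF assms(1)])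
  show "Ck_on k S (\<lambda>x. \<Sum>b\<in>Basis. (a x \<bullet> b) *\<^sub>R frechet_derivative \<phi> (at (F x)) b)"
    using assms(2) by (intro Ck_on_sum Ck_on_scaleR Ck_on_inner Ck_on_const Ck_on_compose[OF assms(1) _ assms(3,4)] assms) simp
qed (rule linear_basis_expansion[OF has_derivative_linear[OF Ck_on_has_derivative[OF assms(2)]]], use assms(4) in blast)

text \<open>The Christoffel form with its upper index lowered. It separates the first derivatives of
  the metric from the inverse metric, which gives both the smoothness of the Christoffel form and
  the Koszul formula.\<close>

definition christoffel_covector :: "(real ^ 'n \<Rightarrow> real ^ 'n ^ 'n) \<Rightarrow> real ^ 'n \<Rightarrow> real ^ 'n \<Rightarrow> real ^ 'n \<Rightarrow> real ^ 'n" where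
  "christoffel_covector K y a b =
     (let K' = frechet_derivative K (at y) in
      \<chi> l. (ip (K' a) b (axis l 1) + ip (K' b) a (axis l 1) - ip (K' (axis l 1)) a b) / 2)"

lemma ip_axis_right: "ip M b (axis l 1) = (\<Sum>j\<in>UNIV. M $ j $ l * b $ j)"
  by (simp add: ip_eq_sum axis_def if_distrib cong: if_cong)

lemma linear_axis_expansion:
  assumes "linear L"
  shows "L a = (\<Sum>i\<in>UNIV. a $ i *\<^sub>R L (axis i 1))"
  using arg_cong[OF vec_eq_sum_axis[of a], of L] by (simp add: linear_sum[OF assms] linear_scale[OF assms])

lemma christoffel_form_eq:
  fixes K :: "real ^ 'n \<Rightarrow> real ^ 'n ^ 'n"
  assumes "K differentiable (at y)"
  shows "christoffel_form K y a b = matrix_inv (K y) *v christoffel_covector K y a b"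
proof -
  define K' where "K' = frechet_derivative K (at y)"
  have K: "(K has_derivative K') (at y)" using assms frechet_derivative_works by (auto simp: K'_def)
  have lin: "linear K'" using K has_derivative_linear by blast
  have pd: "pderiv_coord i (\<lambda>z. K z $ j $ l) y = K' (axis i 1) $ j $ l" for i j l
    unfolding pderiv_coord_def
    by (subst frechet_derivative_at[OF bounded_linear.has_derivative[OF bounded_linear_vec_nth
          bounded_linear.has_derivative[OF bounded_linear_vec_nth K]], symmetric]) simp
  have 1: "ip (K' a) b (axis l 1) = (\<Sum>i\<in>UNIV. \<Sum>j\<in>UNIV. K' (axis i 1) $ j $ l * a $ i * b $ j)" for a b l
  proof -
    have "ip (K' a) b (axis l 1) = (\<Sum>j\<in>UNIV. \<Sum>i\<in>UNIV. K' (axis i 1) $ j $ l * a $ i * b $ j)"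
      by (simp add: ip_axis_right linear_axis_expansion[OF lin, of a] sum_distrib_right sum_distrib_left mult_ac)
    also have "\<dots> = (\<Sum>i\<in>UNIV. \<Sum>j\<in>UNIV. K' (axis i 1) $ j $ l * a $ i * b $ j)" by (rule sum.swap)
    finally show ?thesis .
  qed
  have 2: "ip (K' b) a (axis l 1) = (\<Sum>i\<in>UNIV. \<Sum>j\<in>UNIV. K' (axis j 1) $ i $ l * a $ i * b $ j)" for l
    by (subst sum.swap) (simp add: 1 mult_ac)
  have cov: "christoffel_covector K y a b $ l = (\<Sum>i\<in>UNIV. \<Sum>j\<in>UNIV.
     (K' (axis i 1) $ j $ l + K' (axis j 1) $ i $ l - K' (axis l 1) $ i $ j) * a $ i * b $ j) / 2" for l
    by (simp add: christoffel_covector_def Let_def 1[of a b] 2 ip_eq_sum[of "K' (axis l 1)"] flip: K'_def sum.distrib sum_subtractf)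
      (simp add: algebra_simps)
  show ?thesis
  proof (rule vec_eq_iff[THEN iffD2], rule allI)
    fix k
    have "christoffel_form K y a b $ k = (\<Sum>i\<in>UNIV. \<Sum>j\<in>UNIV. \<Sum>l\<in>UNIV. matrix_inv (K y) $ k $ l *
       ((K' (axis i 1) $ j $ l + K' (axis j 1) $ i $ l - K' (axis l 1) $ i $ j) * a $ i * b $ j) / 2)"
      unfolding christoffel_form_def christoffel_def pd
      by (simp add: sum_divide_distrib sum_distrib_right sum_distrib_left mult_ac)
    also have "\<dots> = (\<Sum>i\<in>UNIV. \<Sum>l\<in>UNIV. \<Sum>j\<in>UNIV. matrix_inv (K y) $ k $ l *
       ((K' (axis i 1) $ j $ l + K' (axis j 1) $ i $ l - K' (axis l 1) $ i $ j) * a $ i * b $ j) / 2)"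
      by (intro sum.cong refl sum.swap)
    also have "\<dots> = (\<Sum>l\<in>UNIV. \<Sum>i\<in>UNIV. \<Sum>j\<in>UNIV. matrix_inv (K y) $ k $ l *
       ((K' (axis i 1) $ j $ l + K' (axis j 1) $ i $ l - K' (axis l 1) $ i $ j) * a $ i * b $ j) / 2)"
      by (rule sum.swap)
    also have "\<dots> = (\<Sum>l\<in>UNIV. matrix_inv (K y) $ k $ l * christoffel_covector K y a b $ l)"
      by (simp add: cov sum_distrib_left sum_divide_distrib)
    finally show "christoffel_form K y a b $ k = (matrix_inv (K y) *v christoffel_covector K y a b) $ k"
      by (simp add: matrix_vector_mult_def)
  qed
qed

text \<open>The Koszul formula for fields with constant components: pairing with the metric cancels
  the inverse in \<open>christoffel_form_eq\<close>.\<close>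

lemma christoffel_form_ip:
  fixes K :: "real ^ 'n \<Rightarrow> real ^ 'n ^ 'n"
  assumes K: "(K has_derivative K') (at y)" and spd: "spd (K y)"
  shows "ip (K y) (christoffel_form K y a b) c = (ip (K' a) b c + ip (K' b) a c - ip (K' c) a b) / 2"
proof -
  obtain e where e: "orthonormal (K y) e" using spd_exists_orthonormal[OF spd] by auto
  have K'_eq: "frechet_derivative K (at y) = K'" using frechet_derivative_at[OF K] by simp
  have lin: "linear K'" using K has_derivative_linear by blast
  let ?w = "christoffel_covector K y a b"
  have diff: "K differentiable (at y)" using K by (auto simp: differentiable_def)
  have half: "(\<Sum>l\<in>UNIV. c $ l * (ip M v (axis l 1)) / 2) = ip M v c / 2" for M v
    by (subst (2) vec_eq_sum_axis[of c]) (simp add: ip_sum_right ip_scaleR_right sum_divide_distrib)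
  have "ip (K y) (christoffel_form K y a b) c = ip (K y) c (matrix_inv (K y) *v ?w)"
    using christoffel_form_eq[OF diff, of a b] by (simp add: spd_sym[OF spd, of _ c])
  also have "\<dots> = c \<bullet> ?w"
    using orthonormal_inverse(2)[OF e] by (simp add: ip_def matrix_vector_mul_assoc)
  also have "\<dots> = (\<Sum>l\<in>UNIV. c $ l * (ip (K' a) b (axis l 1)) / 2) + (\<Sum>l\<in>UNIV. c $ l * (ip (K' b) a (axis l 1)) / 2)
     - (\<Sum>l\<in>UNIV. c $ l * ip (K' (axis l 1)) a b / 2)"
    by (simp add: inner_vec_def christoffel_covector_def K'_eq Let_def algebra_simps add_divide_distrib
        diff_divide_distrib flip: sum.distrib sum_subtractf)
  also have "(\<Sum>l\<in>UNIV. c $ l * ip (K' (axis l 1)) a b / 2) = ip (K' c) a b / 2"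
  proof -
    \<comment> \<open>The covector is given on coordinate vectors; linearity extends it to an
      arbitrary \<open>c\<close>.\<close>
    have "linear (\<lambda>c. ip (K' c) a b)"
      by (rule linearI) (simp_all add: linear_add[OF lin] linear_scale[OF lin] ip_matrix_add ip_matrix_scaleR)
    from linear_axis_expansion[OF this, of c] show ?thesis by (simp add: sum_divide_distrib)
  qed
  finally show ?thesis unfolding half by (simp add: field_simps)
qed

text \<open>Differentiates the symmetry of \<open>K z\<close>, which is why symmetry is required on
  a neighbourhood of \<open>y\<close>.\<close>

lemma metric_derivative_sym:
  assumes "open T" "y \<in> T" "\<And>z. z \<in> T \<Longrightarrow> spd (K z)" "(K has_derivative K') (at y)"
  shows "ip (K' a) b c = ip (K' a) c b"
proof -
  have D: "((\<lambda>z. ip (K z) b c) has_derivative (\<lambda>h. ip (K' h) b c)) (at y)" for b c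
    using ip_has_derivative[OF assms(4) has_derivative_const has_derivative_const]
    by (simp add: ip_zero_left ip_zero_right)
  have "((\<lambda>z. ip (K z) b c) has_derivative (\<lambda>h. ip (K' h) c b)) (at y)"
    by (rule has_derivative_transform_within_open[OF D[of c b] assms(1,2)]) (rule spd_sym[OF assms(3)])
  from has_derivative_unique[OF this D[of b c]] show ?thesis by (simp add: fun_eq_iff)
qed

text \<open>One chart expression \<open>F\<close> of a map, with the target metric \<open>K\<close>.
  Taking the identity as \<open>F\<close> and \<open>G\<close> as metric describes the tangent
  bundle of the source, so the facts on the connection serve both bundles.\<close>

locale pullback_bundle =
  fixes S :: "(real ^ 'm) set" and T :: "(real ^ 'n) set"
    and F :: "real ^ 'm \<Rightarrow> real ^ 'n" and K :: "real ^ 'n \<Rightarrow> real ^ 'n ^ 'n"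
  assumes open_S: "open S" and open_T: "open T" and F_smooth: "smooth_on S F"
    and K_smooth: "smooth_on T K" and F_into: "F ` S \<subseteq> T" and K_spd: "\<And>y. y \<in> T \<Longrightarrow> spd (K y)"
begin

text \<open>Takes a direction at a single point, the connection being tensorial in it.\<close>

definition cov :: "real ^ 'm \<Rightarrow> (real ^ 'm \<Rightarrow> real ^ 'n) \<Rightarrow> real ^ 'm \<Rightarrow> real ^ 'n" where
  "cov \<xi> V x = frechet_derivative V (at x) \<xi>
     + christoffel_form K (F x) (frechet_derivative F (at x) \<xi>) (V x)"

lemma pullback_connection_cov: "pullback_connection K F X V = (\<lambda>x. cov (X x) V x)"
  by (simp add: pullback_connection_def cov_def fun_eq_iff)

lemma F_in: "x \<in> S \<Longrightarrow> F x \<in> T"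
  using F_into by auto

text \<open>By the Koszul formula the two Christoffel terms add up to the derivative of
  \<open>K\<close> in the direction in which \<open>F\<close> moves; the other terms are the product
  rule.\<close>

lemma metric_compat:
  assumes x: "x \<in> S" and V: "V differentiable (at x)" and W: "W differentiable (at x)"
  shows "((\<lambda>x. ip (K (F x)) (V x) (W x)) has_derivative
     (\<lambda>\<xi>. ip (K (F x)) (cov \<xi> V x) (W x) + ip (K (F x)) (V x) (cov \<xi> W x))) (at x)"
proof -
  define K' where "K' = frechet_derivative K (at (F x))"
  define F' where "F' = frechet_derivative F (at x)"
  have K: "(K has_derivative K') (at (F x))"
    using smooth_on_has_derivative[OF K_smooth F_in[OF x]] by (simp add: K'_def)
  have F: "(F has_derivative F') (at x)"
    using smooth_on_has_derivative[OF F_smooth x] by (simp add: F'_def)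
  have spd: "spd (K (F x))" using K_spd F_in[OF x] by simp
  note sym = metric_derivative_sym[OF open_T F_in[OF x] K_spd K]
  have key: "ip (K (F x)) (christoffel_form K (F x) a (V x)) (W x)
      + ip (K (F x)) (V x) (christoffel_form K (F x) a (W x)) = ip (K' a) (V x) (W x)" for a
    unfolding spd_sym[OF spd, of "V x"] christoffel_form_ip[OF K spd]
    using sym[of a "V x" "W x"] sym[of "V x" a "W x"] sym[of "W x" a "V x"] by (simp add: field_simps)
  show ?thesis
    by (rule has_derivative_eq_rhs, rule ip_has_derivative[OF has_derivative_compose[OF F K]
          frechet_derivative_works[THEN iffD1, OF V] frechet_derivative_works[THEN iffD1, OF W]])
      (simp add: fun_eq_iff cov_def ip_add_left ip_add_right key[symmetric] F'_def)
qed

lemma christoffel_form_commute: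
  assumes y: "y \<in> T"
  shows "christoffel_form K y a b = christoffel_form K y b a"
proof (rule spd_eqI[OF K_spd[OF y]])
  fix c
  have K: "(K has_derivative frechet_derivative K (at y)) (at y)"
    using smooth_on_has_derivative[OF K_smooth y] .
  show "ip (K y) (christoffel_form K y a b) c = ip (K y) (christoffel_form K y b a) c"
    unfolding christoffel_form_ip[OF K K_spd[OF y]]
    using metric_derivative_sym[OF open_T y K_spd K, of c a b] by simp
qed

lemma Ck_on_christoffel_form:
  assumes a: "Ck_on k S a" and b: "Ck_on k S b"
  shows "Ck_on k S (\<lambda>x. christoffel_form K (F x) (a x) (b x))"
proof (rule Ck_on_congI[OF open_S])
  note F = smooth_onD[OF F_smooth]
  have D: "Ck_on k S (\<lambda>x. frechet_derivative K (at (F x)) (w x))" if "Ck_on k S w" for w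
    by (rule Ck_on_frechet_compose_apply[OF open_S smooth_onD[OF K_smooth] F F_into that])
  have w: "Ck_on k S (\<lambda>x. christoffel_covector K (F x) (a x) (b x))"
    unfolding christoffel_covector_def Let_def
    by (intro Ck_on_vec Ck_on_divide Ck_on_diff Ck_on_add Ck_on_ip open_S D a b Ck_on_const) simp_all
  have inv: "Ck_on k S (\<lambda>x. matrix_inv (K (F x)))"
    by (rule Ck_on_compose[OF open_S smooth_onD[OF smooth_on_matrix_inv[OF open_T K_smooth K_spd]] F F_into])
  show "Ck_on k S (\<lambda>x. matrix_inv (K (F x)) *v christoffel_covector K (F x) (a x) (b x))"
    by (rule Ck_on_bilinear[OF open_S bounded_bilinear_matrix_vector inv w])
  show "christoffel_form K (F x) (a x) (b x) = matrix_inv (K (F x)) *v christoffel_covector K (F x) (a x) (b x)"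
    if "x \<in> S" for x
    by (rule christoffel_form_eq[OF smooth_on_differentiable[OF K_smooth F_in[OF that]]])
qed

lemma Ck_on_cov:
  assumes "Ck_on (Suc k) S V" "Ck_on k S X"
  shows "Ck_on k S (\<lambda>x. cov (X x) V x)"
  unfolding cov_def
  by (intro Ck_on_add open_S Ck_on_frechet_apply Ck_on_christoffel_form assms smooth_onD[OF F_smooth]
      Ck_on_SucD[OF assms(1)])

lemma push_differentiable:
  assumes "x \<in> S"
  shows "(\<lambda>y. frechet_derivative F (at y) a) differentiable (at x)"
  using smooth_onD[OF F_smooth, of 2] assms by (simp add: numeral_2_eq_2)

text \<open>Torsion freeness of the target connection seen along \<open>F\<close>: second
  derivatives commute and the Christoffel form is symmetric.\<close>

lemma cov_push_commute:
  assumes "x \<in> S"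
  shows "cov a (\<lambda>y. frechet_derivative F (at y) b) x = cov b (\<lambda>y. frechet_derivative F (at y) a) x"
  unfolding cov_def
  using second_derivative_symmetric[OF open_S smooth_onD[OF F_smooth] assms, of a b]
    christoffel_form_commute[OF F_in[OF assms]] by simp

end

section \<open>The second fundamental form\<close>

locale isometric_chart_map = pullback_bundle S T F K
  for S :: "(real ^ 'm) set" and T :: "(real ^ 'n) set" and F K +
  fixes G :: "real ^ 'm \<Rightarrow> real ^ 'm ^ 'm"
  assumes G_smooth: "smooth_on S G" and G_spd: "\<And>x. x \<in> S \<Longrightarrow> spd (G x)"
    and isometric: "\<And>x u v. x \<in> S \<Longrightarrow> ip (G x) u v =
      ip (K (F x)) (frechet_derivative F (at x) u) (frechet_derivative F (at x) v)"
begin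

sublocale base: pullback_bundle S S "\<lambda>x. x" G
  by unfold_locales (use open_S G_smooth G_spd in \<open>auto simp: smooth_on_def Ck_on_ident\<close>)

abbreviation push where "push x \<equiv> frechet_derivative F (at x)"

lemma linear_push: "x \<in> S \<Longrightarrow> linear (push x)"
  using has_derivative_linear[OF smooth_on_has_derivative[OF F_smooth]] .

text \<open>The vector \<open>b\<close> is extended with constant components, for which the
  Levi-Civita derivative reduces to the Christoffel form.\<close>

definition second_form :: "real ^ 'm \<Rightarrow> real ^ 'm \<Rightarrow> real ^ 'm \<Rightarrow> real ^ 'n" where
  "second_form x a b = cov a (\<lambda>y. push y b) x - push x (christoffel_form G x a b)"

text \<open>The tangential part of the target connection is the Levi-Civita connection of the
  induced metric. Differentiating \<open>ip (G z) b c\<close> through the immersion expresses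
  \<open>G'\<close> by the form \<open>?s\<close>, which is symmetric in its first two arguments;
  the Koszul formula then solves for \<open>?s\<close>.\<close>

lemma ip_cov_push:
  assumes x: "x \<in> S"
  shows "ip (K (F x)) (cov a (\<lambda>y. push y b) x) (push x c) = ip (G x) (christoffel_form G x a b) c"
proof -
  define G' where "G' = frechet_derivative G (at x)"
  have G: "(G has_derivative G') (at x)"
    using smooth_on_has_derivative[OF G_smooth x] by (simp add: G'_def)
  let ?s = "\<lambda>a b c. ip (K (F x)) (cov a (\<lambda>y. push y b) x) (push x c)"
  have D: "ip (G' \<xi>) b c = ?s \<xi> b c + ?s \<xi> c b" for \<xi> b c
  proof -
    have 1: "((\<lambda>z. ip (G z) b c) has_derivative (\<lambda>h. ip (G' h) b c)) (at x)"
      using ip_has_derivative[OF G has_derivative_const has_derivative_const]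
      by (simp add: ip_zero_left ip_zero_right)
    have 2: "((\<lambda>z. ip (G z) b c) has_derivative (\<lambda>\<xi>. ?s \<xi> b c + ip (K (F x)) (push x b) (cov \<xi> (\<lambda>y. push y c) x))) (at x)"
      by (rule has_derivative_transform_within_open[OF
            metric_compat[OF x push_differentiable[OF x] push_differentiable[OF x]] open_S x])
        (simp add: isometric)
    have "ip (G' \<xi>) b c = ?s \<xi> b c + ip (K (F x)) (push x b) (cov \<xi> (\<lambda>y. push y c) x)"
      using has_derivative_unique[OF 1 2] by (rule fun_cong)
    then show ?thesis by (simp add: spd_sym[OF K_spd[OF F_in[OF x]], of "push x b"])
  qed
  show ?thesis
    unfolding christoffel_form_ip[OF G G_spd[OF x]] D
    using cov_push_commute[OF x] by simp
qed

lemma second_form_normal: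
  assumes "x \<in> S"
  shows "ip (K (F x)) (second_form x a b) (push x c) = 0"
  using ip_cov_push[OF assms] isometric[OF assms] by (simp add: second_form_def ip_diff_left)

lemma push_forward_has_derivative:
  assumes x: "x \<in> S" and Y: "Y differentiable (at x)"
  shows "((\<lambda>y. push y (Y y)) has_derivative
    (\<lambda>\<xi>. frechet_derivative (\<lambda>z. push z (Y x)) (at x) \<xi> + push x (frechet_derivative Y (at x) \<xi>))) (at x)"
  using frechet_apply_has_derivative[OF open_S smooth_onD[OF F_smooth] has_derivative_ident
    frechet_derivative_works[THEN iffD1, OF Y] open_S x] by simp

text \<open>The derivatives of \<open>Y\<close> in the two terms cancel, so the second fundamental
  form is tensorial and may be computed with frozen vectors.\<close>

lemma second_fundamental_form_eq:
  assumes x: "x \<in> S" and Y: "Y differentiable (at x)"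
  shows "second_fundamental_form G K F X Y x = second_form x (X x) (Y x)"
proof -
  have pf: "push_forward F Y = (\<lambda>y. push y (Y y))" by (simp add: push_forward_def fun_eq_iff)
  show ?thesis
    using frechet_derivative_at[OF push_forward_has_derivative[OF assms], symmetric] linear_add[OF linear_push[OF x]]
    by (simp add: second_fundamental_form_def second_form_def pullback_connection_def pf
        push_forward_def[of F "levi_civita G X Y"] levi_civita_def cov_def)
qed

lemma cov_push_forward:
  assumes x: "x \<in> S" and Y: "Y differentiable (at x)"
  shows "cov \<xi> (\<lambda>y. push y (Y y)) x = second_form x \<xi> (Y x) + push x (base.cov \<xi> Y x)"
  using frechet_derivative_at[OF push_forward_has_derivative[OF assms], symmetric] linear_add[OF linear_push[OF x]]
  by (simp add: second_form_def cov_def base.cov_def)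

lemma levi_civita_eq: "levi_civita G X Y = (\<lambda>x. base.cov (X x) Y x)"
  by (simp add: levi_civita_def base.cov_def fun_eq_iff)

end

section \<open>The mean curvature vector in charts\<close>

text \<open>The Laplace-Beltrami operator as the trace of the Hessian in a frame, in the same shape
  as \<open>rough_laplacian\<close>; its divergence form is \<open>divergence_flux\<close>.\<close>

definition laplacian ::
    "(real ^ 'm \<Rightarrow> real ^ 'm ^ 'm) \<Rightarrow> ('m::finite \<Rightarrow> real ^ 'm \<Rightarrow> real ^ 'm) \<Rightarrow> (real ^ 'm \<Rightarrow> real) \<Rightarrow> real ^ 'm \<Rightarrow> real" where
  "laplacian G E u x = (\<Sum>i\<in>UNIV. frechet_derivative (\<lambda>y. frechet_derivative u (at y) (E i y)) (at x) (E i x)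
      - frechet_derivative u (at x) (levi_civita G (E i) (E i) x))"

locale framed_chart_map = isometric_chart_map S T F K G
  for S :: "(real ^ 'm) set" and T :: "(real ^ 'n) set" and F K G +
  fixes E :: "'m \<Rightarrow> real ^ 'm \<Rightarrow> real ^ 'm"
  assumes frame: "orthonormal_frame_on G S E"
begin

abbreviation H where "H \<equiv> mean_curvature G K F E"

lemma E_Ck: "Ck_on k S (E i)"
  by (rule smooth_onD[OF orthonormal_frame_on_smooth[OF frame]])

lemma E_differentiable: "x \<in> S \<Longrightarrow> E i differentiable (at x)"
  by (rule smooth_on_differentiable[OF orthonormal_frame_on_smooth[OF frame]])

lemma E_orthonormal: "x \<in> S \<Longrightarrow> orthonormal (G x) (\<lambda>i. E i x)"
  by (rule orthonormal_frame_onD[OF frame])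

lemma mean_curvature_eq:
  "x \<in> S \<Longrightarrow> H x = (1 / real CARD('m)) *\<^sub>R (\<Sum>i\<in>UNIV. second_form x (E i x) (E i x))"
  by (simp add: mean_curvature_def second_fundamental_form_eq[OF _ E_differentiable])

lemma mean_curvature_normal:
  assumes "x \<in> S"
  shows "ip (K (F x)) (H x) (push x c) = 0"
  by (simp add: mean_curvature_eq[OF assms] ip_scaleR_left ip_sum_left second_form_normal[OF assms])

lemma sum_cov_push_frame:
  assumes "x \<in> S"
  shows "(\<Sum>i\<in>UNIV. cov (E i x) (\<lambda>y. push y (E i y)) x)
    = real CARD('m) *\<^sub>R H x + push x (\<Sum>i\<in>UNIV. base.cov (E i x) (E i) x)"
  by (simp add: cov_push_forward[OF assms E_differentiable[OF assms]] mean_curvature_eq[OF assms]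
      sum.distrib linear_sum[OF linear_push[OF assms]])

text \<open>\<open>second_form\<close> has frozen arguments, so smoothness in \<open>x\<close> is
  read off from the Gauss formula \<open>cov_push_forward\<close>, in which only smooth fields are
  differentiated.\<close>

lemma mean_curvature_smooth: "Ck_on k S H"
proof (rule Ck_on_congI[OF open_S])
  have P: "Ck_on k S (\<lambda>y. push y (E i y))" for i k
    by (rule Ck_on_frechet_apply[OF open_S smooth_onD[OF F_smooth] E_Ck])
  show "Ck_on k S (\<lambda>x. (1 / real CARD('m)) *\<^sub>R
     (\<Sum>i\<in>UNIV. cov (E i x) (\<lambda>y. push y (E i y)) x - push x (base.cov (E i x) (E i) x)))"
    by (intro Ck_on_scaleR Ck_on_const Ck_on_sum Ck_on_diff open_S Ck_on_cov P E_Ck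
        Ck_on_frechet_apply[OF open_S smooth_onD[OF F_smooth]] base.Ck_on_cov)
  show "H x = (1 / real CARD('m)) *\<^sub>R
     (\<Sum>i\<in>UNIV. cov (E i x) (\<lambda>y. push y (E i y)) x - push x (base.cov (E i x) (E i) x))" if "x \<in> S" for x
    by (simp add: mean_curvature_eq[OF that] cov_push_forward[OF that E_differentiable[OF that]])
qed

definition sq :: "(real ^ 'm \<Rightarrow> real ^ 'n) \<Rightarrow> real ^ 'm \<Rightarrow> real" where
  "sq V x = ip (K (F x)) (V x) (V x)"

lemma sq_nonneg: "x \<in> S \<Longrightarrow> 0 \<le> sq V x"
  unfolding sq_def by (rule spd_nonneg[OF K_spd[OF F_in]])

lemma sq_smooth:
  assumes "\<And>k. Ck_on k S V"
  shows "Ck_on k S (sq V)"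
  unfolding sq_def
  by (intro Ck_on_ip open_S assms Ck_on_compose[OF open_S smooth_onD[OF K_smooth] smooth_onD[OF F_smooth] F_into])

lemma sq_derivative:
  assumes "Ck_on 1 S V" "x \<in> S"
  shows "frechet_derivative (sq V) (at x) \<xi> = 2 * ip (K (F x)) (cov \<xi> V x) (V x)"
proof -
  have V: "V differentiable (at x)" using assms by simp
  have "(sq V has_derivative (\<lambda>\<xi>. ip (K (F x)) (cov \<xi> V x) (V x) + ip (K (F x)) (V x) (cov \<xi> V x))) (at x)"
    using metric_compat[OF assms(2) V V] by (simp add: sq_def[abs_def])
  from frechet_derivative_at[OF this] show ?thesis
    using spd_sym[OF K_spd[OF F_in[OF assms(2)]], of "V x"] by (simp add: fun_eq_iff)
qed

text \<open>Metric compatibility used twice: differentiating the second factor produces the gradient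
  term, and the first-order corrections of the two Laplacians correspond.\<close>

lemma laplacian_sq:
  assumes V: "\<And>k. Ck_on k S V" and x: "x \<in> S"
  shows "laplacian G E (sq V) x = 2 * ip (K (F x)) (rough_laplacian G K F E V x) (V x) + 2 * norm_grad_sq K F E V x"
proof -
  have V1: "Ck_on 1 S V" by (rule V)
  have 1: "frechet_derivative (\<lambda>y. frechet_derivative (sq V) (at y) (E i y)) (at x) (E i x)
      = 2 * ip (K (F x)) (cov (E i x) (\<lambda>y. cov (E i y) V y) x) (V x)
        + 2 * ip (K (F x)) (cov (E i x) V x) (cov (E i x) V x)" for i
  proof -
    have D: "(\<lambda>y. cov (E i y) V y) differentiable (at x)" "V differentiable (at x)"
      using Ck_on_cov[OF V E_Ck, of 1 i] V1 x by simp_all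
    have "((\<lambda>y. 2 * ip (K (F y)) (cov (E i y) V y) (V y)) has_derivative
       (\<lambda>\<xi>. 2 * (ip (K (F x)) (cov \<xi> (\<lambda>y. cov (E i y) V y) x) (V x)
          + ip (K (F x)) (cov (E i x) V x) (cov \<xi> V x)))) (at x)"
      by (intro has_derivative_mult_right metric_compat x D)
    then have "((\<lambda>y. frechet_derivative (sq V) (at y) (E i y)) has_derivative
       (\<lambda>\<xi>. 2 * (ip (K (F x)) (cov \<xi> (\<lambda>y. cov (E i y) V y) x) (V x)
          + ip (K (F x)) (cov (E i x) V x) (cov \<xi> V x)))) (at x)"
      by (rule has_derivative_transform_within_open[OF _ open_S x]) (simp add: sq_derivative[OF V1])
    from frechet_derivative_at[OF this] show ?thesis by (simp add: fun_eq_iff)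
  qed
  show ?thesis
    by (simp add: laplacian_def 1 sq_derivative[OF V1 x] rough_laplacian_def norm_grad_sq_def
        pullback_connection_cov ip_sum_left ip_diff_left sum_distrib_left
        flip: sum.distrib) (simp add: algebra_simps)
qed

text \<open>Cauchy-Schwarz in each frame direction; the factor 4 is the square of the 2 in
  \<open>sq_derivative\<close>.\<close>

lemma gradient_sq_le:
  assumes "Ck_on 1 S V" "x \<in> S"
  shows "(\<Sum>i\<in>UNIV. (frechet_derivative (sq V) (at x) (E i x))\<^sup>2) \<le> 4 * sq V x * norm_grad_sq K F E V x"
proof -
  have "(frechet_derivative (sq V) (at x) (E i x))\<^sup>2
      \<le> 4 * sq V x * ip (K (F x)) (cov (E i x) V x) (cov (E i x) V x)" for i
    using spd_Cauchy_Schwarz[OF K_spd[OF F_in[OF assms(2)]], of "cov (E i x) V x" "V x"]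
    by (simp add: sq_derivative[OF assms] sq_def power_mult_distrib mult_ac)
  then have "(\<Sum>i\<in>UNIV. (frechet_derivative (sq V) (at x) (E i x))\<^sup>2)
      \<le> (\<Sum>i\<in>UNIV. 4 * sq V x * ip (K (F x)) (cov (E i x) V x) (cov (E i x) V x))"
    by (rule sum_mono)
  then show ?thesis by (simp add: norm_grad_sq_def pullback_connection_cov sum_distrib_left)
qed

text \<open>Since \<open>H\<close> is normal, the tangential part of its derivative has trace \<open>- m |H|\<^sup>2\<close>.\<close>

lemma norm_grad_sq_mean_curvature:
  assumes V: "Ck_on 1 S V" and VH: "\<And>x. x \<in> S \<Longrightarrow> V x = H x" and x: "x \<in> S"
  shows "real CARD('m) * (sq V x)\<^sup>2 \<le> norm_grad_sq K F E V x"
proof -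
  let ?m = "real CARD('m)"
  define a where "a i = ip (K (F x)) (cov (E i x) V x) (push x (E i x))" for i
  have spd: "spd (K (F x))" by (rule K_spd[OF F_in[OF x]])
  have P: "Ck_on 1 S (\<lambda>y. push y (E i y))" for i
    by (rule Ck_on_frechet_apply[OF open_S smooth_onD[OF F_smooth] E_Ck])
  \<comment> \<open>The inner product of \<open>V\<close> with a tangent field vanishes identically
    on \<open>S\<close>, so the two terms of its product rule are opposite.\<close>
  have a: "a i = - ip (K (F x)) (V x) (cov (E i x) (\<lambda>y. push y (E i y)) x)" for i
  proof -
    have D: "V differentiable (at x)" "(\<lambda>y. push y (E i y)) differentiable (at x)"
      using V P[of i] x by simp_all
    have "((\<lambda>y. ip (K (F y)) (V y) (push y (E i y))) has_derivative (\<lambda>_. 0)) (at x)"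
      by (rule has_derivative_transform_within_open[OF has_derivative_const open_S x])
        (simp add: VH mean_curvature_normal)
    from has_derivative_unique[OF this metric_compat[OF x D]] show ?thesis
      by (simp add: a_def fun_eq_iff eq_neg_iff_add_eq_0)
  qed
  have "(\<Sum>i\<in>UNIV. a i) = - ip (K (F x)) (V x) (\<Sum>i\<in>UNIV. cov (E i x) (\<lambda>y. push y (E i y)) x)"
    by (simp add: a ip_sum_right sum_negf)
  also have "\<dots> = - ?m * sq V x"
    using mean_curvature_normal[OF x] by (simp add: sum_cov_push_frame[OF x] VH[OF x] sq_def ip_add_right ip_scaleR_right)
  finally have "(?m * sq V x)\<^sup>2 = (\<Sum>i\<in>UNIV. a i)\<^sup>2" by simp
  \<comment> \<open>Cauchy-Schwarz over the frame directions costs one factor \<open>?m\<close>; the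
    left side has two, so one survives the cancellation.\<close>
  also have "\<dots> \<le> (\<Sum>i\<in>UNIV. (a i)\<^sup>2) * ?m"
    by (rule sum_squared_le_sum_of_squares)
  also have "(\<Sum>i\<in>UNIV. (a i)\<^sup>2) \<le> norm_grad_sq K F E V x"
    unfolding norm_grad_sq_def pullback_connection_cov
  proof (rule sum_mono)
    fix i
    have "ip (K (F x)) (push x (E i x)) (push x (E i x)) = 1"
      using isometric[OF x, of "E i x" "E i x"] E_orthonormal[OF x] by (simp add: orthonormal_def)
    then show "(a i)\<^sup>2 \<le> ip (K (F x)) (cov (E i x) V x) (cov (E i x) V x)"
      using spd_Cauchy_Schwarz[OF spd, of "cov (E i x) V x" "push x (E i x)"] by (simp add: a_def)
  qed
  finally have "?m * (?m * (sq V x)\<^sup>2) \<le> ?m * norm_grad_sq K F E V x"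
    by (simp add: power2_eq_square mult_ac)
  then show ?thesis by (simp add: mult_le_cancel_left)
qed

text \<open>The hypothesis makes the right side at least \<open>2 * \<epsilon>\<close> times
  \<open>sq V x * norm_grad_sq K F E V x\<close>. One half dominates the cubic term, by the trace
  inequality and a dimension of at least 1; the other half dominates the gradient term, by
  \<open>gradient_sq_le\<close>.\<close>

lemma superbiharmonic_pointwise:
  assumes V: "\<And>k. Ck_on k S V" and VH: "\<And>x. x \<in> S \<Longrightarrow> V x = H x" and x: "x \<in> S" and eps: "0 \<le> \<epsilon>"
    and sb: "ip (K (F x)) (rough_laplacian G K F E V x) (V x) \<ge> (\<epsilon> - 1) * norm_grad_sq K F E V x"
  shows "\<epsilon> * (sq V x) ^ 3 + \<epsilon> / 4 * (\<Sum>i\<in>UNIV. (frechet_derivative (sq V) (at x) (E i x))\<^sup>2)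
    \<le> sq V x * laplacian G E (sq V) x"
proof -
  let ?n = "norm_grad_sq K F E V x" and ?u = "sq V x"
  have u: "0 \<le> ?u" by (rule sq_nonneg[OF x])
  have "1 * ?u\<^sup>2 \<le> real CARD('m) * ?u\<^sup>2"
    by (intro mult_right_mono) (simp_all add: Suc_leI)
  also have "\<dots> \<le> ?n" by (rule norm_grad_sq_mean_curvature[OF V VH x])
  finally have "?u * ?u\<^sup>2 \<le> ?u * ?n" using u by (simp add: mult_left_mono)
  then have "\<epsilon> * ?u ^ 3 \<le> \<epsilon> * (?u * ?n)"
    using eps by (intro mult_left_mono) (simp_all add: power3_eq_cube power2_eq_square mult.assoc)
  moreover have "\<epsilon> / 4 * (\<Sum>i\<in>UNIV. (frechet_derivative (sq V) (at x) (E i x))\<^sup>2) \<le> \<epsilon> / 4 * (4 * ?u * ?n)"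
    using eps by (intro mult_left_mono gradient_sq_le[OF V x]) simp
  moreover have "?u * (2 * \<epsilon> * ?n) \<le> ?u * laplacian G E (sq V) x"
    using sb u by (intro mult_left_mono) (simp_all add: laplacian_sq[OF V x] algebra_simps)
  ultimately show ?thesis by (simp add: algebra_simps)
qed

section \<open>The divergence theorem in charts\<close>

lemma det_pos: "x \<in> S \<Longrightarrow> det (G x) > 0"
  using det_pos_orthonormal E_orthonormal by blast

lemma Ck_on_det: "Ck_on k S (\<lambda>x. det (G x))"
  unfolding det_def
  by (intro Ck_on_sum Ck_on_mult Ck_on_const Ck_on_prod Ck_on_nth open_S smooth_onD[OF G_smooth])

text \<open>The left side is the divergence of \<open>E i\<close> with respect to the density
  \<open>sqrt (det (G x))\<close>, which is the trace of the covariant derivative of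
  \<open>E i\<close>. Differentiating the constant inner products of the frame moves the derivative
  to \<open>E j\<close>.\<close>

lemma frame_divergence:
  assumes x: "x \<in> S"
  shows "(\<Sum>k\<in>UNIV. frechet_derivative (E i) (at x) (axis k 1) $ k)
     + (\<Sum>j\<in>UNIV. ip (frechet_derivative G (at x) (E i x)) (E j x) (E j x)) / 2
     = - ip (G x) (E i x) (\<Sum>j\<in>UNIV. base.cov (E j x) (E j) x)"
proof -
  define G' where "G' = frechet_derivative G (at x)"
  have G: "(G has_derivative G') (at x)"
    using smooth_on_has_derivative[OF G_smooth x] by (simp add: G'_def)
  note sym = metric_derivative_sym[OF open_S x G_spd G]
  have lin: "linear (frechet_derivative (E i) (at x))"
    using E_differentiable[OF x] frechet_derivative_works has_derivative_linear by blast
  have 1: "ip (G x) (base.cov (E j x) (E i) x) (E j x) =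
     ip (G x) (frechet_derivative (E i) (at x) (E j x)) (E j x) + ip (G' (E i x)) (E j x) (E j x) / 2" for j
    by (simp add: base.cov_def ip_add_left frechet_derivative_id[unfolded id_def] christoffel_form_ip[OF G G_spd[OF x]] sym[of _ "E i x"])
  have 2: "ip (G x) (base.cov (E j x) (E i) x) (E j x) = - ip (G x) (E i x) (base.cov (E j x) (E j) x)" for j
  proof -
    have "((\<lambda>y. ip (G y) (E i y) (E j y)) has_derivative (\<lambda>_. 0)) (at x)"
      by (rule has_derivative_transform_within_open[OF has_derivative_const[of "if i = j then 1 else 0"] open_S x])
        (use E_orthonormal in \<open>simp add: orthonormal_def\<close>)
    from has_derivative_unique[OF this base.metric_compat[OF x E_differentiable[OF x] E_differentiable[OF x]]]
    show ?thesis by (simp add: fun_eq_iff eq_neg_iff_add_eq_0)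
  qed
  have "(\<Sum>j\<in>UNIV. ip (G x) (base.cov (E j x) (E i) x) (E j x)) = - ip (G x) (E i x) (\<Sum>j\<in>UNIV. base.cov (E j x) (E j) x)"
    by (simp add: 2 ip_sum_right sum_negf)
  then show ?thesis
    unfolding orthonormal_trace[OF E_orthonormal[OF x] G_spd[OF x] lin]
    by (simp add: 1 sum.distrib sum_divide_distrib flip: G'_def)
qed

text \<open>The coefficient along \<open>E i\<close> of the gradient of \<open>u\<close>, multiplied
  by \<open>\<zeta>\<close> and the volume density.\<close>

definition flux :: "(real ^ 'm \<Rightarrow> real) \<Rightarrow> (real ^ 'm \<Rightarrow> real) \<Rightarrow> 'm \<Rightarrow> real ^ 'm \<Rightarrow> real" where
  "flux \<zeta> u i x = \<zeta> x * (sqrt (det (G x)) * frechet_derivative u (at x) (E i x))"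

lemma Ck_on_flux:
  assumes "Ck_on k S \<zeta>" "Ck_on (Suc k) S u"
  shows "Ck_on k S (flux \<zeta> u i)"
  unfolding flux_def
  by (intro Ck_on_mult assms open_S Ck_on_sqrt Ck_on_det det_pos Ck_on_frechet_apply E_Ck)

text \<open>The left side is the coordinate divergence of the vector density with coefficients
  \<open>flux\<close>. By \<open>frame_divergence\<close>, the divergences of the frame fields
  supply exactly the first-order part of \<open>laplacian\<close>.\<close>

lemma divergence_flux:
  assumes zeta: "Ck_on 1 S \<zeta>" and u: "Ck_on 2 S u" and x: "x \<in> S"
  shows "(\<Sum>i\<in>UNIV. \<Sum>k\<in>UNIV. frechet_derivative (\<lambda>y. flux \<zeta> u i y * E i y $ k) (at x) (axis k 1))
     = sqrt (det (G x)) * (\<zeta> x * laplacian G E u x)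
     + sqrt (det (G x)) * (\<Sum>i\<in>UNIV. frechet_derivative \<zeta> (at x) (E i x) * frechet_derivative u (at x) (E i x))"
proof -
  define r where "r = sqrt (det (G x))"
  define G' where "G' = frechet_derivative G (at x)"
  have u2: "Ck_on (Suc 1) S u" using u by (simp add: numeral_2_eq_2)
  have linu: "linear (frechet_derivative u (at x))"
    using has_derivative_linear[OF Ck_on_has_derivative[OF u2 x]] .
  let ?Du = "\<lambda>i y. frechet_derivative u (at y) (E i y)"
  have rpos: "r > 0" using det_pos[OF x] by (simp add: r_def)
  have Dr: "((\<lambda>y. sqrt (det (G y))) has_derivative (\<lambda>h. r * (\<Sum>j\<in>UNIV. ip (G' h) (E j x) (E j x)) / 2)) (at x)"
    by (rule has_derivative_eq_rhs, rule has_derivative_real_sqrt[OF det_pos[OF x]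
          det_has_derivative[OF smooth_on_has_derivative[OF G_smooth x] E_orthonormal[OF x]]])
      (use rpos real_sqrt_mult_self[of "det (G x)"] det_pos[OF x] in \<open>auto simp: fun_eq_iff r_def G'_def field_simps\<close>)
  have DE: "(E i has_derivative frechet_derivative (E i) (at x)) (at x)" for i
    using E_differentiable[OF x] frechet_derivative_works by blast
  have DDu: "(?Du i has_derivative frechet_derivative (?Du i) (at x)) (at x)" for i
    using Ck_on_has_derivative[of 0 S "?Du i" x] Ck_on_frechet_apply[OF open_S u2 E_Ck, of i] x by simp
  have Dz: "(\<zeta> has_derivative frechet_derivative \<zeta> (at x)) (at x)"
    using Ck_on_has_derivative[OF _ x, of 0] zeta by simp
  define dv where "dv i = - ip (G x) (E i x) (\<Sum>j\<in>UNIV. base.cov (E j x) (E j) x)" for i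
  have main: "(\<Sum>k\<in>UNIV. frechet_derivative (\<lambda>y. flux \<zeta> u i y * E i y $ k) (at x) (axis k 1))
     = r * (frechet_derivative \<zeta> (at x) (E i x) * ?Du i x) + r * (\<zeta> x * (frechet_derivative (?Du i) (at x) (E i x) + ?Du i x * dv i))" for i
  proof -
    define f' where "f' h = frechet_derivative \<zeta> (at x) h * (r * ?Du i x)
      + \<zeta> x * ((r * (\<Sum>j\<in>UNIV. ip (G' h) (E j x) (E j x)) / 2) * ?Du i x + r * frechet_derivative (?Du i) (at x) h)" for h
    have Df: "(flux \<zeta> u i has_derivative f') (at x)"
      unfolding flux_def
      by (rule has_derivative_eq_rhs, rule has_derivative_mult[OF Dz has_derivative_mult[OF Dr DDu]])
        (simp add: fun_eq_iff f'_def r_def algebra_simps)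
    have linf: "linear f'" using has_derivative_linear[OF Df] .
    have "frechet_derivative (\<lambda>y. flux \<zeta> u i y * E i y $ k) (at x) h
       = flux \<zeta> u i x * frechet_derivative (E i) (at x) h $ k + f' h * E i x $ k" for k h
      using frechet_derivative_at[OF has_derivative_mult[OF Df bounded_linear.has_derivative[OF bounded_linear_vec_nth DE]], of i k, symmetric]
      by (simp add: fun_eq_iff)
    then have "(\<Sum>k\<in>UNIV. frechet_derivative (\<lambda>y. flux \<zeta> u i y * E i y $ k) (at x) (axis k 1))
       = flux \<zeta> u i x * (\<Sum>k\<in>UNIV. frechet_derivative (E i) (at x) (axis k 1) $ k) + f' (E i x)"
      using linear_axis_expansion[OF linf, of "E i x"] by (simp add: sum.distrib sum_distrib_left mult.commute)
    also have "\<dots> = r * (frechet_derivative \<zeta> (at x) (E i x) * ?Du i x) + r * (\<zeta> x * (frechet_derivative (?Du i) (at x) (E i x)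
       + ?Du i x * ((\<Sum>k\<in>UNIV. frechet_derivative (E i) (at x) (axis k 1) $ k) + (\<Sum>j\<in>UNIV. ip (G' (E i x)) (E j x) (E j x)) / 2)))"
      by (simp add: f'_def flux_def algebra_simps flip: r_def)
    finally show ?thesis using frame_divergence[OF x, of i] by (simp add: dv_def G'_def)
  qed
  \<comment> \<open>By expansion in the frame, the weighted divergences recombine to the derivative
    of \<open>u\<close> along the sum of the fields \<open>base.cov (E j x) (E j) x\<close>.\<close>
  have "(\<Sum>i\<in>UNIV. ?Du i x * dv i) = - frechet_derivative u (at x) (\<Sum>j\<in>UNIV. base.cov (E j x) (E j) x)"
    (is "_ = - frechet_derivative u (at x) ?v")
  proof -
    have "frechet_derivative u (at x) ?v = (\<Sum>i\<in>UNIV. ip (G x) ?v (E i x) * ?Du i x)"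
      using arg_cong[OF orthonormal_expansion[OF E_orthonormal[OF x] G_spd[OF x], of ?v], of "frechet_derivative u (at x)"]
      by (simp add: linear_sum[OF linu] linear_scale[OF linu])
    then show ?thesis
      using spd_sym[OF G_spd[OF x], of ?v] by (simp add: dv_def sum_negf mult.commute)
  qed
  then have "(\<Sum>i\<in>UNIV. frechet_derivative (?Du i) (at x) (E i x) + ?Du i x * dv i) = laplacian G E u x"
    by (simp add: laplacian_def levi_civita_eq sum.distrib sum_subtractf linear_sum[OF linu])
  then show ?thesis unfolding main
    by (simp add: r_def sum.distrib flip: sum_distrib_left)
qed

end

section \<open>Integrals of compactly supported derivatives, and Green's identity in a chart\<close>

lemma lborel_integral_translate:
  fixes f :: "'a::euclidean_space \<Rightarrow> real"
  assumes "f \<in> borel_measurable borel"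
  shows "integral\<^sup>L lborel (\<lambda>x. f (x + c)) = integral\<^sup>L lborel f"
proof -
  have "integral\<^sup>L lborel f = integral\<^sup>L (distr lborel borel ((+) c)) f"
    by (simp add: lborel_distr_plus)
  also have "\<dots> = integral\<^sup>L lborel (\<lambda>x. f (c + x))"
    by (rule integral_distr) (use assms in auto)
  finally show ?thesis by (simp add: add.commute)
qed

lemma integrable_continuous_compact_support:
  fixes f :: "'a::euclidean_space \<Rightarrow> real"
  assumes "compact C" "continuous_on C f" "\<And>x. x \<notin> C \<Longrightarrow> f x = 0"
  shows "integrable lborel f"
proof -
  have "integrable lborel (\<lambda>x. indicator C x *\<^sub>R f x)"
    using borel_integrable_compact[OF assms(1,2)] by simp
  moreover have "(\<lambda>x. indicator C x *\<^sub>R f x) = f" using assms(3) by (auto simp: fun_eq_iff indicator_def)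
  ultimately show ?thesis by simp
qed

lemma frechet_derivative_eq_0_open:
  assumes "open U" "x \<in> U" "\<And>y. y \<in> U \<Longrightarrow> f y = 0"
  shows "frechet_derivative f (at x) v = 0"
proof -
  have "frechet_derivative f (at x) = frechet_derivative (\<lambda>_. 0) (at x)"
    by (rule frechet_derivative_cong_open[OF assms(1,2)]) (simp add: assms(3))
  then show ?thesis by (simp add: frechet_derivative_const)
qed

text \<open>Difference quotients of \<open>f\<close> integrate to zero by translation invariance.
  The mean value theorem bounds them by \<open>B\<close>, and they live on a compact set independent
  of the step, so dominated convergence passes to the derivative.\<close>

lemma integral_derivative_compact_support:
  fixes f :: "'a::euclidean_space \<Rightarrow> real"
  assumes f: "Ck_on 1 UNIV f" and C: "compact C" and f0: "\<And>x. x \<notin> C \<Longrightarrow> f x = 0"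
  shows "integrable lborel (\<lambda>x. frechet_derivative f (at x) v)"
    and "integral\<^sup>L lborel (\<lambda>x. frechet_derivative f (at x) v) = 0"
proof -
  let ?D = "\<lambda>x. frechet_derivative f (at x) v"
  have D0: "?D x = 0" if "x \<notin> C" for x
    by (rule frechet_derivative_eq_0_open[of "- C"]) (use that f0 compact_imp_closed[OF C] in auto)
  have cont: "continuous_on UNIV ?D" and fder: "\<And>x. (f has_derivative frechet_derivative f (at x)) (at x)"
    using f Ck_on_has_derivative[of 0 UNIV f] by auto
  show int: "integrable lborel ?D"
    using integrable_continuous_compact_support[OF C continuous_on_subset[OF cont] D0] by simp
  have contf: "continuous_on UNIV f" using Ck_on_continuous[OF f] .
  obtain B where B: "\<And>x. \<bar>?D x\<bar> \<le> B"
  proof -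
    have "bounded (?D ` C)"
      using compact_imp_bounded[OF compact_continuous_image[OF continuous_on_subset[OF cont] C]] by simp
    then obtain B where "\<And>x. x \<in> C \<Longrightarrow> \<bar>?D x\<bar> \<le> B" by (auto simp: bounded_iff)
    then have "\<bar>?D x\<bar> \<le> max B 0" for x using D0 by (cases "x \<in> C") (auto simp: le_max_iff_disj)
    then show ?thesis using that by blast
  qed
  define t where "t n = 1 / real (Suc n)" for n
  define g where "g n x = (f (x + t n *\<^sub>R v) - f x) / t n" for n x
  have t: "0 < t n" "t n \<le> 1" for n by (auto simp: t_def)
  have t0: "t \<longlonglongrightarrow> 0" unfolding t_def by (rule LIMSEQ_Suc[OF lim_const_over_n])
  \<comment> \<open>Contains the supports of all difference quotients with step at most 1.\<close>
  define C' where "C' = (\<lambda>(x, s). x - s *\<^sub>R v) ` (C \<times> {0..1})"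
  have C': "compact C'" unfolding C'_def
    by (intro compact_continuous_image compact_Times C compact_Icc) (auto intro!: continuous_intros simp: case_prod_beta)
  have inC': "x \<in> C'" if "x + s *\<^sub>R v \<in> C" "0 \<le> s" "s \<le> 1" for x s
    unfolding C'_def by (rule image_eqI[of _ _ "(x + s *\<^sub>R v, s)"]) (use that in auto)
  have line: "((\<lambda>s. f (x + s *\<^sub>R v)) has_real_derivative ?D (x + s *\<^sub>R v)) (at s)" for x s
  proof -
    have "((\<lambda>s. x + s *\<^sub>R v) has_derivative (\<lambda>h. h *\<^sub>R v)) (at s)"
      by (auto intro!: derivative_eq_intros)
    from has_derivative_compose[OF this fder] show ?thesis
      using linear_scale[OF has_derivative_linear[OF fder]]
      by (simp add: has_field_derivative_def mult_commute_abs)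
  qed
  have gB: "\<bar>g n x\<bar> \<le> B * indicator C' x" for n x
  proof (cases "x \<in> C'")
    case True
    have "\<exists>s. 0 < s \<and> s < t n \<and> f (x + t n *\<^sub>R v) - f (x + 0 *\<^sub>R v) = (t n - 0) * ?D (x + s *\<^sub>R v)"
      by (rule MVT2[OF t(1)]) (rule line)
    then obtain s where "f (x + t n *\<^sub>R v) - f x = t n * ?D (x + s *\<^sub>R v)" by auto
    then have "g n x = ?D (x + s *\<^sub>R v)" using t(1)[of n] by (simp add: g_def)
    then show ?thesis using True B by simp
  next
    case False
    then have "x \<notin> C" "x + t n *\<^sub>R v \<notin> C"
      using inC'[of x 0] inC'[of x "t n"] t[of n] by auto
    then show ?thesis using False f0 by (simp add: g_def)
  qed
  have glim: "(\<lambda>n. g n x) \<longlonglongrightarrow> ?D x" for x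
  proof -
    have "((\<lambda>h. (f (x + h *\<^sub>R v) - f x) / h) \<longlongrightarrow> ?D x) (at 0)"
      using line[of x 0] by (simp add: DERIV_def)
    moreover have "filterlim t (at 0) sequentially"
      using t0 t(1) by (simp add: filterlim_at less_imp_neq eventually_sequentially) (metis less_irrefl)
    ultimately show ?thesis unfolding g_def by (rule filterlim_compose)
  qed
  have meas: "f \<in> borel_measurable borel" by (rule borel_measurable_continuous_onI[OF contf])
  have shift: "(\<lambda>x. f (x + c)) \<in> borel_measurable borel" for c
    by (intro borel_measurable_continuous_onI continuous_on_compose2[OF contf]) (auto intro!: continuous_intros)
  have intf: "integrable lborel f"
    by (rule integrable_continuous_compact_support[OF C continuous_on_subset[OF contf] f0]) auto
  have intfc: "integrable lborel (\<lambda>x. f (x + c))" for c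
  proof (rule integrable_continuous_compact_support)
    show "compact ((\<lambda>x. x - c) ` C)" by (intro compact_continuous_image C continuous_intros)
    show "continuous_on ((\<lambda>x. x - c) ` C) (\<lambda>x. f (x + c))"
      by (intro continuous_on_compose2[OF contf]) (auto intro!: continuous_intros)
    show "f (x + c) = 0" if "x \<notin> (\<lambda>x. x - c) ` C" for x
      using that by (intro f0) (force simp: image_iff)
  qed
  have "integral\<^sup>L lborel (g n) = 0" for n
    using lborel_integral_translate[OF meas, of "t n *\<^sub>R v"] intf intfc[of "t n *\<^sub>R v"]
    by (simp add: g_def[abs_def])
  moreover have "(\<lambda>n. integral\<^sup>L lborel (g n)) \<longlonglongrightarrow> integral\<^sup>L lborel ?D"
  proof (rule integral_dominated_convergence[where w = "\<lambda>x. B * indicator C' x"])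
    show "?D \<in> borel_measurable lborel" using int by simp
    show "g n \<in> borel_measurable lborel" for n
      using meas shift by (simp add: g_def[abs_def])
    show "integrable lborel (\<lambda>x. B * indicator C' x)"
      using integrable_continuous_compact_support[OF C', of "\<lambda>x. B * indicator C' x"]
      by (simp add: continuous_on_cong[of C' C' _ "\<lambda>_. B"])
  qed (use glim gB in auto)
  ultimately show "integral\<^sup>L lborel ?D = 0" by (simp add: LIMSEQ_const_iff)
qed

context framed_chart_map
begin

lemma cip_frame:
  assumes "\<alpha> differentiable (at x)" "\<beta> differentiable (at x)" "x \<in> S"
  shows "cip (G x) (frechet_derivative \<alpha> (at x)) (frechet_derivative \<beta> (at x))
    = (\<Sum>i\<in>UNIV. frechet_derivative \<alpha> (at x) (E i x) * frechet_derivative \<beta> (at x) (E i x))"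
  by (rule cip_orthonormal[OF E_orthonormal[OF assms(3)]])
    (use assms frechet_derivative_works has_derivative_linear in blast)+

lemma continuous_on_laplacian:
  assumes "Ck_on 2 S u"
  shows "continuous_on S (laplacian G E u)"
proof -
  have u2: "Ck_on (Suc (Suc 0)) S u" using assms by (simp add: numeral_2_eq_2)
  have "Ck_on 0 S (\<lambda>x. \<Sum>i\<in>UNIV. frechet_derivative (\<lambda>y. frechet_derivative u (at y) (E i y)) (at x) (E i x)
      - frechet_derivative u (at x) (base.cov (E i x) (E i) x))"
    by (intro Ck_on_sum Ck_on_diff Ck_on_frechet_apply open_S u2 Ck_on_SucD[OF u2] E_Ck base.Ck_on_cov)
  then show ?thesis by (simp add: laplacian_def[abs_def] levi_civita_eq)
qed

text \<open>The components of the flux field, extended by zero off \<open>S\<close>, are C^1 on the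
  whole space because \<open>\<zeta>\<close> vanishes outside a compact subset of \<open>S\<close>;
  their derivatives therefore integrate to zero.\<close>

lemma weak_laplacian:
  assumes zeta: "Ck_on 1 S \<zeta>" and u: "Ck_on 2 S u"
    and C: "compact C" "C \<subseteq> S" "\<And>x. x \<in> S - C \<Longrightarrow> \<zeta> x = 0"
  shows "integrable lborel (\<lambda>x. indicator S x * (sqrt (det (G x)) * (\<zeta> x * laplacian G E u x)))" (is "integrable _ ?f")
    and "integral\<^sup>L lborel (\<lambda>x. indicator S x * (sqrt (det (G x)) * (\<zeta> x * laplacian G E u x)))
      = - integral\<^sup>L lborel (\<lambda>x. indicator S x * (sqrt (det (G x)) *
           cip (G x) (frechet_derivative \<zeta> (at x)) (frechet_derivative u (at x))))" (is "_ = - integral\<^sup>L lborel ?g")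
proof -
  have closed: "closed C" using C compact_imp_closed by blast
  have u1: "Ck_on 1 S u" by (rule Ck_on_mono[OF u]) simp
  let ?s = "\<lambda>x. \<Sum>i\<in>UNIV. frechet_derivative \<zeta> (at x) (E i x) * frechet_derivative u (at x) (E i x)"
  have cip: "cip (G x) (frechet_derivative \<zeta> (at x)) (frechet_derivative u (at x)) = ?s x" if "x \<in> S" for x
    by (rule cip_frame) (use zeta u1 that in auto)
  have Dz0: "frechet_derivative \<zeta> (at x) v = 0" if "x \<in> S - C" for x v
    by (rule frechet_derivative_eq_0_open[of "S - C"]) (use that C closed open_S in auto)
  have cont_s: "continuous_on S ?s"
  proof -
    have "Ck_on 0 S ?s"
      using zeta u1 by (intro Ck_on_sum Ck_on_mult Ck_on_frechet_apply open_S E_Ck) simp_all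
    then show ?thesis by simp
  qed
  have cont_r: "continuous_on S (\<lambda>x. sqrt (det (G x)))"
    using Ck_on_continuous[OF Ck_on_det] by (intro continuous_on_real_sqrt)
  have cont_z: "continuous_on S \<zeta>" using zeta by (rule Ck_on_continuous)
  have int_f: "integrable lborel ?f"
  proof (rule integrable_continuous_compact_support[OF C(1)])
    have "continuous_on C (\<lambda>x. sqrt (det (G x)) * (\<zeta> x * laplacian G E u x))"
      by (intro continuous_on_mult continuous_on_subset[OF cont_r] continuous_on_subset[OF cont_z]
          continuous_on_subset[OF continuous_on_laplacian[OF u]] C)
    then show "continuous_on C ?f"
      by (rule continuous_on_eq) (use C in auto)
    show "?f x = 0" if "x \<notin> C" for x using that C(3)[of x] by (auto simp: indicator_def)
  qed
  then show "integrable lborel ?f" .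
  have int_g: "integrable lborel ?g"
  proof (rule integrable_continuous_compact_support[OF C(1)])
    have "continuous_on C (\<lambda>x. sqrt (det (G x)) * ?s x)"
      by (intro continuous_on_mult continuous_on_subset[OF cont_r] continuous_on_subset[OF cont_s] C)
    then show "continuous_on C ?g"
      by (rule continuous_on_eq) (use C in \<open>auto simp: cip\<close>)
    show "?g x = 0" if "x \<notin> C" for x using that Dz0[of x] by (auto simp: indicator_def cip)
  qed
  define X where "X i k x = (if x \<in> S then flux \<zeta> u i x * E i x $ k else 0)" for i k x
  have X0: "X i k x = 0" if "x \<notin> C" for i k x
    using that C(3)[of x] by (auto simp: X_def flux_def)
  have X1: "Ck_on 1 UNIV (X i k)" for i k
  proof -
    have "Ck_on 1 S (\<lambda>x. flux \<zeta> u i x * E i x $ k)"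
      using u by (intro Ck_on_mult Ck_on_flux Ck_on_nth open_S zeta E_Ck) (simp add: numeral_2_eq_2)
    then have "Ck_on 1 S (X i k)" by (rule Ck_on_congI[OF open_S]) (simp add: X_def)
    moreover have "Ck_on 1 (- C) (X i k)"
      by (rule Ck_on_congI[OF _ Ck_on_const[where c = 0]]) (use closed X0 in auto)
    ultimately have "Ck_on 1 (S \<union> - C) (X i k)" using closed open_S by (intro Ck_on_Un) auto
    moreover have "S \<union> - C = UNIV" using C by auto
    ultimately show ?thesis by simp
  qed
  note intX = integral_derivative_compact_support[OF X1 C(1) X0]
  have sum: "(\<Sum>i\<in>UNIV. \<Sum>k\<in>UNIV. frechet_derivative (X i k) (at x) (axis k 1)) = ?f x + ?g x" for x
  proof (cases "x \<in> S")
    case True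
    have "frechet_derivative (X i k) (at x) = frechet_derivative (\<lambda>x. flux \<zeta> u i x * E i x $ k) (at x)" for i k
      by (rule frechet_derivative_cong_open[OF open_S True]) (simp add: X_def)
    then show ?thesis using divergence_flux[OF zeta u True] True by (simp add: cip)
  next
    case False
    have "frechet_derivative (X i k) (at x) v = 0" for i k v
      by (rule frechet_derivative_eq_0_open[of "- C"]) (use False C closed X0 in auto)
    then show ?thesis using False by simp
  qed
  have "integral\<^sup>L lborel (\<lambda>x. \<Sum>i\<in>UNIV. \<Sum>k\<in>UNIV. frechet_derivative (X i k) (at x) (axis k 1)) = 0"
    by (simp add: Bochner_Integration.integral_sum intX)
  then have "integral\<^sup>L lborel ?f + integral\<^sup>L lborel ?g = 0"
    unfolding sum using int_f int_g by simp
  then show "integral\<^sup>L lborel ?f = - integral\<^sup>L lborel ?g" by simp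
qed

text \<open>The pointwise inequality is multiplied by the nonnegative \<open>\<xi>\<close>.
  Integrating \<open>\<xi> x * sq V x * laplacian G E (sq V) x\<close> by parts explains the product
  under the gradient on the right.\<close>

lemma superbiharmonic_weak:
  assumes V: "\<And>k. Ck_on k S V" and VH: "\<And>x. x \<in> S \<Longrightarrow> V x = H x" and eps: "0 \<le> \<epsilon>"
    and sb: "\<And>x. x \<in> S \<Longrightarrow>
      ip (K (F x)) (rough_laplacian G K F E V x) (V x) \<ge> (\<epsilon> - 1) * norm_grad_sq K F E V x"
    and xi: "Ck_on 1 S \<xi>" "\<And>x. x \<in> S \<Longrightarrow> 0 \<le> \<xi> x"
    and C: "compact C" "C \<subseteq> S" "\<And>x. x \<in> S - C \<Longrightarrow> \<xi> x = 0"
  shows "integral\<^sup>L lborel (\<lambda>x. indicator S x * (sqrt (det (G x)) * (\<xi> x * (\<epsilon> * sq V x ^ 3 +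
          \<epsilon> / 4 * cip (G x) (frechet_derivative (sq V) (at x)) (frechet_derivative (sq V) (at x))))))
      \<le> - integral\<^sup>L lborel (\<lambda>x. indicator S x * (sqrt (det (G x)) *
           cip (G x) (frechet_derivative (\<lambda>y. \<xi> y * sq V y) (at x)) (frechet_derivative (sq V) (at x))))"
    (is "integral\<^sup>L lborel ?f \<le> _")
proof -
  have u: "Ck_on k S (sq V)" for k by (rule sq_smooth[OF V])
  have zeta: "Ck_on 1 S (\<lambda>y. \<xi> y * sq V y)" by (intro Ck_on_mult open_S xi u)
  have z0: "\<xi> x * sq V x = 0" if "x \<in> S - C" for x using C(3)[OF that] by simp
  note w = weak_laplacian[OF zeta u C(1,2) z0]
  have u1: "sq V differentiable (at x)" if "x \<in> S" for x using u[of 1] that by simp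
  have "integral\<^sup>L lborel ?f \<le> integral\<^sup>L lborel
      (\<lambda>x. indicator S x * (sqrt (det (G x)) * (\<xi> x * sq V x * laplacian G E (sq V) x)))"
  proof (rule integral_mono)
    show "integrable lborel ?f"
    proof (rule integrable_continuous_compact_support[OF C(1)])
      have "Ck_on 0 S (\<lambda>x. \<Sum>i\<in>UNIV. frechet_derivative (sq V) (at x) (E i x) * frechet_derivative (sq V) (at x) (E i x))"
        by (intro Ck_on_sum Ck_on_mult Ck_on_frechet_apply open_S E_Ck u)
      then have 1: "continuous_on S (\<lambda>x. \<Sum>i\<in>UNIV. frechet_derivative (sq V) (at x) (E i x) * frechet_derivative (sq V) (at x) (E i x))"
        by simp
      have "continuous_on S (\<lambda>x. sqrt (det (G x)) * (\<xi> x * (\<epsilon> * sq V x ^ 3 + \<epsilon> / 4 *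
         (\<Sum>i\<in>UNIV. frechet_derivative (sq V) (at x) (E i x) * frechet_derivative (sq V) (at x) (E i x)))))"
        by (intro continuous_intros 1 Ck_on_continuous[OF Ck_on_det] Ck_on_continuous[OF xi(1)] Ck_on_continuous[OF u[of 0]])
      then have "continuous_on C (\<lambda>x. sqrt (det (G x)) * (\<xi> x * (\<epsilon> * sq V x ^ 3 + \<epsilon> / 4 *
         (\<Sum>i\<in>UNIV. frechet_derivative (sq V) (at x) (E i x) * frechet_derivative (sq V) (at x) (E i x)))))"
        using C(2) by (rule continuous_on_subset)
      then show "continuous_on C ?f"
        by (rule continuous_on_eq) (use C(2) in \<open>auto simp: cip_frame u1\<close>)
      show "?f x = 0" if "x \<notin> C" for x using that C(3)[of x] by (auto simp: indicator_def)
    qed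
    show "?f x \<le> indicator S x * (sqrt (det (G x)) * (\<xi> x * sq V x * laplacian G E (sq V) x))" for x
    proof (cases "x \<in> S")
      case True
      have "\<epsilon> * sq V x ^ 3 + \<epsilon> / 4 * cip (G x) (frechet_derivative (sq V) (at x)) (frechet_derivative (sq V) (at x))
         \<le> sq V x * laplacian G E (sq V) x"
        using superbiharmonic_pointwise[OF V VH True eps sb[OF True]]
        by (simp add: cip_frame u1 True power2_eq_square)
      then have "sqrt (det (G x)) * (\<xi> x * (\<epsilon> * sq V x ^ 3 + \<epsilon> / 4 * cip (G x) (frechet_derivative (sq V) (at x)) (frechet_derivative (sq V) (at x))))
         \<le> sqrt (det (G x)) * (\<xi> x * (sq V x * laplacian G E (sq V) x))"
        using det_pos[OF True] xi(2)[OF True] by (intro mult_left_mono) auto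
      then show ?thesis using True by (simp add: mult.assoc)
    qed simp
  qed (rule w(1))
  then show ?thesis using w(2) by simp
qed

end

section \<open>Change of charts in the target\<close>

text \<open>A change of charts is an isometry onto an open set, so its second fundamental form, being normal,
  vanishes: this is the transformation law of the Christoffel symbols.\<close>

lemma (in isometric_chart_map) second_form_codim_0:
  assumes "CARD('n) = CARD('m)" "x \<in> S"
  shows "second_form x a b = 0"
proof -
  have lin: "linear (push x)" by (rule linear_push[OF assms(2)])
  have "inj (push x)"
    unfolding linear_injective_0[OF lin]
  proof (intro allI impI)
    fix v assume "push x v = 0"
    then have "ip (G x) v v = 0" by (simp add: isometric[OF assms(2)] ip_zero_left)
    then show "v = 0" using spd_eq_0_iff[OF G_spd[OF assms(2)]] by simp
  qed
  then have "surj (push x)"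
    by (rule linear_injective_imp_surjective[OF lin]) (simp add: assms(1))
  then obtain c where "push x c = second_form x a b" by (metis surj_def)
  then have "ip (K (F x)) (second_form x a b) (second_form x a b) = 0"
    using second_form_normal[OF assms(2), of a b c] by simp
  then show ?thesis using spd_eq_0_iff[OF K_spd[OF F_in[OF assms(2)]]] by simp
qed

text \<open>Differentiating the relation between the two push forwards produces a second derivative
  of \<open>\<phi>\<close>; the vanishing second fundamental form of \<open>\<phi>\<close> expresses
  it by the Christoffel forms of the two target metrics.\<close>

lemma mean_curvature_transform:
  fixes F F' :: "real ^ 'm \<Rightarrow> real ^ 'n" and \<phi> :: "real ^ 'n \<Rightarrow> real ^ 'n"
  assumes "framed_chart_map S T F K G E" and "framed_chart_map S T' F' K' G E"
    and "isometric_chart_map T0 T' \<phi> K' K"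
    and T0: "F ` S \<subseteq> T0" and F': "\<And>x. x \<in> S \<Longrightarrow> F' x = \<phi> (F x)" and x: "x \<in> S"
  shows "mean_curvature G K' F' E x = frechet_derivative \<phi> (at (F x)) (mean_curvature G K F E x)"
proof -
  interpret P: framed_chart_map S T F K G E by fact
  interpret P': framed_chart_map S T' F' K' G E by fact
  interpret Q: isometric_chart_map T0 T' \<phi> K' K by fact
  have Fin: "F y \<in> T0" if "y \<in> S" for y using T0 that by auto
  have FD: "(F has_derivative P.push y) (at y)" if "y \<in> S" for y
    by (rule smooth_on_has_derivative[OF P.F_smooth that])
  have push: "P'.push y v = Q.push (F y) (P.push y v)" if "y \<in> S" for y v
  proof -
    have "((\<lambda>y. \<phi> (F y)) has_derivative (\<lambda>v. Q.push (F y) (P.push y v))) (at y)"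
      by (rule has_derivative_compose[OF FD[OF that] smooth_on_has_derivative[OF Q.F_smooth Fin[OF that]]])
    then have "(F' has_derivative (\<lambda>v. Q.push (F y) (P.push y v))) (at y)"
      by (rule has_derivative_transform_within_open[OF _ P.open_S that]) (simp add: F')
    from frechet_derivative_at[OF this] show ?thesis by (simp add: fun_eq_iff)
  qed
  have lin: "linear (Q.push (F x))" by (rule Q.linear_push[OF Fin[OF x]])
  have "P'.second_form x a b = Q.push (F x) (P.second_form x a b)" for a b
  proof -
    have "((\<lambda>y. Q.push (F y) (P.push y b)) has_derivative
       (\<lambda>\<xi>. frechet_derivative (\<lambda>z. Q.push z (P.push x b)) (at (F x)) (P.push x \<xi>)
          + Q.push (F x) (frechet_derivative (\<lambda>y. P.push y b) (at x) \<xi>))) (at x)"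
      by (rule frechet_apply_has_derivative[OF Q.open_S smooth_onD[OF Q.F_smooth] FD[OF x]
            frechet_derivative_works[THEN iffD1, OF P.push_differentiable[OF x]] P.open_S x T0])
    then have "((\<lambda>y. P'.push y b) has_derivative
       (\<lambda>\<xi>. frechet_derivative (\<lambda>z. Q.push z (P.push x b)) (at (F x)) (P.push x \<xi>)
          + Q.push (F x) (frechet_derivative (\<lambda>y. P.push y b) (at x) \<xi>))) (at x)"
      by (rule has_derivative_transform_within_open[OF _ P.open_S x]) (simp add: push)
    from frechet_derivative_at[OF this]
    have "frechet_derivative (\<lambda>y. P'.push y b) (at x) a =
       frechet_derivative (\<lambda>z. Q.push z (P.push x b)) (at (F x)) (P.push x a)
          + Q.push (F x) (frechet_derivative (\<lambda>y. P.push y b) (at x) a)"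
      by (simp add: fun_eq_iff)
    moreover have "Q.cov (P.push x a) (\<lambda>y. Q.push y (P.push x b)) (F x) =
       Q.push (F x) (christoffel_form K (F x) (P.push x a) (P.push x b))"
      using Q.second_form_codim_0[OF refl Fin[OF x], of "P.push x a" "P.push x b"]
      by (simp add: Q.second_form_def)
    ultimately show ?thesis
      by (simp add: P'.second_form_def P.second_form_def P'.cov_def P.cov_def Q.cov_def push[OF x] F'[OF x]
          linear_diff[OF lin] linear_add[OF lin])
  qed
  then show ?thesis
    by (simp add: P.mean_curvature_eq[OF x] P'.mean_curvature_eq[OF x] linear_scale[OF lin] linear_sum[OF lin])
qed

section \<open>Differentiable functions on a manifold\<close>

lemma continuous_on_open_locally:
  fixes \<phi> :: "'a::t2_space \<Rightarrow> 'b::topological_space"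
  assumes "open W" "\<And>p. p \<in> W \<Longrightarrow> \<exists>V. open V \<and> p \<in> V \<and> continuous_on (V \<inter> W) \<phi>"
  shows "continuous_on W \<phi>"
proof (rule continuous_at_imp_continuous_on, rule ballI)
  fix p assume p: "p \<in> W"
  then obtain V where "open V" "p \<in> V" "continuous_on (V \<inter> W) \<phi>" using assms(2) by blast
  then show "isCont \<phi> p" using continuous_on_eq_continuous_at[of "V \<inter> W" \<phi>] p assms(1) by (simp add: open_Int)
qed

locale riem =
  fixes A :: "('p::{t2_space,second_countable_topology}, 'm::finite) chart set" and g :: "('p, 'm) metric"
  assumes riem: "riemannian_manifold A g"
begin

abbreviation codom :: "('p, 'm) chart \<Rightarrow> (real ^ 'm) set" where "codom c \<equiv> snd c ` fst c"
abbreviation trans :: "('p, 'm) chart \<Rightarrow> ('p, 'm) chart \<Rightarrow> real ^ 'm \<Rightarrow> real ^ 'm" where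
  "trans c d \<equiv> local_rep id c d"

lemma manifold: "smooth_manifold A"
  using riem by (simp add: riemannian_manifold_def)

lemma chart: "c \<in> A \<Longrightarrow> is_chart c"
  using manifold by (simp add: smooth_manifold_def)

lemma open_dom: "c \<in> A \<Longrightarrow> open (fst c)"
  using chart by (simp add: is_chart_def)

lemma open_codom: "c \<in> A \<Longrightarrow> open (codom c)"
  using chart by (simp add: is_chart_def)

lemma homeo: "c \<in> A \<Longrightarrow> homeomorphism (fst c) (codom c) (snd c) (chart_inv c)"
  using chart by (simp add: is_chart_def)

lemma chart_inv_left: "c \<in> A \<Longrightarrow> p \<in> fst c \<Longrightarrow> chart_inv c (snd c p) = p"
  using homeo by (auto simp: homeomorphism_def)

lemma chart_inv_right: "c \<in> A \<Longrightarrow> x \<in> codom c \<Longrightarrow> snd c (chart_inv c x) = x"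
  using homeomorphism_apply2[OF homeo] by blast

lemma chart_inv_in: "c \<in> A \<Longrightarrow> x \<in> codom c \<Longrightarrow> chart_inv c x \<in> fst c"
  using homeomorphism_image2[OF homeo] by blast

lemma chart_cont: "c \<in> A \<Longrightarrow> continuous_on (fst c) (snd c)"
  using homeo by (auto simp: homeomorphism_def)

lemma chart_inv_cont: "c \<in> A \<Longrightarrow> continuous_on (codom c) (chart_inv c)"
  using homeo by (auto simp: homeomorphism_def)

lemma chart_image_eq: "c \<in> A \<Longrightarrow> snd c ` (fst c \<inter> W) = codom c \<inter> chart_inv c -` W"
  by (auto simp: chart_inv_left)

lemma open_chart_image:
  assumes "c \<in> A" "open W"
  shows "open (snd c ` (fst c \<inter> W))"
proof -
  have "open (chart_inv c -` W \<inter> codom c)"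
    using continuous_on_open_vimage[OF open_codom[OF assms(1)], of "chart_inv c"] chart_inv_cont[OF assms(1)] assms(2)
    by blast
  then show ?thesis unfolding chart_image_eq[OF assms(1)] by (subst Int_commute)
qed

lemma chart_inv_image_eq:
  assumes "c \<in> A" "X \<subseteq> codom c"
  shows "chart_inv c ` X = fst c \<inter> snd c -` X"
proof (intro equalityI subsetI)
  fix p assume "p \<in> chart_inv c ` X"
  then obtain x where x: "x \<in> X" "p = chart_inv c x" by blast
  then show "p \<in> fst c \<inter> snd c -` X"
    using assms chart_inv_in[OF assms(1), of x] chart_inv_right[OF assms(1), of x] by auto
next
  fix p assume p: "p \<in> fst c \<inter> snd c -` X"
  then have "p = chart_inv c (snd c p)" using chart_inv_left[OF assms(1), of p] by simp
  then show "p \<in> chart_inv c ` X" using p by blast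
qed

lemma open_chart_inv_image:
  assumes "c \<in> A" "X \<subseteq> codom c" "open X"
  shows "open (chart_inv c ` X)"
  using continuous_on_open_vimage[OF open_dom[OF assms(1)], of "snd c"] chart_cont[OF assms(1)] assms(3)
  by (simp add: chart_inv_image_eq[OF assms(1,2)] Int_commute)

lemma compact_chart_inv_image:
  assumes "c \<in> A" "X \<subseteq> codom c" "compact X"
  shows "compact (chart_inv c ` X)"
  by (rule compact_continuous_image[OF continuous_on_subset[OF chart_inv_cont[OF assms(1)] assms(2)] assms(3)])

lemma chart_exists: "\<exists>c\<in>A. p \<in> fst c"
  using manifold by (auto simp: smooth_manifold_def)

lemma chart_at_in: "chart_at A p \<in> A" "p \<in> fst (chart_at A p)"
proof -
  have "\<exists>c. c \<in> A \<and> p \<in> fst c" using chart_exists by blast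
  from someI_ex[OF this] show "chart_at A p \<in> A" "p \<in> fst (chart_at A p)"
    unfolding chart_at_def by blast+
qed

lemma trans_dom: "local_dom id c d = snd c ` (fst c \<inter> fst d)"
  by (auto simp: local_dom_def)

lemma open_trans_dom: "c \<in> A \<Longrightarrow> d \<in> A \<Longrightarrow> open (local_dom id c d)"
  by (simp add: trans_dom open_chart_image open_dom)

lemma trans_smooth: "c \<in> A \<Longrightarrow> d \<in> A \<Longrightarrow> smooth_on (local_dom id c d) (trans c d)"
  using manifold by (simp add: smooth_manifold_def)

lemma trans_apply: "c \<in> A \<Longrightarrow> p \<in> fst c \<Longrightarrow> trans c d (snd c p) = snd d p"
  by (simp add: local_rep_def chart_inv_left)

lemma metric_smooth: "c \<in> A \<Longrightarrow> smooth_on (codom c) (g c)"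
  using riem open_codom unfolding riemannian_manifold_def smooth_on_def
  by (intro allI Ck_on_matrix) auto

lemma metric_spd: "c \<in> A \<Longrightarrow> x \<in> codom c \<Longrightarrow> spd (g c x)"
  using riem by (auto simp: riemannian_manifold_def spd_def)

lemma metric_spd': "c \<in> A \<Longrightarrow> p \<in> fst c \<Longrightarrow> spd (g c (snd c p))"
  by (rule metric_spd) auto

lemma metric_trans:
  assumes "c \<in> A" "d \<in> A" "p \<in> fst c" "p \<in> fst d"
  shows "ip (g c (snd c p)) u v = ip (g d (snd d p))
     (frechet_derivative (trans c d) (at (snd c p)) u) (frechet_derivative (trans c d) (at (snd c p)) v)"
proof -
  have "snd c p \<in> local_dom id c d" using assms by (auto simp: trans_dom)
  then show ?thesis
    using riem assms by (auto simp: riemannian_manifold_def trans_apply)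
qed

lemma trans_derivative:
  assumes "c \<in> A" "d \<in> A" "p \<in> fst c" "p \<in> fst d"
  shows "(trans c d has_derivative frechet_derivative (trans c d) (at (snd c p))) (at (snd c p))"
  by (rule smooth_on_has_derivative[OF trans_smooth[OF assms(1,2)]]) (use assms in \<open>auto simp: trans_dom\<close>)

section \<open>C^1 functions and their differentials in charts\<close>

definition mC1 :: "'p set \<Rightarrow> ('p \<Rightarrow> real) \<Rightarrow> bool" where
  "mC1 W \<phi> \<longleftrightarrow> (\<forall>c\<in>A. Ck_on 1 (snd c ` (fst c \<inter> W)) (\<phi> \<circ> chart_inv c))"

definition der :: "('p, 'm) chart \<Rightarrow> ('p \<Rightarrow> real) \<Rightarrow> 'p \<Rightarrow> real ^ 'm \<Rightarrow> real" where
  "der c \<phi> p = frechet_derivative (\<phi> \<circ> chart_inv c) (at (snd c p))"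

lemma mC1D: "mC1 W \<phi> \<Longrightarrow> c \<in> A \<Longrightarrow> Ck_on 1 (snd c ` (fst c \<inter> W)) (\<phi> \<circ> chart_inv c)"
  by (simp add: mC1_def)

lemma mC1_has_derivative:
  "mC1 W \<phi> \<Longrightarrow> c \<in> A \<Longrightarrow> p \<in> fst c \<Longrightarrow> p \<in> W \<Longrightarrow> ((\<phi> \<circ> chart_inv c) has_derivative der c \<phi> p) (at (snd c p))"
  unfolding der_def by (rule Ck_on_has_derivative[OF mC1D[unfolded One_nat_def]]) auto

lemma linear_der:
  assumes "mC1 W \<phi>" "c \<in> A" "p \<in> fst c" "p \<in> W"
  shows "linear (der c \<phi> p)"
  using mC1_has_derivative[OF assms] by (rule has_derivative_linear)

lemma mC1_subset: "mC1 W \<phi> \<Longrightarrow> V \<subseteq> W \<Longrightarrow> mC1 V \<phi>"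
  unfolding mC1_def by (meson Ck_on_subset Int_mono image_mono order_refl)

lemma mC1_congI: "open W \<Longrightarrow> mC1 W \<psi> \<Longrightarrow> (\<And>p. p \<in> W \<Longrightarrow> \<phi> p = \<psi> p) \<Longrightarrow> mC1 W \<phi>"
  unfolding mC1_def
proof
  fix c assume *: "open W" "\<forall>c\<in>A. Ck_on 1 (snd c ` (fst c \<inter> W)) (\<psi> \<circ> chart_inv c)" "\<And>p. p \<in> W \<Longrightarrow> \<phi> p = \<psi> p" "c \<in> A"
  show "Ck_on 1 (snd c ` (fst c \<inter> W)) (\<phi> \<circ> chart_inv c)"
    by (rule Ck_on_congI[OF open_chart_image[OF *(4,1)] *(2)[rule_format, OF *(4)]])
      (use *(3) in \<open>auto simp: chart_inv_left[OF *(4)]\<close>)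
qed

lemma mC1_Un: "open V \<Longrightarrow> open W \<Longrightarrow> mC1 V \<phi> \<Longrightarrow> mC1 W \<phi> \<Longrightarrow> mC1 (V \<union> W) \<phi>"
  unfolding mC1_def by (simp only: Int_Un_distrib image_Un) (blast intro: Ck_on_Un open_chart_image)

lemma mC1_const: "open W \<Longrightarrow> mC1 W (\<lambda>_. a)"
  unfolding mC1_def by (simp add: o_def Ck_on_const open_chart_image del: Ck_on.simps One_nat_def)

lemma mC1_add: "open W \<Longrightarrow> mC1 W \<phi> \<Longrightarrow> mC1 W \<psi> \<Longrightarrow> mC1 W (\<lambda>p. \<phi> p + \<psi> p)"
  unfolding mC1_def by (simp add: o_def Ck_on_add open_chart_image del: Ck_on.simps One_nat_def)

lemma mC1_mult: "open W \<Longrightarrow> mC1 W \<phi> \<Longrightarrow> mC1 W \<psi> \<Longrightarrow> mC1 W (\<lambda>p. \<phi> p * \<psi> p)"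
  unfolding mC1_def by (simp add: o_def Ck_on_mult open_chart_image del: Ck_on.simps One_nat_def)

lemma mC1_divide:
  assumes "open W" "mC1 W \<phi>" "mC1 W \<psi>" "\<And>p. p \<in> W \<Longrightarrow> \<psi> p \<noteq> 0"
  shows "mC1 W (\<lambda>p. \<phi> p / \<psi> p)"
  unfolding mC1_def
proof
  fix c assume c: "c \<in> A"
  have "Ck_on 1 (snd c ` (fst c \<inter> W)) (\<lambda>x. (\<phi> \<circ> chart_inv c) x / (\<psi> \<circ> chart_inv c) x)"
    by (rule Ck_on_divide[OF open_chart_image[OF c assms(1)] mC1D[OF assms(2) c] mC1D[OF assms(3) c]])
      (use assms(4) in \<open>auto simp: chart_inv_left[OF c]\<close>)
  then show "Ck_on 1 (snd c ` (fst c \<inter> W)) ((\<lambda>p. \<phi> p / \<psi> p) \<circ> chart_inv c)" by (simp add: o_def)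
qed

lemma mC1_sum:
  assumes "open W" "\<And>i. i \<in> I \<Longrightarrow> mC1 W (\<phi> i)"
  shows "mC1 W (\<lambda>p. \<Sum>i\<in>I. \<phi> i p)"
  using assms by (induction I rule: infinite_finite_induct) (simp_all add: mC1_const mC1_add)

lemma mC1_compose:
  assumes "open W" "mC1 W \<phi>" "Ck_on 1 T \<theta>" "\<phi> ` W \<subseteq> T"
  shows "mC1 W (\<lambda>p. \<theta> (\<phi> p))"
  unfolding mC1_def
proof
  fix c assume c: "c \<in> A"
  have "(\<phi> \<circ> chart_inv c) ` snd c ` (fst c \<inter> W) \<subseteq> T"
    using assms(4) chart_inv_left[OF c] by auto
  from Ck_on_compose[OF open_chart_image[OF c assms(1)] assms(3) mC1D[OF assms(2) c] this]
  show "Ck_on 1 (snd c ` (fst c \<inter> W)) ((\<lambda>p. \<theta> (\<phi> p)) \<circ> chart_inv c)" by (simp add: o_def)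
qed

text \<open>A function of the coordinates of one chart reaches the other charts through the smooth
  transition maps.\<close>

lemma mC1_chart:
  assumes c: "c \<in> A" and X: "open X" "X \<subseteq> codom c" and \<eta>: "Ck_on 1 X \<eta>"
  shows "mC1 (chart_inv c ` X) (\<lambda>p. \<eta> (snd c p))"
  unfolding mC1_def
proof
  fix d assume d: "d \<in> A"
  let ?Y = "snd d ` (fst d \<inter> chart_inv c ` X)"
  have sub: "chart_inv c ` X \<subseteq> fst c" using X chart_inv_in[OF c] by auto
  have oY: "open ?Y" by (intro open_chart_image d open_chart_inv_image c X)
  have Y: "?Y \<subseteq> local_dom id d c" using sub by (auto simp: trans_dom)
  have im: "trans d c ` ?Y \<subseteq> X"
    using X chart_inv_right[OF c] by (auto simp: trans_apply[OF d])
  have "Ck_on 1 ?Y (\<lambda>x. \<eta> (trans d c x))"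
    by (rule Ck_on_compose[OF oY \<eta> Ck_on_subset[OF smooth_onD[OF trans_smooth[OF d c]] Y] im])
  then show "Ck_on 1 ?Y ((\<lambda>p. \<eta> (snd c p)) \<circ> chart_inv d)"
    by (rule Ck_on_congI[OF oY]) (simp add: local_rep_def)
qed

text \<open>\<open>W\<close> and the complement of \<open>C\<close> are open and cover the manifold,
  and the extension is C^1 on each.\<close>

lemma mC1_extend:
  assumes "closed C" "open W" "C \<subseteq> W" "mC1 W \<phi>" "\<And>p. p \<in> W - C \<Longrightarrow> \<phi> p = 0"
  shows "mC1 UNIV (\<lambda>p. if p \<in> W then \<phi> p else 0)"
proof -
  have "mC1 W (\<lambda>p. if p \<in> W then \<phi> p else 0)" by (rule mC1_congI[OF assms(2,4)]) simp
  moreover have "mC1 (- C) (\<lambda>p. if p \<in> W then \<phi> p else 0)"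
    by (rule mC1_congI[OF _ mC1_const[where a = 0]]) (use assms(1,5) in auto)
  ultimately have "mC1 (W \<union> - C) (\<lambda>p. if p \<in> W then \<phi> p else 0)"
    using assms(1,2) by (intro mC1_Un) auto
  moreover have "W \<union> - C = UNIV" using assms(3) by auto
  ultimately show ?thesis by simp
qed

lemma mC1_continuous:
  assumes "open W" "mC1 W \<phi>"
  shows "continuous_on W \<phi>"
proof (rule continuous_on_open_locally[OF assms(1)])
  fix p assume p: "p \<in> W"
  obtain c where c: "c \<in> A" "p \<in> fst c" using chart_exists by blast
  have "continuous_on (fst c \<inter> W) (\<lambda>q. (\<phi> \<circ> chart_inv c) (snd c q))"
    by (rule continuous_on_compose2[OF Ck_on_continuous[OF mC1D[OF assms(2) c(1)]]])
      (auto intro: continuous_on_subset[OF chart_cont[OF c(1)]])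
  then have "continuous_on (fst c \<inter> W) \<phi>"
    by (rule continuous_on_eq) (simp add: chart_inv_left[OF c(1)])
  then show "\<exists>V. open V \<and> p \<in> V \<and> continuous_on (V \<inter> W) \<phi>" using open_dom c by blast
qed

lemma der_change:
  assumes "mC1 W \<phi>" "open W" "p \<in> W" "c \<in> A" "d \<in> A" "p \<in> fst c" "p \<in> fst d"
  shows "der c \<phi> p v = der d \<phi> p (frechet_derivative (trans c d) (at (snd c p)) v)"
proof -
  have "((\<phi> \<circ> chart_inv d) has_derivative der d \<phi> p) (at (trans c d (snd c p)))"
    using mC1_has_derivative[OF assms(1,5,7,3)] by (simp add: trans_apply[OF assms(4,6)])
  from has_derivative_compose[OF trans_derivative[OF assms(4,5,6,7)] this]
  have *: "((\<lambda>x. (\<phi> \<circ> chart_inv d) (trans c d x)) has_derivative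
     (\<lambda>v. der d \<phi> p (frechet_derivative (trans c d) (at (snd c p)) v))) (at (snd c p))" .
  have "((\<phi> \<circ> chart_inv c) has_derivative
     (\<lambda>v. der d \<phi> p (frechet_derivative (trans c d) (at (snd c p)) v))) (at (snd c p))"
  proof (rule has_derivative_transform_within_open[OF * open_trans_dom[OF assms(4,5)]])
    show "snd c p \<in> local_dom id c d" using assms by (auto simp: trans_dom)
    show "(\<phi> \<circ> chart_inv d) (trans c d x) = (\<phi> \<circ> chart_inv c) x" if xd: "x \<in> local_dom id c d" for x
    proof -
      obtain q where "q \<in> fst c" "q \<in> fst d" "x = snd c q" using xd by (auto simp: trans_dom)
      then show ?thesis by (simp add: trans_apply[OF assms(4)] chart_inv_left assms)
    qed
  qed
  from frechet_derivative_at[OF this] show ?thesis by (simp add: der_def fun_eq_iff)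
qed

lemma der_cong:
  assumes "open W" "p \<in> W" "c \<in> A" "p \<in> fst c" "\<And>q. q \<in> W \<Longrightarrow> \<phi> q = \<psi> q"
  shows "der c \<phi> p = der c \<psi> p"
  unfolding der_def
  by (rule frechet_derivative_cong_open[OF open_chart_image[OF assms(3,1)]])
    (use assms in \<open>auto simp: chart_inv_left\<close>)

lemma der_eqI:
  "((\<phi> \<circ> chart_inv c) has_derivative D) (at (snd c p)) \<Longrightarrow> der c \<phi> p = D"
  unfolding der_def by (rule frechet_derivative_at[symmetric])

lemma der_mult:
  assumes "mC1 W \<phi>" "mC1 W \<psi>" "p \<in> W" "c \<in> A" "p \<in> fst c"
  shows "der c (\<lambda>p. \<phi> p * \<psi> p) p v = \<phi> p * der c \<psi> p v + der c \<phi> p v * \<psi> p"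
proof -
  have "((\<lambda>x. (\<phi> \<circ> chart_inv c) x * (\<psi> \<circ> chart_inv c) x) has_derivative
     (\<lambda>v. \<phi> p * der c \<psi> p v + der c \<phi> p v * \<psi> p)) (at (snd c p))"
    using has_derivative_mult[OF mC1_has_derivative[OF assms(1,4,5,3)] mC1_has_derivative[OF assms(2,4,5,3)]]
    by (simp add: chart_inv_left[OF assms(4,5)])
  then show ?thesis using der_eqI[of "\<lambda>p. \<phi> p * \<psi> p" c _ p] by (simp add: o_def)
qed

lemma der_sum:
  assumes "\<And>i. i \<in> I \<Longrightarrow> mC1 W (\<phi> i)" "p \<in> W" "c \<in> A" "p \<in> fst c"
  shows "der c (\<lambda>p. \<Sum>i\<in>I. \<phi> i p) p v = (\<Sum>i\<in>I. der c (\<phi> i) p v)"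
proof -
  have "((\<lambda>x. \<Sum>i\<in>I. (\<phi> i \<circ> chart_inv c) x) has_derivative (\<lambda>v. \<Sum>i\<in>I. der c (\<phi> i) p v)) (at (snd c p))"
    by (intro has_derivative_sum mC1_has_derivative[OF assms(1) assms(3,4,2)])
  then show ?thesis using der_eqI[of "\<lambda>p. \<Sum>i\<in>I. \<phi> i p" c _ p] by (simp add: o_def)
qed

lemma der_compose:
  assumes "mC1 W \<phi>" "p \<in> W" "c \<in> A" "p \<in> fst c" "(\<theta> has_real_derivative D) (at (\<phi> p))"
  shows "der c (\<lambda>p. \<theta> (\<phi> p)) p v = D * der c \<phi> p v"
proof -
  have "((\<lambda>x. \<theta> ((\<phi> \<circ> chart_inv c) x)) has_derivative (\<lambda>v. D * der c \<phi> p v)) (at (snd c p))"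
    by (rule has_derivative_compose[OF mC1_has_derivative[OF assms(1,3,4,2)]])
      (use assms(5) in \<open>simp add: chart_inv_left[OF assms(3,4)] has_field_derivative_def\<close>)
  then show ?thesis using der_eqI[of "\<lambda>p. \<theta> (\<phi> p)" c _ p] by (simp add: o_def)
qed

lemma der_const:
  assumes "c \<in> A"
  shows "der c (\<lambda>_. a) p v = 0"
  by (simp add: der_def o_def frechet_derivative_const)

lemma der_eq_0_open:
  assumes "open W" "p \<in> W" "c \<in> A" "p \<in> fst c" "\<And>q. q \<in> W \<Longrightarrow> \<phi> q = 0"
  shows "der c \<phi> p v = 0"
  using der_cong[OF assms(1-4), of \<phi> "\<lambda>_. 0"] assms(5) der_const[OF assms(3)] by simp

section \<open>Gradients\<close>

definition gnorm :: "('p, 'm) chart \<Rightarrow> real ^ 'm \<Rightarrow> real ^ 'm \<Rightarrow> real" where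
  "gnorm c x v = sqrt (ip (g c x) v v)"

text \<open>A bound on the dual norm of the differential, stated in every chart so that it can be
  read in any of them; by \<open>grad_boundI\<close>, checking one chart establishes it.\<close>

definition grad_bound :: "('p \<Rightarrow> real) \<Rightarrow> 'p \<Rightarrow> real \<Rightarrow> bool" where
  "grad_bound \<phi> p L \<longleftrightarrow> (\<forall>c\<in>A. p \<in> fst c \<longrightarrow> (\<forall>v. \<bar>der c \<phi> p v\<bar> \<le> L * gnorm c (snd c p) v))"

lemma grad_boundD: "grad_bound \<phi> p L \<Longrightarrow> c \<in> A \<Longrightarrow> p \<in> fst c \<Longrightarrow> \<bar>der c \<phi> p v\<bar> \<le> L * gnorm c (snd c p) v"
  by (simp add: grad_bound_def)

lemma grad_boundI:
  assumes "mC1 W \<phi>" "open W" "p \<in> W" "c \<in> A" "p \<in> fst c" "\<And>v. \<bar>der c \<phi> p v\<bar> \<le> L * gnorm c (snd c p) v"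
  shows "grad_bound \<phi> p L"
  unfolding grad_bound_def
proof (intro ballI impI allI)
  fix d v assume d: "d \<in> A" "p \<in> fst d"
  show "\<bar>der d \<phi> p v\<bar> \<le> L * gnorm d (snd d p) v"
    using der_change[OF assms(1-3) d(1) assms(4) d(2) assms(5), of v] assms(6)
      metric_trans[OF d(1) assms(4) d(2) assms(5), of v v] by (simp add: gnorm_def)
qed

lemma gnorm_nonneg: "c \<in> A \<Longrightarrow> x \<in> codom c \<Longrightarrow> 0 \<le> gnorm c x v"
  by (simp add: gnorm_def spd_nonneg[OF metric_spd])

definition grad_ip :: "('p \<Rightarrow> real) \<Rightarrow> ('p \<Rightarrow> real) \<Rightarrow> 'p \<Rightarrow> real" where
  "grad_ip \<phi> \<psi> p = (let c = chart_at A p in cip (g c (snd c p)) (der c \<phi> p) (der c \<psi> p))"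

text \<open>\<open>grad_ip\<close> is computed in a chosen chart. The derivative of a transition map
  carries orthonormal bases to orthonormal bases, so every chart gives the same value.\<close>

lemma grad_ip_chart:
  assumes phi: "mC1 W \<phi>" "mC1 W \<psi>" "open W" "p \<in> W" and c: "c \<in> A" "p \<in> fst c"
  shows "grad_ip \<phi> \<psi> p = cip (g c (snd c p)) (der c \<phi> p) (der c \<psi> p)"
proof -
  let ?d = "chart_at A p"
  note d = chart_at_in[of p]
  obtain e where e: "orthonormal (g c (snd c p)) e"
    using spd_exists_orthonormal[OF metric_spd'[OF c]] by auto
  let ?e = "\<lambda>i. frechet_derivative (trans c ?d) (at (snd c p)) (e i)"
  have "orthonormal (g ?d (snd ?d p)) ?e"
    using e metric_trans[OF c(1) d(1) c(2) d(2)] by (simp add: orthonormal_def)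
  then show ?thesis
    using cip_orthonormal[OF e linear_der[OF phi(1) c phi(4)] linear_der[OF phi(2) c phi(4)]]
      cip_orthonormal[OF _ linear_der[OF phi(1) d phi(4)] linear_der[OF phi(2) d phi(4)]]
    by (simp add: grad_ip_def Let_def der_change[OF phi(1,3,4) c(1) d(1) c(2) d(2)] der_change[OF phi(2,3,4) c(1) d(1) c(2) d(2)])
qed

lemma grad_ip_orthonormal:
  assumes phi: "mC1 W \<phi>" "mC1 W \<psi>" "open W" "p \<in> W" and c: "c \<in> A" "p \<in> fst c"
    and e: "orthonormal (g c (snd c p)) e"
  shows "grad_ip \<phi> \<psi> p = (\<Sum>i\<in>UNIV. der c \<phi> p (e i) * der c \<psi> p (e i))"
  unfolding grad_ip_chart[OF phi c]
  by (rule cip_orthonormal[OF e linear_der[OF phi(1) c phi(4)] linear_der[OF phi(2) c phi(4)]])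

text \<open>Each component in an orthonormal basis is at most \<open>L\<close> in absolute value;
  the crude dimensional factor only enters the constant of the final estimate.\<close>

lemma grad_ip_bound:
  assumes phi: "mC1 W \<phi>" "open W" "p \<in> W" and L: "grad_bound \<phi> p L"
  shows "grad_ip \<phi> \<phi> p \<le> real CARD('m) * L\<^sup>2"
proof -
  obtain c where c: "c \<in> A" "p \<in> fst c" using chart_exists by blast
  obtain e where e: "orthonormal (g c (snd c p)) e"
    using spd_exists_orthonormal[OF metric_spd'[OF c]] by auto
  have "\<bar>der c \<phi> p (e i)\<bar> \<le> L" for i
    using grad_boundD[OF L c, of "e i"] e by (simp add: orthonormal_def gnorm_def)
  then have "(der c \<phi> p (e i))\<^sup>2 \<le> L\<^sup>2" for i
    by (metis abs_ge_zero power2_abs power_mono)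
  then have "(\<Sum>i\<in>UNIV. (der c \<phi> p (e i))\<^sup>2) \<le> (\<Sum>i\<in>(UNIV::'m set). L\<^sup>2)"
    by (rule sum_mono)
  then show ?thesis by (simp add: grad_ip_orthonormal[OF phi(1,1,2,3) c e] power2_eq_square)
qed

text \<open>\<open>chart_at\<close> may jump from point to point, so continuity is seen in one fixed
  chart near each point.\<close>

lemma grad_ip_continuous:
  assumes W: "open W" and phi: "mC1 W \<phi>" "mC1 W \<psi>"
  shows "continuous_on W (grad_ip \<phi> \<psi>)"
proof (rule continuous_on_open_locally[OF W])
  fix p assume p: "p \<in> W"
  obtain c where c: "c \<in> A" "p \<in> fst c" using chart_exists by blast
  let ?X = "snd c ` (fst c \<inter> W)"
  have X: "open ?X" by (rule open_chart_image[OF c(1) W])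
  have inv: "continuous_on ?X (\<lambda>x. matrix_inv (g c x) $ i $ j)" for i j
  proof -
    have "Ck_on 0 (codom c) (\<lambda>x. matrix_inv (g c x) $ i $ j)"
      by (intro Ck_on_nth open_codom c smooth_onD[OF smooth_on_matrix_inv[OF open_codom metric_smooth metric_spd]])
    then show ?thesis by (auto elim: continuous_on_subset)
  qed
  have D: "continuous_on ?X (\<lambda>x. frechet_derivative (\<theta> \<circ> chart_inv c) (at x) v)" if "mC1 W \<theta>" for \<theta> v
    using mC1D[OF that c(1)] by simp
  have "continuous_on ?X (\<lambda>x. cip (g c x) (frechet_derivative (\<phi> \<circ> chart_inv c) (at x)) (frechet_derivative (\<psi> \<circ> chart_inv c) (at x)))"
    unfolding cip_def by (intro continuous_on_sum continuous_on_mult inv D phi)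
  then have "continuous_on (fst c \<inter> W) (\<lambda>q. cip (g c (snd c q)) (der c \<phi> q) (der c \<psi> q))"
    unfolding der_def by (rule continuous_on_compose2) (auto intro: continuous_on_subset[OF chart_cont[OF c(1)]])
  then have "continuous_on (fst c \<inter> W) (grad_ip \<phi> \<psi>)"
    by (rule continuous_on_eq) (simp add: grad_ip_chart[OF phi W _ c(1)])
  then show "\<exists>V. open V \<and> p \<in> V \<and> continuous_on (V \<inter> W) (grad_ip \<phi> \<psi>)" using open_dom c by blast
qed

end

section \<open>Lengths of paths\<close>

lemma C1_differentiable_on_locally:
  fixes f :: "real \<Rightarrow> 'a::real_normed_vector"
  assumes "\<And>t. t \<in> X \<Longrightarrow> \<exists>N. open N \<and> t \<in> N \<and> f C1_differentiable_on N"
  shows "f C1_differentiable_on X"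
  unfolding C1_differentiable_on_eq
proof
  show "\<forall>t\<in>X. f differentiable at t"
    using assms unfolding C1_differentiable_on_eq by blast
  show "continuous_on X (\<lambda>t. vector_derivative f (at t))"
  proof (rule continuous_at_imp_continuous_on, rule ballI)
    fix t assume "t \<in> X"
    then obtain N where "open N" "t \<in> N" "continuous_on N (\<lambda>t. vector_derivative f (at t))"
      using assms unfolding C1_differentiable_on_eq by blast
    then show "isCont (\<lambda>t. vector_derivative f (at t)) t"
      using continuous_on_eq_continuous_at by blast
  qed
qed

lemma C1_differentiable_on_cong_open:
  assumes "open N" "f C1_differentiable_on N" "\<And>t. t \<in> N \<Longrightarrow> f t = h t"
  shows "h C1_differentiable_on N"
proof -
  obtain D where D: "\<And>t. t \<in> N \<Longrightarrow> (f has_vector_derivative D t) (at t)" "continuous_on N D"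
    using assms(2) by (auto simp: C1_differentiable_on_def)
  have "(h has_vector_derivative D t) (at t)" if "t \<in> N" for t
    by (rule has_vector_derivative_transform_within_open[OF D(1)[OF that] assms(1) that assms(3)])
  then show ?thesis using D(2) by (auto simp: C1_differentiable_on_def)
qed

context riem
begin

text \<open>The exceptional set is a parameter so that it can be followed through joins.\<close>

definition path_except :: "(real \<Rightarrow> 'p) \<Rightarrow> real set \<Rightarrow> bool" where
  "path_except \<gamma> S \<longleftrightarrow> path \<gamma> \<and> finite S \<and>
     (\<forall>c\<in>A. (snd c \<circ> \<gamma>) C1_differentiable_on (({0<..<1} - S) \<inter> \<gamma> -` fst c))"

lemma piecewise_C1_path_except: "piecewise_C1_path A \<gamma> \<longleftrightarrow> (\<exists>S. path_except \<gamma> S)"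
  by (auto simp: piecewise_C1_path_def path_except_def)

lemma open_regular: "path_except \<gamma> S \<Longrightarrow> open ({0<..<1} - S)"
  by (simp add: path_except_def open_Diff finite_imp_closed)

lemma continuous_regular: "path_except \<gamma> S \<Longrightarrow> continuous_on ({0<..<1} - S) \<gamma>"
  unfolding path_except_def path_def by (auto elim: continuous_on_subset)

lemma open_regular_preimage:
  assumes "path_except \<gamma> S" "open W"
  shows "open (({0<..<1} - S) \<inter> \<gamma> -` W)"
proof -
  have "open (\<gamma> -` W \<inter> ({0<..<1} - S))"
    using continuous_on_open_vimage[OF open_regular[OF assms(1)], of \<gamma>] continuous_regular[OF assms(1)] assms(2)
    by blast
  then show ?thesis by (subst Int_commute)
qed

lemma velocity:
  assumes "path_except \<gamma> S" "c \<in> A" "t \<in> {0<..<1} - S" "\<gamma> t \<in> fst c"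
  shows "((snd c \<circ> \<gamma>) has_vector_derivative vector_derivative (snd c \<circ> \<gamma>) (at t)) (at t)"
  using assms unfolding path_except_def C1_differentiable_on_eq vector_derivative_works[symmetric] by blast

text \<open>\<open>speed\<close> uses the chart chosen by \<open>chart_at\<close>; the chain rule
  for the transition map and the transformation law of the metric carry it to any chart.\<close>

lemma speed_chart:
  assumes P: "path_except \<gamma> S" and c: "c \<in> A" and t: "t \<in> {0<..<1} - S" "\<gamma> t \<in> fst c"
  shows "speed A g \<gamma> t = gnorm c (snd c (\<gamma> t)) (vector_derivative (snd c \<circ> \<gamma>) (at t))"
proof -
  let ?d = "chart_at A (\<gamma> t)"
  note d = chart_at_in[of "\<gamma> t"]
  let ?v = "vector_derivative (snd c \<circ> \<gamma>) (at t)"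
  let ?T = "frechet_derivative (trans c ?d) (at (snd c (\<gamma> t)))"
  have V: "((snd c \<circ> \<gamma>) has_derivative (\<lambda>h. h *\<^sub>R ?v)) (at t)"
    using velocity[OF P c t] by (simp add: has_vector_derivative_def)
  have "(trans c ?d has_derivative ?T) (at ((snd c \<circ> \<gamma>) t))"
    using trans_derivative[OF c d(1) t(2) d(2)] by simp
  from has_derivative_compose[OF V this]
  have "((\<lambda>s. trans c ?d ((snd c \<circ> \<gamma>) s)) has_vector_derivative ?T ?v) (at t)"
    using linear_scale[OF has_derivative_linear[OF trans_derivative[OF c d(1) t(2) d(2)]]]
    by (simp add: has_vector_derivative_def)
  then have "((snd ?d \<circ> \<gamma>) has_vector_derivative ?T ?v) (at t)"
    by (rule has_vector_derivative_transform_within_open[OF _ open_regular_preimage[OF P open_dom[OF c]]])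
      (use t in \<open>auto simp: trans_apply[OF c]\<close>)
  then have "vector_derivative (snd ?d \<circ> \<gamma>) (at t) = ?T ?v" by (rule vector_derivative_at)
  then show ?thesis
    by (simp add: speed_def Let_def gnorm_def metric_trans[OF c d(1) t(2) d(2)])
qed

lemma speed_nonneg: "0 \<le> speed A g \<gamma> t"
  unfolding speed_def Let_def using spd_nonneg[OF metric_spd'[OF chart_at_in]] by simp

lemma speed_continuous:
  assumes P: "path_except \<gamma> S"
  shows "continuous_on ({0<..<1} - S) (speed A g \<gamma>)"
proof (rule continuous_on_open_locally[OF open_regular[OF P]])
  fix t assume t: "t \<in> {0<..<1} - S"
  obtain c where c: "c \<in> A" "\<gamma> t \<in> fst c" using chart_exists by blast
  let ?N = "({0<..<1} - S) \<inter> \<gamma> -` fst c"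
  have 1: "continuous_on ?N (\<lambda>s. vector_derivative (snd c \<circ> \<gamma>) (at s))"
    using P c unfolding path_except_def C1_differentiable_on_eq by blast
  have 2: "continuous_on ?N (\<lambda>s. snd c (\<gamma> s))"
    by (rule continuous_on_compose2[OF chart_cont[OF c(1)]]) (auto intro: continuous_on_subset[OF continuous_regular[OF P]])
  have 3: "continuous_on ?N (\<lambda>s. g c (snd c (\<gamma> s)))"
    by (rule continuous_on_compose2[OF Ck_on_continuous[OF smooth_onD[OF metric_smooth[OF c(1)]]] 2]) auto
  have "continuous_on ?N (\<lambda>s. gnorm c (snd c (\<gamma> s)) (vector_derivative (snd c \<circ> \<gamma>) (at s)))"
    unfolding gnorm_def ip_def
    by (intro continuous_on_real_sqrt continuous_on_inner 1
        bounded_bilinear.continuous_on[OF bounded_bilinear_matrix_vector 3])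
  then have "continuous_on ?N (speed A g \<gamma>)"
    by (rule continuous_on_eq) (simp add: speed_chart[OF P c(1)])
  moreover have "?N \<inter> ({0<..<1} - S) = ?N" by blast
  ultimately show "\<exists>V. open V \<and> t \<in> V \<and> continuous_on (V \<inter> ({0<..<1} - S)) (speed A g \<gamma>)"
    using open_regular_preimage[OF P open_dom[OF c(1)]] t c(2) by (intro exI[of _ ?N]) simp
qed

text \<open>The speed set to 0 at exceptional times, where \<open>vector_derivative\<close> carries
  no information. It is continuous on an open set and zero elsewhere, hence Borel, and it alters the
  length integrand only on a finite set.\<close>

definition reg_speed :: "(real \<Rightarrow> 'p) \<Rightarrow> real set \<Rightarrow> real \<Rightarrow> real" where
  "reg_speed \<gamma> S t = indicator ({0<..<1} - S) t * speed A g \<gamma> t"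

lemma reg_speed_measurable:
  assumes "path_except \<gamma> S"
  shows "reg_speed \<gamma> S \<in> borel_measurable borel"
proof -
  have "(\<lambda>t. indicator ({0<..<1} - S) t *\<^sub>R speed A g \<gamma> t) \<in> borel_measurable borel"
    by (rule borel_measurable_continuous_on_indicator[OF _ speed_continuous[OF assms]])
      (use open_regular[OF assms] in simp)
  then show ?thesis by (simp add: reg_speed_def[abs_def])
qed

lemma reg_speed_nonneg: "0 \<le> reg_speed \<gamma> S t"
  by (simp add: reg_speed_def speed_nonneg)

lemma AE_lborel_finite:
  fixes S :: "real set"
  assumes "finite S" "\<And>t. t \<notin> S \<Longrightarrow> Q t"
  shows "AE t in lborel. Q t"
  by (rule AE_I'[of S]) (use assms in \<open>auto simp: null_sets_def emeasure_lborel_countable[OF countable_finite] finite_imp_closed borel_closed\<close>)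

lemma path_length_reg:
  assumes "path_except \<gamma> S"
  shows "path_length A g \<gamma> = (\<integral>\<^sup>+ t. ennreal (reg_speed \<gamma> S t) \<partial>lborel)"
  unfolding path_length_def
proof (rule nn_integral_cong_AE, rule AE_lborel_finite[of "insert 0 (insert 1 S)"])
  show "finite (insert 0 (insert 1 S))" using assms by (simp add: path_except_def)
  show "ennreal (speed A g \<gamma> t) * indicator {0..1} t = ennreal (reg_speed \<gamma> S t)"
    if "t \<notin> insert 0 (insert 1 S)" for t
    using that by (auto simp: reg_speed_def indicator_def)
qed

text \<open>Along the path the derivative of \<open>\<phi>\<close> is at most \<open>L\<close> times
  the speed, and the fundamental theorem of calculus tolerates a finite exceptional set.\<close>

lemma path_length_ge:
  assumes P: "path_except \<gamma> S" and phi: "mC1 UNIV \<phi>" and L: "L > 0" "\<And>p. grad_bound \<phi> p L"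
  shows "ennreal \<bar>\<phi> (\<gamma> 1) - \<phi> (\<gamma> 0)\<bar> \<le> ennreal L * path_length A g \<gamma>"
proof (cases "path_length A g \<gamma> = \<infinity>")
  case True
  then show ?thesis using L(1) by (simp add: ennreal_mult_top)
next
  case False
  let ?s = "reg_speed \<gamma> S"
  \<comment> \<open>The value 0 at exceptional times makes the bound by \<open>reg_speed\<close>
    hold everywhere.\<close>
  define f' where "f' t = (if t \<in> {0<..<1} - S then vector_derivative (\<phi> \<circ> \<gamma>) (at t) else 0)" for t
  have int: "integrable lborel ?s"
  proof (rule integrableI_nonneg)
    show "?s \<in> borel_measurable lborel" using reg_speed_measurable[OF P] by simp
    show "(\<integral>\<^sup>+ t. ennreal (?s t) \<partial>lborel) < \<infinity>"
      using False by (simp add: path_length_reg[OF P] top.not_eq_extremum)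
  qed (simp add: reg_speed_nonneg)
  have len: "path_length A g \<gamma> = ennreal (integral\<^sup>L lborel ?s)"
    unfolding path_length_reg[OF P] by (rule nn_integral_eq_integral[OF int]) (simp add: reg_speed_nonneg)
  have hi: "(?s has_integral (integral\<^sup>L lborel ?s)) UNIV"
    by (rule has_integral_integral_lborel[OF int])
  have s01: "?s integrable_on {0..1}"
    using integrable_on_subcbox[OF has_integral_integrable[OF hi], of 0 1] by simp
  have sle: "integral {0..1} ?s \<le> integral\<^sup>L lborel ?s"
    using integral_subset_le[of "{0..1}" UNIV ?s] s01 has_integral_integrable[OF hi] reg_speed_nonneg
    by (simp add: integral_unique[OF hi])
  have der: "((\<phi> \<circ> \<gamma>) has_vector_derivative f' t) (at t)" and bnd: "\<bar>f' t\<bar> \<le> L * ?s t"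
    if t: "t \<in> {0<..<1} - S" for t
  proof -
    obtain c where c: "c \<in> A" "\<gamma> t \<in> fst c" using chart_exists by blast
    let ?v = "vector_derivative (snd c \<circ> \<gamma>) (at t)"
    have D: "((\<phi> \<circ> chart_inv c) has_derivative der c \<phi> (\<gamma> t)) (at ((snd c \<circ> \<gamma>) t))"
      using mC1_has_derivative[OF phi c] by simp
    have V: "((snd c \<circ> \<gamma>) has_derivative (\<lambda>h. h *\<^sub>R ?v)) (at t)"
      using velocity[OF P c(1) t c(2)] by (simp add: has_vector_derivative_def)
    have "((\<lambda>s. (\<phi> \<circ> chart_inv c) ((snd c \<circ> \<gamma>) s)) has_vector_derivative der c \<phi> (\<gamma> t) ?v) (at t)"
      using has_derivative_compose[OF V D] linear_scale[OF has_derivative_linear[OF D]]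
      by (simp add: has_vector_derivative_def)
    then have *: "((\<phi> \<circ> \<gamma>) has_vector_derivative der c \<phi> (\<gamma> t) ?v) (at t)"
      by (rule has_vector_derivative_transform_within_open[OF _ open_regular_preimage[OF P open_dom[OF c(1)]]])
        (use t c in \<open>auto simp: chart_inv_left[OF c(1)]\<close>)
    then have f': "f' t = der c \<phi> (\<gamma> t) ?v" using t by (simp add: f'_def vector_derivative_at)
    show "((\<phi> \<circ> \<gamma>) has_vector_derivative f' t) (at t)" using * f' by simp
    show "\<bar>f' t\<bar> \<le> L * ?s t"
      using grad_boundD[OF L(2) c, of ?v] t speed_chart[OF P c(1) t c(2)] by (simp add: f' reg_speed_def)
  qed
  have cont: "continuous_on {0..1} (\<phi> \<circ> \<gamma>)"
    unfolding o_def
    by (rule continuous_on_compose2[OF mC1_continuous[OF open_UNIV phi]]) (use P in \<open>simp_all add: path_except_def path_def\<close>)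
  have finS: "finite S" using P by (simp add: path_except_def)
  have f'i: "(f' has_integral ((\<phi> \<circ> \<gamma>) 1 - (\<phi> \<circ> \<gamma>) 0)) {0..1}"
    by (rule fundamental_theorem_of_calculus_interior_strong[OF finS zero_le_one der cont])
  have "norm (integral {0..1} f') \<le> integral {0..1} (\<lambda>t. L * ?s t)"
  proof (rule integral_norm_bound_integral)
    show "norm (f' t) \<le> L * ?s t" for t
    proof (cases "t \<in> {0<..<1} - S")
      case True
      then show ?thesis using bnd by simp
    next
      case False
      then have "f' t = 0" unfolding f'_def by (rule if_not_P)
      then show ?thesis using mult_nonneg_nonneg[OF less_imp_le[OF L(1)] reg_speed_nonneg] by simp
    qed
    show "(\<lambda>t. L * ?s t) integrable_on {0..1}" using s01 by (rule integrable_on_mult_right)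
  qed (rule has_integral_integrable[OF f'i])
  then have "\<bar>\<phi> (\<gamma> 1) - \<phi> (\<gamma> 0)\<bar> \<le> L * integral {0..1} ?s"
    using integral_unique[OF f'i] by (simp add: o_def)
  also have "\<dots> \<le> L * integral\<^sup>L lborel ?s"
    by (intro mult_left_mono sle) (use L in simp)
  finally have "\<bar>\<phi> (\<gamma> 1) - \<phi> (\<gamma> 0)\<bar> \<le> L * integral\<^sup>L lborel ?s" .
  moreover have "ennreal L * ennreal (integral\<^sup>L lborel ?s) = ennreal (L * integral\<^sup>L lborel ?s)"
    by (rule ennreal_mult[symmetric]) (use L(1) in \<open>simp_all add: reg_speed_nonneg\<close>)
  ultimately show ?thesis unfolding len by (simp add: ennreal_leI)
qed

text \<open>Each half runs at twice the speed, which the change of variables compensates. The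
  midpoint joins the exceptional set because the velocity may jump there.\<close>

lemma path_except_join:
  assumes P: "path_except \<gamma> S" and Q: "path_except \<delta> R" and e: "pathfinish \<gamma> = pathstart \<delta>"
  defines "J \<equiv> insert (1/2) ((\<lambda>t. t / 2) ` S \<union> (\<lambda>t. (t + 1) / 2) ` R)"
  shows "path_except (\<gamma> +++ \<delta>) J"
    and "path_length A g (\<gamma> +++ \<delta>) = path_length A g \<gamma> + path_length A g \<delta>"
proof -
  let ?j = "\<gamma> +++ \<delta>"
  have left: "2 * t \<in> {0<..<1} - S" if "t \<in> {0<..<1} - J" "t < 1/2" for t
  proof -
    have "2 * t \<notin> S"
    proof
      assume "2 * t \<in> S"
      then have "t \<in> (\<lambda>t. t / 2) ` S" by (intro image_eqI[of _ _ "2 * t"]) auto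
      then show False using that(1) by (simp add: J_def)
    qed
    then show ?thesis using that by auto
  qed
  have right: "2 * t - 1 \<in> {0<..<1} - R" if "t \<in> {0<..<1} - J" "t > 1/2" for t
  proof -
    have "2 * t - 1 \<notin> R"
    proof
      assume "2 * t - 1 \<in> R"
      then have "t \<in> (\<lambda>t. (t + 1) / 2) ` R" by (intro image_eqI[of _ _ "2 * t - 1"]) auto
      then show False using that(1) by (simp add: J_def)
    qed
    then show ?thesis using that by auto
  qed
  have jl: "?j t = \<gamma> (2 * t)" if "t < 1/2" for t using that by (simp add: joinpaths_def)
  have jr: "?j t = \<delta> (2 * t - 1)" if "t > 1/2" for t using that by (simp add: joinpaths_def)
  have pj: "path ?j" using P Q e by (auto simp: path_except_def intro: path_join_imp)
  have finJ: "finite J" using P Q by (simp add: J_def path_except_def)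
  have affine: "(f \<circ> (\<lambda>t. 2 * t + b)) C1_differentiable_on N" if "f C1_differentiable_on M" "(\<lambda>t. 2 * t + b) ` N \<subseteq> M"
    for f :: "real \<Rightarrow> real ^ 'm" and b N M
  proof (rule C1_differentiable_compose)
    show "(\<lambda>t. 2 * t + b) C1_differentiable_on N"
      by (intro C1_differentiable_on_add C1_differentiable_on_mult C1_differentiable_on_ident C1_differentiable_on_const)
    show "f C1_differentiable_on (\<lambda>t. 2 * t + b) ` N" using that by (auto intro: C1_differentiable_on_subset)
    show "finite (N \<inter> (\<lambda>t. 2 * t + b) -` {x})" for x
      by (rule finite_subset[of _ "{(x - b) / 2}"]) auto
  qed
  have shifted: "open ((\<lambda>t. 2 * t + b) -` M)" if "open M" for b and M :: "real set"
    using that by (intro open_vimage) (auto intro!: continuous_intros)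
  show PJ: "path_except ?j J"
    unfolding path_except_def
  proof (intro conjI ballI pj finJ)
    fix c assume c: "c \<in> A"
    let ?M = "({0<..<1} - S) \<inter> \<gamma> -` fst c" and ?M' = "({0<..<1} - R) \<inter> \<delta> -` fst c"
    show "(snd c \<circ> ?j) C1_differentiable_on (({0<..<1} - J) \<inter> ?j -` fst c)"
    proof (rule C1_differentiable_on_locally)
      fix t assume t: "t \<in> ({0<..<1} - J) \<inter> ?j -` fst c"
      then have "t \<noteq> 1/2" by (auto simp: J_def)
      then consider "t < 1/2" | "t > 1/2" by linarith
      then show "\<exists>N. open N \<and> t \<in> N \<and> (snd c \<circ> ?j) C1_differentiable_on N"
      proof cases
        case 1
        let ?N = "{..<1/2} \<inter> (\<lambda>t. 2 * t + 0) -` ?M"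
        have oN: "open ?N" by (intro open_Int shifted open_regular_preimage[OF P] open_dom c) simp
        have "(snd c \<circ> \<gamma>) C1_differentiable_on ?M" using P c by (simp add: path_except_def)
        then have "((snd c \<circ> \<gamma>) \<circ> (\<lambda>t. 2 * t + 0)) C1_differentiable_on ?N" by (rule affine) auto
        then have "(snd c \<circ> ?j) C1_differentiable_on ?N"
          by (rule C1_differentiable_on_cong_open[OF oN]) (auto simp: jl)
        then show ?thesis using oN t 1 left[of t] by (intro exI[of _ ?N]) (auto simp: jl)
      next
        case 2
        let ?N = "{1/2<..} \<inter> (\<lambda>t. 2 * t + (-1)) -` ?M'"
        have oN: "open ?N" by (intro open_Int shifted open_regular_preimage[OF Q] open_dom c) simp
        have "(snd c \<circ> \<delta>) C1_differentiable_on ?M'" using Q c by (simp add: path_except_def)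
        then have "((snd c \<circ> \<delta>) \<circ> (\<lambda>t. 2 * t + (-1))) C1_differentiable_on ?N" by (rule affine) auto
        then have "(snd c \<circ> ?j) C1_differentiable_on ?N"
          by (rule C1_differentiable_on_cong_open[OF oN]) (auto simp: jr)
        then show ?thesis using oN t 2 right[of t] by (intro exI[of _ ?N]) (auto simp: jr)
      qed
    qed
  qed
  have sl: "speed A g ?j t = 2 * speed A g \<gamma> (2 * t)" if t: "t \<in> {0<..<1} - J" "t < 1/2" for t
  proof -
    obtain c where c: "c \<in> A" "\<gamma> (2 * t) \<in> fst c" using chart_exists by blast
    have cj: "?j t \<in> fst c" using c jl[OF t(2)] by simp
    let ?v = "vector_derivative (snd c \<circ> \<gamma>) (at (2 * t))"
    have "((\<lambda>t. 2 * t) has_vector_derivative 2) (at t)"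
      by (auto intro!: derivative_eq_intros simp: has_vector_derivative_def)
    from vector_diff_chain_at[OF this velocity[OF P c(1) left[OF t] c(2)]]
    have "((snd c \<circ> \<gamma>) \<circ> (\<lambda>t. 2 * t) has_vector_derivative 2 *\<^sub>R ?v) (at t)" .
    then have "(snd c \<circ> ?j has_vector_derivative 2 *\<^sub>R ?v) (at t)"
      by (rule has_vector_derivative_transform_within_open[of _ _ _ "{..<1/2}"]) (use t in \<open>auto simp: jl\<close>)
    then show ?thesis
      using speed_chart[OF PJ c(1) t(1) cj] speed_chart[OF P c(1) left[OF t] c(2)]
      by (simp add: vector_derivative_at jl[OF t(2)] gnorm_def ip_scaleR_left ip_scaleR_right real_sqrt_mult)
  qed
  have sr: "speed A g ?j t = 2 * speed A g \<delta> (2 * t - 1)" if t: "t \<in> {0<..<1} - J" "t > 1/2" for t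
  proof -
    obtain c where c: "c \<in> A" "\<delta> (2 * t - 1) \<in> fst c" using chart_exists by blast
    have cj: "?j t \<in> fst c" using c jr[OF t(2)] by simp
    let ?v = "vector_derivative (snd c \<circ> \<delta>) (at (2 * t - 1))"
    have "((\<lambda>t. 2 * t - 1) has_vector_derivative 2) (at t)"
      by (auto intro!: derivative_eq_intros simp: has_vector_derivative_def)
    from vector_diff_chain_at[OF this velocity[OF Q c(1) right[OF t] c(2)]]
    have "((snd c \<circ> \<delta>) \<circ> (\<lambda>t. 2 * t - 1) has_vector_derivative 2 *\<^sub>R ?v) (at t)" .
    then have "(snd c \<circ> ?j has_vector_derivative 2 *\<^sub>R ?v) (at t)"
      by (rule has_vector_derivative_transform_within_open[of _ _ _ "{1/2<..}"]) (use t in \<open>auto simp: jr\<close>)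
    then show ?thesis
      using speed_chart[OF PJ c(1) t(1) cj] speed_chart[OF Q c(1) right[OF t] c(2)]
      by (simp add: vector_derivative_at jr[OF t(2)] gnorm_def ip_scaleR_left ip_scaleR_right real_sqrt_mult)
  qed
  let ?f = "\<lambda>t. ennreal (reg_speed \<gamma> S t)" and ?h = "\<lambda>t. ennreal (reg_speed \<delta> R t)"
  have mf: "?f \<in> borel_measurable borel" "?h \<in> borel_measurable borel"
    using reg_speed_measurable[OF P] reg_speed_measurable[OF Q] by simp_all
  have "path_length A g ?j = (\<integral>\<^sup>+ t. 2 * ?f (0 + 2 * t) + 2 * ?h (-1 + 2 * t) \<partial>lborel)"
    unfolding path_length_def
  proof (rule nn_integral_cong_AE, rule AE_lborel_finite[of "insert 0 (insert 1 J)"])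
    show "finite (insert 0 (insert 1 J))" using finJ by simp
    fix t assume t: "t \<notin> insert 0 (insert 1 J)"
    show "ennreal (speed A g ?j t) * indicator {0..1} t = 2 * ?f (0 + 2 * t) + 2 * ?h (-1 + 2 * t)"
    proof (cases "t \<in> {0<..<1}")
      case False
      then show ?thesis using t by (auto simp: reg_speed_def indicator_def)
    next
      case True
      then have t': "t \<in> {0<..<1} - J" using t by auto
      then have "t \<noteq> 1/2" by (auto simp: J_def)
      then consider "t < 1/2" | "t > 1/2" by linarith
      then show ?thesis
      proof cases
        case 1
        then show ?thesis using sl[OF t' 1] left[OF t' 1] t'
          by (simp add: reg_speed_def ennreal_mult speed_nonneg)
      next
        case 2
        then show ?thesis using sr[OF t' 2] right[OF t' 2] t'
          by (simp add: reg_speed_def ennreal_mult speed_nonneg)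
      qed
    qed
  qed
  also have "\<dots> = (\<integral>\<^sup>+ t. 2 * ?f (0 + 2 * t) \<partial>lborel) + (\<integral>\<^sup>+ t. 2 * ?h (-1 + 2 * t) \<partial>lborel)"
    using reg_speed_measurable[OF P] reg_speed_measurable[OF Q] by (intro nn_integral_add) simp_all
  also have "(\<integral>\<^sup>+ t. 2 * ?f (0 + 2 * t) \<partial>lborel) = (\<integral>\<^sup>+ t. ?f t \<partial>lborel)"
    using nn_integral_real_affine[OF mf(1), of 2 0] reg_speed_measurable[OF P] by (simp add: nn_integral_cmult)
  also have "(\<integral>\<^sup>+ t. 2 * ?h (-1 + 2 * t) \<partial>lborel) = (\<integral>\<^sup>+ t. ?h t \<partial>lborel)"
    using nn_integral_real_affine[OF mf(2), of 2 "-1"] reg_speed_measurable[OF Q] by (simp add: nn_integral_cmult)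
  finally show "path_length A g ?j = path_length A g \<gamma> + path_length A g \<delta>"
    by (simp add: path_length_reg[OF P] path_length_reg[OF Q])
qed

text \<open>The coordinate velocity is the constant \<open>y - x\<close> over unit time, so a bound
  on its length along the segment bounds the length of the path.\<close>

lemma path_except_segment:
  assumes c: "c \<in> A" and seg: "closed_segment x y \<subseteq> codom c"
    and M: "\<And>z. z \<in> closed_segment x y \<Longrightarrow> gnorm c z (y - x) \<le> M"
  defines "\<gamma> \<equiv> \<lambda>t. chart_inv c (x + t *\<^sub>R (y - x))"
  shows "path_except \<gamma> {}" "path_length A g \<gamma> \<le> ennreal M"
proof -
  let ?l = "\<lambda>t. x + t *\<^sub>R (y - x)"
  have inseg: "?l t \<in> closed_segment x y" if "0 \<le> t" "t \<le> 1" for t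
    using that by (auto simp: in_segment algebra_simps intro!: exI[of _ t])
  have incod: "?l t \<in> codom c" if "0 \<le> t" "t \<le> 1" for t using inseg[OF that] seg by blast
  have path: "path \<gamma>"
    unfolding path_def \<gamma>_def
    by (rule continuous_on_compose2[OF chart_inv_cont[OF c]]) (use incod in \<open>auto intro!: continuous_intros\<close>)
  have lder: "(?l has_vector_derivative (y - x)) (at t)" for t
    by (auto intro!: derivative_eq_intros simp: has_vector_derivative_def)
  have chartder: "(snd d \<circ> \<gamma> has_vector_derivative frechet_derivative (trans c d) (at (?l t)) (y - x)) (at t)"
    if d: "d \<in> A" and t: "?l t \<in> local_dom id c d" for d t
  proof -
    have D: "(trans c d has_derivative frechet_derivative (trans c d) (at (?l t))) (at (?l t))"
      by (rule smooth_on_has_derivative[OF trans_smooth[OF c d] t])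
    have "((\<lambda>t. trans c d (?l t)) has_vector_derivative frechet_derivative (trans c d) (at (?l t)) (y - x)) (at t)"
      using has_derivative_compose[OF lder[of t, unfolded has_vector_derivative_def] D] linear_scale[OF has_derivative_linear[OF D]]
      by (simp add: has_vector_derivative_def)
    moreover have "trans c d (?l s) = (snd d \<circ> \<gamma>) s" for s by (simp add: \<gamma>_def local_rep_def)
    ultimately show ?thesis by (simp add: o_def)
  qed
  show P: "path_except \<gamma> {}"
    unfolding path_except_def
  proof (intro conjI ballI path finite.emptyI)
    fix d assume d: "d \<in> A"
    let ?X = "({0<..<1} - {}) \<inter> \<gamma> -` fst d"
    have X: "?l t \<in> local_dom id c d" if "t \<in> ?X" for t
    proof -
      have "?l t \<in> codom c" using that by (intro incod) auto
      then have "?l t = snd c (\<gamma> t)" "\<gamma> t \<in> fst c"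
        using chart_inv_right[OF c, of "?l t"] chart_inv_in[OF c, of "?l t"] by (simp_all add: \<gamma>_def)
      then show ?thesis using that by (auto simp: trans_dom)
    qed
    have "continuous_on ?X (\<lambda>t. frechet_derivative (trans c d) (at (?l t)) (y - x))"
      using smooth_onD[OF trans_smooth[OF c d], of 1] X
      by (intro continuous_on_compose2[of "local_dom id c d" "\<lambda>z. frechet_derivative (trans c d) (at z) (y - x)" ?X ?l])
        (auto intro!: continuous_intros)
    then show "(snd d \<circ> \<gamma>) C1_differentiable_on ?X"
      unfolding C1_differentiable_on_def
      by (intro exI[of _ "\<lambda>t. frechet_derivative (trans c d) (at (?l t)) (y - x)"] conjI ballI)
        (rule chartder[OF d X])
  qed
  have sp: "speed A g \<gamma> t \<le> M" if "t \<in> {0<..<1}" for t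
  proof -
    have l: "?l t \<in> codom c" using that by (intro incod) auto
    then have t: "\<gamma> t \<in> fst c" "snd c (\<gamma> t) = ?l t"
      using chart_inv_right[OF c, of "?l t"] chart_inv_in[OF c, of "?l t"] by (simp_all add: \<gamma>_def)
    have "(snd c \<circ> \<gamma> has_vector_derivative (y - x)) (at t)"
    proof (rule has_vector_derivative_transform_within_open[OF lder])
      show "open (?l -` codom c)" by (intro open_vimage open_codom c) (auto intro!: continuous_intros)
    qed (use l in \<open>auto simp: \<gamma>_def chart_inv_right[OF c]\<close>)
    then have "speed A g \<gamma> t = gnorm c (?l t) (y - x)"
      using speed_chart[OF P c _ t(1)] that t(2) by (simp add: vector_derivative_at)
    also have "\<dots> \<le> M" using that by (intro M inseg) auto
    finally show ?thesis .
  qed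
  have M0: "0 \<le> M"
    using M[OF ends_in_segment(1)] gnorm_nonneg[OF c, of x] seg by (meson ends_in_segment(1) order_trans subsetD)
  have "path_length A g \<gamma> \<le> (\<integral>\<^sup>+ (t::real). ennreal M * indicator {0..1} t \<partial>lborel)"
    unfolding path_length_reg[OF P]
    by (rule nn_integral_mono) (use sp M0 in \<open>auto simp: reg_speed_def indicator_def intro!: ennreal_leI\<close>)
  then show "path_length A g \<gamma> \<le> ennreal M" by (simp add: nn_integral_cmult)
qed

end

section \<open>Bump functions\<close>

text \<open>A C^1 function positive exactly on the positive reals; from it all bumps and cutoffs are
  made.\<close>

definition pos_sq :: "real \<Rightarrow> real" where "pos_sq y = (max 0 y)\<^sup>2"

text \<open>The quadratic remainder is uniform across the kink of \<open>max 0\<close> at 0. It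
  gives the derivative, and later permits differentiation under an integral.\<close>

lemma pos_sq_taylor: "\<bar>pos_sq z - pos_sq y - 2 * max 0 y * (z - y)\<bar> \<le> (z - y)\<^sup>2"
proof (cases "0 \<le> z"; cases "0 \<le> y")
  assume zy: "0 \<le> z" "0 \<le> y"
  have "pos_sq z - pos_sq y - 2 * max 0 y * (z - y) = (z - y)\<^sup>2"
    using zy by (simp add: pos_sq_def power2_eq_square algebra_simps)
  then show ?thesis by simp
next
  assume zy: "0 \<le> z" "\<not> 0 \<le> y"
  have "z * y \<le> 0" using zy by (simp add: mult_nonneg_nonpos)
  then have "2 * (z * y) \<le> y\<^sup>2" using zero_le_power2[of y] by linarith
  then have "z\<^sup>2 \<le> (z - y)\<^sup>2" by (simp add: power2_diff mult.assoc)
  then show ?thesis using zy by (simp add: pos_sq_def)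
next
  assume zy: "\<not> 0 \<le> z" "0 \<le> y"
  have "y * z \<le> 0" using zy by (simp add: mult_nonneg_nonpos)
  then have "0 \<le> y\<^sup>2 - 2 * (y * z)" by (smt (verit) zero_le_power2)
  moreover have "pos_sq z - pos_sq y - 2 * max 0 y * (z - y) = y\<^sup>2 - 2 * (y * z)"
    using zy by (simp add: pos_sq_def power2_eq_square algebra_simps)
  moreover have "y\<^sup>2 - 2 * (y * z) \<le> (z - y)\<^sup>2" by (simp add: power2_diff)
  ultimately show ?thesis by simp
next
  assume "\<not> 0 \<le> z" "\<not> 0 \<le> y"
  then show ?thesis by (simp add: pos_sq_def)
qed

lemma pos_sq_derivative: "(pos_sq has_real_derivative 2 * max 0 y) (at y)"
proof -
  have B: "\<bar>(pos_sq z - pos_sq y) / (z - y) - 2 * max 0 y\<bar> \<le> \<bar>z - y\<bar>" if "z \<noteq> y" for z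
  proof -
    have "(pos_sq z - pos_sq y) / (z - y) - 2 * max 0 y = (pos_sq z - pos_sq y - 2 * max 0 y * (z - y)) / (z - y)"
      using that by (simp add: field_simps)
    then have "\<bar>(pos_sq z - pos_sq y) / (z - y) - 2 * max 0 y\<bar>
        = \<bar>pos_sq z - pos_sq y - 2 * max 0 y * (z - y)\<bar> / \<bar>z - y\<bar>"
      by (simp only: abs_divide)
    also have "\<dots> \<le> (\<bar>z - y\<bar> * \<bar>z - y\<bar>) / \<bar>z - y\<bar>"
      by (rule divide_right_mono) (use pos_sq_taylor[of z y] in \<open>simp_all add: power2_eq_square\<close>)
    also have "\<dots> = \<bar>z - y\<bar>" by (rule nonzero_mult_div_cancel_right) (use that in simp)
    finally show ?thesis .
  qed
  have "((\<lambda>z. (pos_sq z - pos_sq y) / (z - y) - 2 * max 0 y) \<longlongrightarrow> 0) (at y)"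
  proof (rule Lim_null_comparison)
    show "\<forall>\<^sub>F z in at y. norm ((pos_sq z - pos_sq y) / (z - y) - 2 * max 0 y) \<le> \<bar>z - y\<bar>"
      using B by (auto simp: eventually_at_filter)
    show "((\<lambda>z. \<bar>z - y\<bar>) \<longlongrightarrow> 0) (at y)" by (rule tendsto_rabs_zero[OF LIM_zero[OF tendsto_ident_at]])
  qed
  then have "((\<lambda>z. (pos_sq z - pos_sq y) / (z - y)) \<longlongrightarrow> 2 * max 0 y) (at y)"
    by (rule LIM_zero_cancel)
  then show ?thesis by (simp add: has_field_derivative_iff)
qed

lemma Ck_on_pos_sq: "Ck_on 1 UNIV pos_sq"
  unfolding One_nat_def
proof (rule Ck_on_SucI[OF open_UNIV])
  show "(pos_sq has_derivative (\<lambda>v. (2 * max 0 y) * v)) (at y)" for y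
    using pos_sq_derivative[of y] by (simp add: has_field_derivative_def)
  show "Ck_on 0 UNIV (\<lambda>y. (2 * max 0 y) * v)" for v :: real
    by (auto intro!: continuous_intros)
qed

lemma pos_sq_pos: "y > 0 \<Longrightarrow> pos_sq y > 0"
  by (simp add: pos_sq_def)

lemma pos_sq_nonneg: "0 \<le> pos_sq y"
  by (simp add: pos_sq_def)

lemma pos_sq_eq_0: "y \<le> 0 \<Longrightarrow> pos_sq y = 0"
  by (simp add: pos_sq_def max_def)

definition bump :: "'a::euclidean_space \<Rightarrow> real \<Rightarrow> 'a \<Rightarrow> real" where
  "bump x0 r x = pos_sq (r\<^sup>2 - (x - x0) \<bullet> (x - x0))"

lemma Ck_on_bump: "Ck_on 1 UNIV (bump x0 r)"
  unfolding bump_def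
  by (rule Ck_on_compose[OF open_UNIV Ck_on_pos_sq])
    (intro Ck_on_diff Ck_on_inner Ck_on_const Ck_on_ident open_UNIV, simp)

lemma bump_eq_0: "0 \<le> r \<Longrightarrow> x \<notin> ball x0 r \<Longrightarrow> bump x0 r x = 0"
  unfolding bump_def by (rule pos_sq_eq_0)
    (simp add: dist_norm norm_minus_commute flip: power2_norm_eq_inner)

lemma bump_pos: "x \<in> ball x0 r \<Longrightarrow> bump x0 r x > 0"
  unfolding bump_def by (rule pos_sq_pos)
    (simp add: dist_norm norm_minus_commute power_strict_mono flip: power2_norm_eq_inner)

lemma bump_nonneg: "0 \<le> bump x0 r x"
  by (simp add: bump_def pos_sq_nonneg)

lemma ip_le_norm:
  "\<bar>ip G v v\<bar> \<le> (\<Sum>i\<in>UNIV. \<Sum>j\<in>UNIV. \<bar>G $ i $ j\<bar>) * (norm v)\<^sup>2"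
proof -
  have "\<bar>ip G v v\<bar> \<le> (\<Sum>i\<in>UNIV. \<Sum>j\<in>UNIV. \<bar>G $ i $ j * v $ i * v $ j\<bar>)"
    unfolding ip_eq_sum by (intro order_trans[OF sum_abs] sum_mono sum_abs)
  also have "\<dots> \<le> (\<Sum>i\<in>UNIV. \<Sum>j\<in>UNIV. \<bar>G $ i $ j\<bar> * (norm v)\<^sup>2)"
  proof (intro sum_mono)
    fix i j
    have "\<bar>v $ i\<bar> * \<bar>v $ j\<bar> \<le> norm v * norm v"
      by (intro mult_mono component_le_norm_cart) simp_all
    then show "\<bar>G $ i $ j * v $ i * v $ j\<bar> \<le> \<bar>G $ i $ j\<bar> * (norm v)\<^sup>2"
      by (simp add: abs_mult mult.assoc power2_eq_square mult_left_mono)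
  qed
  finally show ?thesis by (simp add: sum_distrib_right)
qed

context riem
begin

text \<open>A closed coordinate ball inside the image of \<open>W\<close> carries the bump; its
  preimage is compact, hence closed, and allows extension by zero.\<close>

lemma exists_bump:
  assumes "open W" "p \<in> W"
  obtains \<beta> C where "mC1 UNIV \<beta>" "\<And>q. 0 \<le> \<beta> q" "\<beta> p > 0" "compact C" "C \<subseteq> W" "\<And>q. q \<notin> C \<Longrightarrow> \<beta> q = 0"
proof -
  obtain c where c: "c \<in> A" "p \<in> fst c" using chart_exists by blast
  have "open (snd c ` (fst c \<inter> W))" "snd c p \<in> snd c ` (fst c \<inter> W)"
    using open_chart_image[OF c(1) assms(1)] assms(2) c(2) by auto
  then obtain r where r: "r > 0" "cball (snd c p) r \<subseteq> snd c ` (fst c \<inter> W)"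
    using open_contains_cball by blast
  define C where "C = chart_inv c ` cball (snd c p) r"
  have cod: "cball (snd c p) r \<subseteq> codom c" using r by blast
  have C: "compact C" unfolding C_def by (rule compact_chart_inv_image[OF c(1) cod]) simp
  have CW: "C \<subseteq> fst c \<inter> W"
  proof
    fix q assume "q \<in> C"
    then obtain y where "y \<in> fst c \<inter> W" "q = chart_inv c (snd c y)" using r unfolding C_def by blast
    then show "q \<in> fst c \<inter> W" using chart_inv_left[OF c(1), of y] by simp
  qed
  have dom: "chart_inv c ` codom c = fst c" using homeomorphism_image2[OF homeo[OF c(1)]] .
  define \<beta> where "\<beta> q = (if q \<in> fst c then bump (snd c p) r (snd c q) else 0)" for q
  have 0: "bump (snd c p) r (snd c q) = 0" if q: "q \<in> fst c - C" for q
  proof (rule bump_eq_0)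
    show "snd c q \<notin> ball (snd c p) r"
    proof
      assume "snd c q \<in> ball (snd c p) r"
      then have "chart_inv c (snd c q) \<in> C" unfolding C_def by (intro imageI) auto
      then show False using q chart_inv_left[OF c(1), of q] by simp
    qed
  qed (use r in simp)
  have "mC1 (fst c) (\<lambda>q. bump (snd c p) r (snd c q))"
    using mC1_chart[OF c(1) open_codom[OF c(1)] subset_refl Ck_on_subset[OF Ck_on_bump]] dom by simp
  from mC1_extend[OF compact_imp_closed[OF C] open_dom[OF c(1)] _ this 0] CW
  have "mC1 UNIV \<beta>" unfolding \<beta>_def by auto
  moreover have "\<beta> p > 0" using c r by (simp add: \<beta>_def bump_pos)
  moreover have "\<beta> q = 0" if "q \<notin> C" for q using 0 that by (simp add: \<beta>_def)
  moreover have "0 \<le> \<beta> q" for q by (simp add: \<beta>_def bump_nonneg)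
  moreover have "C \<subseteq> W" using CW by blast
  ultimately show ?thesis using that C by blast
qed

section \<open>Gradient bounds and Lipschitz test functions\<close>

lemma der_sq_le:
  assumes phi: "mC1 W \<phi>" "open W" "p \<in> W" and c: "c \<in> A" "p \<in> fst c"
  shows "(der c \<phi> p v)\<^sup>2 \<le> grad_ip \<phi> \<phi> p * (gnorm c (snd c p) v)\<^sup>2"
proof -
  let ?G = "g c (snd c p)"
  have spd: "spd ?G" by (rule metric_spd'[OF c])
  obtain e where e: "orthonormal ?G e" using spd_exists_orthonormal[OF spd] by auto
  note lin = linear_der[OF phi(1) c phi(3)]
  define a where "a i = ip ?G v (e i)" for i
  have v: "v = (\<Sum>i\<in>UNIV. a i *\<^sub>R e i)" unfolding a_def by (rule orthonormal_expansion[OF e spd])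
  have 1: "der c \<phi> p v = (\<Sum>i\<in>UNIV. a i * der c \<phi> p (e i))"
    by (subst v) (simp add: linear_sum[OF lin] linear_scale[OF lin])
  have "ip ?G v v = (\<Sum>i\<in>UNIV. a i * a i)"
    by (subst (2) v) (simp add: ip_sum_right ip_scaleR_right a_def)
  then have 2: "(gnorm c (snd c p) v)\<^sup>2 = (\<Sum>i\<in>UNIV. (a i)\<^sup>2)"
    using spd_nonneg[OF spd, of v] by (simp add: gnorm_def power2_eq_square)
  have 3: "grad_ip \<phi> \<phi> p = (\<Sum>i\<in>UNIV. (der c \<phi> p (e i))\<^sup>2)"
    by (simp add: grad_ip_orthonormal[OF phi(1,1,2,3) c e] power2_eq_square)
  show ?thesis unfolding 1 2 3
    using Cauchy_Schwarz_ineq_sum[of a "\<lambda>i. der c \<phi> p (e i)" UNIV] by (simp add: mult.commute)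
qed

lemma grad_bound_compact:
  assumes phi: "mC1 W \<phi>" "open W" and C: "compact C" "C \<subseteq> W"
  shows "\<exists>L>0. \<forall>q\<in>C. grad_bound \<phi> q L"
proof -
  have "bounded (grad_ip \<phi> \<phi> ` C)"
    by (intro compact_imp_bounded compact_continuous_image C continuous_on_subset[OF grad_ip_continuous[OF phi(2,1,1)]])
  then obtain B where B: "\<And>q. q \<in> C \<Longrightarrow> grad_ip \<phi> \<phi> q \<le> B" by (auto simp: bounded_iff abs_le_iff)
  \<comment> \<open>The maximum keeps \<open>L\<close> positive whatever \<open>B\<close>
    is.\<close>
  define L where "L = sqrt (max B 1)"
  have L: "L > 0" "L\<^sup>2 = max B 1" by (simp_all add: L_def)
  have "grad_bound \<phi> q L" if q: "q \<in> C" for q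
  proof -
    obtain c where c: "c \<in> A" "q \<in> fst c" using chart_exists by blast
    have qW: "q \<in> W" using q C by blast
    have "\<bar>der c \<phi> q v\<bar> \<le> L * gnorm c (snd c q) v" for v
    proof (rule power2_le_imp_le)
      have "(der c \<phi> q v)\<^sup>2 \<le> grad_ip \<phi> \<phi> q * (gnorm c (snd c q) v)\<^sup>2"
        by (rule der_sq_le[OF phi qW c])
      also have "\<dots> \<le> L\<^sup>2 * (gnorm c (snd c q) v)\<^sup>2"
        using B[OF q] by (intro mult_right_mono) (auto simp: L(2))
      finally show "\<bar>der c \<phi> q v\<bar>\<^sup>2 \<le> (L * gnorm c (snd c q) v)\<^sup>2" by (simp add: power_mult_distrib)
      have "snd c q \<in> codom c" using c by blast
      then show "0 \<le> L * gnorm c (snd c q) v" using L gnorm_nonneg[OF c(1)] by simp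
    qed
    then show ?thesis by (rule grad_boundI[OF phi qW c])
  qed
  then show ?thesis using L by blast
qed

text \<open>A rescaled bump. It separates \<open>p\<close> from the complement of \<open>W\<close>,
  by its value at \<open>p\<close>, in any distance that dominates the increments of functions with
  gradient at most 1; \<open>riemannian_dist\<close> and later \<open>dst\<close> do.\<close>

lemma exists_bump_Lipschitz:
  assumes "open W" "p \<in> W"
  obtains \<phi> where "mC1 UNIV \<phi>" "\<And>q. grad_bound \<phi> q 1" "\<phi> p > 0" "\<And>q. q \<notin> W \<Longrightarrow> \<phi> q = 0"
proof -
  obtain \<beta> C where b: "mC1 UNIV \<beta>" "\<And>q. 0 \<le> \<beta> q" "\<beta> p > 0" "compact C" "C \<subseteq> W" "\<And>q. q \<notin> C \<Longrightarrow> \<beta> q = 0"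
    by (rule exists_bump[OF assms]) (rule that, assumption+)
  obtain L where L: "L > 0" "\<And>q. q \<in> C \<Longrightarrow> grad_bound \<beta> q L"
    using grad_bound_compact[OF b(1) open_UNIV b(4)] by auto
  define \<phi> where "\<phi> q = inverse L * \<beta> q" for q
  have phi: "mC1 UNIV \<phi>" unfolding \<phi>_def by (intro mC1_mult mC1_const b(1) open_UNIV)
  have gb: "grad_bound \<phi> q 1" for q
  proof -
    obtain c where c: "c \<in> A" "q \<in> fst c" using chart_exists by blast
    have cq: "snd c q \<in> codom c" using c by blast
    have d: "der c \<phi> q v = inverse L * der c \<beta> q v" for v
      unfolding \<phi>_def using der_mult[OF mC1_const[OF open_UNIV] b(1) UNIV_I c, of "inverse L" v] der_const[OF c(1)] by simp
    have "\<bar>der c \<beta> q v\<bar> \<le> L * gnorm c (snd c q) v" for v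
    proof (cases "q \<in> C")
      case True
      show ?thesis by (rule grad_boundD[OF L(2)[OF True] c])
    next
      case False
      have "der c \<beta> q v = 0"
        by (rule der_eq_0_open[of "- C"]) (use False b(4,6) c in \<open>auto simp: compact_imp_closed\<close>)
      then show ?thesis using L gnorm_nonneg[OF c(1) cq] by simp
    qed
    then have "\<bar>der c \<phi> q v\<bar> \<le> 1 * gnorm c (snd c q) v" for v
      using L(1) by (simp add: d abs_mult field_simps)
    then show ?thesis by (rule grad_boundI[OF phi open_UNIV UNIV_I c])
  qed
  have "\<phi> p > 0" using b(3) L(1) by (simp add: \<phi>_def)
  moreover have "\<phi> q = 0" if "q \<notin> W" for q
  proof -
    have "q \<notin> C" using b(5) that by blast
    then show ?thesis by (simp add: \<phi>_def b(6))
  qed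
  ultimately show ?thesis by (rule that[OF phi gb])
qed

lemma riemannian_dist_ge:
  assumes "mC1 UNIV \<phi>" "\<And>q. grad_bound \<phi> q 1"
  shows "ennreal \<bar>\<phi> p - \<phi> q\<bar> \<le> riemannian_dist A g p q"
  unfolding riemannian_dist_def
proof (rule INF_greatest)
  fix \<gamma> assume "\<gamma> \<in> {\<gamma>. piecewise_C1_path A \<gamma> \<and> pathstart \<gamma> = p \<and> pathfinish \<gamma> = q}"
  then have "piecewise_C1_path A \<gamma>" and ends: "\<gamma> 0 = p" "\<gamma> 1 = q"
    by (simp_all add: pathstart_def pathfinish_def)
  then obtain S where S: "path_except \<gamma> S" by (auto simp only: piecewise_C1_path_except)
  have "ennreal \<bar>\<phi> (\<gamma> 1) - \<phi> (\<gamma> 0)\<bar> \<le> ennreal 1 * path_length A g \<gamma>"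
    by (rule path_length_ge[OF S assms(1) zero_less_one assms(2)])
  then show "ennreal \<bar>\<phi> p - \<phi> q\<bar> \<le> path_length A g \<gamma>"
    by (simp add: ends abs_minus_commute)
qed

section \<open>Chains of chart segments\<close>

lemma gnorm_equiv:
  assumes "c \<in> A" "x \<in> codom c"
  shows "\<exists>\<kappa>>0. \<forall>v. norm v \<le> \<kappa> * gnorm c x v \<and> gnorm c x v \<le> \<kappa> * norm v"
proof -
  let ?G = "g c x"
  have spd: "spd ?G" by (rule metric_spd[OF assms])
  obtain e where e: "orthonormal ?G e" using spd_exists_orthonormal[OF spd] by auto
  \<comment> \<open>One constant for both comparisons: the norms of the basis vectors bound the
    expansion of \<open>v\<close>, the matrix entries bound the quadratic form, and the summand 1
    makes \<open>\<kappa>\<close> at most its square.\<close>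
  define \<kappa> where "\<kappa> = 1 + (\<Sum>i\<in>UNIV. norm (e i)) + (\<Sum>i\<in>UNIV. \<Sum>j\<in>UNIV. \<bar>?G $ i $ j\<bar>)"
  have s: "0 \<le> (\<Sum>i\<in>UNIV. norm (e i))" "0 \<le> (\<Sum>i\<in>UNIV. \<Sum>j\<in>UNIV. \<bar>?G $ i $ j\<bar>)"
    by (simp_all add: sum_nonneg)
  then have k: "\<kappa> \<ge> 1" unfolding \<kappa>_def by linarith
  have gn: "0 \<le> gnorm c x v" for v by (rule gnorm_nonneg[OF assms])
  have n1: "norm v \<le> \<kappa> * gnorm c x v" for v
  proof -
    have a: "\<bar>ip ?G v (e i)\<bar> \<le> gnorm c x v" for i
    proof (rule power2_le_imp_le)
      show "\<bar>ip ?G v (e i)\<bar>\<^sup>2 \<le> (gnorm c x v)\<^sup>2"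
        using spd_Cauchy_Schwarz[OF spd, of v "e i"] e spd_nonneg[OF spd, of v] by (simp add: orthonormal_def gnorm_def)
    qed (rule gn)
    have "norm v = norm (\<Sum>i\<in>UNIV. ip ?G v (e i) *\<^sub>R e i)" using orthonormal_expansion[OF e spd, of v] by simp
    also have "\<dots> \<le> (\<Sum>i\<in>UNIV. gnorm c x v * norm (e i))"
      by (rule sum_norm_le) (simp add: mult_right_mono a)
    also have "\<dots> = (\<Sum>i\<in>UNIV. norm (e i)) * gnorm c x v" by (simp add: sum_distrib_left mult.commute)
    also have "\<dots> \<le> \<kappa> * gnorm c x v" by (rule mult_right_mono[OF _ gn]) (use s in \<open>simp add: \<kappa>_def\<close>)
    finally show ?thesis .
  qed
  have n2: "gnorm c x v \<le> \<kappa> * norm v" for v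
  proof -
    have "ip ?G v v \<le> (\<Sum>i\<in>UNIV. \<Sum>j\<in>UNIV. \<bar>?G $ i $ j\<bar>) * (norm v)\<^sup>2"
      using ip_le_norm[of ?G v] by linarith
    also have "\<dots> \<le> \<kappa> * (norm v)\<^sup>2" by (rule mult_right_mono) (use s in \<open>simp_all add: \<kappa>_def\<close>)
    also have "\<dots> \<le> \<kappa> * \<kappa> * (norm v)\<^sup>2" using k by (intro mult_right_mono) simp_all
    finally have "ip ?G v v \<le> (\<kappa> * norm v)\<^sup>2" by (simp add: power2_eq_square mult_ac)
    then show ?thesis unfolding gnorm_def using k by (intro real_le_lsqrt) simp_all
  qed
  have "\<kappa> > 0" using k by linarith
  then show ?thesis by (intro exI[of _ \<kappa>] conjI allI n1 n2)
qed

text \<open>On a good ball lengths can be measured, up to the factor 2, with the single norm at the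
  centre.\<close>

definition good :: "('p, 'm) chart \<Rightarrow> real ^ 'm \<Rightarrow> real \<Rightarrow> bool" where
  "good c x0 \<rho> \<longleftrightarrow> c \<in> A \<and> 0 < \<rho> \<and> ball x0 \<rho> \<subseteq> codom c \<and>
     (\<forall>z\<in>ball x0 \<rho>. \<forall>v. gnorm c z v \<le> 2 * gnorm c x0 v \<and> gnorm c x0 v \<le> 2 * gnorm c z v)"

lemma good_center: "good c x0 \<rho> \<Longrightarrow> x0 \<in> codom c"
  unfolding good_def using centre_in_ball by blast

lemma good_smaller: "good c x0 \<rho> \<Longrightarrow> 0 < r \<Longrightarrow> r \<le> \<rho> \<Longrightarrow> good c x0 r"
  unfolding good_def using subset_ball[of r \<rho> x0] by blast

lemma exists_good:
  assumes c: "c \<in> A" and x0: "x0 \<in> codom c"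
  shows "\<exists>\<rho>. good c x0 \<rho>"
proof -
  obtain \<kappa> where k: "\<kappa> > 0" "\<And>v. norm v \<le> \<kappa> * gnorm c x0 v" using gnorm_equiv[OF assms] by blast
  define \<Delta> where "\<Delta> z = (\<Sum>i\<in>UNIV. \<Sum>j\<in>UNIV. \<bar>(g c z - g c x0) $ i $ j\<bar>)" for z
  have "continuous_on (codom c) (g c)"
    by (rule Ck_on_continuous[OF smooth_onD[OF metric_smooth[OF c], of 0]])
  then have "continuous_on (codom c) \<Delta>"
    unfolding \<Delta>_def by (intro continuous_intros)
  then have "isCont \<Delta> x0" using open_codom[OF c] x0 continuous_on_eq_continuous_at by blast
  moreover have "\<Delta> x0 = 0" by (simp add: \<Delta>_def)
  \<comment> \<open>Combined with \<open>norm v \<le> \<kappa> * gnorm c x0 v\<close>, this bound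
    changes the quadratic form by at most half of its value at the centre, within the factor 4 that
    the factor 2 for norms allows.\<close>
  moreover have "1 / (2 * \<kappa>\<^sup>2) > 0" using k(1) by simp
  ultimately obtain e where e: "e > 0" "\<And>z. dist z x0 < e \<Longrightarrow> \<bar>\<Delta> z\<bar> < 1 / (2 * \<kappa>\<^sup>2)"
    unfolding continuous_at_eps_delta by (metis dist_real_def diff_zero)
  obtain r where r: "r > 0" "ball x0 r \<subseteq> codom c" using open_codom[OF c] x0 openE by blast
  define \<rho> where "\<rho> = min e r"
  have "gnorm c z v \<le> 2 * gnorm c x0 v \<and> gnorm c x0 v \<le> 2 * gnorm c z v" if z: "z \<in> ball x0 \<rho>" for z v
  proof -
    have zc: "z \<in> codom c" using z r by (auto simp: \<rho>_def)
    have "\<bar>\<Delta> z\<bar> < 1 / (2 * \<kappa>\<^sup>2)" by (rule e(2)) (use z in \<open>simp add: \<rho>_def dist_commute\<close>)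
    then have Dz: "\<Delta> z < 1 / (2 * \<kappa>\<^sup>2)" by linarith
    have a0: "0 \<le> ip (g c x0) v v" "0 \<le> ip (g c z) v v"
      using spd_nonneg[OF metric_spd[OF c]] x0 zc by auto
    have "(norm v)\<^sup>2 \<le> (\<kappa> * gnorm c x0 v)\<^sup>2" using k(2)[of v] by (intro power_mono) auto
    also have "\<dots> = \<kappa>\<^sup>2 * ip (g c x0) v v" using a0 by (simp add: power_mult_distrib gnorm_def)
    finally have nv: "(norm v)\<^sup>2 \<le> \<kappa>\<^sup>2 * ip (g c x0) v v" .
    have "ip (g c z) v v - ip (g c x0) v v = ip (g c z - g c x0) v v"
      using ip_matrix_add[of "g c z - g c x0" "g c x0" v v] by simp
    then have "\<bar>ip (g c z) v v - ip (g c x0) v v\<bar> \<le> \<Delta> z * (norm v)\<^sup>2"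
      using ip_le_norm[of "g c z - g c x0" v] by (simp add: \<Delta>_def)
    also have "\<dots> \<le> 1 / (2 * \<kappa>\<^sup>2) * (\<kappa>\<^sup>2 * ip (g c x0) v v)"
      by (intro mult_mono nv less_imp_le[OF Dz]) (use k(1) in simp_all)
    also have "\<dots> = ip (g c x0) v v / 2" using k(1) by simp
    finally have "ip (g c z) v v \<le> 4 * ip (g c x0) v v" "ip (g c x0) v v \<le> 4 * ip (g c z) v v"
      using a0 by linarith+
    then have "sqrt (ip (g c z) v v) \<le> sqrt (4 * ip (g c x0) v v)" "sqrt (ip (g c x0) v v) \<le> sqrt (4 * ip (g c z) v v)"
      by simp_all
    then show ?thesis by (simp add: gnorm_def real_sqrt_mult)
  qed
  then have "good c x0 \<rho>" unfolding good_def using c e r by (auto simp: \<rho>_def)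
  then show ?thesis by blast
qed

lemma gnorm_minus: "gnorm c x (v - w) = gnorm c x (w - v)"
proof -
  have "ip (g c x) (v - w) (v - w) = ip (g c x) (- (w - v)) (- (w - v))" by simp
  then show ?thesis unfolding gnorm_def by (simp only: ip_minus_left ip_minus_right minus_minus)
qed

lemma gnorm_scaleR: "gnorm c x (t *\<^sub>R v) = \<bar>t\<bar> * gnorm c x v"
  by (simp add: gnorm_def ip_scaleR_left ip_scaleR_right real_sqrt_mult flip: mult.assoc)

text \<open>The factor \<open>2\<close> is the distortion of the metric over a good ball: \<open>l\<close> bounds the length of the
  chart segment from \<open>p\<close> to \<open>q\<close>. Chains of such links replace paths, so that no path has to be
  subdivided or shortened.\<close>

definition link :: "'p \<Rightarrow> 'p \<Rightarrow> real \<Rightarrow> bool" where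
  "link p q l \<longleftrightarrow> (\<exists>c x0 \<rho>. good c x0 \<rho> \<and> p \<in> fst c \<and> q \<in> fst c \<and> snd c p \<in> ball x0 \<rho> \<and> snd c q \<in> ball x0 \<rho> \<and>
     l = 2 * gnorm c x0 (snd c q - snd c p))"

inductive reach :: "'p \<Rightarrow> real \<Rightarrow> 'p \<Rightarrow> bool" where
  reach_refl: "reach p 0 p"
| reach_step: "reach p L q \<Longrightarrow> link q r l \<Longrightarrow> reach p (L + l) r"

lemma linkI:
  "good c x0 \<rho> \<Longrightarrow> p \<in> fst c \<Longrightarrow> q \<in> fst c \<Longrightarrow> snd c p \<in> ball x0 \<rho> \<Longrightarrow> snd c q \<in> ball x0 \<rho> \<Longrightarrow>
    link p q (2 * gnorm c x0 (snd c q - snd c p))"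
  unfolding link_def by blast

lemma linkE:
  assumes "link p q l"
  obtains c x0 \<rho> where "c \<in> A" "good c x0 \<rho>" "p \<in> fst c" "q \<in> fst c" "snd c p \<in> ball x0 \<rho>" "snd c q \<in> ball x0 \<rho>"
    "l = 2 * gnorm c x0 (snd c q - snd c p)"
proof -
  obtain c x0 \<rho> where *: "good c x0 \<rho>" "p \<in> fst c" "q \<in> fst c" "snd c p \<in> ball x0 \<rho>" "snd c q \<in> ball x0 \<rho>"
    "l = 2 * gnorm c x0 (snd c q - snd c p)" using assms unfolding link_def by blast
  have "c \<in> A" using *(1) by (simp add: good_def)
  then show ?thesis using * by (rule that)
qed

lemma link_nonneg: "link p q l \<Longrightarrow> 0 \<le> l"
  by (erule linkE) (simp add: gnorm_nonneg[OF _ good_center])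

lemma link_sym:
  assumes "link p q l"
  shows "link q p l"
proof -
  obtain c x0 \<rho> where *: "c \<in> A" "good c x0 \<rho>" "p \<in> fst c" "q \<in> fst c" "snd c p \<in> ball x0 \<rho>" "snd c q \<in> ball x0 \<rho>"
    "l = 2 * gnorm c x0 (snd c q - snd c p)" using assms by (rule linkE)
  show ?thesis using linkI[OF *(2,4,3,6,5)] *(7) gnorm_minus[of c x0 "snd c q"] by simp
qed

lemma link_reach: "link p q l \<Longrightarrow> reach p l q"
  using reach_step[OF reach_refl] by simp

lemma reach_nonneg: "reach p L q \<Longrightarrow> 0 \<le> L"
  by (induction rule: reach.induct) (auto dest: link_nonneg)

lemma reach_trans: "reach q L' r \<Longrightarrow> reach p L q \<Longrightarrow> reach p (L + L') r"
proof (induction rule: reach.induct)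
  case (reach_step q L' r s l)
  then show ?case using reach.reach_step[of p "L + L'" r s l] by (simp add: add.assoc)
qed simp

lemma reach_sym: "reach p L q \<Longrightarrow> reach q L p"
proof (induction rule: reach.induct)
  case (reach_step p L q r l)
  then show ?case using reach_trans[OF reach_step.IH link_reach[OF link_sym[OF reach_step.hyps(2)]]]
    by (simp add: add.commute)
qed (rule reach_refl)

text \<open>A norm is homogeneous along a segment, so cutting at the fraction \<open>s / l\<close>
  splits the length exactly.\<close>

lemma link_split:
  assumes "link q r l" "0 \<le> s" "s \<le> l"
  shows "\<exists>z. link q z s \<and> link z r (l - s)"
proof -
  obtain c x0 \<rho> where c: "c \<in> A" and L: "good c x0 \<rho>" "q \<in> fst c" "r \<in> fst c" "snd c q \<in> ball x0 \<rho>" "snd c r \<in> ball x0 \<rho>"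
    "l = 2 * gnorm c x0 (snd c r - snd c q)" using assms(1) by (rule linkE)
  \<comment> \<open>If \<open>l = 0\<close> then also \<open>s = 0\<close>, and division by zero
    gives \<open>\<tau> = 0\<close>; hence \<open>\<tau> * l = s\<close> in every case.\<close>
  define \<tau> where "\<tau> = s / l"
  have t: "0 \<le> \<tau>" "\<tau> \<le> 1" "\<tau> * l = s"
    using assms(2,3) by (auto simp: \<tau>_def divide_le_eq_1)
  have t': "(1 - \<tau>) * l = l - s" using t(3) by (simp add: left_diff_distrib)
  define y where "y = snd c q + \<tau> *\<^sub>R (snd c r - snd c q)"
  have "y = (1 - \<tau>) *\<^sub>R snd c q + \<tau> *\<^sub>R snd c r" by (simp add: y_def algebra_simps)
  then have yb: "y \<in> ball x0 \<rho>"
    using convexD[OF convex_ball L(4,5), of "1 - \<tau>" \<tau>] t by simp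
  then have yc: "y \<in> codom c" using L(1) by (auto simp: good_def)
  let ?z = "chart_inv c y"
  have z: "?z \<in> fst c" "snd c ?z = y" using chart_inv_in[OF c yc] chart_inv_right[OF c yc] by auto
  have 1: "2 * gnorm c x0 (y - snd c q) = s"
    using t by (simp add: y_def gnorm_scaleR L(6) mult_ac)
  have "snd c r - y = (1 - \<tau>) *\<^sub>R (snd c r - snd c q)" by (simp add: y_def algebra_simps)
  then have 2: "2 * gnorm c x0 (snd c r - y) = l - s"
    using t t' by (simp add: gnorm_scaleR L(6) mult_ac)
  have "link q ?z s" using linkI[OF L(1,2) z(1) L(4)] yb z(2) 1 by simp
  moreover have "link ?z r (l - s)" using linkI[OF L(1) z(1) L(3) _ L(5)] yb z(2) 2 by simp
  ultimately show ?thesis by blast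
qed

text \<open>The cut falls either into the earlier part of the chain or into its last link, which
  \<open>link_split\<close> divides. This supplies the intermediate points for the Hopf-Rinow
  theorem.\<close>

lemma reach_split:
  "reach p L q \<Longrightarrow> 0 \<le> R \<Longrightarrow> R \<le> L \<Longrightarrow> \<exists>z. reach p R z \<and> reach z (L - R) q"
proof (induction rule: reach.induct)
  case (reach_refl p)
  then show ?case using reach.reach_refl[of p] by (intro exI[of _ p]) simp
next
  case (reach_step p L q r l)
  show ?case
  proof (cases "R \<le> L")
    case True
    then obtain z where z: "reach p R z" "reach z (L - R) q" using reach_step by blast
    have "reach z (L - R + l) r" by (rule reach.reach_step[OF z(2) reach_step.hyps(2)])
    then have "reach z (L + l - R) r" by (simp add: algebra_simps)
    then show ?thesis using z by blast
  next
    case False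
    then obtain z where z: "link q z (R - L)" "link z r (l - (R - L))"
      using link_split[OF reach_step.hyps(2), of "R - L"] reach_step.prems by auto
    have "reach p (L + (R - L)) z" by (rule reach.reach_step[OF reach_step.hyps(1) z(1)])
    then have "reach p R z" by simp
    moreover have "reach z (L + l - R) r" using link_reach[OF z(2)] by (simp add: algebra_simps)
    ultimately show ?thesis by blast
  qed
qed

lemma link_path:
  assumes "link p q l"
  shows "\<exists>\<gamma> S. path_except \<gamma> S \<and> pathstart \<gamma> = p \<and> pathfinish \<gamma> = q \<and> path_length A g \<gamma> \<le> ennreal l"
proof -
  obtain c x0 \<rho> where c: "c \<in> A" and L: "good c x0 \<rho>" "p \<in> fst c" "q \<in> fst c" "snd c p \<in> ball x0 \<rho>" "snd c q \<in> ball x0 \<rho>"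
    "l = 2 * gnorm c x0 (snd c q - snd c p)" using assms(1) by (rule linkE)
  \<comment> \<open>A ball is convex, so the segment stays where the norm at the centre controls the
    metric up to the factor 2 built into \<open>l\<close>.\<close>
  have seg: "closed_segment (snd c p) (snd c q) \<subseteq> ball x0 \<rho>"
    using L(4,5) by (simp add: closed_segment_subset)
  then have segc: "closed_segment (snd c p) (snd c q) \<subseteq> codom c" using L(1) unfolding good_def by blast
  let ?\<gamma> = "\<lambda>t. chart_inv c (snd c p + t *\<^sub>R (snd c q - snd c p))"
  have "gnorm c z (snd c q - snd c p) \<le> l" if "z \<in> closed_segment (snd c p) (snd c q)" for z
    using L(1,6) seg that unfolding good_def by blast
  from path_except_segment[OF c segc this]
  have "path_except ?\<gamma> {}" "path_length A g ?\<gamma> \<le> ennreal l" by auto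
  moreover have "pathstart ?\<gamma> = p" "pathfinish ?\<gamma> = q"
    using L(2,3) by (simp_all add: pathstart_def pathfinish_def chart_inv_left[OF c])
  ultimately show ?thesis by blast
qed

lemma reach_path:
  "reach p L q \<Longrightarrow> \<exists>\<gamma> S. path_except \<gamma> S \<and> pathstart \<gamma> = p \<and> pathfinish \<gamma> = q \<and> path_length A g \<gamma> \<le> ennreal L"
proof (induction rule: reach.induct)
  case (reach_refl p)
  \<comment> \<open>The trivial chain is realized by a degenerate link of length 0 from
    \<open>p\<close> to itself.\<close>
  obtain c where c: "c \<in> A" "p \<in> fst c" using chart_exists by blast
  obtain \<rho> where "good c (snd c p) \<rho>" using exists_good[OF c(1), of "snd c p"] c(2) by blast
  then have "snd c p \<in> ball (snd c p) \<rho>" by (simp add: good_def)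
  from link_path[OF linkI[OF \<open>good c _ \<rho>\<close> c(2) c(2) this this]]
  show ?case by (simp add: gnorm_def ip_zero_left)
next
  case (reach_step p L q r l)
  obtain \<gamma> S where 1: "path_except \<gamma> S" "pathstart \<gamma> = p" "pathfinish \<gamma> = q" "path_length A g \<gamma> \<le> ennreal L"
    using reach_step.IH by blast
  obtain \<delta> R where 2: "path_except \<delta> R" "pathstart \<delta> = q" "pathfinish \<delta> = r" "path_length A g \<delta> \<le> ennreal l"
    using link_path[OF reach_step.hyps(2)] by blast
  have e: "pathfinish \<gamma> = pathstart \<delta>" using 1 2 by simp
  have "path_length A g (\<gamma> +++ \<delta>) \<le> ennreal L + ennreal l"
    unfolding path_except_join(2)[OF 1(1) 2(1) e] by (rule add_mono[OF 1(4) 2(4)])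
  also have "\<dots> = ennreal (L + l)"
    using reach_nonneg[OF reach_step.hyps(1)] link_nonneg[OF reach_step.hyps(2)] by simp
  finally have "path_length A g (\<gamma> +++ \<delta>) \<le> ennreal (L + l)" .
  moreover have "pathstart (\<gamma> +++ \<delta>) = p" "pathfinish (\<gamma> +++ \<delta>) = r" using 1 2 by simp_all
  ultimately show ?case using path_except_join(1)[OF 1(1) 2(1) e] by blast
qed

lemma riemannian_dist_le_reach:
  assumes "reach p L q"
  shows "riemannian_dist A g p q \<le> ennreal L"
proof -
  obtain \<gamma> S where 1: "path_except \<gamma> S" "pathstart \<gamma> = p" "pathfinish \<gamma> = q" "path_length A g \<gamma> \<le> ennreal L"
    using reach_path[OF assms] by blast
  then have "\<gamma> \<in> {\<gamma>. piecewise_C1_path A \<gamma> \<and> pathstart \<gamma> = p \<and> pathfinish \<gamma> = q}"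
    by (auto simp only: piecewise_C1_path_except mem_Collect_eq)
  then show ?thesis unfolding riemannian_dist_def using 1(4) by (rule INF_lower2[of \<gamma> _ "path_length A g"])
qed

lemma exists_link_nhd:
  fixes p :: 'p
  obtains c \<rho> W where "good c (snd c p) \<rho>" "p \<in> fst c" "open W" "p \<in> W"
    "W = chart_inv c ` ball (snd c p) \<rho>" "W \<subseteq> fst c"
proof -
  obtain c where c: "c \<in> A" "p \<in> fst c" using chart_exists by blast
  obtain \<rho> where G: "good c (snd c p) \<rho>" using exists_good[OF c(1), of "snd c p"] c(2) by blast
  have sub: "ball (snd c p) \<rho> \<subseteq> codom c" "\<rho> > 0" using G by (auto simp: good_def)
  define W where "W = chart_inv c ` ball (snd c p) \<rho>"
  have "open W" unfolding W_def by (rule open_chart_inv_image[OF c(1) sub(1)]) simp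
  moreover have "p \<in> W" unfolding W_def
    by (rule image_eqI[of _ _ "snd c p"]) (use sub chart_inv_left[OF c] in auto)
  moreover have "W \<subseteq> fst c" unfolding W_def using chart_inv_in[OF c(1)] sub by blast
  ultimately show ?thesis using that G c(2) W_def by blast
qed

lemma good_nhd_coord:
  assumes "good c x0 \<rho>" "q \<in> chart_inv c ` ball x0 \<rho>"
  shows "q \<in> fst c" "snd c q \<in> ball x0 \<rho>"
proof -
  have c: "c \<in> A" and sub: "ball x0 \<rho> \<subseteq> codom c" using assms(1) by (auto simp: good_def)
  obtain y where y: "y \<in> ball x0 \<rho>" "q = chart_inv c y" using assms(2) by blast
  then have "y \<in> codom c" using sub by blast
  then show "q \<in> fst c" "snd c q \<in> ball x0 \<rho>" using chart_inv_in[OF c] chart_inv_right[OF c] y by auto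
qed

text \<open>Every point is linked to a whole neighbourhood, so the set reachable from
  \<open>p\<close> is open, and by symmetry of links its complement is open too.\<close>

lemma reach_connected: "\<exists>L. reach p L q"
proof -
  have nhd: "\<exists>W. open W \<and> q \<in> W \<and> (\<forall>r\<in>W. \<exists>l. link q r l)" for q
  proof -
    obtain c \<rho> W where W: "good c (snd c q) \<rho>" "q \<in> fst c" "open W" "q \<in> W"
      "W = chart_inv c ` ball (snd c q) \<rho>" "W \<subseteq> fst c" by (rule exists_link_nhd) (rule that, assumption+)
    have "\<exists>l. link q r l" if rW: "r \<in> W" for r
    proof -
      have r: "r \<in> fst c" "snd c r \<in> ball (snd c q) \<rho>"
        using good_nhd_coord[OF W(1)] rW W(5) by simp_all
      have "snd c q \<in> ball (snd c q) \<rho>" using W(1) by (simp add: good_def)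
      from linkI[OF W(1,2) r(1) this r(2)] show ?thesis by blast
    qed
    then show ?thesis using W by blast
  qed
  define Q where "Q = {q. \<exists>L. reach p L q}"
  have "open Q"
  proof (rule open_subopen[THEN iffD2], rule ballI)
    fix q assume "q \<in> Q"
    then obtain L where L: "reach p L q" by (auto simp: Q_def)
    obtain W where W: "open W" "q \<in> W" "\<And>r. r \<in> W \<Longrightarrow> \<exists>l. link q r l" using nhd[of q] by metis
    have "W \<subseteq> Q"
    proof
      fix r assume "r \<in> W"
      then obtain l where "link q r l" using W(3) by blast
      from reach_step[OF L this] show "r \<in> Q" unfolding Q_def by blast
    qed
    then show "\<exists>W. open W \<and> q \<in> W \<and> W \<subseteq> Q" using W by blast
  qed
  moreover have "open (- Q)"
  proof (rule open_subopen[THEN iffD2], rule ballI)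
    fix q assume q: "q \<in> - Q"
    obtain W where W: "open W" "q \<in> W" "\<And>r. r \<in> W \<Longrightarrow> \<exists>l. link q r l" using nhd[of q] by metis
    have "r \<notin> Q" if rW: "r \<in> W" for r
    proof
      assume "r \<in> Q"
      then obtain L where L: "reach p L r" by (auto simp: Q_def)
      obtain l where "link q r l" using W(3)[OF rW] by blast
      from reach_step[OF L link_sym[OF this]] have "q \<in> Q" unfolding Q_def by blast
      then show False using q by simp
    qed
    then show "\<exists>W. open W \<and> q \<in> W \<and> W \<subseteq> - Q" using W by blast
  qed
  moreover have "p \<in> Q" using reach_refl by (auto simp: Q_def)
  moreover have "connected (UNIV :: 'p set)" using manifold by (simp add: smooth_manifold_def)
  ultimately have "Q = UNIV" using connectedD[of UNIV Q "- Q"] by blast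
  then show ?thesis by (auto simp: Q_def)
qed

end

section \<open>The Hopf-Rinow theorem\<close>

text \<open>\<open>len\<close> is the intermediate point property of length spaces, with an error
  \<open>\<eta>\<close>. If some ball is not compact, let \<open>s\<close> be the supremum of the
  radii of compact balls about \<open>x\<close>. The ball of radius \<open>s\<close> is totally
  bounded, hence compact by completeness, and local compactness enlarges it, against the choice of
  \<open>s\<close>.\<close>

lemma (in Metric_space) hopf_rinow:
  assumes complete: mcomplete
    and loc: "\<And>x. x \<in> M \<Longrightarrow> \<exists>r>0. compactin mtopology (mcball x r)"
    and len: "\<And>x y R \<eta>. x \<in> M \<Longrightarrow> y \<in> M \<Longrightarrow> 0 \<le> R \<Longrightarrow> 0 < \<eta> \<Longrightarrow> d x y < R + \<eta> \<Longrightarrow> \<exists>z\<in>M. d x z \<le> R \<and> d z y < \<eta>"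
    and x: "x \<in> M"
  shows "compactin mtopology (mcball x R)"
proof (rule ccontr)
  assume not: "\<not> compactin mtopology (mcball x R)"
  define T where "T = {r. 0 \<le> r \<and> compactin mtopology (mcball x r)}"
  have down: "compactin mtopology (mcball x r)" if "compactin mtopology (mcball x r')" "r \<le> r'" for r r'
    by (rule closed_compactin[OF that(1) mcball_subset_concentric[OF that(2)] closedin_mcball])
  have bound: "r \<le> R" if "r \<in> T" for r
  proof (rule ccontr)
    assume "\<not> r \<le> R"
    then show False using down[of r R] that not by (simp add: T_def)
  qed
  then have bdd: "bdd_above T" by (auto simp: bdd_above_def)
  obtain r0 where "r0 > 0" "compactin mtopology (mcball x r0)" using loc[OF x] by blast
  then have r0: "r0 > 0" "r0 \<in> T" by (simp_all add: T_def)
  define s where "s = Sup T"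
  have s0: "s > 0" unfolding s_def using cSup_upper[OF r0(2) bdd] r0(1) by linarith
  have below: "compactin mtopology (mcball x r)" if rs: "r < s" for r
  proof -
    have T: "T \<noteq> {}" using r0(2) by blast
    have "\<exists>r'\<in>T. r < r'" by (rule less_cSupD[OF T rs[unfolded s_def]])
    then obtain r' where r': "r' \<in> T" "r < r'" by blast
    have "compactin mtopology (mcball x r')" using r'(1) by (simp add: T_def)
    then show ?thesis by (rule down) (use r'(2) in simp)
  qed
  \<comment> \<open>Points at distance at most \<open>s\<close> lie within \<open>e / 2\<close> of a
    compact ball of slightly smaller radius, whose finite \<open>e / 2\<close>-net is then an
    \<open>e\<close>-net.\<close>
  have "mtotally_bounded (mcball x s)"
    unfolding mtotally_bounded_def
  proof (intro allI impI)
    fix e :: real assume e: "e > 0"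
    define r where "r = max 0 (s - e / 4)"
    have r: "0 \<le> r" "r < s" "s < r + e / 2" using e s0 by (auto simp: r_def)
    have "\<exists>K. finite K \<and> K \<subseteq> mcball x r \<and> mcball x r \<subseteq> (\<Union>k\<in>K. mball k (e / 2))"
      by (rule compactin_imp_mtotally_bounded[OF below[OF r(2)], unfolded mtotally_bounded_def, rule_format])
        (use e in simp)
    then obtain K where K: "finite K" "K \<subseteq> mcball x r" "mcball x r \<subseteq> (\<Union>k\<in>K. mball k (e / 2))"
      by blast
    have "mcball x s \<subseteq> (\<Union>k\<in>K. mball k e)"
    proof
      fix y assume y: "y \<in> mcball x s"
      then have "y \<in> M" "d x y < r + e / 2" using r by auto
      then obtain z where z: "z \<in> M" "d x z \<le> r" "d z y < e / 2" using len[OF x _ r(1), of y "e / 2"] e by auto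
      then have "z \<in> mcball x r" using x by simp
      then obtain k where k: "k \<in> K" "k \<in> M" "d k z < e / 2" using K(3) by auto
      have "d k y < e" using triangle[OF k(2) z(1) \<open>y \<in> M\<close>] k z by linarith
      then show "y \<in> (\<Union>k\<in>K. mball k e)" using k \<open>y \<in> M\<close> by auto
    qed
    moreover have "K \<subseteq> mcball x s" using K(2) mcball_subset_concentric[of r s x] r by auto
    ultimately show "\<exists>K. finite K \<and> K \<subseteq> mcball x s \<and> mcball x s \<subseteq> (\<Union>k\<in>K. mball k e)" using K(1) by blast
  qed
  then have "compactin mtopology (mtopology closure_of mcball x s)"
    using mtotally_bounded_eq_compact_closure_of[OF complete] by blast
  then have comp: "compactin mtopology (mcball x s)" by (simp add: closure_of_closedin)
  have "\<exists>r. \<forall>k\<in>M. 0 < r k \<and> compactin mtopology (mcball k (r k))"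
    by (rule bchoice) (use loc in blast)
  then obtain r where r: "\<And>k. k \<in> M \<Longrightarrow> 0 < r k" "\<And>k. k \<in> M \<Longrightarrow> compactin mtopology (mcball k (r k))" by blast
  \<comment> \<open>Half radii leave room: a point within \<open>\<delta>\<close> of the ball, with
    \<open>\<delta>\<close> at most every selected \<open>r k / 2\<close>, still lies in one of the
    finitely many compact balls of radius \<open>r k\<close>.\<close>
  let ?U = "(\<lambda>k. mball k (r k / 2)) ` mcball x s"
  have "\<forall>U\<in>?U. openin mtopology U" by auto
  moreover have "mcball x s \<subseteq> \<Union>?U" using r(1) by (force simp: centre_in_mball_iff)
  ultimately obtain \<F> where F: "finite \<F>" "\<F> \<subseteq> ?U" "mcball x s \<subseteq> \<Union>\<F>"
    using comp unfolding compactin_def by meson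
  then obtain K where K: "finite K" "K \<subseteq> mcball x s" "\<F> = (\<lambda>k. mball k (r k / 2)) ` K"
    by (meson finite_subset_image)
  have KM: "K \<subseteq> M" using K(2) by auto
  have "x \<in> mcball x s" using x s0 by simp
  then have "K \<noteq> {}" using F(3) K(3) by blast
  define \<delta> where "\<delta> = Min ((\<lambda>k. r k / 2) ` K)"
  have "\<forall>k\<in>K. 0 < r k / 2" using r(1) KM by auto
  then have \<delta>0: "\<delta> > 0" using K(1) \<open>K \<noteq> {}\<close> by (simp add: \<delta>_def)
  have "\<delta> \<le> r k / 2" if "k \<in> K" for k
    unfolding \<delta>_def by (rule Min_le) (use K(1) that in auto)
  then have \<delta>: "\<delta> > 0" "\<And>k. k \<in> K \<Longrightarrow> \<delta> \<le> r k / 2"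
    using \<delta>0 by blast+
  have "mcball x (s + \<delta> / 2) \<subseteq> (\<Union>k\<in>K. mcball k (r k))"
  proof
    fix y assume "y \<in> mcball x (s + \<delta> / 2)"
    then have y: "y \<in> M" "d x y < s + \<delta>" using \<delta>(1) by auto
    then obtain z where z: "z \<in> M" "d x z \<le> s" "d z y < \<delta>" using len[OF x y(1), of s \<delta>] s0 \<delta>(1) by auto
    then have "z \<in> mcball x s" using x by simp
    then obtain k where k: "k \<in> K" "k \<in> M" "d k z < r k / 2" using F(3) K(3) by auto
    have "d k y \<le> r k" using triangle[OF k(2) z(1) y(1)] k z \<delta>(2)[OF k(1)] by linarith
    then show "y \<in> (\<Union>k\<in>K. mcball k (r k))" using k y by auto
  qed
  moreover have "compactin mtopology (\<Union>k\<in>K. mcball k (r k))"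
    using K(1) KM r(2) by (intro compactin_Union) auto
  ultimately have "compactin mtopology (mcball x (s + \<delta> / 2))"
    using closed_compactin closedin_mcball by blast
  then have "s + \<delta> / 2 \<in> T" using s0 \<delta>(1) by (simp add: T_def)
  then show False using cSup_upper[OF _ bdd] \<delta>(1) unfolding s_def by fastforce
qed

section \<open>The chain distance, its topology and its compact balls\<close>

context riem
begin

text \<open>A real infimum, legitimate because \<open>reach_connected\<close> makes the set nonempty
  and lengths are nonnegative.\<close>

definition dst :: "'p \<Rightarrow> 'p \<Rightarrow> real" where
  "dst p q = Inf {L. reach p L q}"

lemma bdd_reach: "bdd_below {L. reach p L q}"
  by (rule bdd_belowI[of _ 0]) (simp add: reach_nonneg)

lemma dst_le: "reach p L q \<Longrightarrow> dst p q \<le> L"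
  unfolding dst_def by (rule cInf_lower[OF _ bdd_reach]) simp

lemma dst_less:
  assumes "dst p q < L"
  obtains L' where "reach p L' q" "L' < L"
proof -
  have "{L. reach p L q} \<noteq> {}" using reach_connected[of p q] by simp
  then show ?thesis using assms cInf_lessD[of "{L. reach p L q}" L] that unfolding dst_def by auto
qed

lemma dst_nonneg: "0 \<le> dst p q"
proof -
  have "{L. reach p L q} \<noteq> {}" using reach_connected[of p q] by simp
  then show ?thesis unfolding dst_def by (rule cInf_greatest) (simp add: reach_nonneg)
qed

lemma dst_self: "dst p p = 0"
  using dst_le[OF reach_refl, of p] dst_nonneg[of p p] by linarith

lemma dst_sym: "dst p q = dst q p"
proof -
  have "{L. reach p L q} = {L. reach q L p}" using reach_sym by blast
  then show ?thesis by (simp add: dst_def)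
qed

lemma dst_triangle: "dst p r \<le> dst p q + dst q r"
proof (rule field_le_epsilon)
  fix e :: real assume e: "0 < e"
  have 1: "dst p q < dst p q + e / 2" "dst q r < dst q r + e / 2" using e by auto
  obtain L where L: "reach p L q" "L < dst p q + e / 2" using 1(1) by (rule dst_less)
  obtain L' where L': "reach q L' r" "L' < dst q r + e / 2" using 1(2) by (rule dst_less)
  have "dst p r \<le> L + L'" by (rule dst_le[OF reach_trans[OF L'(1) L(1)]])
  then show "dst p r \<le> dst p q + dst q r + e" using L(2) L'(2) by simp
qed

lemma riemannian_dist_le_dst:
  assumes "dst p q < L"
  shows "riemannian_dist A g p q < ennreal L"
proof -
  obtain L' where "reach p L' q" "L' < L" using assms by (rule dst_less)
  then have "riemannian_dist A g p q \<le> ennreal L'" using riemannian_dist_le_reach by blast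
  also have "\<dots> < ennreal L" using \<open>L' < L\<close> reach_nonneg[OF \<open>reach p L' q\<close>] by (simp add: ennreal_lessI)
  finally show ?thesis .
qed

lemma dst_ge:
  assumes "mC1 UNIV \<phi>" "\<And>q. grad_bound \<phi> q 1"
  shows "\<bar>\<phi> p - \<phi> q\<bar> \<le> dst p q"
proof (rule field_le_epsilon)
  fix e :: real assume e: "0 < e"
  have "ennreal \<bar>\<phi> p - \<phi> q\<bar> \<le> riemannian_dist A g p q" by (rule riemannian_dist_ge[OF assms])
  also have "\<dots> < ennreal (dst p q + e)" by (rule riemannian_dist_le_dst) (use e in simp)
  finally have "\<bar>\<phi> p - \<phi> q\<bar> < dst p q + e" by (simp only: ennreal_less_iff[OF abs_ge_zero])
  then show "\<bar>\<phi> p - \<phi> q\<bar> \<le> dst p q + e" by simp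
qed

lemma dst_local:
  assumes "good c x0 \<rho>" "p \<in> fst c" "q \<in> fst c" "snd c p \<in> ball x0 \<rho>" "snd c q \<in> ball x0 \<rho>"
  shows "dst p q \<le> 2 * gnorm c x0 (snd c q - snd c p)"
  by (rule dst_le[OF link_reach[OF linkI[OF assms]]])

text \<open>The radius is the value at \<open>p\<close> of a Lipschitz bump that vanishes off
  \<open>W\<close>.\<close>

lemma open_contains_dst_ball:
  assumes "open W" "p \<in> W"
  shows "\<exists>e>0. \<forall>q. dst p q < e \<longrightarrow> q \<in> W"
proof -
  obtain \<phi> where phi: "mC1 UNIV \<phi>" "\<And>q. grad_bound \<phi> q 1" "\<phi> p > 0" "\<And>q. q \<notin> W \<Longrightarrow> \<phi> q = 0"
    by (rule exists_bump_Lipschitz[OF assms]) (rule that, assumption+)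
  have "q \<in> W" if "dst p q < \<phi> p" for q
  proof (rule ccontr)
    assume "q \<notin> W"
    then show False using dst_ge[OF phi(1,2), of p q] phi(3,4) that by simp
  qed
  then show ?thesis using phi(3) by blast
qed

lemma dst_eq_0: "dst p q = 0 \<longleftrightarrow> p = q"
proof
  assume d: "dst p q = 0"
  show "p = q"
  proof (rule ccontr)
    assume "p \<noteq> q"
    then obtain e where "e > 0" "\<forall>r. dst p r < e \<longrightarrow> r \<in> - {q}"
      using open_contains_dst_ball[of "- {q}" p] by auto
    moreover have "dst p q < e" using d \<open>e > 0\<close> by simp
    ultimately have "q \<in> - {q}" by blast
    then show False by simp
  qed
qed (simp add: dst_self)

lemma dst_ball_nhd:
  assumes e: "e > 0"
  shows "\<exists>W. open W \<and> p \<in> W \<and> (\<forall>q\<in>W. dst p q < e)"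
proof -
  obtain c \<rho> where c: "good c (snd c p) \<rho>" "p \<in> fst c" by (rule exists_link_nhd[of p]) (rule that, assumption+)
  have cA: "c \<in> A" "0 < \<rho>" "ball (snd c p) \<rho> \<subseteq> codom c" using c(1) by (auto simp: good_def)
  have pc: "snd c p \<in> codom c" using c(2) by blast
  obtain \<kappa> where k: "\<kappa> > 0" "\<And>v. gnorm c (snd c p) v \<le> \<kappa> * norm v" using gnorm_equiv[OF cA(1) pc] by blast
  \<comment> \<open>A link from the centre to a point of the ball of radius \<open>r\<close> has
    length below \<open>2 * \<kappa> * r\<close>, which is at most \<open>e\<close>.\<close>
  define r where "r = min \<rho> (e / (2 * \<kappa>))"
  have r: "r > 0" "r \<le> \<rho>" using cA(2) e k(1) by (auto simp: r_def)
  have g: "good c (snd c p) r" by (rule good_smaller[OF c(1) r])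
  then have sub: "ball (snd c p) r \<subseteq> codom c" by (simp add: good_def)
  have "open (chart_inv c ` ball (snd c p) r)" by (rule open_chart_inv_image[OF cA(1) sub]) simp
  moreover have "p \<in> chart_inv c ` ball (snd c p) r"
    by (rule image_eqI[of _ _ "snd c p"]) (use r chart_inv_left[OF cA(1) c(2)] in auto)
  moreover have "dst p q < e" if q: "q \<in> chart_inv c ` ball (snd c p) r" for q
  proof -
    have qc: "q \<in> fst c" "snd c q \<in> ball (snd c p) r" using good_nhd_coord[OF g q] by auto
    have "dst p q \<le> 2 * gnorm c (snd c p) (snd c q - snd c p)"
      by (rule dst_local[OF g c(2) qc(1) _ qc(2)]) (use r in simp)
    also have "\<dots> \<le> 2 * (\<kappa> * norm (snd c q - snd c p))" using k(2) by simp
    also have "\<dots> < 2 * (\<kappa> * r)"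
      using qc(2) k(1) by (simp add: dist_norm norm_minus_commute)
    also have "\<dots> \<le> e"
    proof -
      have "r \<le> e / (2 * \<kappa>)" by (simp add: r_def)
      then show ?thesis using k(1) by (simp add: field_simps)
    qed
    finally show ?thesis .
  qed
  ultimately show ?thesis by blast
qed

sublocale M: Metric_space UNIV dst
  by unfold_locales (auto simp: dst_nonneg dst_sym dst_eq_0 intro: dst_triangle)

lemma mtopology_eq: "M.mtopology = euclidean"
proof (rule topology_eq[THEN iffD2], rule allI)
  fix W :: "'p set"
  show "openin M.mtopology W \<longleftrightarrow> openin euclidean W"
  proof
    assume W: "openin M.mtopology W"
    have "open W"
    proof (rule open_subopen[THEN iffD2], rule ballI)
      fix p assume "p \<in> W"
      then obtain e where e: "e > 0" "M.mball p e \<subseteq> W" using W by (auto simp: M.openin_mtopology)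
      obtain V where V: "open V" "p \<in> V" "\<forall>q\<in>V. dst p q < e" using dst_ball_nhd[OF e(1), of p] by blast
      then have "V \<subseteq> W" using e(2) by auto
      then show "\<exists>T. open T \<and> p \<in> T \<and> T \<subseteq> W" using V by blast
    qed
    then show "openin euclidean W" by simp
  next
    assume "openin euclidean W"
    then have W: "open W" by simp
    have "\<exists>e>0. M.mball p e \<subseteq> W" if "p \<in> W" for p
      using open_contains_dst_ball[OF W that] by auto
    then show "openin M.mtopology W" by (simp add: M.openin_mtopology)
  qed
qed

lemma continuous_dst: "continuous_on UNIV (dst p)"
proof (rule continuous_at_imp_continuous_on, rule ballI)
  fix q :: 'p
  show "isCont (dst p) q"
    unfolding continuous_at_open
  proof (intro allI impI, elim conjE)
    fix T assume T: "open T" "dst p q \<in> T"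
    then obtain e where e: "e > 0" "ball (dst p q) e \<subseteq> T" using openE by blast
    obtain V where V: "open V" "q \<in> V" "\<And>r. r \<in> V \<Longrightarrow> dst q r < e" using dst_ball_nhd[OF e(1), of q] by blast
    have "dst p r \<in> T" if r: "r \<in> V" for r
    proof -
      have "\<bar>dst p q - dst p r\<bar> < e"
        using dst_triangle[of p q r] dst_triangle[of p r q] V(3)[OF r] dst_sym[of r q] by simp
      then show ?thesis using e(2) by (auto simp: dist_real_def)
    qed
    then show "\<exists>S. open S \<and> q \<in> S \<and> (\<forall>x'\<in>S. dst p x' \<in> T)" using V by blast
  qed
qed

text \<open>\<open>riemannian_dist\<close> is dominated by \<open>dst\<close>, so a
  \<open>dst\<close>-Cauchy sequence converges in \<open>riemannian_dist\<close>. Lipschitz bumps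
  turn this into convergence in the manifold topology, which is the topology of
  \<open>dst\<close>.\<close>

lemma mcomplete_dst:
  assumes "complete_riemannian A g"
  shows "M.mcomplete"
  unfolding M.mcomplete_def
proof (intro allI impI)
  fix X :: "nat \<Rightarrow> 'p" assume X: "M.MCauchy X"
  have "\<exists>K. \<forall>i\<ge>K. \<forall>j\<ge>K. riemannian_dist A g (X i) (X j) < e" if e: "e > 0" for e :: ennreal
  proof -
    \<comment> \<open>The extended tolerance is replaced by a positive real one; an infinite
      tolerance admits any.\<close>
    obtain r where r: "r > 0" "ennreal r \<le> e"
    proof (cases e)
      case (real r)
      then show ?thesis using that[of r] e by simp
    next
      case top
      then show ?thesis using that[of 1] by simp
    qed
    obtain K where K: "\<And>i j. K \<le> i \<Longrightarrow> K \<le> j \<Longrightarrow> dst (X i) (X j) < r"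
      using X r(1) unfolding M.MCauchy_def by metis
    have "riemannian_dist A g (X i) (X j) < e" if "i \<ge> K" "j \<ge> K" for i j
      using riemannian_dist_le_dst[OF K[OF that]] r(2) by (rule less_le_trans)
    then show ?thesis by blast
  qed
  then obtain p where p: "(\<lambda>i. riemannian_dist A g (X i) p) \<longlonglongrightarrow> 0"
    using assms unfolding complete_riemannian_def by blast
  have "eventually (\<lambda>i. X i \<in> W) sequentially" if W: "open W" "p \<in> W" for W
  proof -
    obtain \<phi> where phi: "mC1 UNIV \<phi>" "\<And>q. grad_bound \<phi> q 1" "\<phi> p > 0" "\<And>q. q \<notin> W \<Longrightarrow> \<phi> q = 0"
      by (rule exists_bump_Lipschitz[OF W]) (rule that, assumption+)
    \<comment> \<open>Eventually the bump at \<open>X i\<close> differs from its value at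
      \<open>p\<close> by less than that value, so it is nonzero and \<open>X i\<close> lies in
      \<open>W\<close>.\<close>
    have "eventually (\<lambda>i. riemannian_dist A g (X i) p < ennreal (\<phi> p)) sequentially"
      using order_tendstoD(2)[OF p, of "ennreal (\<phi> p)"] phi(3) by simp
    then show ?thesis
    proof (rule eventually_mono)
      fix i assume "riemannian_dist A g (X i) p < ennreal (\<phi> p)"
      then have "ennreal \<bar>\<phi> (X i) - \<phi> p\<bar> < ennreal (\<phi> p)"
        using riemannian_dist_ge[OF phi(1,2), of "X i" p] by (rule le_less_trans[rotated])
      then have "\<bar>\<phi> (X i) - \<phi> p\<bar> < \<phi> p" using phi(3) by (simp add: ennreal_less_iff)
      then have "\<phi> (X i) \<noteq> 0" using phi(3) by auto
      then show "X i \<in> W" using phi(4) by blast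
    qed
  qed
  then have "limitin M.mtopology X p sequentially"
    unfolding mtopology_eq by (simp add: limitin_canonical_iff tendsto_def)
  then show "\<exists>x. limitin M.mtopology X x sequentially" by blast
qed

lemma compact_dst_ball:
  assumes "complete_riemannian A g"
  shows "compact {q. dst p q \<le> R}"
proof -
  have "compactin M.mtopology (M.mcball p R)"
  proof (rule M.hopf_rinow[OF mcomplete_dst[OF assms]])
    fix x :: 'p
    obtain \<beta> C where b: "mC1 UNIV \<beta>" "\<And>q. 0 \<le> \<beta> q" "\<beta> x > 0" "compact C" "C \<subseteq> UNIV" "\<And>q. q \<notin> C \<Longrightarrow> \<beta> q = 0"
      by (rule exists_bump[of UNIV x]) (simp, simp, rule that, assumption+)
    have "open {q. \<beta> q > 0}"
      using mC1_continuous[OF open_UNIV b(1)] by (intro open_Collect_less continuous_on_const)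
    then obtain e where e: "e > 0" "\<forall>q. dst x q < e \<longrightarrow> q \<in> {q. \<beta> q > 0}"
      using open_contains_dst_ball[of "{q. \<beta> q > 0}" x] b(3) by blast
    have "M.mcball x (e / 2) \<subseteq> C"
    proof
      fix q assume "q \<in> M.mcball x (e / 2)"
      then have "dst x q < e" using e(1) by simp
      then have "\<beta> q \<noteq> 0" using e(2) by auto
      then show "q \<in> C" using b(6) by blast
    qed
    moreover have "compactin M.mtopology C" unfolding mtopology_eq using b(4) by simp
    ultimately have "compactin M.mtopology (M.mcball x (e / 2))"
      by (intro closed_compactin[OF _ _ M.closedin_mcball])
    then show "\<exists>r>0. compactin M.mtopology (M.mcball x r)" using e(1) by (intro exI[of _ "e / 2"]) simp
  next
    fix x y :: 'p and R \<eta> :: real assume R: "0 \<le> R" "0 < \<eta>" "dst x y < R + \<eta>"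
    \<comment> \<open>A chain of length below \<open>R + \<eta>\<close> is cut at length
      \<open>R\<close>; if it is shorter than \<open>R\<close>, the endpoint \<open>y\<close> itself
      serves.\<close>
    obtain L where L: "reach x L y" "L < R + \<eta>" using R(3) by (rule dst_less)
    show "\<exists>z\<in>UNIV. dst x z \<le> R \<and> dst z y < \<eta>"
    proof (cases "R \<le> L")
      case True
      obtain z where "reach x R z" "reach z (L - R) y" using reach_split[OF L(1) R(1) True] by blast
      then have "dst x z \<le> R" "dst z y \<le> L - R" using dst_le by blast+
      then show ?thesis using L(2) by (intro bexI[of _ z]) auto
    next
      case False
      then show ?thesis using dst_le[OF L(1)] R dst_self[of y] by (intro bexI[of _ y]) auto
    qed
  qed simp
  moreover have "M.mcball p R = {q. dst p q \<le> R}" by auto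
  ultimately show ?thesis unfolding mtopology_eq by simp
qed

end

section \<open>Smoothing the distance function\<close>

text \<open>First-order expansion with a remainder uniform over \<open>norm z \<le> R\<close>; the
  gradient of the bump at \<open>z\<close> is \<open>- 4 * max 0 (s^2 - z \<bullet> z)\<close> times
  \<open>z\<close>.\<close>

lemma bump_taylor:
  fixes z h :: "'a::euclidean_space"
  assumes "norm z \<le> R" "norm h \<le> 1"
  shows "\<bar>bump 0 s (z + h) - bump 0 s z + 4 * max 0 (s\<^sup>2 - z \<bullet> z) * (z \<bullet> h)\<bar> \<le> ((2 * R + 1)\<^sup>2 + 2 * s\<^sup>2) * (norm h)\<^sup>2"
proof -
  define a where "a = s\<^sup>2 - z \<bullet> z"
  define b where "b = s\<^sup>2 - (z + h) \<bullet> (z + h)"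
  have ba: "b - a = - 2 * (z \<bullet> h) - h \<bullet> h"
    by (simp add: a_def b_def inner_add_left inner_add_right inner_commute[of h z])
  have R: "0 \<le> R" using norm_ge_zero assms(1) by (rule order_trans)
  have hh: "h \<bullet> h \<le> norm h"
    using mult_right_mono[OF assms(2), of "norm h"] by (simp add: power2_eq_square flip: power2_norm_eq_inner)
  have "\<bar>z \<bullet> h\<bar> \<le> R * norm h"
    using Cauchy_Schwarz_ineq2[of z h] mult_right_mono[OF assms(1), of "norm h"] by simp
  then have "\<bar>b - a\<bar> \<le> (2 * R + 1) * norm h" unfolding ba using hh inner_ge_zero[of h] norm_ge_zero[of h]
    unfolding abs_le_iff distrib_right by linarith
  then have "\<bar>b - a\<bar>\<^sup>2 \<le> ((2 * R + 1) * norm h)\<^sup>2" by (rule power_mono) simp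
  then have 1: "\<bar>pos_sq b - pos_sq a - 2 * max 0 a * (b - a)\<bar> \<le> (2 * R + 1)\<^sup>2 * (norm h)\<^sup>2"
    using pos_sq_taylor[of b a] by (simp add: power_mult_distrib)
  have "max 0 a \<le> s\<^sup>2" by (simp add: a_def)
  then have 2: "\<bar>2 * max 0 a * (h \<bullet> h)\<bar> \<le> 2 * s\<^sup>2 * (norm h)\<^sup>2"
    by (simp add: abs_mult power2_norm_eq_inner mult_right_mono)
  have "bump 0 s (z + h) - bump 0 s z + 4 * max 0 a * (z \<bullet> h)
     = (pos_sq b - pos_sq a - 2 * max 0 a * (b - a)) - 2 * max 0 a * (h \<bullet> h)"
    unfolding ba by (simp add: bump_def a_def b_def algebra_simps)
  then show ?thesis using 1 2 unfolding a_def[symmetric] distrib_right by linarith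
qed

text \<open>Differentiation under the integral. As \<open>F\<close> has bounded support,
  \<open>bump_taylor\<close> applies with one radius to all relevant \<open>y\<close>, and the error
  is a constant times \<open>(norm h)^2\<close> times the integral of the absolute value of
  \<open>F\<close>.\<close>

lemma convolution_bump_Ck:
  fixes F :: "'a::euclidean_space \<Rightarrow> real"
  assumes F: "integrable lborel F" and supp: "\<And>y. y \<notin> ball x0 \<rho> \<Longrightarrow> F y = 0" and s: "0 \<le> s"
  shows "Ck_on 1 UNIV (\<lambda>x. integral\<^sup>L lborel (\<lambda>y. F y * bump 0 s (x - y)))" (is "Ck_on 1 UNIV ?h")
    and "integrable lborel (\<lambda>y. F y * bump 0 s (x - y))"
proof -
  \<comment> \<open>The gradient of \<open>bump 0 s\<close>: continuous, bounded, and zero outside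
    the ball of radius \<open>s\<close>.\<close>
  define q where "q z = (- 4 * max 0 (s\<^sup>2 - z \<bullet> z)) *\<^sub>R z" for z :: 'a
  have q_bound: "norm (q z) \<le> 4 * s\<^sup>2 * s" for z
  proof (cases "norm z \<le> s")
    case True
    have "max 0 (s\<^sup>2 - z \<bullet> z) \<le> s\<^sup>2" by simp
    then have "4 * max 0 (s\<^sup>2 - z \<bullet> z) * norm z \<le> 4 * s\<^sup>2 * s" using True s by (intro mult_mono) auto
    then show ?thesis by (simp add: q_def)
  next
    case False
    then have "s\<^sup>2 \<le> (norm z)\<^sup>2" using s by (intro power_mono) auto
    then have "max 0 (s\<^sup>2 - z \<bullet> z) = 0" by (simp add: power2_norm_eq_inner)
    then show ?thesis using s by (simp add: q_def)
  qed
  have q_cont: "continuous_on UNIV q" unfolding q_def by (intro continuous_intros)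
  have bump_bound: "\<bar>bump 0 s z\<bar> \<le> (s\<^sup>2)\<^sup>2" for z :: 'a
  proof -
    have "(max 0 (s\<^sup>2 - z \<bullet> z))\<^sup>2 \<le> (s\<^sup>2)\<^sup>2" by (rule power_mono) auto
    then show ?thesis by (simp add: bump_def pos_sq_def)
  qed
  have bump_cont: "continuous_on UNIV (bump 0 s :: 'a \<Rightarrow> real)"
    using Ck_on_continuous[OF Ck_on_bump] .
  have sh: "(\<lambda>y. f (x - y)) \<in> borel_measurable borel" if "continuous_on UNIV f"
    for f :: "'a \<Rightarrow> 'b::{second_countable_topology,real_normed_vector}" and x
    by (rule borel_measurable_continuous_onI, rule continuous_on_compose2[OF that]) (auto intro!: continuous_intros)
  have Fm: "F \<in> borel_measurable borel" using borel_measurable_integrable[OF F] by simp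
  have intb: "integrable lborel (\<lambda>y. F y * bump 0 s (x - y))" for x
    by (rule Bochner_Integration.integrable_bound[where f = "\<lambda>y. (s\<^sup>2)\<^sup>2 * F y"])
      (use F Fm sh[OF bump_cont, of x] bump_bound in \<open>auto simp: abs_mult mult.commute[of "\<bar>F _\<bar>"] intro!: mult_right_mono borel_measurable_times\<close>)
  then show "integrable lborel (\<lambda>y. F y * bump 0 s (x - y))" .
  have intq: "integrable lborel (\<lambda>y. F y *\<^sub>R q (x - y))" for x
    by (rule Bochner_Integration.integrable_bound[where f = "\<lambda>y. (4 * s\<^sup>2 * s) * F y"])
      (use F Fm sh[OF q_cont, of x] q_bound s in \<open>auto simp: abs_mult mult.commute[of "\<bar>F _\<bar>"] intro!: mult_right_mono borel_measurable_scaleR\<close>)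
  define P where "P x = integral\<^sup>L lborel (\<lambda>y. F y *\<^sub>R q (x - y))" for x
  have Pv: "P x \<bullet> v = integral\<^sup>L lborel (\<lambda>y. F y * (q (x - y) \<bullet> v))" for x v
    unfolding P_def by (subst integral_inner_left[symmetric]) (use intq in simp_all)
  have intqv: "integrable lborel (\<lambda>y. F y * (q (x - y) \<bullet> v))" for x v
    using integrable_inner_left[OF intq, of x v] by simp
  have deriv: "(?h has_derivative (\<lambda>v. P x \<bullet> v)) (at x)" for x
  proof (rule has_derivativeI_sandwich[of 1])
    \<comment> \<open>Bounds \<open>norm (x - y)\<close> for every \<open>y\<close> in the ball
      outside which \<open>F\<close> vanishes.\<close>
    define R where "R = norm (x - x0) + \<rho>"
    define C where "C = (2 * R + 1)\<^sup>2 + 2 * s\<^sup>2"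
    define J where "J = integral\<^sup>L lborel (\<lambda>y. \<bar>F y\<bar>)"
    show "bounded_linear (\<lambda>v. P x \<bullet> v)" by (rule bounded_linear_inner_right)
    show "((\<lambda>y. C * J * norm (y - x)) \<longlongrightarrow> 0) (at x within UNIV)"
      by (rule tendsto_mult_right_zero, rule tendsto_norm_zero, rule LIM_zero[OF tendsto_ident_at])
    fix x' assume x': "x' \<noteq> x" "dist x' x < 1"
    define h where "h = x' - x"
    have h: "norm h \<le> 1" "h \<noteq> 0" "x' = x + h" using x' by (auto simp: h_def dist_norm)
    have e1: "?h x' - ?h x - P x \<bullet> h =
      integral\<^sup>L lborel (\<lambda>y. F y * (bump 0 s ((x - y) + h) - bump 0 s (x - y) - q (x - y) \<bullet> h))"
    proof -
      have "integral\<^sup>L lborel (\<lambda>y. F y * (bump 0 s ((x - y) + h) - bump 0 s (x - y) - q (x - y) \<bullet> h))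
        = integral\<^sup>L lborel (\<lambda>y. F y * bump 0 s (x' - y) - F y * bump 0 s (x - y) - F y * (q (x - y) \<bullet> h))"
        by (simp add: h(3) algebra_simps)
      also have "\<dots> = ?h x' - ?h x - integral\<^sup>L lborel (\<lambda>y. F y * (q (x - y) \<bullet> h))"
        using intb[of x'] intb[of x] intqv[of x h] by simp
      finally show ?thesis by (simp add: Pv)
    qed
    have "norm (integral\<^sup>L lborel (\<lambda>y. F y * (bump 0 s ((x - y) + h) - bump 0 s (x - y) - q (x - y) \<bullet> h)))
        \<le> integral\<^sup>L lborel (\<lambda>y. (C * (norm h)\<^sup>2) * \<bar>F y\<bar>)"
    proof (rule Bochner_Integration.integral_norm_bound_integral)
      have "integrable lborel (\<lambda>y. F y * bump 0 s (x' - y) - F y * bump 0 s (x - y) - F y * (q (x - y) \<bullet> h))"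
        by (intro Bochner_Integration.integrable_diff intb intqv)
      then show "integrable lborel (\<lambda>y. F y * (bump 0 s ((x - y) + h) - bump 0 s (x - y) - q (x - y) \<bullet> h))"
        by (simp add: h(3) algebra_simps)
      show "integrable lborel (\<lambda>y. (C * (norm h)\<^sup>2) * \<bar>F y\<bar>)"
        by (intro integrable_mult_right integrable_abs F)
      fix y
      show "norm (F y * (bump 0 s ((x - y) + h) - bump 0 s (x - y) - q (x - y) \<bullet> h)) \<le> (C * (norm h)\<^sup>2) * \<bar>F y\<bar>"
      proof (cases "y \<in> ball x0 \<rho>")
        case True
        have "norm (x - y) \<le> norm (x - x0) + norm (x0 - y)" using norm_triangle_ineq[of "x - x0" "x0 - y"] by simp
        then have z: "norm (x - y) \<le> R" using True by (simp add: R_def dist_norm)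
        have "\<bar>bump 0 s ((x - y) + h) - bump 0 s (x - y) - q (x - y) \<bullet> h\<bar> \<le> C * (norm h)\<^sup>2"
          using bump_taylor[OF z h(1), of s] by (simp add: q_def C_def)
        then have "\<bar>F y\<bar> * \<bar>bump 0 s ((x - y) + h) - bump 0 s (x - y) - q (x - y) \<bullet> h\<bar> \<le> \<bar>F y\<bar> * (C * (norm h)\<^sup>2)"
          by (rule mult_left_mono) simp
        then show ?thesis by (simp only: real_norm_def abs_mult mult.commute[of "\<bar>F y\<bar>"])
      next
        case False
        then show ?thesis by (simp add: supp)
      qed
    qed
    also have "\<dots> = C * (norm h)\<^sup>2 * J" by (simp add: J_def)
    finally have b: "norm (?h x' - ?h x - P x \<bullet> (x' - x)) \<le> C * (norm h)\<^sup>2 * J"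
      using e1 by (simp add: h_def)
    have nh: "norm h > 0" using h(2) by simp
    have "norm (?h x' - ?h x - P x \<bullet> (x' - x)) / norm (x' - x) \<le> C * (norm h)\<^sup>2 * J / norm h"
      using divide_right_mono[OF b, of "norm h"] by (simp add: h_def)
    also have "\<dots> = C * J * norm (x' - x)" using nh by (simp add: power2_eq_square h_def)
    finally show "norm (?h x' - ?h x - P x \<bullet> (x' - x)) / norm (x' - x) \<le> C * J * norm (x' - x)" .
  qed simp
  have contP: "continuous_on UNIV (\<lambda>x. P x \<bullet> v)" for v
  proof (rule continuous_on_inner[OF _ continuous_on_const])
    show "continuous_on UNIV P"
      unfolding continuous_on_sequentially
    proof (intro allI ballI impI, elim conjE)
      fix X and a :: 'a assume X: "X \<longlonglongrightarrow> a"
      show "(P \<circ> X) \<longlonglongrightarrow> P a"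
        unfolding P_def o_def
      proof (rule integral_dominated_convergence[where w = "\<lambda>y. (4 * s\<^sup>2 * s) * \<bar>F y\<bar>"])
        show "(\<lambda>y. F y *\<^sub>R q (a - y)) \<in> borel_measurable lborel" "(\<lambda>y. F y *\<^sub>R q (X n - y)) \<in> borel_measurable lborel" for n
          using borel_measurable_integrable[OF intq] by auto
        show "integrable lborel (\<lambda>y. (4 * s\<^sup>2 * s) * \<bar>F y\<bar>)" by (intro integrable_mult_right integrable_abs F)
        have "(\<lambda>n. F y *\<^sub>R q (X n - y)) \<longlonglongrightarrow> F y *\<^sub>R q (a - y)" for y
          by (intro tendsto_intros isCont_tendsto_compose[of _ q] X)
            (use q_cont in \<open>simp add: continuous_on_eq_continuous_at\<close>)
        then show "AE y in lborel. (\<lambda>n. F y *\<^sub>R q (X n - y)) \<longlonglongrightarrow> F y *\<^sub>R q (a - y)" by simp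
        have "norm (F y *\<^sub>R q (X n - y)) \<le> (4 * s\<^sup>2 * s) * \<bar>F y\<bar>" for n y
          using mult_left_mono[OF q_bound[of "X n - y"], of "\<bar>F y\<bar>"] by (simp add: mult.commute)
        then show "AE y in lborel. norm (F y *\<^sub>R q (X n - y)) \<le> (4 * s\<^sup>2 * s) * \<bar>F y\<bar>" for n by simp
      qed
    qed
  qed
  show "Ck_on 1 UNIV ?h"
    unfolding One_nat_def by (rule Ck_on_SucI[OF open_UNIV deriv]) (use contP in simp)
qed

text \<open>By homogeneity of \<open>N\<close>, the difference quotients on the line through
  \<open>x\<close> in direction \<open>v\<close> are bounded by \<open>N v\<close>.\<close>

lemma derivative_le_Lipschitz:
  fixes h :: "'a::euclidean_space \<Rightarrow> real"
  assumes D: "(h has_derivative D) (at x)" and B: "open B" "x \<in> B"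
    and lip: "\<And>y. y \<in> B \<Longrightarrow> \<bar>h y - h x\<bar> \<le> N (y - x)" and N: "\<And>t v. N (t *\<^sub>R v) = \<bar>t\<bar> * N v"
  shows "\<bar>D v\<bar> \<le> N v"
proof -
  have L: "((\<lambda>t. x + t *\<^sub>R v) has_derivative (\<lambda>t. t *\<^sub>R v)) (at 0)"
    by (auto intro!: derivative_eq_intros)
  have "((\<lambda>t. h (x + t *\<^sub>R v)) has_real_derivative D v) (at 0)"
    using has_derivative_compose[OF L, of h D] D linear_scale[OF has_derivative_linear[OF D]]
    by (simp add: has_field_derivative_def mult_commute_abs)
  then have lim: "((\<lambda>t. \<bar>(h (x + t *\<^sub>R v) - h x) / t\<bar>) \<longlongrightarrow> \<bar>D v\<bar>) (at 0)"
    by (intro tendsto_rabs) (simp add: DERIV_def)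
  have "open ((\<lambda>t. x + t *\<^sub>R v) -` B)"
    by (intro open_vimage B) (auto intro!: continuous_intros)
  then have "eventually (\<lambda>t. t \<in> (\<lambda>t. x + t *\<^sub>R v) -` B) (nhds 0)"
    by (rule eventually_nhds_in_open) (use B in simp)
  then have "eventually (\<lambda>t. \<bar>(h (x + t *\<^sub>R v) - h x) / t\<bar> \<le> N v) (at 0)"
    unfolding eventually_at_filter
  proof (rule eventually_mono, intro impI)
    fix t :: real assume t: "t \<in> (\<lambda>t. x + t *\<^sub>R v) -` B" "t \<noteq> 0"
    have "\<bar>h (x + t *\<^sub>R v) - h x\<bar> \<le> N (x + t *\<^sub>R v - x)" by (rule lip) (use t in simp)
    also have "\<dots> = \<bar>t\<bar> * N v" by (simp add: N)
    finally show "\<bar>(h (x + t *\<^sub>R v) - h x) / t\<bar> \<le> N v" using t(2) by (simp add: abs_divide field_simps)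
  qed
  from tendsto_upperbound[OF lim this] show ?thesis by simp
qed

text \<open>Convolution averages translates, so it keeps the Lipschitz bound with respect to
  \<open>N\<close> without loss. As \<open>N\<close> must not depend on the base point, the lemma is
  applied with the metric frozen at the centre of a good ball.\<close>

lemma mollify:
  fixes f :: "'a::euclidean_space \<Rightarrow> real"
  assumes rho: "\<rho> > 0" and lip: "\<And>x y. x \<in> ball x0 \<rho> \<Longrightarrow> y \<in> ball x0 \<rho> \<Longrightarrow> \<bar>f x - f y\<bar> \<le> N (x - y)"
    and M: "M > 0" "\<And>v. N v \<le> M * norm v" and N: "\<And>t v. N (t *\<^sub>R v) = \<bar>t\<bar> * N v" and eta: "\<eta> > 0"
  shows "\<exists>h. Ck_on 1 UNIV h \<and> (\<forall>x\<in>ball x0 (\<rho> / 2). \<bar>h x - f x\<bar> \<le> \<eta> \<and> (\<forall>v. \<bar>frechet_derivative h (at x) v\<bar> \<le> N v))"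
proof -
  \<comment> \<open>The radius \<open>\<rho> / 2\<close> keeps the translates of the half ball
    inside the ball; \<open>\<eta> / M\<close> makes the average \<open>\<eta>\<close>-close to
    \<open>f\<close>.\<close>
  define s where "s = min (\<rho> / 2) (\<eta> / M)"
  have s: "s > 0" "s \<le> \<rho> / 2" "M * s \<le> \<eta>"
    using rho M(1) eta by (auto simp: s_def min_def field_simps)
  define k :: "'a \<Rightarrow> real" where "k = bump 0 s"
  have k0: "k y = 0" if "norm y \<ge> s" for y
    unfolding k_def by (rule bump_eq_0) (use s that in auto)
  have kn: "0 \<le> k y" for y by (simp add: k_def bump_nonneg)
  have kc: "continuous_on UNIV k" unfolding k_def using Ck_on_continuous[OF Ck_on_bump] .
  have ksym: "k (x - y) = k (y - x)" for x y
    by (simp add: k_def bump_def inner_diff_left inner_diff_right inner_commute algebra_simps)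
  have km: "k \<in> borel_measurable borel" by (rule borel_measurable_continuous_onI[OF kc])
  have intk: "integrable lborel k"
    by (rule integrable_continuous_compact_support[of "cball 0 s"]) (use k0 continuous_on_subset[OF kc] in \<open>auto simp: not_le\<close>)
  define Z where "Z = integral\<^sup>L lborel k"
  have fin: "emeasure lborel (ball z r) < top" for z :: 'a and r
    using emeasure_bounded_finite[OF bounded_ball, of z r] by simp
  have Z: "Z > 0"
  proof -
    \<comment> \<open>On the ball of radius \<open>s / 2\<close> the kernel is at least its value on
      the boundary sphere, where the argument of \<open>pos_sq\<close> is
      \<open>3 / 4 * s^2\<close>; hence its integral is positive.\<close>
    have b: "pos_sq (3 / 4 * s\<^sup>2) * indicator (ball 0 (s / 2)) y \<le> k y" for y
    proof (cases "y \<in> ball 0 (s / 2)")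
      case True
      then have "(norm y)\<^sup>2 \<le> (s / 2)\<^sup>2" by (intro power_mono) auto
      then have "3 / 4 * s\<^sup>2 \<le> s\<^sup>2 - y \<bullet> y" by (simp add: power_divide power2_norm_eq_inner)
      then have "pos_sq (3 / 4 * s\<^sup>2) \<le> pos_sq (s\<^sup>2 - y \<bullet> y)"
        unfolding pos_sq_def by (intro power_mono max.mono) simp_all
      then show ?thesis using True by (simp add: k_def bump_def)
    qed (simp add: kn)
    have m: "integrable lborel (\<lambda>y::'a. pos_sq (3 / 4 * s\<^sup>2) * indicator (ball 0 (s / 2)) y :: real)"
      by (intro integrable_mult_right integrable_real_indicator) (simp_all add: fin)
    have "0 < pos_sq (3 / 4 * s\<^sup>2) * measure lborel (ball (0::'a) (s / 2))"
      using s(1) content_ball_pos[of "s / 2" "0::'a"] by (simp add: pos_sq_pos)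
    also have "\<dots> = integral\<^sup>L lborel (\<lambda>y::'a. pos_sq (3 / 4 * s\<^sup>2) * indicator (ball 0 (s / 2)) y)"
      by simp
    also have "\<dots> \<le> Z" unfolding Z_def by (rule integral_mono[OF m intk b])
    finally show ?thesis .
  qed
  define F where "F y = (if y \<in> ball x0 \<rho> then f y else 0)" for y
  have "M-lipschitz_on (ball x0 \<rho>) f"
  proof (rule lipschitz_onI)
    fix x y assume "x \<in> ball x0 \<rho>" "y \<in> ball x0 \<rho>"
    from lip[OF this] M(2)[of "x - y"] show "dist (f x) (f y) \<le> M * dist x y"
      by (simp add: dist_real_def dist_norm)
  qed (use M(1) in simp)
  then have "continuous_on (ball x0 \<rho>) f" by (rule lipschitz_on_continuous_on)
  then have "(\<lambda>y. indicator (ball x0 \<rho>) y *\<^sub>R f y) \<in> borel_measurable borel"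
    by (intro borel_measurable_continuous_on_indicator) simp_all
  moreover have "(\<lambda>y. indicator (ball x0 \<rho>) y *\<^sub>R f y) = F" by (auto simp: F_def fun_eq_iff)
  ultimately have Fm: "F \<in> borel_measurable borel" by simp
  define B where "B = \<bar>f x0\<bar> + M * \<rho>"
  have B0: "0 \<le> B" using M(1) rho by (simp add: B_def)
  have FB: "\<bar>F y\<bar> \<le> B" for y
  proof (cases "y \<in> ball x0 \<rho>")
    case True
    have "\<bar>f y - f x0\<bar> \<le> M * norm (y - x0)" using lip[OF True, of x0] M(2)[of "y - x0"] rho by simp
    also have "\<dots> \<le> M * \<rho>" using True M(1) by (simp add: dist_norm norm_minus_commute)
    finally show ?thesis using True by (simp add: F_def B_def)
  qed (simp add: F_def B0)
  have Fi: "integrable lborel F"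
  proof (rule Bochner_Integration.integrable_bound)
    show "integrable lborel (\<lambda>y. B * indicator (ball x0 \<rho>) y :: real)"
      by (intro integrable_mult_right integrable_real_indicator) (simp_all add: fin)
    have "norm (F y) \<le> norm (B * indicator (ball x0 \<rho>) y :: real)" for y
      using FB[of y] by (cases "y \<in> ball x0 \<rho>") (simp_all add: F_def)
    then show "AE y in lborel. norm (F y) \<le> norm (B * indicator (ball x0 \<rho>) y :: real)" by simp
  qed (use Fm in simp)
  define G where "G x = integral\<^sup>L lborel (\<lambda>y. F y * bump 0 s (x - y))" for x
  have G1: "Ck_on 1 UNIV G"
    unfolding G_def by (rule convolution_bump_Ck[OF Fi]) (use s in \<open>auto simp: F_def\<close>)
  have shm: "(\<lambda>y. F (y + x)) \<in> borel_measurable borel" for x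
    by (rule measurable_compose[OF _ Fm]) simp
  have Gshift: "G x = integral\<^sup>L lborel (\<lambda>y. F (y + x) * k y)" for x
  proof -
    have "(\<lambda>y. k (x - y)) \<in> borel_measurable borel"
      by (rule measurable_compose[OF _ km]) simp
    then have "(\<lambda>y. F y * k (x - y)) \<in> borel_measurable borel" using Fm by (rule borel_measurable_times[rotated])
    from lborel_integral_translate[OF this, of x] show ?thesis
      using ksym[of 0] by (simp add: G_def k_def)
  qed
  have Gi: "integrable lborel (\<lambda>y. F (y + x) * k y)" for x
  proof (rule Bochner_Integration.integrable_bound)
    show "integrable lborel (\<lambda>y. B * k y)" by (intro integrable_mult_right intk)
    have "norm (F (y + x) * k y) \<le> norm (B * k y)" for y
      using mult_right_mono[OF FB[of "y + x"] kn[of y]] kn[of y] B0 by (simp add: abs_mult)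
    then show "AE y in lborel. norm (F (y + x) * k y) \<le> norm (B * k y)" by simp
  qed (use shm km in simp)
  have inb: "y + x \<in> ball x0 \<rho>" if "x \<in> ball x0 (\<rho> / 2)" "norm y < s" for x y
  proof -
    have "dist x0 (y + x) \<le> dist x0 x + norm y"
      using norm_triangle_ineq[of "x0 - x" "- y"] by (simp add: dist_norm algebra_simps)
    then show ?thesis using that s(2) by simp
  qed
  have est: "\<bar>integral\<^sup>L lborel u\<bar> \<le> c * Z" if "integrable lborel u" "\<And>y. \<bar>u y\<bar> \<le> c * k y" for u c
  proof -
    have "norm (integral\<^sup>L lborel u) \<le> integral\<^sup>L lborel (\<lambda>y. c * k y)"
      by (rule Bochner_Integration.integral_norm_bound_integral[OF that(1) integrable_mult_right[OF intk]]) (use that(2) in simp)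
    then show ?thesis by (simp add: Z_def)
  qed
  have G_lip: "\<bar>G x - G x'\<bar> \<le> N (x - x') * Z" if xx: "x \<in> ball x0 (\<rho> / 2)" "x' \<in> ball x0 (\<rho> / 2)" for x x'
  proof -
    have "\<bar>F (y + x) * k y - F (y + x') * k y\<bar> \<le> N (x - x') * k y" for y
    proof (cases "norm y < s")
      case True
      have "\<bar>F (y + x) - F (y + x')\<bar> \<le> N (x - x')"
        using lip[OF inb[OF xx(1) True] inb[OF xx(2) True]] inb[OF xx(1) True] inb[OF xx(2) True] by (simp add: F_def)
      from mult_right_mono[OF this kn[of y]] show ?thesis
        using kn[of y] by (simp add: abs_mult flip: left_diff_distrib)
    qed (simp add: k0)
    from est[OF Bochner_Integration.integrable_diff[OF Gi[of x] Gi[of x']] this] show ?thesis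
      using Gi[of x] Gi[of x'] by (simp add: Gshift)
  qed
  have G_close: "\<bar>G x - f x * Z\<bar> \<le> \<eta> * Z" if x: "x \<in> ball x0 (\<rho> / 2)" for x
  proof -
    have xb: "x \<in> ball x0 \<rho>" using x rho by simp
    have "\<bar>F (y + x) * k y - f x * k y\<bar> \<le> \<eta> * k y" for y
    proof (cases "norm y < s")
      case True
      have "\<bar>F (y + x) - f x\<bar> \<le> M * norm y"
        using lip[OF inb[OF x True] xb] inb[OF x True] M(2)[of y] by (simp add: F_def)
      also have "\<dots> \<le> M * s" using True M(1) by simp
      also have "\<dots> \<le> \<eta>" by (rule s(3))
      finally have "\<bar>F (y + x) - f x\<bar> \<le> \<eta>" .
      from mult_right_mono[OF this kn[of y]] show ?thesis
        using kn[of y] by (simp add: abs_mult flip: left_diff_distrib)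
    qed (simp add: k0)
    from est[OF Bochner_Integration.integrable_diff[OF Gi[of x] integrable_mult_right[OF intk]] this] show ?thesis
      using Gi[of x] intk by (simp add: Gshift Z_def)
  qed
  define h where "h x = G x / Z" for x
  have h1: "Ck_on 1 UNIV h"
    unfolding h_def by (rule Ck_on_divide[OF open_UNIV G1 Ck_on_const[OF open_UNIV]]) (use Z in simp)
  have "\<bar>h x - f x\<bar> \<le> \<eta>" if "x \<in> ball x0 (\<rho> / 2)" for x
  proof -
    have "h x - f x = (G x - f x * Z) / Z" using Z by (simp add: h_def field_simps)
    then have "\<bar>h x - f x\<bar> = \<bar>G x - f x * Z\<bar> / Z" using Z by (simp add: abs_divide)
    then show ?thesis using G_close[OF that] Z by (simp add: divide_le_eq)
  qed
  moreover have "\<bar>frechet_derivative h (at x) v\<bar> \<le> N v" if x: "x \<in> ball x0 (\<rho> / 2)" for x v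
  proof (rule derivative_le_Lipschitz[OF _ open_ball x _ N])
    show "(h has_derivative frechet_derivative h (at x)) (at x)"
      using Ck_on_has_derivative[of 0 UNIV h x] h1 by simp
    fix y assume y: "y \<in> ball x0 (\<rho> / 2)"
    have "h y - h x = (G y - G x) / Z" by (simp add: h_def diff_divide_distrib)
    then have "\<bar>h y - h x\<bar> = \<bar>G y - G x\<bar> / Z" using Z by (simp add: abs_divide)
    then show "\<bar>h y - h x\<bar> \<le> N (y - x)" using G_lip[OF y x] Z by (simp add: divide_le_eq)
  qed
  ultimately show ?thesis using h1 by blast
qed

context riem
begin

text \<open>The bound 4 has one factor 2 from comparing \<open>dst\<close> with the norm at the
  centre and one from moving that norm to \<open>q\<close>. The neighbourhood is chosen before
  \<open>\<eta>\<close>, so that a partition of unity can be fixed before the accuracy.\<close>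

lemma smooth_dst_locally:
  "\<exists>W. open W \<and> p \<in> W \<and> (\<forall>\<eta>>0. \<exists>r. mC1 W r \<and> (\<forall>q\<in>W. \<bar>r q - dst p0 q\<bar> \<le> \<eta> \<and> grad_bound r q 4))"
proof -
  obtain c \<rho> where G: "good c (snd c p) \<rho>" and p: "p \<in> fst c" by (rule exists_link_nhd[of p]) (rule that, assumption+)
  let ?x = "snd c p"
  have c: "c \<in> A" and rho: "\<rho> > 0" and sub: "ball ?x \<rho> \<subseteq> codom c" using G by (auto simp: good_def)
  have xc: "?x \<in> codom c" using p by blast
  obtain \<kappa> where k: "\<kappa> > 0" "\<And>v. gnorm c ?x v \<le> \<kappa> * norm v" using gnorm_equiv[OF c xc] by blast
  let ?B = "ball ?x (\<rho> / 2)"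
  have G2: "good c ?x (\<rho> / 2)" by (rule good_smaller[OF G]) (use rho in auto)
  have sub2: "?B \<subseteq> codom c" using G2 by (simp add: good_def)
  define W where "W = chart_inv c ` ?B"
  have W: "open W" unfolding W_def by (rule open_chart_inv_image[OF c sub2]) simp
  have pW: "p \<in> W" unfolding W_def by (rule image_eqI[of _ _ ?x]) (use rho chart_inv_left[OF c p] in auto)
  define f where "f x = dst p0 (chart_inv c x)" for x
  have lip: "\<bar>f x - f y\<bar> \<le> 2 * gnorm c ?x (x - y)" if xy: "x \<in> ball ?x \<rho>" "y \<in> ball ?x \<rho>" for x y
  proof -
    have xyc: "x \<in> codom c" "y \<in> codom c" using xy sub by auto
    have "dst (chart_inv c y) (chart_inv c x) \<le> 2 * gnorm c ?x (snd c (chart_inv c x) - snd c (chart_inv c y))"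
      by (rule dst_local[OF G chart_inv_in[OF c xyc(2)] chart_inv_in[OF c xyc(1)]])
        (use xy chart_inv_right[OF c] xyc in simp_all)
    then have "dst (chart_inv c y) (chart_inv c x) \<le> 2 * gnorm c ?x (x - y)"
      using chart_inv_right[OF c] xyc by simp
    then show ?thesis
      using dst_triangle[of p0 "chart_inv c x" "chart_inv c y"] dst_triangle[of p0 "chart_inv c y" "chart_inv c x"]
        dst_sym[of "chart_inv c x" "chart_inv c y"] by (simp add: f_def)
  qed
  have "\<exists>r. mC1 W r \<and> (\<forall>q\<in>W. \<bar>r q - dst p0 q\<bar> \<le> \<eta> \<and> grad_bound r q 4)" if eta: "\<eta> > 0" for \<eta>
  proof -
    have "\<exists>h. Ck_on 1 UNIV h \<and> (\<forall>x\<in>?B. \<bar>h x - f x\<bar> \<le> \<eta> \<and> (\<forall>v. \<bar>frechet_derivative h (at x) v\<bar> \<le> 2 * gnorm c ?x v))"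
    proof (rule mollify[where M = "2 * \<kappa>" and N = "\<lambda>v. 2 * gnorm c ?x v", OF rho lip])
      show "2 * gnorm c ?x v \<le> 2 * \<kappa> * norm v" for v using k(2)[of v] by simp
      show "2 * gnorm c ?x (t *\<^sub>R v) = \<bar>t\<bar> * (2 * gnorm c ?x v)" for t v by (simp add: gnorm_scaleR)
    qed (use k(1) eta in simp_all)
    then obtain h where h: "Ck_on 1 UNIV h" "\<And>x. x \<in> ?B \<Longrightarrow> \<bar>h x - f x\<bar> \<le> \<eta>"
      "\<And>x v. x \<in> ?B \<Longrightarrow> \<bar>frechet_derivative h (at x) v\<bar> \<le> 2 * gnorm c ?x v" by blast
    define r where "r q = h (snd c q)" for q
    have r1: "mC1 W r"
      unfolding r_def W_def by (rule mC1_chart[OF c open_ball sub2 Ck_on_subset[OF h(1)]]) simp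
    have "\<bar>r q - dst p0 q\<bar> \<le> \<eta> \<and> grad_bound r q 4" if q: "q \<in> W" for q
    proof
      have qc: "q \<in> fst c" "snd c q \<in> ?B" using good_nhd_coord[OF G2] q by (simp_all add: W_def)
      show "\<bar>r q - dst p0 q\<bar> \<le> \<eta>" using h(2)[OF qc(2)] by (simp add: r_def f_def chart_inv_left[OF c qc(1)])
      have "der c r q = frechet_derivative h (at (snd c q))"
        unfolding der_def
        by (rule frechet_derivative_cong_open[OF open_ball qc(2)]) (use sub2 chart_inv_right[OF c] in \<open>auto simp: r_def\<close>)
      moreover have "gnorm c ?x v \<le> 2 * gnorm c (snd c q) v" for v
        using G2 qc(2) unfolding good_def by blast
      ultimately have "\<bar>der c r q v\<bar> \<le> 4 * gnorm c (snd c q) v" for v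
        using h(3)[OF qc(2), of v] by (smt (verit, best))
      then show "grad_bound r q 4" by (rule grad_boundI[OF r1 W q c qc(1)])
    qed
    then show ?thesis using r1 by blast
  qed
  then show ?thesis using W pW by blast
qed

text \<open>Local approximations \<open>r p\<close> are glued by a partition of unity
  \<open>\<omega> p\<close>. The differentials of the \<open>\<omega> p\<close> sum to 0, so the
  differential of the glued function is the average of those of the \<open>r p\<close> plus the sum
  of \<open>r p q - dst p0 q\<close> times the differentials of \<open>\<omega> p\<close>. The
  accuracy bounds the second sum by 1, hence 5 = 4 + 1.\<close>

lemma exists_smooth_dst:
  assumes K: "compact K"
  shows "\<exists>W \<phi>. open W \<and> K \<subseteq> W \<and> mC1 W \<phi> \<and> (\<forall>q\<in>K. \<bar>\<phi> q - dst p0 q\<bar> \<le> 1 \<and> grad_bound \<phi> q 5)"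
proof -
  have ex: "\<forall>p. \<exists>U C \<beta>. open U \<and> (\<forall>\<eta>>0. \<exists>r. mC1 U r \<and> (\<forall>q\<in>U. \<bar>r q - dst p0 q\<bar> \<le> \<eta> \<and> grad_bound r q 4)) \<and>
      mC1 UNIV \<beta> \<and> (\<forall>q. 0 \<le> \<beta> q) \<and> \<beta> p > 0 \<and> compact C \<and> C \<subseteq> U \<and> (\<forall>q. q \<notin> C \<longrightarrow> \<beta> q = 0)"
    (is "\<forall>p. ?Q p")
  proof
    fix p
    obtain U where U: "open U" "p \<in> U" "\<forall>\<eta>>0. \<exists>r. mC1 U r \<and> (\<forall>q\<in>U. \<bar>r q - dst p0 q\<bar> \<le> \<eta> \<and> grad_bound r q 4)"
      using smooth_dst_locally[of p p0] by (elim exE conjE)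
    obtain \<beta> C where b: "mC1 UNIV \<beta>" "\<And>q. 0 \<le> \<beta> q" "\<beta> p > 0" "compact C" "C \<subseteq> U" "\<And>q. q \<notin> C \<Longrightarrow> \<beta> q = 0"
      by (rule exists_bump[OF U(1,2)]) (rule that, assumption+)
    show "?Q p"
      by (rule exI[of _ U], rule exI[of _ C], rule exI[of _ \<beta>], intro conjI allI impI U(1) U(3)[rule_format] b) assumption+
  qed
  obtain U C \<beta> where D: "\<forall>p. open (U p) \<and> (\<forall>\<eta>>0. \<exists>r. mC1 (U p) r \<and> (\<forall>q\<in>U p. \<bar>r q - dst p0 q\<bar> \<le> \<eta> \<and> grad_bound r q 4)) \<and>
      mC1 UNIV (\<beta> p) \<and> (\<forall>q. 0 \<le> \<beta> p q) \<and> \<beta> p p > 0 \<and> compact (C p) \<and> C p \<subseteq> U p \<and> (\<forall>q. q \<notin> C p \<longrightarrow> \<beta> p q = 0)"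
    using ex[unfolded choice_iff] by (elim exE) (rule that)
  have U: "open (U p)" and approx: "\<eta> > 0 \<Longrightarrow> \<exists>r. mC1 (U p) r \<and> (\<forall>q\<in>U p. \<bar>r q - dst p0 q\<bar> \<le> \<eta> \<and> grad_bound r q 4)"
    and b: "mC1 UNIV (\<beta> p)" and b0: "0 \<le> \<beta> p q" and bp: "\<beta> p p > 0"
    and C: "compact (C p)" "C p \<subseteq> U p" and bC: "q \<notin> C p \<Longrightarrow> \<beta> p q = 0" for p q \<eta>
    using D[rule_format, of p] by simp_all
  have pos_open: "open {q. \<beta> p q > 0}" for p
    using mC1_continuous[OF open_UNIV b] by (intro open_Collect_less continuous_on_const)
  obtain I where I: "finite I" "K \<subseteq> (\<Union>p\<in>I. {q. \<beta> p q > 0})"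
    by (rule compactE_image[OF K, of K "\<lambda>p. {q. \<beta> p q > 0}"]) (use pos_open bp in auto)
  define S where "S q = (\<Sum>p\<in>I. \<beta> p q)" for q
  have S1: "mC1 UNIV S" unfolding S_def by (intro mC1_sum open_UNIV b)
  define W where "W = {q. S q > 0}"
  have W: "open W" unfolding W_def
    using mC1_continuous[OF open_UNIV S1] by (intro open_Collect_less continuous_on_const)
  have KW: "K \<subseteq> W"
  proof
    fix q assume "q \<in> K"
    then obtain p where p: "p \<in> I" "\<beta> p q > 0" using I(2) by auto
    have "0 < \<beta> p q" by (rule p(2))
    also have "\<dots> \<le> S q" unfolding S_def by (rule member_le_sum[OF p(1) _ I(1)]) (rule b0)
    finally show "q \<in> W" by (simp add: W_def)
  qed
  have SW: "S q \<noteq> 0" "S q > 0" if "q \<in> W" for q using that by (auto simp: W_def)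
  define \<omega> where "\<omega> p q = \<beta> p q / S q" for p q
  have chi1: "mC1 W (\<omega> p)" for p
    unfolding \<omega>_def by (rule mC1_divide[OF W mC1_subset[OF b] mC1_subset[OF S1]]) (use SW in auto)
  have chi0: "0 \<le> \<omega> p q" if "q \<in> W" for p q using b0 SW(2)[OF that] by (simp add: \<omega>_def)
  have chi_sum: "(\<Sum>p\<in>I. \<omega> p q) = 1" if "q \<in> W" for q
    using SW(1)[OF that] by (simp add: \<omega>_def S_def flip: sum_divide_distrib)
  have "\<forall>p. \<exists>L>0. \<forall>q\<in>K. grad_bound (\<omega> p) q L" using grad_bound_compact[OF chi1 W K KW] by blast
  then obtain L where L: "\<And>p. L p > 0" "\<And>p q. q \<in> K \<Longrightarrow> grad_bound (\<omega> p) q (L p)"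
    unfolding choice_iff by blast
  \<comment> \<open>Compensates the gradient bounds \<open>L p\<close> of the partition, which are
    known by now; the summand 1 also gives \<open>\<eta> \<le> 1\<close>.\<close>
  define \<eta> where "\<eta> = 1 / (1 + (\<Sum>p\<in>I. L p))"
  have Ls: "0 \<le> (\<Sum>p\<in>I. L p)" using L(1) by (intro sum_nonneg less_imp_le)
  have eta: "\<eta> > 0" "\<eta> \<le> 1" "\<eta> * (\<Sum>p\<in>I. L p) \<le> 1" using Ls by (auto simp: \<eta>_def divide_simps)
  obtain r where r: "\<And>p. mC1 (U p) (r p)" "\<And>p q. q \<in> U p \<Longrightarrow> \<bar>r p q - dst p0 q\<bar> \<le> \<eta>" "\<And>p q. q \<in> U p \<Longrightarrow> grad_bound (r p) q 4"
  proof -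
    have "\<forall>p. \<exists>r. mC1 (U p) r \<and> (\<forall>q\<in>U p. \<bar>r q - dst p0 q\<bar> \<le> \<eta> \<and> grad_bound r q 4)"
      using approx[OF eta(1)] by (intro allI)
    then have "\<exists>r. \<forall>p. mC1 (U p) (r p) \<and> (\<forall>q\<in>U p. \<bar>r p q - dst p0 q\<bar> \<le> \<eta> \<and> grad_bound (r p) q 4)"
      by (rule choice)
    then obtain r where "\<forall>p. mC1 (U p) (r p) \<and> (\<forall>q\<in>U p. \<bar>r p q - dst p0 q\<bar> \<le> \<eta> \<and> grad_bound (r p) q 4)"
      by (elim exE)
    then show ?thesis by (intro that[of r]) simp_all
  qed
  \<comment> \<open>\<open>r p\<close> is C^1 only on \<open>U p\<close>; its product with the bump
    extends by zero beyond the compact set \<open>C p\<close>.\<close>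
  define \<rho> where "\<rho> p q = (if q \<in> U p then \<beta> p q * r p q else 0)" for p q
  have rho1: "mC1 UNIV (\<rho> p)" for p
    unfolding \<rho>_def
    by (rule mC1_extend[OF compact_imp_closed[OF C(1)] U C(2) mC1_mult[OF U mC1_subset[OF b] r(1)]])
      (use bC in auto)
  define \<psi> where "\<psi> p q = \<rho> p q / S q" for p q
  have psi1: "mC1 W (\<psi> p)" for p
    unfolding \<psi>_def by (rule mC1_divide[OF W mC1_subset[OF rho1] mC1_subset[OF S1]]) (use SW in auto)
  define \<phi> where "\<phi> q = (\<Sum>p\<in>I. \<psi> p q)" for q
  have phi1: "mC1 W \<phi>" unfolding \<phi>_def by (intro mC1_sum W psi1)
  have out: "\<rho> p q = 0" "\<beta> p q = 0" if "q \<in> - C p" for p q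
    using bC[of q p] that by (simp_all add: \<rho>_def)
  have psi_close: "\<bar>\<psi> p q - dst p0 q * \<omega> p q\<bar> \<le> \<eta> * \<omega> p q" if q: "q \<in> W" for p q
  proof (cases "q \<in> U p")
    case True
    have "\<psi> p q - dst p0 q * \<omega> p q = (r p q - dst p0 q) * \<omega> p q"
      using True by (simp add: \<psi>_def \<rho>_def \<omega>_def algebra_simps)
    then show ?thesis using mult_right_mono[OF r(2)[OF True] chi0[OF q]] chi0[OF q, of p] by (simp add: abs_mult)
  next
    case False
    then have "q \<in> - C p" using C(2) by blast
    then show ?thesis by (simp add: \<psi>_def \<omega>_def out)
  qed
  have close: "\<bar>\<phi> q - dst p0 q\<bar> \<le> 1" if q: "q \<in> K" for q
  proof -
    have qW: "q \<in> W" using q KW by blast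
    have "\<phi> q - dst p0 q = (\<Sum>p\<in>I. \<psi> p q - dst p0 q * \<omega> p q)"
      using chi_sum[OF qW] by (simp add: \<phi>_def sum_subtractf flip: sum_distrib_left)
    also have "\<bar>\<dots>\<bar> \<le> (\<Sum>p\<in>I. \<eta> * \<omega> p q)" by (intro order_trans[OF sum_abs] sum_mono psi_close qW)
    also have "\<dots> = \<eta>" using chi_sum[OF qW] by (simp flip: sum_distrib_left)
    finally show ?thesis using eta(2) by simp
  qed
  have "grad_bound \<phi> q 5" if q: "q \<in> K" for q
  proof -
    have qW: "q \<in> W" using q KW by blast
    obtain c where c: "c \<in> A" "q \<in> fst c" using chart_exists by blast
    have qc: "snd c q \<in> codom c" using c(2) by blast
    have "\<bar>der c \<phi> q v\<bar> \<le> 5 * gnorm c (snd c q) v" for v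
    proof -
      let ?g = "gnorm c (snd c q) v"
      have g0: "0 \<le> ?g" by (rule gnorm_nonneg[OF c(1) qc])
      have each: "\<bar>der c (\<psi> p) q v - dst p0 q * der c (\<omega> p) q v\<bar> \<le> \<omega> p q * (4 * ?g) + \<eta> * (L p * ?g)" for p
      proof (cases "q \<in> U p")
        case True
        have UW: "open (U p \<inter> W)" "q \<in> U p \<inter> W" using U W True qW by auto
        have "der c (\<psi> p) q = der c (\<lambda>q. \<omega> p q * r p q) q"
          by (rule der_cong[OF UW c]) (simp add: \<psi>_def \<rho>_def \<omega>_def)
        moreover have "der c (\<lambda>q. \<omega> p q * r p q) q v = \<omega> p q * der c (r p) q v + der c (\<omega> p) q v * r p q"
          by (rule der_mult[OF mC1_subset[OF chi1] mC1_subset[OF r(1)] UW(2) c]) auto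
        ultimately have eq: "der c (\<psi> p) q v - dst p0 q * der c (\<omega> p) q v
            = \<omega> p q * der c (r p) q v + (r p q - dst p0 q) * der c (\<omega> p) q v"
          by (simp add: algebra_simps)
        have "\<bar>\<omega> p q * der c (r p) q v\<bar> \<le> \<omega> p q * (4 * ?g)"
          using mult_left_mono[OF grad_boundD[OF r(3)[OF True] c, of v] chi0[OF qW]] chi0[OF qW, of p] by (simp add: abs_mult)
        moreover have "\<bar>(r p q - dst p0 q) * der c (\<omega> p) q v\<bar> \<le> \<eta> * (L p * ?g)"
          unfolding abs_mult by (rule mult_mono[OF r(2)[OF True] grad_boundD[OF L(2)[OF q] c]]) (use eta in simp_all)
        ultimately show ?thesis unfolding eq by linarith
      next
        case False
        have CW: "open (- C p \<inter> W)" "q \<in> - C p \<inter> W"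
          using compact_imp_closed[OF C(1), of p] W False C(2)[of p] qW by auto
        have "der c (\<psi> p) q v = 0" "der c (\<omega> p) q v = 0"
          by (rule der_eq_0_open[OF CW c], simp add: \<psi>_def \<omega>_def out)+
        then show ?thesis using chi0[OF qW, of p] g0 eta(1) L(1)[of p] by simp
      qed
      have "(\<Sum>p\<in>I. der c (\<omega> p) q v) = der c (\<lambda>q. \<Sum>p\<in>I. \<omega> p q) q v"
        by (rule der_sum[symmetric, OF chi1 qW c])
      also have "\<dots> = der c (\<lambda>_. 1) q v"
        using der_cong[OF W qW c, of "\<lambda>q. \<Sum>p\<in>I. \<omega> p q" "\<lambda>_. 1"] chi_sum by simp
      also have "\<dots> = 0" by (rule der_const[OF c(1)])
      finally have z: "(\<Sum>p\<in>I. der c (\<omega> p) q v) = 0" .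
      have "der c \<phi> q v = (\<Sum>p\<in>I. der c (\<psi> p) q v)"
        unfolding \<phi>_def by (rule der_sum[OF psi1 qW c])
      also have "\<dots> = (\<Sum>p\<in>I. der c (\<psi> p) q v - dst p0 q * der c (\<omega> p) q v)"
        using z by (simp add: sum_subtractf flip: sum_distrib_left)
      also have "\<bar>\<dots>\<bar> \<le> (\<Sum>p\<in>I. \<omega> p q * (4 * ?g) + \<eta> * (L p * ?g))"
        by (intro order_trans[OF sum_abs] sum_mono each)
      also have "\<dots> = 4 * ?g + \<eta> * (\<Sum>p\<in>I. L p) * ?g"
        using chi_sum[OF qW] by (simp add: sum.distrib mult.assoc flip: sum_distrib_left sum_distrib_right)
      also have "\<dots> \<le> 4 * ?g + 1 * ?g" by (intro add_left_mono mult_right_mono eta(3) g0)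
      finally show ?thesis by simp
    qed
    then show ?thesis by (rule grad_boundI[OF phi1 W qW c])
  qed
  then show ?thesis using W KW phi1 close by (intro exI[of _ W] exI[of _ \<phi>]) simp
qed

text \<open>The smooth distance \<open>\<phi>\<close> is within 1 of the distance on the ball of
  radius \<open>4 * R\<close>. Where the distance is at most \<open>R\<close>, \<open>\<phi>\<close>
  is at most \<open>2 * R\<close> and the profile \<open>\<theta>\<close> is at least
  \<open>(5 / 9)^2\<close>, which exceeds \<open>1 / 4\<close>. Beyond \<open>3 * R + 1\<close>,
  which is below \<open>4 * R\<close>, it vanishes. The slope of \<open>\<theta>\<close> is at most
  \<open>4 / (3 * R)\<close>, hence at most \<open>7 / (5 * R)\<close>, and the gradient bound 5 of
  \<open>\<phi>\<close> turns this into \<open>7 / R\<close>.\<close>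

lemma exists_cutoff:
  assumes complete: "complete_riemannian A g" and R: "R > 1"
  shows "\<exists>\<Phi> C. mC1 UNIV \<Phi> \<and> compact C \<and> (\<forall>q. q \<notin> C \<longrightarrow> \<Phi> q = 0) \<and> (\<forall>q. 0 \<le> \<Phi> q) \<and>
     (\<forall>q. dst p0 q \<le> R \<longrightarrow> 1 / 4 \<le> \<Phi> q) \<and> (\<forall>q. grad_bound \<Phi> q (7 / R))"
proof -
  define K where "K = {q. dst p0 q \<le> 4 * R}"
  have K: "compact K" unfolding K_def by (rule compact_dst_ball[OF complete])
  obtain W \<phi> where W: "open W" "K \<subseteq> W" and phi: "mC1 W \<phi>"
    and close: "\<And>q. q \<in> K \<Longrightarrow> \<bar>\<phi> q - dst p0 q\<bar> \<le> 1" and gb: "\<And>q. q \<in> K \<Longrightarrow> grad_bound \<phi> q 5"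
    using exists_smooth_dst[OF K, of p0] by (elim exE conjE) (rule that, auto)
  define V where "V = {q. dst p0 q < 4 * R}"
  have V: "open V" unfolding V_def by (intro open_Collect_less continuous_dst continuous_on_const)
  have VK: "V \<subseteq> K" by (auto simp: V_def K_def)
  define C where "C = {q. dst p0 q \<le> 3 * R + 1}"
  have C: "compact C" unfolding C_def by (rule compact_dst_ball[OF complete])
  have CV: "C \<subseteq> V" using R by (auto simp: C_def V_def)
  define \<theta> where "\<theta> y = pos_sq (1 - (y / (3 * R))\<^sup>2)" for y
  have theta1: "Ck_on 1 UNIV \<theta>"
    unfolding \<theta>_def
    by (rule Ck_on_compose[OF open_UNIV Ck_on_pos_sq])
      (intro Ck_on_diff Ck_on_power Ck_on_divide Ck_on_const Ck_on_ident open_UNIV, use R in simp_all)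
  have theta_der: "(\<theta> has_real_derivative 2 * max 0 (1 - (y / (3 * R))\<^sup>2) * (- 2 * y / (9 * R\<^sup>2))) (at y)" for y
    unfolding \<theta>_def
  proof (rule DERIV_chain2[OF pos_sq_derivative])
    show "((\<lambda>y. 1 - (y / (3 * R))\<^sup>2) has_real_derivative - 2 * y / (9 * R\<^sup>2)) (at y)"
      using R by (auto intro!: derivative_eq_intros simp: power2_eq_square field_simps)
  qed
  have theta_bound: "\<bar>2 * max 0 (1 - (y / (3 * R))\<^sup>2) * (- 2 * y / (9 * R\<^sup>2))\<bar> \<le> 7 / (5 * R)" for y
  proof (cases "\<bar>y\<bar> \<le> 3 * R")
    case True
    have "\<bar>- 2 * y / (9 * R\<^sup>2)\<bar> \<le> (2 * (3 * R)) / (9 * R\<^sup>2)"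
      unfolding abs_divide abs_mult by (intro divide_mono) (use True R in simp_all)
    also have "\<dots> = 2 / (3 * R)" using R by (simp add: power2_eq_square field_simps)
    finally have 1: "\<bar>- 2 * y / (9 * R\<^sup>2)\<bar> \<le> 2 / (3 * R)" .
    have "\<bar>2 * max 0 (1 - (y / (3 * R))\<^sup>2)\<bar> \<le> 2" by (simp add: max_def)
    then have "\<bar>2 * max 0 (1 - (y / (3 * R))\<^sup>2) * (- 2 * y / (9 * R\<^sup>2))\<bar> \<le> 2 * (2 / (3 * R))"
      unfolding abs_mult by (rule mult_mono[OF _ 1[unfolded abs_mult], unfolded abs_mult]) simp_all
    also have "\<dots> \<le> 7 / (5 * R)" using R by (simp add: field_simps)
    finally show ?thesis .
  next
    case False
    then have "1 \<le> \<bar>y / (3 * R)\<bar>" using R by (simp add: abs_divide)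
    then have "1\<^sup>2 \<le> \<bar>y / (3 * R)\<bar>\<^sup>2" by (rule power_mono) simp
    then have "1 \<le> (y / (3 * R))\<^sup>2" by (simp only: power2_abs one_power2)
    then have "max 0 (1 - (y / (3 * R))\<^sup>2) = 0" by simp
    then show ?thesis using R by simp
  qed
  define \<Phi> where "\<Phi> q = (if q \<in> V then \<theta> (\<phi> q) else 0)" for q
  have phiV: "mC1 V \<phi>" by (rule mC1_subset[OF phi]) (use VK W in blast)
  have thV: "mC1 V (\<lambda>q. \<theta> (\<phi> q))" by (rule mC1_compose[OF V phiV theta1]) simp
  have z: "\<theta> (\<phi> q) = 0" if q: "q \<in> V - C" for q
  proof -
    have "3 * R \<le> \<phi> q" using close[of q] q VK by (auto simp: C_def)
    then have "1 \<le> \<phi> q / (3 * R)" using R by simp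
    then have "1 \<le> (\<phi> q / (3 * R))\<^sup>2" using power_mono[of 1 "\<phi> q / (3 * R)" 2] by simp
    then show ?thesis unfolding \<theta>_def by (intro pos_sq_eq_0) simp
  qed
  have Phi1: "mC1 UNIV \<Phi>"
    unfolding \<Phi>_def by (rule mC1_extend[OF compact_imp_closed[OF C] V CV thV z])
  have Phi0: "\<Phi> q = 0" if "q \<notin> C" for q using z[of q] that by (simp add: \<Phi>_def)
  have "1 / 4 \<le> \<Phi> q" if q: "dst p0 q \<le> R" for q
  proof -
    have qV: "q \<in> V" using q R by (simp add: V_def)
    then have "\<bar>\<phi> q - dst p0 q\<bar> \<le> 1" using close VK by blast
    then have "\<bar>\<phi> q\<bar> \<le> 2 * R" using q R dst_nonneg[of p0 q] by linarith
    then have "\<bar>\<phi> q / (3 * R)\<bar> \<le> 2 / 3" using R by (simp add: abs_divide divide_le_eq)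
    then have "\<bar>\<phi> q / (3 * R)\<bar>\<^sup>2 \<le> (2 / 3)\<^sup>2" by (rule power_mono) simp
    then have "(\<phi> q / (3 * R))\<^sup>2 \<le> (2 / 3)\<^sup>2" by (simp only: power2_abs)
    then have "5 / 9 \<le> 1 - (\<phi> q / (3 * R))\<^sup>2" by (simp add: power2_eq_square)
    then have "(5 / 9)\<^sup>2 \<le> \<theta> (\<phi> q)" unfolding \<theta>_def pos_sq_def by (intro power_mono) auto
    then show ?thesis using qV by (simp add: \<Phi>_def power2_eq_square)
  qed
  moreover have "grad_bound \<Phi> q (7 / R)" for q
  proof -
    obtain c where c: "c \<in> A" "q \<in> fst c" using chart_exists by blast
    have g0: "0 \<le> gnorm c (snd c q) v" for v using gnorm_nonneg[OF c(1)] c(2) by blast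
    have "\<bar>der c \<Phi> q v\<bar> \<le> 7 / R * gnorm c (snd c q) v" for v
    proof (cases "q \<in> V")
      case True
      have qK: "q \<in> K" using True VK by blast
      have "der c \<Phi> q = der c (\<lambda>q. \<theta> (\<phi> q)) q" by (rule der_cong[OF V True c]) (simp add: \<Phi>_def)
      then have "\<bar>der c \<Phi> q v\<bar> = \<bar>2 * max 0 (1 - (\<phi> q / (3 * R))\<^sup>2) * (- 2 * \<phi> q / (9 * R\<^sup>2))\<bar> * \<bar>der c \<phi> q v\<bar>"
        using der_compose[OF phiV True c theta_der, of v] by (simp only: abs_mult)
      also have "\<dots> \<le> 7 / (5 * R) * (5 * gnorm c (snd c q) v)"
        by (rule mult_mono[OF theta_bound grad_boundD[OF gb[OF qK] c]]) (use R in simp_all)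
      finally show ?thesis by simp
    next
      case False
      have "der c \<Phi> q v = 0"
        by (rule der_eq_0_open[of "- C"]) (use False CV C c Phi0 in \<open>auto simp: compact_imp_closed\<close>)
      then show ?thesis using g0 R by simp
    qed
    then show ?thesis by (rule grad_boundI[OF Phi1 open_UNIV UNIV_I c])
  qed
  moreover have "0 \<le> \<Phi> q" for q by (simp add: \<Phi>_def \<theta>_def pos_sq_nonneg)
  ultimately show ?thesis using Phi1 C Phi0 by (intro exI[of _ \<Phi>] exI[of _ C]) simp
qed

end

section \<open>Integration over the manifold\<close>

locale riem_volume = riem A g
  for A :: "('p::{t2_space,second_countable_topology}, 'm::finite) chart set" and g :: "('p, 'm) metric" +
  fixes \<mu> :: "'p measure"
  assumes vol: "riemannian_volume A g \<mu>"
begin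

lemma sets_vol[simp, measurable_cong]: "sets \<mu> = sets borel"
  using vol by (simp add: riemannian_volume_def)

lemma space_vol[simp]: "space \<mu> = UNIV"
  using sets_eq_imp_space_eq[OF sets_vol] by simp

lemma emeasure_vol:
  assumes "c \<in> A" "S \<in> sets borel" "S \<subseteq> fst c"
  shows "emeasure \<mu> S = (\<integral>\<^sup>+ x. ennreal (sqrt (det (g c x))) * indicator (snd c ` S) x \<partial>lborel)"
  using vol assms unfolding riemannian_volume_def by blast

lemma det_pos: "c \<in> A \<Longrightarrow> x \<in> codom c \<Longrightarrow> det (g c x) > 0"
  using det_pos_orthonormal spd_exists_orthonormal[OF metric_spd] by blast

lemma sqrt_det_continuous: "c \<in> A \<Longrightarrow> continuous_on (codom c) (\<lambda>x. sqrt (det (g c x)))"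
proof -
  assume c: "c \<in> A"
  have "Ck_on 0 (codom c) (\<lambda>x. det (g c x))"
    unfolding det_def
    by (intro Ck_on_sum Ck_on_mult Ck_on_const Ck_on_prod Ck_on_nth open_codom smooth_onD[OF metric_smooth] c)
  then show ?thesis by (simp add: continuous_on_real_sqrt)
qed

text \<open>The inverse chart made total by a constant value off its domain, so that it is Borel on
  the whole space.\<close>

definition to_manifold :: "('p, 'm) chart \<Rightarrow> real ^ 'm \<Rightarrow> 'p" where
  "to_manifold c x = (if x \<in> codom c then chart_inv c x else undefined)"

lemma to_manifold_vimage:
  assumes "c \<in> A"
  shows "to_manifold c -` S \<inter> codom c = snd c ` (S \<inter> fst c)"
proof -
  have "to_manifold c -` S \<inter> codom c = codom c \<inter> chart_inv c -` S" by (auto simp: to_manifold_def)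
  then show ?thesis using chart_image_eq[OF assms, of S] by (simp add: Int_commute)
qed

lemma to_manifold_measurable:
  assumes c: "c \<in> A"
  shows "to_manifold c \<in> borel_measurable borel"
proof (rule borel_measurableI)
  fix S :: "'p set" assume S: "open S"
  have o: "open (to_manifold c -` S \<inter> codom c)"
    unfolding to_manifold_vimage[OF c] using open_chart_image[OF c S] by (simp add: Int_commute)
  have "to_manifold c -` S = (to_manifold c -` S \<inter> codom c) \<union> (if undefined \<in> S then - codom c else {})"
    by (auto simp: to_manifold_def split: if_splits)
  moreover have "\<dots> \<in> sets borel" using o open_codom[OF c] by (auto intro!: sets.Un borel_open borel_closed)
  ultimately show "to_manifold c -` S \<inter> space borel \<in> sets borel" by simp
qed

text \<open>The volume restricted to the chart domain is the image under \<open>to_manifold\<close>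
  of Lebesgue measure with density \<open>w\<close>; the two measures are compared on Borel
  sets.\<close>

lemma integral_chart:
  fixes \<phi> :: "'p \<Rightarrow> real"
  assumes c: "c \<in> A" and phi: "\<phi> \<in> borel_measurable borel" "\<And>p. p \<notin> fst c \<Longrightarrow> \<phi> p = 0"
  shows "integral\<^sup>L \<mu> \<phi> = integral\<^sup>L lborel (\<lambda>x. indicator (codom c) x * (sqrt (det (g c x)) * \<phi> (chart_inv c x)))"
proof -
  let ?T = "to_manifold c"
  define w where "w x = indicator (codom c) x * sqrt (det (g c x))" for x
  have w: "w \<in> borel_measurable borel"
    using borel_measurable_continuous_on_indicator[OF _ sqrt_det_continuous[OF c]] open_codom[OF c]
    unfolding w_def[abs_def] by simp
  have w0: "0 \<le> w x" for x using det_pos[OF c] by (auto simp: w_def indicator_def less_imp_le)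
  have i: "(\<lambda>p. indicator (fst c) p :: real) \<in> borel_measurable \<mu>"
    using open_dom[OF c] by (intro borel_measurable_indicator) simp
  have T: "?T \<in> lborel \<rightarrow>\<^sub>M borel" using to_manifold_measurable[OF c] by simp
  have Tw: "?T \<in> density lborel (\<lambda>x. ennreal (w x)) \<rightarrow>\<^sub>M borel" using T by simp
  have eq: "density \<mu> (\<lambda>p. ennreal (indicator (fst c) p)) = distr (density lborel (\<lambda>x. ennreal (w x))) borel ?T"
  proof (rule measure_eqI)
    fix S assume "S \<in> sets (density \<mu> (\<lambda>p. ennreal (indicator (fst c) p)))"
    then have S: "S \<in> sets borel" by simp
    have SI: "S \<inter> fst c \<in> sets borel" using S open_dom[OF c] by auto
    have TS: "?T -` S \<in> sets borel" using measurable_sets[OF to_manifold_measurable[OF c] S] by simp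
    have "emeasure (density \<mu> (\<lambda>p. ennreal (indicator (fst c) p))) S = (\<integral>\<^sup>+ p. ennreal (indicator (fst c) p) * indicator S p \<partial>\<mu>)"
      using i S by (intro emeasure_density) auto
    also have "\<dots> = (\<integral>\<^sup>+ p. indicator (S \<inter> fst c) p \<partial>\<mu>)"
      by (intro nn_integral_cong) (auto simp: indicator_def)
    also have "\<dots> = emeasure \<mu> (S \<inter> fst c)" using SI by simp
    also have "\<dots> = (\<integral>\<^sup>+ x. ennreal (sqrt (det (g c x))) * indicator (snd c ` (S \<inter> fst c)) x \<partial>lborel)"
      by (rule emeasure_vol[OF c SI]) simp
    also have "\<dots> = (\<integral>\<^sup>+ x. ennreal (w x) * indicator (?T -` S) x \<partial>lborel)"
      unfolding to_manifold_vimage[OF c, symmetric]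
      by (intro nn_integral_cong) (simp add: w_def indicator_def)
    also have "\<dots> = emeasure (density lborel (\<lambda>x. ennreal (w x))) (?T -` S)"
      using w TS by (intro emeasure_density[symmetric]) auto
    also have "\<dots> = emeasure (distr (density lborel (\<lambda>x. ennreal (w x))) borel ?T) S"
      using emeasure_distr[OF Tw S] by simp
    finally show "emeasure (density \<mu> (\<lambda>p. ennreal (indicator (fst c) p))) S
      = emeasure (distr (density lborel (\<lambda>x. ennreal (w x))) borel ?T) S" .
  qed simp
  have phim: "\<phi> \<in> borel_measurable \<mu>" using phi(1) by simp
  have "integral\<^sup>L \<mu> \<phi> = integral\<^sup>L \<mu> (\<lambda>p. indicator (fst c) p *\<^sub>R \<phi> p)"
    by (rule Bochner_Integration.integral_cong) (auto simp: indicator_def phi(2))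
  also have "\<dots> = integral\<^sup>L (density \<mu> (\<lambda>p. ennreal (indicator (fst c) p))) \<phi>"
    by (rule integral_density[symmetric, OF phim i]) simp
  also have "\<dots> = integral\<^sup>L (density lborel (\<lambda>x. ennreal (w x))) (\<lambda>x. \<phi> (?T x))"
    unfolding eq by (rule integral_distr[OF Tw phi(1)])
  also have "\<dots> = integral\<^sup>L lborel (\<lambda>x. w x *\<^sub>R \<phi> (?T x))"
    by (rule integral_density) (use measurable_compose[OF T phi(1)] w w0 in auto)
  also have "\<dots> = integral\<^sup>L lborel (\<lambda>x. indicator (codom c) x * (sqrt (det (g c x)) * \<phi> (chart_inv c x)))"
    by (rule Bochner_Integration.integral_cong) (auto simp: w_def to_manifold_def indicator_def)
  finally show ?thesis .
qed

section \<open>Local finiteness and full support of the volume\<close>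

lemma chart_ball_measure:
  fixes p :: 'p
  shows "\<exists>W. open W \<and> p \<in> W \<and> emeasure \<mu> W < \<infinity>"
proof -
  obtain c where c: "c \<in> A" "p \<in> fst c" using chart_exists by blast
  have "snd c p \<in> codom c" using c(2) by blast
  then obtain r where r: "r > 0" "cball (snd c p) r \<subseteq> codom c"
    using open_codom[OF c(1)] open_contains_cball by blast
  have sub: "ball (snd c p) r \<subseteq> codom c" using r(2) ball_subset_cball by blast
  define W where "W = chart_inv c ` ball (snd c p) r"
  have W: "open W" unfolding W_def by (rule open_chart_inv_image[OF c(1) sub]) simp
  have pW: "p \<in> W" unfolding W_def
    by (rule image_eqI[of _ _ "snd c p"]) (use r(1) chart_inv_left[OF c] in auto)
  have WS: "W \<subseteq> fst c" unfolding W_def using chart_inv_in[OF c(1)] sub by blast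
  have "snd c ` W = ball (snd c p) r"
  proof -
    have "snd c ` W = (\<lambda>x. snd c (chart_inv c x)) ` ball (snd c p) r" by (simp add: W_def image_image)
    also have "\<dots> = (\<lambda>x. x) ` ball (snd c p) r"
      by (rule image_cong[OF refl]) (rule chart_inv_right[OF c(1)], use sub in blast)
    finally show ?thesis by simp
  qed
  then have e: "emeasure \<mu> W = (\<integral>\<^sup>+ x. ennreal (sqrt (det (g c x))) * indicator (ball (snd c p) r) x \<partial>lborel)"
    using emeasure_vol[OF c(1) _ WS] W by simp
  have "bounded ((\<lambda>x. sqrt (det (g c x))) ` cball (snd c p) r)"
    by (intro compact_imp_bounded compact_continuous_image continuous_on_subset[OF sqrt_det_continuous[OF c(1)] r(2)]) simp
  then obtain B where B0: "\<forall>y\<in>(\<lambda>x. sqrt (det (g c x))) ` cball (snd c p) r. norm y \<le> B"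
    unfolding bounded_iff by blast
  have B: "sqrt (det (g c x)) \<le> B" if "x \<in> cball (snd c p) r" for x
    using bspec[OF B0 imageI[OF that]] unfolding real_norm_def by linarith
  have "emeasure \<mu> W \<le> (\<integral>\<^sup>+ x. ennreal B * indicator (ball (snd c p) r) x \<partial>lborel)"
    unfolding e by (rule nn_integral_mono) (use B in \<open>auto simp: indicator_def intro!: ennreal_leI\<close>)
  also have "\<dots> = ennreal B * emeasure lborel (ball (snd c p) r)" by (rule nn_integral_cmult_indicator) simp
  also have "\<dots> < \<infinity>"
    using emeasure_bounded_finite[OF bounded_ball, of "snd c p" r] by (simp add: ennreal_mult_less_top)
  finally show ?thesis using W pW by blast
qed

lemma emeasure_compact_finite:
  assumes K: "compact K"
  shows "emeasure \<mu> K < \<infinity>"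
proof -
  obtain W where W: "\<forall>p. open (W p) \<and> p \<in> W p \<and> emeasure \<mu> (W p) < \<infinity>"
    using choice[of "\<lambda>p W. open W \<and> p \<in> W \<and> emeasure \<mu> W < \<infinity>"] chart_ball_measure by auto
  obtain I where I: "finite I" "K \<subseteq> (\<Union>p\<in>I. W p)"
    by (rule compactE_image[OF K, of K W]) (use W in auto)
  have "emeasure \<mu> K \<le> emeasure \<mu> (\<Union>p\<in>I. W p)"
    by (rule emeasure_mono[OF I(2)]) (use W I(1) in auto)
  also have "\<dots> \<le> (\<Sum>p\<in>I. emeasure \<mu> (W p))"
    by (rule emeasure_subadditive_finite[OF I(1)]) (use W in auto)
  also have "\<dots> < \<infinity>" using I(1) W by (simp add: less_top)
  finally show ?thesis .
qed

lemma integrable_compact_support: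
  fixes \<phi> :: "'p \<Rightarrow> real"
  assumes phi: "continuous_on UNIV \<phi>" and K: "compact K" "\<And>p. p \<notin> K \<Longrightarrow> \<phi> p = 0"
  shows "integrable \<mu> \<phi>"
proof -
  have "bounded (\<phi> ` K)"
    by (intro compact_imp_bounded compact_continuous_image continuous_on_subset[OF phi] K) simp
  then obtain B where B: "\<And>p. p \<in> K \<Longrightarrow> \<bar>\<phi> p\<bar> \<le> B" by (auto simp: bounded_iff)
  show ?thesis
  proof (rule Bochner_Integration.integrable_bound)
    have "K \<in> sets \<mu>" using compact_imp_closed[OF K(1)] by simp
    then show "integrable \<mu> (\<lambda>p. B * indicator K p)"
      using emeasure_compact_finite[OF K(1)] by (intro integrable_mult_right integrable_real_indicator)
    show "\<phi> \<in> borel_measurable \<mu>" using borel_measurable_continuous_onI[OF phi] by simp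
    have "norm (\<phi> p) \<le> norm (B * indicator K p :: real)" for p
      using B[of p] K(2)[of p] by (cases "p \<in> K") auto
    then show "AE p in \<mu>. norm (\<phi> p) \<le> norm (B * indicator K p)" by simp
  qed
qed

text \<open>The density is positive, so a null set would have a Lebesgue null image in the chart,
  and the image of an open neighbourhood is open and nonempty.\<close>

lemma emeasure_open_pos:
  assumes W: "open W" "p \<in> W"
  shows "emeasure \<mu> W > 0"
proof -
  obtain c where c: "c \<in> A" "p \<in> fst c" using chart_exists by blast
  let ?X = "snd c ` (fst c \<inter> W)"
  have X: "open ?X" "snd c p \<in> ?X" using open_chart_image[OF c(1) W(1)] W(2) c(2) by auto
  have XW: "fst c \<inter> W \<in> sets borel" using open_dom[OF c(1)] W(1) by auto
  have "emeasure \<mu> (fst c \<inter> W) = (\<integral>\<^sup>+ x. ennreal (sqrt (det (g c x))) * indicator ?X x \<partial>lborel)"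
    by (rule emeasure_vol[OF c(1) XW]) simp
  moreover have "\<dots> \<noteq> 0"
  proof
    assume 0: "(\<integral>\<^sup>+ x. ennreal (sqrt (det (g c x))) * indicator ?X x \<partial>lborel) = 0"
    have s: "?X \<subseteq> codom c" by blast
    have "(\<lambda>x. indicator ?X x *\<^sub>R sqrt (det (g c x))) \<in> borel_measurable borel"
      by (rule borel_measurable_continuous_on_indicator[OF _ continuous_on_subset[OF sqrt_det_continuous[OF c(1)] s]])
        (use X in simp)
    then have "(\<lambda>x. ennreal (indicator ?X x * sqrt (det (g c x)))) \<in> borel_measurable borel" by simp
    moreover have "(\<lambda>x. ennreal (indicator ?X x * sqrt (det (g c x)))) = (\<lambda>x. ennreal (sqrt (det (g c x))) * indicator ?X x)"
      by (auto simp: fun_eq_iff indicator_def)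
    ultimately have m: "(\<lambda>x. ennreal (sqrt (det (g c x))) * indicator ?X x) \<in> borel_measurable lborel" by simp
    have ae: "AE x in lborel. ennreal (sqrt (det (g c x))) * indicator ?X x = 0"
      using 0 nn_integral_0_iff_AE[OF m] by simp
    have pos: "ennreal (sqrt (det (g c x))) * indicator ?X x \<noteq> 0" if "x \<in> ?X" for x
    proof -
      have "det (g c x) > 0" using det_pos[OF c(1)] s that by blast
      then show ?thesis using that by simp
    qed
    have "AE x in lborel. x \<notin> ?X"
      by (rule AE_mp[OF ae]) (use pos in \<open>intro AE_I2, blast\<close>)
    then have "?X \<in> null_sets lborel" using X(1) by (subst (asm) AE_iff_null) auto
    then show False using X open_not_negligible[of ?X] negligible_iff_null_sets null_sets_completionI by blast
  qed
  ultimately have "emeasure \<mu> (fst c \<inter> W) > 0" by (simp add: zero_less_iff_neq_zero)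
  also have "emeasure \<mu> (fst c \<inter> W) \<le> emeasure \<mu> W" by (rule emeasure_mono) (use W in auto)
  finally show ?thesis .
qed

end

section \<open>Algebra of gradient inner products, and transition maps as isometries\<close>

context riem
begin

lemma grad_ip_sum:
  assumes "\<And>i. i \<in> I \<Longrightarrow> mC1 UNIV (\<phi> i)" "mC1 UNIV \<psi>"
  shows "grad_ip (\<lambda>p. \<Sum>i\<in>I. \<phi> i p) \<psi> p = (\<Sum>i\<in>I. grad_ip (\<phi> i) \<psi> p)"
proof -
  obtain c where c: "c \<in> A" "p \<in> fst c" using chart_exists by blast
  obtain e where e: "orthonormal (g c (snd c p)) e"
    using spd_exists_orthonormal[OF metric_spd'[OF c]] by auto
  have s: "mC1 UNIV (\<lambda>p. \<Sum>i\<in>I. \<phi> i p)" by (intro mC1_sum open_UNIV assms(1))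
  have "grad_ip (\<lambda>p. \<Sum>i\<in>I. \<phi> i p) \<psi> p = (\<Sum>j\<in>UNIV. \<Sum>i\<in>I. der c (\<phi> i) p (e j) * der c \<psi> p (e j))"
    by (simp add: grad_ip_orthonormal[OF s assms(2) open_UNIV UNIV_I c e] der_sum[OF assms(1) UNIV_I c] sum_distrib_right)
  also have "\<dots> = (\<Sum>i\<in>I. \<Sum>j\<in>UNIV. der c (\<phi> i) p (e j) * der c \<psi> p (e j))" by (rule sum.swap)
  also have "\<dots> = (\<Sum>i\<in>I. grad_ip (\<phi> i) \<psi> p)"
    by (rule sum.cong[OF refl]) (simp add: grad_ip_orthonormal[OF assms(1) assms(2) open_UNIV UNIV_I c e])
  finally show ?thesis .
qed

text \<open>Covers the test function of the Caccioppoli inequality: a squared cutoff times a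
  function of \<open>u\<close>.\<close>

lemma grad_ip_product:
  assumes "mC1 UNIV \<Phi>" "mC1 UNIV u" "(\<theta> has_real_derivative D) (at (u p))" "mC1 UNIV (\<lambda>p. \<theta> (u p))"
  shows "grad_ip (\<lambda>p. \<Phi> p * \<Phi> p * \<theta> (u p)) u p
    = 2 * \<Phi> p * \<theta> (u p) * grad_ip \<Phi> u p + (\<Phi> p)\<^sup>2 * D * grad_ip u u p"
proof -
  obtain c where c: "c \<in> A" "p \<in> fst c" using chart_exists by blast
  obtain e where e: "orthonormal (g c (snd c p)) e"
    using spd_exists_orthonormal[OF metric_spd'[OF c]] by auto
  note F = mC1_mult[OF open_UNIV assms(1,1)]
  have d: "der c (\<lambda>p. \<Phi> p * \<Phi> p * \<theta> (u p)) p v = 2 * \<Phi> p * \<theta> (u p) * der c \<Phi> p v + (\<Phi> p)\<^sup>2 * D * der c u p v" for v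
    unfolding der_mult[OF F assms(4) UNIV_I c] der_mult[OF assms(1,1) UNIV_I c] der_compose[OF assms(2) UNIV_I c assms(3)]
    by (simp add: power2_eq_square algebra_simps)
  show ?thesis
    unfolding grad_ip_orthonormal[OF mC1_mult[OF open_UNIV F assms(4)] assms(2) open_UNIV UNIV_I c e]
      grad_ip_orthonormal[OF assms(1,2) open_UNIV UNIV_I c e] grad_ip_orthonormal[OF assms(2,2) open_UNIV UNIV_I c e] d
    by (simp add: sum_distrib_left distrib_right mult.assoc flip: sum.distrib)
qed

lemma grad_ip_self_nonneg:
  assumes "mC1 UNIV \<phi>"
  shows "0 \<le> grad_ip \<phi> \<phi> p"
proof -
  obtain c where c: "c \<in> A" "p \<in> fst c" using chart_exists by blast
  obtain e where e: "orthonormal (g c (snd c p)) e"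
    using spd_exists_orthonormal[OF metric_spd'[OF c]] by auto
  show ?thesis unfolding grad_ip_orthonormal[OF assms assms open_UNIV UNIV_I c e] by (intro sum_nonneg) simp
qed

lemma grad_ip_Young:
  assumes "mC1 UNIV \<Phi>" "mC1 UNIV u" "\<delta> > 0"
  shows "- (2 * a * b * grad_ip \<Phi> u p) \<le> \<delta> * a\<^sup>2 * grad_ip u u p + b\<^sup>2 / \<delta> * grad_ip \<Phi> \<Phi> p"
proof -
  obtain c where c: "c \<in> A" "p \<in> fst c" using chart_exists by blast
  obtain e where e: "orthonormal (g c (snd c p)) e"
    using spd_exists_orthonormal[OF metric_spd'[OF c]] by auto
  have "- (2 * a * b * (y * x)) \<le> \<delta> * a\<^sup>2 * (x * x) + b\<^sup>2 / \<delta> * (y * y)" for x y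
  proof -
    \<comment> \<open>The square is completed separately in each component of an orthonormal
      basis.\<close>
    have "0 \<le> (\<delta> * a * x + b * y)\<^sup>2 / \<delta>" using assms(3) by simp
    also have "\<dots> = \<delta> * a\<^sup>2 * (x * x) + b\<^sup>2 / \<delta> * (y * y) + 2 * a * b * (y * x)"
      using assms(3) by (simp add: power2_eq_square field_simps)
    finally show ?thesis by simp
  qed
  then have "(\<Sum>i\<in>UNIV. - (2 * a * b * (der c \<Phi> p (e i) * der c u p (e i))))
    \<le> (\<Sum>i\<in>UNIV. \<delta> * a\<^sup>2 * (der c u p (e i) * der c u p (e i)) + b\<^sup>2 / \<delta> * (der c \<Phi> p (e i) * der c \<Phi> p (e i)))"
    by (intro sum_mono)
  then show ?thesis
    by (simp add: grad_ip_orthonormal[OF assms(1,2) open_UNIV UNIV_I c e] grad_ip_orthonormal[OF assms(1,1) open_UNIV UNIV_I c e]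
        grad_ip_orthonormal[OF assms(2,2) open_UNIV UNIV_I c e] sum_negf sum.distrib sum_distrib_left)
qed

text \<open>The transformation law in \<open>riemannian_manifold\<close> says that transition maps
  are isometric; as they preserve the dimension, \<open>second_form_codim_0\<close> applies to
  them.\<close>

lemma isometric_chart_map_trans:
  assumes "c \<in> A" "d \<in> A"
  shows "isometric_chart_map (local_dom id c d) (codom d) (trans c d) (g d) (g c)"
proof
  have sub: "local_dom id c d \<subseteq> codom c" by (auto simp: trans_dom)
  show "open (local_dom id c d)" "open (codom d)" using open_trans_dom[OF assms] open_codom[OF assms(2)] by auto
  show "smooth_on (local_dom id c d) (trans c d)" by (rule trans_smooth[OF assms])
  show "smooth_on (codom d) (g d)" by (rule metric_smooth[OF assms(2)])
  show "trans c d ` local_dom id c d \<subseteq> codom d"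
  proof
    fix y assume "y \<in> trans c d ` local_dom id c d"
    then obtain p where p: "p \<in> fst c" "p \<in> fst d" "y = trans c d (snd c p)" unfolding trans_dom by blast
    then show "y \<in> codom d" using trans_apply[OF assms(1) p(1), of d] by simp
  qed
  show "spd (g d y)" if "y \<in> codom d" for y by (rule metric_spd[OF assms(2) that])
  show "smooth_on (local_dom id c d) (g c)"
    using metric_smooth[OF assms(1)] Ck_on_subset[OF _ sub] unfolding smooth_on_def by blast
  show "spd (g c x)" if "x \<in> local_dom id c d" for x using metric_spd[OF assms(1)] sub that by blast
  show "ip (g c x) u v = ip (g d (trans c d x)) (frechet_derivative (trans c d) (at x) u)
      (frechet_derivative (trans c d) (at x) v)" if "x \<in> local_dom id c d" for x u v
    using riem assms that unfolding riemannian_manifold_def by blast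
qed

lemma grad_ip_eq_0_open:
  assumes "mC1 UNIV \<phi>" "mC1 UNIV \<psi>" "open W" "p \<in> W" "\<And>q. q \<in> W \<Longrightarrow> \<phi> q = 0"
  shows "grad_ip \<phi> \<psi> p = 0"
proof -
  obtain c where c: "c \<in> A" "p \<in> fst c" using chart_exists by blast
  obtain e where e: "orthonormal (g c (snd c p)) e"
    using spd_exists_orthonormal[OF metric_spd'[OF c]] by auto
  have "der c \<phi> p v = 0" for v by (rule der_eq_0_open[OF assms(3,4) c assms(5)])
  then show ?thesis by (simp add: grad_ip_orthonormal[OF assms(1,2) open_UNIV UNIV_I c e])
qed

end

section \<open>Isometric immersions and the norm of the mean curvature\<close>

locale immersion = src: riem A g + tgt: riem C h
  for A :: "('p::{t2_space,second_countable_topology}, 'm::finite) chart set" and g :: "('p, 'm) metric"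
    and C :: "('q::{t2_space,second_countable_topology}, 'n::finite) chart set" and h :: "('q, 'n) metric" +
  fixes f :: "'p \<Rightarrow> 'q"
  assumes imm: "isometric_immersion A g C h f"
begin

lemma f_continuous: "continuous_on UNIV f"
  using imm by (simp add: isometric_immersion_def smooth_map_def)

lemma open_f_preimage: "open X \<Longrightarrow> open (f -` X)"
  using f_continuous by (simp add: continuous_on_open_vimage[OF open_UNIV])

lemma local_dom_eq: "local_dom f c d = snd c ` (fst c \<inter> f -` fst d)"
  by (simp add: local_dom_def)

lemma open_local_dom: "c \<in> A \<Longrightarrow> d \<in> C \<Longrightarrow> open (local_dom f c d)"
  unfolding local_dom_eq by (intro src.open_chart_image open_f_preimage tgt.open_dom)

lemma local_dom_sub: "local_dom f c d \<subseteq> snd c ` fst c"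
  by (auto simp: local_dom_def)

lemma local_rep_apply: "c \<in> A \<Longrightarrow> p \<in> fst c \<Longrightarrow> local_rep f c d (snd c p) = snd d (f p)"
  by (simp add: local_rep_def src.chart_inv_left)

text \<open>The open set \<open>S\<close> is left free because two target charts are compared on a
  smaller set than the domain of either expression.\<close>

lemma isometric_chart_map_subset:
  assumes c: "c \<in> A" and d: "d \<in> C" and S: "open S" "S \<subseteq> local_dom f c d"
  shows "isometric_chart_map S (tgt.codom d) (local_rep f c d) (h d) (g c)"
proof
  have Sc: "S \<subseteq> src.codom c" using S(2) local_dom_sub by blast
  show "open S" "open (tgt.codom d)" using S tgt.open_codom[OF d] by auto
  show "smooth_on S (local_rep f c d)"
    using imm c d S(2) unfolding isometric_immersion_def smooth_map_def smooth_on_def by (meson Ck_on_subset)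
  show "smooth_on (tgt.codom d) (h d)" by (rule tgt.metric_smooth[OF d])
  show "local_rep f c d ` S \<subseteq> tgt.codom d"
  proof
    fix y assume "y \<in> local_rep f c d ` S"
    then obtain x where x: "x \<in> S" "y = local_rep f c d x" by blast
    then obtain p where p: "p \<in> fst c" "f p \<in> fst d" "x = snd c p" using S(2) unfolding local_dom_eq by blast
    then show "y \<in> tgt.codom d" using x(2) local_rep_apply[OF c p(1), of d] by simp
  qed
  show "spd (h d y)" if "y \<in> tgt.codom d" for y by (rule tgt.metric_spd[OF d that])
  show "smooth_on S (g c)" using src.metric_smooth[OF c] Sc unfolding smooth_on_def by (meson Ck_on_subset)
  show "spd (g c x)" if "x \<in> S" for x using src.metric_spd[OF c] Sc that by blast
  show "ip (g c x) u v = ip (h d (local_rep f c d x)) (frechet_derivative (local_rep f c d) (at x) u)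
      (frechet_derivative (local_rep f c d) (at x) v)" if "x \<in> S" for x u v
    using imm c d S(2) that unfolding isometric_immersion_def by blast
qed

lemma exists_frame:
  assumes "c \<in> A" "d \<in> C"
  shows "\<exists>E. orthonormal_frame_on (g c) (local_dom f c d) E"
proof -
  interpret isometric_chart_map "local_dom f c d" "tgt.codom d" "local_rep f c d" "h d" "g c"
    by (rule isometric_chart_map_subset[OF assms open_local_dom[OF assms] subset_refl])
  show ?thesis by (rule exists_orthonormal_frame[OF open_S G_smooth G_spd])
qed

end

locale mean_curvature_immersion = immersion A g C h f + src: riem_volume A g \<mu>
  for A :: "('p::{t2_space,second_countable_topology}, 'm::finite) chart set" and g :: "('p, 'm) metric"
    and C :: "('q::{t2_space,second_countable_topology}, 'n::finite) chart set" and h :: "('q, 'n) metric"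
    and f :: "'p \<Rightarrow> 'q" and \<mu> :: "'p measure" +
  fixes H :: "('p, 'q, 'n) section_along"
  assumes field: "mean_curvature_field A g C h f H"
begin

section \<open>The mean curvature as a section along \<open>f\<close>, and its squared
  length\<close>

lemma framed_subset:
  assumes "c \<in> A" "d \<in> C" "open S" "S \<subseteq> local_dom f c d" "orthonormal_frame_on (g c) S E"
  shows "framed_chart_map S (tgt.codom d) (local_rep f c d) (h d) (g c) E"
  by (intro framed_chart_map.intro framed_chart_map_axioms.intro isometric_chart_map_subset assms)

lemma field_eq:
  assumes "c \<in> A" "d \<in> C" "open S" "S \<subseteq> local_dom f c d" "orthonormal_frame_on (g c) S E" "x \<in> S"
  shows "H d (chart_inv c x) = mean_curvature (g c) (h d) (local_rep f c d) E x"
  using field assms unfolding mean_curvature_field_def is_local_frame_def by blast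

text \<open>\<open>mean_curvature_field\<close> prescribes \<open>H\<close> in each target chart by
  its own formula. A common frame on the overlap of the chart domains lets
  \<open>mean_curvature_transform\<close> compare the two.\<close>

lemma field_change:
  assumes d: "d \<in> C" "f p \<in> fst d" and d': "d' \<in> C" "f p \<in> fst d'"
  shows "H d' p = frechet_derivative (tgt.trans d d') (at (snd d (f p))) (H d p)"
proof -
  obtain c where c: "c \<in> A" "p \<in> fst c" using src.chart_exists by blast
  define S where "S = snd c ` (fst c \<inter> f -` (fst d \<inter> fst d'))"
  have S: "open S" unfolding S_def
    by (intro src.open_chart_image c open_f_preimage open_Int tgt.open_dom d d')
  have Sd: "S \<subseteq> local_dom f c d" and Sd': "S \<subseteq> local_dom f c d'" unfolding S_def local_dom_eq by blast+
  have x: "snd c p \<in> S" unfolding S_def using c d d' by blast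
  obtain E where "orthonormal_frame_on (g c) (local_dom f c d) E" using exists_frame[OF c(1) d(1)] by blast
  then have E: "orthonormal_frame_on (g c) S E" by (rule orthonormal_frame_on_subset[OF _ Sd])
  have rep: "local_rep f c d (snd c q) = snd d (f q)" "local_rep f c d' (snd c q) = snd d' (f q)" if "q \<in> fst c" for q
    by (rule local_rep_apply[OF c(1) that])+
  have T0: "local_rep f c d ` S \<subseteq> local_dom id d d'"
  proof
    fix y assume "y \<in> local_rep f c d ` S"
    then obtain q where q: "q \<in> fst c" "f q \<in> fst d" "f q \<in> fst d'" "y = local_rep f c d (snd c q)"
      unfolding S_def by blast
    then show "y \<in> local_dom id d d'" unfolding tgt.trans_dom rep[OF q(1)] by blast
  qed
  have F': "local_rep f c d' y = tgt.trans d d' (local_rep f c d y)" if yS: "y \<in> S" for y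
  proof -
    obtain q where q: "q \<in> fst c" "f q \<in> fst d" "y = snd c q" using yS unfolding S_def by blast
    show ?thesis unfolding q(3) rep[OF q(1)] tgt.trans_apply[OF d(1) q(2)] ..
  qed
  have "mean_curvature (g c) (h d') (local_rep f c d') E (snd c p)
    = frechet_derivative (tgt.trans d d') (at (local_rep f c d (snd c p))) (mean_curvature (g c) (h d) (local_rep f c d) E (snd c p))"
    by (rule mean_curvature_transform[OF framed_subset[OF c(1) d(1) S Sd E] framed_subset[OF c(1) d'(1) S Sd' E]
        tgt.isometric_chart_map_trans[OF d(1) d'(1)] T0 F' x])
  then show ?thesis
    using field_eq[OF c(1) d(1) S Sd E x] field_eq[OF c(1) d'(1) S Sd' E x]
    unfolding src.chart_inv_left[OF c] rep[OF c(2)] by simp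
qed

definition normsq :: "'p \<Rightarrow> real" where
  "normsq p = (section_norm C h f H p)\<^sup>2"

text \<open>\<open>section_norm\<close> uses a chosen target chart; \<open>field_change\<close> and
  the transformation law of the metric carry its value to any other.\<close>

lemma normsq_eq:
  assumes d: "d \<in> C" "f p \<in> fst d"
  shows "normsq p = ip (h d (snd d (f p))) (H d p) (H d p)"
proof -
  let ?d = "chart_at C (f p)"
  note d0 = tgt.chart_at_in[of "f p"]
  have "normsq p = ip (h ?d (snd ?d (f p))) (H ?d p) (H ?d p)"
    unfolding normsq_def section_norm_def Let_def
    by (rule real_sqrt_pow2[OF spd_nonneg[OF tgt.metric_spd'[OF d0]]])
  also have "\<dots> = ip (h d (snd d (f p))) (H d p) (H d p)"
    unfolding field_change[OF d0 d] by (rule tgt.metric_trans[OF d0(1) d(1) d0(2) d(2)])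
  finally show ?thesis .
qed

lemma section_norm_nonneg: "0 \<le> section_norm C h f H p"
  unfolding section_norm_def Let_def
  by (rule real_sqrt_ge_zero[OF spd_nonneg[OF tgt.metric_spd'[OF tgt.chart_at_in]]])

lemma normsq_nonneg: "0 \<le> normsq p"
  by (simp add: normsq_def)

lemma section_norm_eq: "section_norm C h f H p = sqrt (normsq p)"
  by (simp add: normsq_def section_norm_nonneg)

lemma field_eq_0:
  assumes "d \<in> C" "f p \<in> fst d" "normsq p = 0"
  shows "H d p = 0"
  using assms(3) spd_eq_0_iff[OF tgt.metric_spd'[OF assms(1,2)]] unfolding normsq_eq[OF assms(1,2)] by simp

lemma field_smooth:
  assumes c: "c \<in> A" and d: "d \<in> C"
  shows "Ck_on k (local_dom f c d) (H d \<circ> chart_inv c)"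
proof -
  obtain E where E: "orthonormal_frame_on (g c) (local_dom f c d) E" using exists_frame[OF c d] by blast
  interpret P: framed_chart_map "local_dom f c d" "tgt.codom d" "local_rep f c d" "h d" "g c" E
    by (rule framed_subset[OF c d open_local_dom[OF c d] subset_refl E])
  show ?thesis
    by (rule Ck_on_congI[OF P.open_S P.mean_curvature_smooth])
      (simp add: field_eq[OF c d P.open_S subset_refl E])
qed

lemma normsq_chart:
  assumes c: "c \<in> A" and d: "d \<in> C" and x: "x \<in> local_dom f c d"
  shows "(normsq \<circ> chart_inv c) x
    = ip (h d (local_rep f c d x)) ((H d \<circ> chart_inv c) x) ((H d \<circ> chart_inv c) x)"
proof -
  obtain p where p: "p \<in> fst c" "f p \<in> fst d" "x = snd c p" using x unfolding local_dom_eq by blast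
  show ?thesis
    unfolding p(3) o_apply src.chart_inv_left[OF c p(1)] local_rep_apply[OF c p(1)] by (rule normsq_eq[OF d p(2)])
qed

text \<open>One target chart may cover only part of the image of a source chart, so regularity is
  checked near each point with a suitable target chart.\<close>

lemma normsq_mC1: "src.mC1 UNIV normsq"
  unfolding src.mC1_def
proof
  fix c assume c: "c \<in> A"
  show "Ck_on 1 (snd c ` (fst c \<inter> UNIV)) (normsq \<circ> chart_inv c)"
  proof (rule Ck_on_locally)
    fix x assume "x \<in> snd c ` (fst c \<inter> UNIV)"
    then obtain p where p: "p \<in> fst c" "x = snd c p" by blast
    obtain d where d: "d \<in> C" "f p \<in> fst d" using tgt.chart_exists by blast
    obtain E where E: "orthonormal_frame_on (g c) (local_dom f c d) E" using exists_frame[OF c d(1)] by blast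
    interpret P: framed_chart_map "local_dom f c d" "tgt.codom d" "local_rep f c d" "h d" "g c" E
      by (rule framed_subset[OF c d(1) open_local_dom[OF c d(1)] subset_refl E])
    have "Ck_on 1 (local_dom f c d) (normsq \<circ> chart_inv c)"
      by (rule Ck_on_congI[OF P.open_S P.sq_smooth[OF field_smooth[OF c d(1)]]])
        (unfold P.sq_def, rule normsq_chart[OF c d(1)])
    moreover have "x \<in> local_dom f c d" unfolding local_dom_eq using p d by blast
    ultimately show "\<exists>U. open U \<and> x \<in> U \<and> Ck_on 1 U (normsq \<circ> chart_inv c)" using P.open_S by blast
  qed
qed

lemma grad_ip_chart_inv:
  assumes c: "c \<in> A" and S: "open S" "S \<subseteq> src.codom c" "x \<in> S"
    and phi: "src.mC1 UNIV \<phi>" "src.mC1 UNIV \<psi>"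
    and eq: "\<And>y. y \<in> S \<Longrightarrow> \<phi> (chart_inv c y) = \<phi>' y" "\<And>y. y \<in> S \<Longrightarrow> \<psi> (chart_inv c y) = \<psi>' y"
  shows "src.grad_ip \<phi> \<psi> (chart_inv c x) = cip (g c x) (frechet_derivative \<phi>' (at x)) (frechet_derivative \<psi>' (at x))"
proof -
  have xc: "x \<in> src.codom c" using S by blast
  have 1: "frechet_derivative (\<phi> \<circ> chart_inv c) (at x) = frechet_derivative \<phi>' (at x)"
    by (rule frechet_derivative_cong_open[OF S(1,3)]) (simp add: eq(1))
  have 2: "frechet_derivative (\<psi> \<circ> chart_inv c) (at x) = frechet_derivative \<psi>' (at x)"
    by (rule frechet_derivative_cong_open[OF S(1,3)]) (simp add: eq(2))
  show ?thesis
    unfolding src.grad_ip_chart[OF phi open_UNIV UNIV_I c src.chart_inv_in[OF c xc]] src.der_def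
      src.chart_inv_right[OF c xc] 1 2 ..
qed

text \<open>Transports \<open>superbiharmonic_weak\<close> to the manifold by
  \<open>integral_chart\<close>; the support of \<open>\<xi>\<close> lies in the domain of a single
  pair of charts.\<close>

lemma superbiharmonic_weak_local:
  assumes sb: "superbiharmonic \<epsilon> A g C h f H" and c: "c \<in> A" and d: "d \<in> C"
    and xi: "src.mC1 UNIV \<xi>" "\<And>p. 0 \<le> \<xi> p"
    and K: "compact K" "K \<subseteq> fst c \<inter> f -` fst d" "\<And>p. p \<notin> K \<Longrightarrow> \<xi> p = 0"
  shows "(\<integral>p. \<xi> p * (\<epsilon> * normsq p ^ 3 + \<epsilon> / 4 * src.grad_ip normsq normsq p) \<partial>\<mu>)
    \<le> - (\<integral>p. src.grad_ip (\<lambda>q. \<xi> q * normsq q) normsq p \<partial>\<mu>)"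
proof -
  let ?S = "local_dom f c d"
  obtain E where E: "orthonormal_frame_on (g c) ?S E" using exists_frame[OF c d] by blast
  interpret P: framed_chart_map ?S "tgt.codom d" "local_rep f c d" "h d" "g c" E
    by (rule framed_subset[OF c d open_local_dom[OF c d] subset_refl E])
  let ?V = "H d \<circ> chart_inv c" and ?xi = "\<lambda>x. \<xi> (chart_inv c x)"
  note S = P.open_S local_dom_sub[of c d]
  have u: "normsq (chart_inv c x) = P.sq ?V x" if "x \<in> ?S" for x
    using normsq_chart[OF c d that] by (simp add: P.sq_def)
  have prod: "src.mC1 UNIV (\<lambda>q. \<xi> q * normsq q)" by (intro src.mC1_mult open_UNIV xi normsq_mC1)
  have lf: "is_local_frame A g C f c d ?S E" unfolding is_local_frame_def using c d S(1) E by blast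
  have VH: "?V x = mean_curvature (g c) (h d) (local_rep f c d) E x" if "x \<in> ?S" for x
    using field_eq[OF c d S(1) subset_refl E that] by simp
  have eps: "0 \<le> \<epsilon>" using sb by (simp add: superbiharmonic_def)
  have sb': "ip (h d (local_rep f c d x)) (rough_laplacian (g c) (h d) (local_rep f c d) E ?V x) (?V x)
      \<ge> (\<epsilon> - 1) * norm_grad_sq (h d) (local_rep f c d) E ?V x" if "x \<in> ?S" for x
    using sb lf that unfolding superbiharmonic_def Let_def by blast
  have xi1: "Ck_on 1 ?S ?xi"
    using Ck_on_subset[OF src.mC1D[OF xi(1) c]] S(2) by (simp add: o_def del: Ck_on.simps One_nat_def)
  have KS: "compact (snd c ` K)"
    by (rule compact_continuous_image[OF continuous_on_subset[OF src.chart_cont[OF c]] K(1)]) (use K(2) in blast)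
  have KS': "snd c ` K \<subseteq> ?S" using K(2) unfolding local_dom_eq by blast
  have off: "chart_inv c x \<notin> K" if "x \<in> src.codom c" "x \<notin> snd c ` K" for x
    using src.chart_inv_right[OF c that(1)] that(2) by force
  have off': "?xi x = 0" if "x \<in> ?S - snd c ` K" for x
    using K(3)[OF off] that S(2) by blast
  have w: "(\<integral>x. indicator ?S x * (sqrt (det (g c x)) * (?xi x * (\<epsilon> * P.sq ?V x ^ 3 +
          \<epsilon> / 4 * cip (g c x) (frechet_derivative (P.sq ?V) (at x)) (frechet_derivative (P.sq ?V) (at x))))) \<partial>lborel)
      \<le> - (\<integral>x. indicator ?S x * (sqrt (det (g c x)) *
           cip (g c x) (frechet_derivative (\<lambda>y. ?xi y * P.sq ?V y) (at x)) (frechet_derivative (P.sq ?V) (at x))) \<partial>lborel)"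
    by (rule P.superbiharmonic_weak[OF field_smooth[OF c d] VH eps sb' xi1 xi(2) KS KS' off'])
  have gr: "src.grad_ip (\<lambda>q. \<xi> q * normsq q) normsq p = 0" if "p \<notin> K" for p
    by (rule src.grad_ip_eq_0_open[OF prod normsq_mC1, of "- K"])
      (use that K(3) compact_imp_closed[OF K(1)] in auto)
  have Kc: "p \<notin> K" if "p \<notin> fst c" for p using that K(2) by blast
  note cont = src.mC1_continuous[OF open_UNIV xi(1)] src.mC1_continuous[OF open_UNIV normsq_mC1]
    src.grad_ip_continuous[OF open_UNIV normsq_mC1 normsq_mC1] src.grad_ip_continuous[OF open_UNIV prod normsq_mC1]
  have L: "(\<integral>p. \<xi> p * (\<epsilon> * normsq p ^ 3 + \<epsilon> / 4 * src.grad_ip normsq normsq p) \<partial>\<mu>)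
    = (\<integral>x. indicator ?S x * (sqrt (det (g c x)) * (?xi x * (\<epsilon> * P.sq ?V x ^ 3 +
          \<epsilon> / 4 * cip (g c x) (frechet_derivative (P.sq ?V) (at x)) (frechet_derivative (P.sq ?V) (at x))))) \<partial>lborel)"
  proof (subst src.integral_chart[OF c])
    show "(\<lambda>p. \<xi> p * (\<epsilon> * normsq p ^ 3 + \<epsilon> / 4 * src.grad_ip normsq normsq p)) \<in> borel_measurable borel"
      by (intro borel_measurable_continuous_onI continuous_intros cont)
    show "\<xi> p * (\<epsilon> * normsq p ^ 3 + \<epsilon> / 4 * src.grad_ip normsq normsq p) = 0" if "p \<notin> fst c" for p
      using K(3)[OF Kc[OF that]] by simp
    show "(\<integral>x. indicator (src.codom c) x * (sqrt (det (g c x)) * (?xi x *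
        (\<epsilon> * normsq (chart_inv c x) ^ 3 + \<epsilon> / 4 * src.grad_ip normsq normsq (chart_inv c x)))) \<partial>lborel)
      = (\<integral>x. indicator ?S x * (sqrt (det (g c x)) * (?xi x * (\<epsilon> * P.sq ?V x ^ 3 +
          \<epsilon> / 4 * cip (g c x) (frechet_derivative (P.sq ?V) (at x)) (frechet_derivative (P.sq ?V) (at x))))) \<partial>lborel)"
    proof (rule Bochner_Integration.integral_cong[OF refl])
      fix x :: "real ^ 'm"
      \<comment> \<open>In the second case the source chart reaches \<open>x\<close>, but
        \<open>x\<close> lies outside the coordinate support of \<open>\<xi>\<close>, so both
        integrands vanish.\<close>
      consider "x \<in> ?S" | "x \<notin> ?S" "x \<in> src.codom c" | "x \<notin> ?S" "x \<notin> src.codom c" by blast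
      then show "indicator (src.codom c) x * (sqrt (det (g c x)) * (?xi x *
          (\<epsilon> * normsq (chart_inv c x) ^ 3 + \<epsilon> / 4 * src.grad_ip normsq normsq (chart_inv c x))))
        = indicator ?S x * (sqrt (det (g c x)) * (?xi x * (\<epsilon> * P.sq ?V x ^ 3 +
          \<epsilon> / 4 * cip (g c x) (frechet_derivative (P.sq ?V) (at x)) (frechet_derivative (P.sq ?V) (at x)))))"
      proof cases
        case 1
        then have "x \<in> src.codom c" using S(2) by blast
        then show ?thesis
          using 1 by (simp add: u grad_ip_chart_inv[OF c S 1 normsq_mC1 normsq_mC1 u u])
      next
        case 2
        then have "x \<notin> snd c ` K" using KS' by blast
        from K(3)[OF off[OF 2(2) this]] show ?thesis using 2 by simp
      next
        case 3
        then show ?thesis by simp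
      qed
    qed
  qed
  have R: "(\<integral>p. src.grad_ip (\<lambda>q. \<xi> q * normsq q) normsq p \<partial>\<mu>)
    = (\<integral>x. indicator ?S x * (sqrt (det (g c x)) *
           cip (g c x) (frechet_derivative (\<lambda>y. ?xi y * P.sq ?V y) (at x)) (frechet_derivative (P.sq ?V) (at x))) \<partial>lborel)"
  proof (subst src.integral_chart[OF c])
    show "src.grad_ip (\<lambda>q. \<xi> q * normsq q) normsq \<in> borel_measurable borel"
      by (intro borel_measurable_continuous_onI cont)
    show "src.grad_ip (\<lambda>q. \<xi> q * normsq q) normsq p = 0" if "p \<notin> fst c" for p
      by (rule gr[OF Kc[OF that]])
    show "(\<integral>x. indicator (src.codom c) x * (sqrt (det (g c x)) *
        src.grad_ip (\<lambda>q. \<xi> q * normsq q) normsq (chart_inv c x)) \<partial>lborel)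
      = (\<integral>x. indicator ?S x * (sqrt (det (g c x)) *
           cip (g c x) (frechet_derivative (\<lambda>y. ?xi y * P.sq ?V y) (at x)) (frechet_derivative (P.sq ?V) (at x))) \<partial>lborel)"
    proof (rule Bochner_Integration.integral_cong[OF refl])
      fix x :: "real ^ 'm"
      consider "x \<in> ?S" | "x \<notin> ?S" "x \<in> src.codom c" | "x \<notin> ?S" "x \<notin> src.codom c" by blast
      then show "indicator (src.codom c) x * (sqrt (det (g c x)) *
          src.grad_ip (\<lambda>q. \<xi> q * normsq q) normsq (chart_inv c x))
        = indicator ?S x * (sqrt (det (g c x)) *
           cip (g c x) (frechet_derivative (\<lambda>y. ?xi y * P.sq ?V y) (at x)) (frechet_derivative (P.sq ?V) (at x)))"
      proof cases
        case 1
        then have xc: "x \<in> src.codom c" using S(2) by blast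
        have "src.grad_ip (\<lambda>q. \<xi> q * normsq q) normsq (chart_inv c x)
          = cip (g c x) (frechet_derivative (\<lambda>y. ?xi y * P.sq ?V y) (at x)) (frechet_derivative (P.sq ?V) (at x))"
          by (rule grad_ip_chart_inv[OF c S 1 prod normsq_mC1]) (simp_all add: u)
        then show ?thesis using 1 xc by simp
      next
        case 2
        then have "x \<notin> snd c ` K" using KS' by blast
        from gr[OF off[OF 2(2) this]] show ?thesis using 2 by simp
      next
        case 3
        then show ?thesis by simp
      qed
    qed
  qed
  show ?thesis unfolding L R by (rule w)
qed

end

context mean_curvature_immersion
begin

text \<open>Both sides are linear in \<open>\<xi>\<close>, which is a finite sum of functions
  \<open>\<eta> p\<close>, each supported in the domain of one pair of charts.\<close>

lemma superbiharmonic_weak_global: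
  assumes sb: "superbiharmonic \<epsilon> A g C h f H"
    and xi: "src.mC1 UNIV \<xi>" "\<And>p. 0 \<le> \<xi> p" and K: "compact K" "\<And>p. p \<notin> K \<Longrightarrow> \<xi> p = 0"
  shows "(\<integral>p. \<xi> p * (\<epsilon> * normsq p ^ 3 + \<epsilon> / 4 * src.grad_ip normsq normsq p) \<partial>\<mu>)
    \<le> - (\<integral>p. src.grad_ip (\<lambda>q. \<xi> q * normsq q) normsq p \<partial>\<mu>)"
proof -
  have "\<forall>p. \<exists>c d \<beta> Q. c \<in> A \<and> d \<in> C \<and> src.mC1 UNIV \<beta> \<and> (\<forall>q. 0 \<le> \<beta> q) \<and> \<beta> p > 0 \<and>
      compact Q \<and> Q \<subseteq> fst c \<inter> f -` fst d \<and> (\<forall>q. q \<notin> Q \<longrightarrow> \<beta> q = 0)"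
  proof
    fix p
    obtain c where c: "c \<in> A" "p \<in> fst c" using src.chart_exists by blast
    obtain d where d: "d \<in> C" "f p \<in> fst d" using tgt.chart_exists by blast
    have W: "open (fst c \<inter> f -` fst d)" by (intro open_Int src.open_dom open_f_preimage tgt.open_dom c d)
    have pW: "p \<in> fst c \<inter> f -` fst d" using c d by blast
    obtain \<beta> Q where b: "src.mC1 UNIV \<beta>" "\<And>q. 0 \<le> \<beta> q" "\<beta> p > 0" "compact Q" "Q \<subseteq> fst c \<inter> f -` fst d"
      "\<And>q. q \<notin> Q \<Longrightarrow> \<beta> q = 0"
      by (rule src.exists_bump[OF W pW]) (rule that, assumption+)
    show "\<exists>c d \<beta> Q. c \<in> A \<and> d \<in> C \<and> src.mC1 UNIV \<beta> \<and> (\<forall>q. 0 \<le> \<beta> q) \<and> \<beta> p > 0 \<and>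
      compact Q \<and> Q \<subseteq> fst c \<inter> f -` fst d \<and> (\<forall>q. q \<notin> Q \<longrightarrow> \<beta> q = 0)"
      by (intro exI conjI allI impI) (rule c(1) d(1) b | assumption)+
  qed
  from this[unfolded choice_iff] obtain c d \<beta> Q where P: "\<forall>p. c p \<in> A \<and> d p \<in> C \<and> src.mC1 UNIV (\<beta> p) \<and>
      (\<forall>q. 0 \<le> \<beta> p q) \<and> \<beta> p p > 0 \<and> compact (Q p) \<and> Q p \<subseteq> fst (c p) \<inter> f -` fst (d p) \<and> (\<forall>q. q \<notin> Q p \<longrightarrow> \<beta> p q = 0)"
    by (elim exE) (rule that)
  have cd: "c p \<in> A" "d p \<in> C" and b1: "src.mC1 UNIV (\<beta> p)" and b0: "0 \<le> \<beta> p q" and bp: "\<beta> p p > 0"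
    and Q: "compact (Q p)" "Q p \<subseteq> fst (c p) \<inter> f -` fst (d p)" and bQ: "q \<notin> Q p \<Longrightarrow> \<beta> p q = 0" for p q
    using P[rule_format, of p] by blast+
  have ob: "open {q. 0 < \<beta> p q}" for p
    by (intro open_Collect_less continuous_on_const src.mC1_continuous[OF open_UNIV b1])
  obtain I where I: "finite I" "K \<subseteq> (\<Union>p\<in>I. {q. 0 < \<beta> p q})"
    by (rule compactE_image[OF K(1), of K "\<lambda>p. {q. 0 < \<beta> p q}"]) (use ob bp in auto)
  define s where "s q = (\<Sum>p\<in>I. \<beta> p q)" for q
  have s1: "src.mC1 UNIV s" unfolding s_def[abs_def] by (intro src.mC1_sum open_UNIV b1)
  define W where "W = {q. 0 < s q}"
  have W: "open W" unfolding W_def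
    by (intro open_Collect_less continuous_on_const src.mC1_continuous[OF open_UNIV s1])
  have KW: "K \<subseteq> W"
  proof
    fix q assume "q \<in> K"
    then obtain p where p: "p \<in> I" "0 < \<beta> p q" using I(2) by blast
    have "\<beta> p q \<le> s q" unfolding s_def by (rule member_le_sum[OF p(1) _ I(1)]) (rule b0)
    then show "q \<in> W" using p(2) by (simp add: W_def)
  qed
  \<comment> \<open>The quotient is taken only where \<open>s\<close> is positive. Since
    \<open>\<xi>\<close> vanishes off \<open>K\<close>, which lies in \<open>W\<close>, the
    extension by zero is C^1.\<close>
  define \<eta> where "\<eta> p q = (if q \<in> W then \<beta> p q * \<xi> q / s q else 0)" for p q
  have sub: "src.mC1 W \<phi>" if "src.mC1 UNIV \<phi>" for \<phi> by (rule src.mC1_subset[OF that subset_UNIV])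
  have e1: "src.mC1 UNIV (\<eta> p)" for p
    unfolding \<eta>_def[abs_def]
  proof (rule src.mC1_extend[OF compact_imp_closed[OF K(1)] W KW])
    have "s q \<noteq> 0" if "q \<in> W" for q using that by (simp add: W_def)
    then show "src.mC1 W (\<lambda>q. \<beta> p q * \<xi> q / s q)"
      by (intro src.mC1_divide src.mC1_mult W sub b1 xi(1) s1)
  qed (simp add: K(2))
  have e0: "0 \<le> \<eta> p q" for p q by (simp add: \<eta>_def W_def b0 xi(2))
  have eQ: "\<eta> p q = 0" if "q \<notin> Q p" for p q by (simp add: \<eta>_def bQ[OF that])
  have es: "(\<Sum>p\<in>I. \<eta> p q) = \<xi> q" for q
  proof (cases "q \<in> W")
    case True
    have "(\<Sum>p\<in>I. \<eta> p q) = s q * \<xi> q / s q"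
      by (simp add: \<eta>_def True s_def sum_distrib_right sum_divide_distrib)
    then show ?thesis using True by (simp add: W_def)
  next
    case False
    then have "q \<notin> K" using KW by blast
    then show ?thesis using False by (simp add: \<eta>_def K(2))
  qed
  let ?e = "\<lambda>p. \<epsilon> * normsq p ^ 3 + \<epsilon> / 4 * src.grad_ip normsq normsq p"
  have ec: "continuous_on UNIV ?e"
    by (intro continuous_intros src.mC1_continuous[OF open_UNIV normsq_mC1] src.grad_ip_continuous normsq_mC1 open_UNIV)
  have prod: "src.mC1 UNIV (\<lambda>q. \<eta> p q * normsq q)" for p by (intro src.mC1_mult open_UNIV e1 normsq_mC1)
  have i1: "integrable \<mu> (\<lambda>q. \<eta> p q * ?e q)" for p
    by (rule src.integrable_compact_support[OF continuous_on_mult[OF src.mC1_continuous[OF open_UNIV e1[of p]] ec] Q(1)[of p]])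
      (simp add: eQ)
  have i2: "integrable \<mu> (src.grad_ip (\<lambda>q. \<eta> p q * normsq q) normsq)" for p
  proof (rule src.integrable_compact_support[OF src.grad_ip_continuous[OF open_UNIV prod[of p] normsq_mC1] Q(1)[of p]])
    fix q assume q: "q \<notin> Q p"
    show "src.grad_ip (\<lambda>q. \<eta> p q * normsq q) normsq q = 0"
      by (rule src.grad_ip_eq_0_open[OF prod normsq_mC1, of "- Q p"])
        (use q eQ compact_imp_closed[OF Q(1)] in auto)
  qed
  have "(\<integral>q. \<xi> q * ?e q \<partial>\<mu>) = (\<integral>q. (\<Sum>p\<in>I. \<eta> p q * ?e q) \<partial>\<mu>)"
    by (simp add: es flip: sum_distrib_right)
  also have "\<dots> = (\<Sum>p\<in>I. \<integral>q. \<eta> p q * ?e q \<partial>\<mu>)" by (rule Bochner_Integration.integral_sum) (rule i1)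
  also have "\<dots> \<le> (\<Sum>p\<in>I. - (\<integral>q. src.grad_ip (\<lambda>q. \<eta> p q * normsq q) normsq q \<partial>\<mu>))"
    by (rule sum_mono) (rule superbiharmonic_weak_local[OF sb cd e1 e0 Q eQ])
  also have "\<dots> = - (\<integral>q. (\<Sum>p\<in>I. src.grad_ip (\<lambda>q. \<eta> p q * normsq q) normsq q) \<partial>\<mu>)"
    by (simp add: Bochner_Integration.integral_sum[OF i2] sum_negf)
  also have "(\<lambda>q. \<Sum>p\<in>I. src.grad_ip (\<lambda>q. \<eta> p q * normsq q) normsq q) = src.grad_ip (\<lambda>q. \<xi> q * normsq q) normsq"
  proof
    fix q
    show "(\<Sum>p\<in>I. src.grad_ip (\<lambda>q. \<eta> p q * normsq q) normsq q) = src.grad_ip (\<lambda>q. \<xi> q * normsq q) normsq q"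
      unfolding src.grad_ip_sum[OF prod normsq_mC1, symmetric] by (simp add: es flip: sum_distrib_right)
  qed
  finally show ?thesis .
qed

end

section \<open>The Caccioppoli inequality\<close>

text \<open>The test function is \<open>weight n (|H|\<^sup>2)\<close> times the square of a cutoff function. The power \<open>s ^ n\<close>
  with \<open>a \<le> 2 (n + 1)\<close> controls small values of \<open>|H|\<close>, where only \<open>|H| powr (2 + a)\<close> is
  integrable; the denominator plays the same role for large values.\<close>

definition weight :: "nat \<Rightarrow> real \<Rightarrow> real" where
  "weight n s = s ^ n / (1 + s) ^ Suc n"

lemma weight_Ck: "Ck_on 1 {-1<..} (weight n)"
  unfolding weight_def[abs_def]
  by (intro Ck_on_divide Ck_on_power Ck_on_add Ck_on_const Ck_on_ident open_greaterThan) auto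

lemma weight_nonneg: "0 \<le> s \<Longrightarrow> 0 \<le> weight n s"
  by (simp add: weight_def)

lemma weight_pos: "0 < s \<Longrightarrow> 0 < weight n s"
  by (simp add: weight_def)

text \<open>The product is \<open>(s / (1 + s)) ^ Suc n\<close>, which is nondecreasing. The sign of
  \<open>D\<close> allows the squared gradient of \<open>u\<close> produced by the test function to
  be dropped.\<close>

lemma weight_derivative:
  assumes "0 \<le> s"
  shows "\<exists>D\<ge>0. ((\<lambda>s. weight n s * s) has_real_derivative D) (at s)"
proof -
  have s: "1 + s \<noteq> 0" using assms by simp
  have "((\<lambda>s. s / (1 + s)) has_real_derivative ((1 + s) - s) / (1 + s)\<^sup>2) (at s)"
    using s by (auto intro!: derivative_eq_intros simp: power2_eq_square)
  from DERIV_power[OF this, of "Suc n"]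
  have "((\<lambda>s. (s / (1 + s)) ^ Suc n) has_real_derivative real (Suc n) * (((1 + s) - s) / (1 + s)\<^sup>2 * (s / (1 + s)) ^ n)) (at s)"
    by simp
  moreover have "(\<lambda>s. (s / (1 + s)) ^ Suc n) = (\<lambda>s. weight n s * s)"
    by (simp add: weight_def fun_eq_iff power_divide)
  ultimately have "((\<lambda>s. weight n s * s) has_real_derivative real (Suc n) * (((1 + s) - s) / (1 + s)\<^sup>2 * (s / (1 + s)) ^ n)) (at s)"
    by simp
  then show ?thesis using assms by (intro exI conjI) auto
qed

text \<open>Here \<open>s\<close> stands for |H|. For \<open>s \<le> 1\<close> the left side is at
  most \<open>s ^ (2 * n + 4)\<close>, whose exponent is at least \<open>2 + a\<close> by the choice
  of \<open>n\<close>; for \<open>s > 1\<close> the denominator gives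
  \<open>s^2 * weight n (s^2) \<le> 1\<close>.\<close>

lemma weight_le_powr:
  assumes "0 \<le> s" "a \<le> 2 * real (Suc n)" "0 \<le> a"
  shows "(s\<^sup>2)\<^sup>2 * weight n (s\<^sup>2) \<le> s powr (2 + a)"
proof -
  consider "s = 0" | "0 < s" "s \<le> 1" | "1 < s" using assms(1) by linarith
  then show ?thesis
  proof cases
    case 1
    then show ?thesis by simp
  next
    case 2
    have "(s\<^sup>2)\<^sup>2 * weight n (s\<^sup>2) = s ^ (2 * n + 4) / (1 + s\<^sup>2) ^ Suc n"
      by (simp add: weight_def power_add flip: power_mult)
    also have "\<dots> \<le> s ^ (2 * n + 4)"
    proof -
      have "1 \<le> (1 + s\<^sup>2) ^ Suc n" by (rule one_le_power) simp
      then show ?thesis using 2 by (simp add: divide_le_eq mult_le_cancel_left1)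
    qed
    also have "\<dots> = s powr real (2 * n + 4)" using 2 by (simp only: powr_realpow)
    also have "\<dots> \<le> s powr (2 + a)" by (rule powr_mono') (use 2 assms in auto)
    finally show ?thesis .
  next
    case 3
    have "s\<^sup>2 * weight n (s\<^sup>2) = (s\<^sup>2 / (1 + s\<^sup>2)) ^ Suc n" by (simp add: weight_def power_divide)
    also have "\<dots> \<le> 1"
    proof (rule power_le_one)
      have "0 < 1 + s\<^sup>2" by (simp add: add_pos_nonneg)
      then show "s\<^sup>2 / (1 + s\<^sup>2) \<le> 1" by simp
    qed simp
    finally have "s\<^sup>2 * (s\<^sup>2 * weight n (s\<^sup>2)) \<le> s\<^sup>2 * 1" by (rule mult_left_mono) simp
    then have "(s\<^sup>2)\<^sup>2 * weight n (s\<^sup>2) \<le> s\<^sup>2" by (simp add: power2_eq_square mult.assoc)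
    also have "\<dots> = s powr 2" using 3 by simp
    also have "\<dots> \<le> s powr (2 + a)" by (rule powr_mono) (use 3 assms in auto)
    finally show ?thesis .
  qed
qed

context mean_curvature_immersion
begin

text \<open>Young's inequality with parameter \<open>\<epsilon> / 4\<close> absorbs the mixed
  gradient term exactly into the gradient term of the weak inequality. It leaves the factor
  \<open>4 / \<epsilon>\<close> in front of \<open>u^2 * weight n u\<close> times the squared
  gradient of the cutoff, where \<open>u\<close> is \<open>normsq\<close>;
  \<open>weight_le_powr\<close> bounds this error.\<close>

lemma Caccioppoli:
  assumes sb: "superbiharmonic \<epsilon> A g C h f H" and eps: "\<epsilon> > 0"
    and Phi: "src.mC1 UNIV \<Phi>" "compact K" "\<And>q. q \<notin> K \<Longrightarrow> \<Phi> q = 0"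
    and bound: "\<And>q. src.grad_ip \<Phi> \<Phi> q \<le> B"
    and a: "0 \<le> a" "a \<le> 2 * real (Suc n)"
    and int: "integrable \<mu> (\<lambda>p. section_norm C h f H p powr (2 + a))"
  shows "\<epsilon> * (\<integral>p. (\<Phi> p)\<^sup>2 * (weight n (normsq p) * normsq p ^ 3) \<partial>\<mu>)
    \<le> 4 / \<epsilon> * B * (\<integral>p. section_norm C h f H p powr (2 + a) \<partial>\<mu>)"
proof -
  let ?w = "\<lambda>p. weight n (normsq p)" and ?sn = "\<lambda>p. section_norm C h f H p powr (2 + a)"
  have w1: "src.mC1 UNIV ?w"
    by (rule src.mC1_compose[OF open_UNIV normsq_mC1 weight_Ck])
      (use normsq_nonneg in \<open>auto intro: less_le_trans[of _ 0]\<close>)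
  have w0: "0 \<le> ?w p" for p by (rule weight_nonneg[OF normsq_nonneg])
  have wn: "src.mC1 UNIV (\<lambda>p. weight n (normsq p) * normsq p)" by (intro src.mC1_mult open_UNIV w1 normsq_mC1)
  define \<xi> where "\<xi> p = \<Phi> p * \<Phi> p * ?w p" for p
  have xi1: "src.mC1 UNIV \<xi>" unfolding \<xi>_def[abs_def] by (intro src.mC1_mult open_UNIV Phi w1)
  have xi0: "0 \<le> \<xi> p" for p by (simp add: \<xi>_def w0)
  have xiK: "\<xi> p = 0" if "p \<notin> K" for p by (simp add: \<xi>_def Phi(3)[OF that])
  let ?e = "\<lambda>p. \<epsilon> * normsq p ^ 3 + \<epsilon> / 4 * src.grad_ip normsq normsq p"
  let ?G = "src.grad_ip (\<lambda>q. \<xi> q * normsq q) normsq"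
  have prod: "src.mC1 UNIV (\<lambda>q. \<xi> q * normsq q)" by (intro src.mC1_mult open_UNIV xi1 normsq_mC1)
  note nc = src.mC1_continuous[OF open_UNIV normsq_mC1]
  have ec: "continuous_on UNIV ?e"
    by (intro continuous_intros nc src.grad_ip_continuous normsq_mC1 open_UNIV)
  have i1: "integrable \<mu> (\<lambda>q. \<xi> q * ?e q)"
    by (rule src.integrable_compact_support[OF continuous_on_mult[OF src.mC1_continuous[OF open_UNIV xi1] ec] Phi(2)])
      (simp add: xiK)
  have i2: "integrable \<mu> ?G"
  proof (rule src.integrable_compact_support[OF src.grad_ip_continuous[OF open_UNIV prod normsq_mC1] Phi(2)])
    fix q assume q: "q \<notin> K"
    show "?G q = 0"
      by (rule src.grad_ip_eq_0_open[OF prod normsq_mC1, of "- K"])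
        (use q xiK compact_imp_closed[OF Phi(2)] in auto)
  qed
  have vc: "continuous_on UNIV (\<lambda>p. (\<Phi> p)\<^sup>2 * (?w p * normsq p ^ 3))"
    by (intro continuous_intros nc src.mC1_continuous[OF open_UNIV w1] src.mC1_continuous[OF open_UNIV Phi(1)])
  have i3: "integrable \<mu> (\<lambda>p. (\<Phi> p)\<^sup>2 * (?w p * normsq p ^ 3))"
    by (rule src.integrable_compact_support[OF vc Phi(2)]) (simp add: Phi(3))
  \<comment> \<open>A pointwise inequality whose right side has nonpositive integral, by the weak
    inequality.\<close>
  have pt: "\<epsilon> * ((\<Phi> p)\<^sup>2 * (?w p * normsq p ^ 3)) - 4 / \<epsilon> * B * ?sn p \<le> \<xi> p * ?e p + ?G p" for p
  proof -
    let ?u = "normsq p"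
    obtain D where D: "D \<ge> 0" "((\<lambda>s. weight n s * s) has_real_derivative D) (at ?u)"
      using weight_derivative[OF normsq_nonneg] by blast
    have fe: "(\<lambda>q. \<xi> q * normsq q) = (\<lambda>p. \<Phi> p * \<Phi> p * (weight n (normsq p) * normsq p))"
      by (simp add: fun_eq_iff \<xi>_def)
    have G: "?G p = 2 * \<Phi> p * (?w p * ?u) * src.grad_ip \<Phi> normsq p + (\<Phi> p)\<^sup>2 * D * src.grad_ip normsq normsq p"
      unfolding fe by (rule src.grad_ip_product[OF Phi(1) normsq_mC1 D(2) wn])
    have "0 \<le> (\<Phi> p)\<^sup>2 * D * src.grad_ip normsq normsq p"
      using D(1) src.grad_ip_self_nonneg[OF normsq_mC1] by simp
    moreover have "?w p * (- (2 * \<Phi> p * ?u * src.grad_ip \<Phi> normsq p))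
      \<le> ?w p * (\<epsilon> / 4 * (\<Phi> p)\<^sup>2 * src.grad_ip normsq normsq p + ?u\<^sup>2 / (\<epsilon> / 4) * src.grad_ip \<Phi> \<Phi> p)"
      using eps by (intro mult_left_mono src.grad_ip_Young Phi(1) normsq_mC1 w0) simp
    moreover have "?u\<^sup>2 * ?w p * src.grad_ip \<Phi> \<Phi> p \<le> ?sn p * B"
    proof (rule mult_mono)
      show "?u\<^sup>2 * ?w p \<le> ?sn p"
        unfolding normsq_def by (rule weight_le_powr[OF section_norm_nonneg a(2,1)])
    qed (use bound src.grad_ip_self_nonneg[OF Phi(1)] in auto)
    then have "4 / \<epsilon> * (?u\<^sup>2 * ?w p * src.grad_ip \<Phi> \<Phi> p) \<le> 4 / \<epsilon> * (?sn p * B)"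
      using eps by (intro mult_left_mono) auto
    ultimately show ?thesis
      unfolding G by (simp add: \<xi>_def power2_eq_square algebra_simps)
  qed
  have "\<epsilon> * (\<integral>p. (\<Phi> p)\<^sup>2 * (?w p * normsq p ^ 3) \<partial>\<mu>) - 4 / \<epsilon> * B * (\<integral>p. ?sn p \<partial>\<mu>)
    = (\<integral>p. \<epsilon> * ((\<Phi> p)\<^sup>2 * (?w p * normsq p ^ 3)) - 4 / \<epsilon> * B * ?sn p \<partial>\<mu>)"
    by (subst Bochner_Integration.integral_diff) (use i3 int in simp_all)
  also have "\<dots> \<le> (\<integral>p. \<xi> p * ?e p + ?G p \<partial>\<mu>)"
    by (rule integral_mono[OF Bochner_Integration.integrable_diff[OF integrable_mult_right[OF i3] integrable_mult_right[OF int]]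
          Bochner_Integration.integrable_add[OF i1 i2] pt])
  also have "\<dots> = (\<integral>p. \<xi> p * ?e p \<partial>\<mu>) + (\<integral>p. ?G p \<partial>\<mu>)" by (rule Bochner_Integration.integral_add[OF i1 i2])
  also have "\<dots> \<le> 0"
    using superbiharmonic_weak_global[OF sb xi1 xi0 Phi(2) xiK] by simp
  finally show ?thesis by simp
qed

lemma normsq_eq_0:
  assumes complete: "complete_riemannian A g"
    and sb: "superbiharmonic \<epsilon> A g C h f H" and eps: "\<epsilon> > 0" and a: "0 \<le> a"
    and fin: "(\<integral>\<^sup>+ p. ennreal (section_norm C h f H p powr (2 + a)) \<partial>\<mu>) < \<infinity>"
  shows "normsq p0 = 0"
proof (rule ccontr)
  assume "normsq p0 \<noteq> 0"
  then have u0: "0 < normsq p0" using normsq_nonneg[of p0] by simp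
  obtain n :: nat where n: "a \<le> 2 * real (Suc n)"
    using real_arch_simple[of a] by (metis of_nat_Suc le_add_same_cancel1 mult_2 of_nat_0_le_iff order_trans add_increasing2 zero_le_one add.commute)
  let ?v = "\<lambda>p. weight n (normsq p) * normsq p ^ 3" and ?sn = "\<lambda>p. section_norm C h f H p powr (2 + a)"
  note nc = src.mC1_continuous[OF open_UNIV normsq_mC1]
  have w1: "src.mC1 UNIV (\<lambda>p. weight n (normsq p))"
    by (rule src.mC1_compose[OF open_UNIV normsq_mC1 weight_Ck])
      (use normsq_nonneg in \<open>auto intro: less_le_trans[of _ 0]\<close>)
  have vc: "continuous_on UNIV ?v"
    by (intro continuous_intros nc src.mC1_continuous[OF open_UNIV w1])
  have v0: "0 \<le> ?v p" for p by (simp add: weight_nonneg normsq_nonneg)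
  have vp: "0 < ?v p0" using u0 by (simp add: weight_pos)
  have snm: "?sn \<in> borel_measurable borel"
    unfolding section_norm_eq
    using borel_measurable_continuous_onI[OF continuous_on_real_sqrt[OF nc]] by measurable
  have int: "integrable \<mu> ?sn"
    by (rule integrableI_nonneg) (use snm fin in \<open>auto simp: top.not_eq_extremum\<close>)
  obtain W0 where W0: "open W0" "p0 \<in> W0" "emeasure \<mu> W0 < \<infinity>" using src.chart_ball_measure by blast
  \<comment> \<open>A neighbourhood of finite volume, inside every ball of radius
    \<open>R > 1\<close> about \<open>p0\<close>, on which \<open>?v\<close> stays above half of its
    value at \<open>p0\<close>.\<close>
  define W where "W = W0 \<inter> {q. src.dst p0 q < 1} \<inter> {q. ?v p0 / 2 < ?v q}"
  have W: "open W" unfolding W_def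
    by (intro open_Int W0 open_Collect_less continuous_on_const src.continuous_dst vc)
  have pW: "p0 \<in> W" unfolding W_def using W0 vp by simp
  have "emeasure \<mu> W \<le> emeasure \<mu> W0" by (rule emeasure_mono) (use W0 in \<open>auto simp: W_def\<close>)
  then have Wfin: "emeasure \<mu> W < \<infinity>" using W0(3) by (rule le_less_trans)
  have mW: "0 < measure \<mu> W"
    using src.emeasure_open_pos[OF W pW] Wfin by (simp add: measure_def enn2real_positive_iff)
  \<comment> \<open>\<open>1 / 32\<close> is \<open>(1 / 4)^2 / 2\<close>, from the lower bound of
    the cutoff and the choice of \<open>W\<close>. In \<open>Y\<close>, 49 is the square of the 7 in
    the gradient bound \<open>7 / R\<close>.\<close>
  define X where "X = \<epsilon> * (?v p0 / 32 * measure \<mu> W)"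
  define Y where "Y = 4 / \<epsilon> * (49 * real CARD('m)) * (\<integral>p. ?sn p \<partial>\<mu>)"
  have X: "0 < X" unfolding X_def using eps vp mW by simp
  have Y: "0 \<le> Y" unfolding Y_def using eps by (intro mult_nonneg_nonneg integral_nonneg_AE) auto
  have main: "X \<le> Y / R\<^sup>2" if R: "R > 1" for R
  proof -
    obtain \<Phi> K where Phi: "src.mC1 UNIV \<Phi>" "compact K" "\<forall>q. q \<notin> K \<longrightarrow> \<Phi> q = 0" "\<forall>q. 0 \<le> \<Phi> q"
      "\<forall>q. src.dst p0 q \<le> R \<longrightarrow> 1 / 4 \<le> \<Phi> q" "\<forall>q. src.grad_bound \<Phi> q (7 / R)"
      using src.exists_cutoff[OF complete R, of p0] by blast
    have PK: "\<Phi> q = 0" if "q \<notin> K" for q using Phi(3) that by blast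
    have bound: "src.grad_ip \<Phi> \<Phi> q \<le> real CARD('m) * (7 / R)\<^sup>2" for q
      by (rule src.grad_ip_bound[OF Phi(1) open_UNIV UNIV_I]) (use Phi(6) in blast)
    have C: "\<epsilon> * (\<integral>p. (\<Phi> p)\<^sup>2 * ?v p \<partial>\<mu>) \<le> 4 / \<epsilon> * (real CARD('m) * (7 / R)\<^sup>2) * (\<integral>p. ?sn p \<partial>\<mu>)"
      by (rule Caccioppoli[OF sb eps Phi(1,2) PK bound a n int])
    have "continuous_on UNIV (\<lambda>p. (\<Phi> p)\<^sup>2 * ?v p)"
      by (intro continuous_on_mult continuous_on_power vc src.mC1_continuous[OF open_UNIV Phi(1)])
    from src.integrable_compact_support[OF this Phi(2)]
    have i: "integrable \<mu> (\<lambda>p. (\<Phi> p)\<^sup>2 * ?v p)" by (simp add: PK)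
    have Wm: "W \<in> sets \<mu>" using W by simp
    have "?v p0 / 32 * measure \<mu> W = (\<integral>p. ?v p0 / 32 * indicator W p \<partial>\<mu>)" using Wm by simp
    also have "\<dots> \<le> (\<integral>p. (\<Phi> p)\<^sup>2 * ?v p \<partial>\<mu>)"
    proof (rule integral_mono[OF _ i])
      show "integrable \<mu> (\<lambda>p. ?v p0 / 32 * indicator W p)"
        by (intro integrable_mult_right integrable_real_indicator Wm Wfin)
      show "?v p0 / 32 * indicator W p \<le> (\<Phi> p)\<^sup>2 * ?v p" for p
      proof (cases "p \<in> W")
        case True
        then have "src.dst p0 p \<le> R" "?v p0 / 2 \<le> ?v p" using R unfolding W_def by auto
        then have "(1 / 4)\<^sup>2 * (?v p0 / 2) \<le> (\<Phi> p)\<^sup>2 * ?v p"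
          using Phi(5) vp by (intro mult_mono power_mono) auto
        then show ?thesis using True by (simp add: power2_eq_square)
      next
        case False
        then show ?thesis using v0[of p] by simp
      qed
    qed
    finally have "X \<le> \<epsilon> * (\<integral>p. (\<Phi> p)\<^sup>2 * ?v p \<partial>\<mu>)"
      unfolding X_def using eps by (intro mult_left_mono) auto
    also note C
    also have "4 / \<epsilon> * (real CARD('m) * (7 / R)\<^sup>2) * (\<integral>p. ?sn p \<partial>\<mu>) = Y / R\<^sup>2"
      by (simp add: Y_def power_divide)
    finally show ?thesis .
  qed
  \<comment> \<open>An explicit radius replaces the limit: as \<open>R > 1\<close>, the estimate
    would give \<open>Y + 2 * X = X * R \<le> X * R^2 \<le> Y\<close>.\<close>
  define R where "R = Y / X + 2"
  have R: "1 < R" using X Y by (simp add: R_def add_nonneg_pos less_le_trans[of 1 2])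
  have "X * R\<^sup>2 \<le> Y" using main[OF R] R by (simp add: pos_le_divide_eq)
  moreover have "X * R \<le> X * R\<^sup>2" using X R by (intro mult_left_mono) (auto simp: power2_eq_square)
  moreover have "X * R = Y + 2 * X" using X by (simp add: R_def field_simps)
  ultimately show False using X by simp
qed

end

theorem theorem1p13:
  fixes A :: "('p::{t2_space,second_countable_topology}, 'm::finite) chart set"
    and g :: "('p, 'm) metric"
    and C :: "('q::{t2_space,second_countable_topology}, 'n::finite) chart set"
    and h :: "('q, 'n) metric"
    and f :: "'p \<Rightarrow> 'q"
    and H :: "('p, 'q, 'n) section_along"
    and \<mu> :: "'p measure"
    and t :: nat
    and \<epsilon> a :: real
  assumes "t \<ge> 1" and "CARD('n) = CARD('m) + t"
    and "riemannian_manifold A g"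
    and "riemannian_manifold C h"
    and "isometric_immersion A g C h f"
    and "complete_riemannian A g"
    and "riemannian_volume A g \<mu>"
    and "mean_curvature_field A g C h f H"
    and "superbiharmonic \<epsilon> A g C h f H" and "\<epsilon> > 0"
    and "a \<ge> 0"
    and "(\<integral>\<^sup>+ p. ennreal (section_norm C h f H p powr (2 + a)) \<partial>\<mu>) < \<infinity>"
  shows "zero_section C f H \<and> minimal_immersion A g C h f"
proof -
  interpret mean_curvature_immersion A g C h f \<mu> H
    by unfold_locales (fact assms)+
  have zero: "H d p = 0" if "d \<in> C" "f p \<in> fst d" for d p
    by (rule field_eq_0[OF that normsq_eq_0[OF assms(6,9,10,11,12)]])
  then have "zero_section C f H" by (simp add: zero_section_def)
  moreover have "minimal_immersion A g C h f"
    unfolding minimal_immersion_def mean_curvature_field_def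
  proof (intro allI impI ballI)
    fix c d \<Omega> E x assume *: "is_local_frame A g C f c d \<Omega> E" "x \<in> \<Omega>"
    then have "c \<in> A" "d \<in> C" "x \<in> local_dom f c d" unfolding is_local_frame_def by blast+
    then obtain p where p: "p \<in> fst c" "f p \<in> fst d" "x = snd c p" unfolding local_dom_eq by blast
    have "H d (chart_inv c x) = 0"
      unfolding p(3) src.chart_inv_left[OF \<open>c \<in> A\<close> p(1)] by (rule zero[OF \<open>d \<in> C\<close> p(2)])
    \<comment> \<open>\<open>mean_curvature_field\<close> equates the value of \<open>H\<close> just
      found with the mean curvature computed in this frame.\<close>
    then show "0 = mean_curvature (g c) (h d) (local_rep f c d) E x"
      using assms(8) * unfolding mean_curvature_field_def by metis
  qed
  ultimately show ?thesis by blast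
qed

end
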